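(* Let $(T,\eta,\mu,(\xi,\zeta,\rho))$ be a pseudomonad on a bicocomplete 2-category $\mathcal{C}$. Suppose that the 2-category $T\text{-}\mathbf{psAlg}$ of pseudo-algebras, pseudomorphisms and transformations has bicoequalizers of codescent objects. Then $T\text{-}\mathbf{psAlg}$ has oplax bicolimits.
   Context: 2-categories and 2-functors are strict; $\mathcal{K}[X,Y]$ denotes a hom-category; juxtaposition of 1-cells and 2-cells denotes whiskering. Bicocomplete means having all small weighted bicolimits. **Oplax bicolimits.** For a 2-functor $F:I\to\mathcal{K}$ with $I$ a small 2-category, an oplax cocone with tip $B$ consists of 1-cells $q_i:F(i)\to B$ and, for each $d:i\to j$, a 2-cell $q_d:q_jF(d)\Rightarrow q_i$, compatible with identities and composition and such that $q_{d'}\circ(q_jF(\sigma))=q_d$ for each 2-cell $\sigma:d\Rightarrow d'$; morphisms are modifications. The oplax bicolimit of $F$ is an oplax cocone with tip $L$ such that composition with it gives equivalences, natural in $B$, between $\mathcal{K}[L,B]$ and the category of oplax cocones with tip $B$. $\mathcal{K}$ has oplax bicolimits if these exist for all small $I$ and all $F$. **Codescent objects.** A codescent object $\mathscr{X}$ in $\mathcal{K}$ consists of objects $\mathscr{X}(0),\mathscr{X}(1),\mathscr{X}(2)$, 1-cells $p_0,p_1,p_2:\mathscr{X}(2)\to\mathscr{X}(1)$, $d_0,d_1:\mathscr{X}(1)\to\mathscr{X}(0)$, $i:\mathscr{X}(0)\to\mathscr{X}(1)$, and invertible 2-cells $n_0:d_0i\Rightarrow 1$, $n_1:d_1i\Rightarrow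 1$, $\theta_{01}:d_0p_0\Rightarrow d_0p_1$, $\theta_{02}:d_1p_0\Rightarrow d_0p_2$, $\theta_{12}:d_1p_1\Rightarrow d_1p_2$. A pair $(q:\mathscr{X}(0)\to C,\ \xi:qd_0\Rightarrow qd_1)$ with $\xi$ invertible pseudocoequalizes $\mathscr{X}$ if $(qn_1)\circ(\xi i)=qn_0$ and $(q\theta_{12})\circ(\xi p_1)\circ(q\theta_{01})=(\xi p_2)\circ(q\theta_{02})\circ(\xi p_0)$. Morphisms $(q,\xi)\to(q',\xi')$ are 2-cells $q\Rightarrow q'$ compatible with $\xi,\xi'$. A bicoequalizer of $\mathscr{X}$ is a pseudocoequalizing pair with tip $\mathrm{bicoeq}(\mathscr{X})$ such that composition with it gives equivalences, natural in $C$, from $\mathcal{K}[\mathrm{bicoeq}(\mathscr{X}),C]$ to the category of pseudocoequalizing pairs with tip $C$. **Pseudomonads and pseudo-algebras.** A pseudomonad on $\mathcal{C}$ is a 2-functor $T:\mathcal{C}\to\mathcal{C}$ with pseudonatural transformations $\eta:1\Rightarrow T$, $\mu:TT\Rightarrow T$ and invertible modifications $\xi:\mu\circ\eta_T\cong 1_T$, $\zeta:\mu\circ T\eta\cong 1_T$, $\rho:\mu\circ T\mu\cong\mu\circ\mu_T$, subject to the usual coherence axioms, i.e. each $(TA,\mu_A,(\xi_A,\rho_A))$ satisfies (A1), (A2) below. Pseudonaturality cells at $f:A\to B$ are written $\eta_f:Tf\,\eta_A\cong\eta_Bf$ and $\mu_f:\mu_B\,TTf\cong Tf\,\mu_A$.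 A pseudo-algebra $(A,a,(\alpha^t,\alpha^s))$ is a 1-cell $a:TA\to A$ with invertible 2-cells $\alpha^t:a\eta_A\Rightarrow 1_A$, $\alpha^s:a\,Ta\Rightarrow a\mu_A$ such that (A1) $(a\zeta_A)\circ(\alpha^s\,T\eta_A)=a\,T\alpha^t$; (A2) $(a\rho_A)\circ(\alpha^s\,T\mu_A)\circ(a\,T\alpha^s)=(\alpha^s\mu_{TA})\circ(a\mu_a)\circ(\alpha^s\,TTa)$. A pseudomorphism $(f,\phi):(A,a,(\alpha^t,\alpha^s))\to(B,b,(\beta^t,\beta^s))$ is $f:A\to B$ with invertible $\phi:b\,Tf\Rightarrow fa$ such that $(f\alpha^t)\circ(\phi\eta_A)=(\beta^tf)\circ(b\eta_f)$ and $(f\alpha^s)\circ(\phi\,Ta)\circ(b\,T\phi)=(\phi\mu_A)\circ(b\mu_f)\circ(\beta^s\,TTf)$. A transformation $(f,\phi)\Rightarrow(g,\gamma)$ is a 2-cell $\sigma:f\Rightarrow g$ with $(\sigma a)\circ\phi=\gamma\circ(b\,T\sigma)$. These form the 2-category $T\text{-}\mathbf{psAlg}$. *)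

theory Defs
  imports "HOL-Library.FuncSet"
begin

unbundle cardinal_syntax

section \<open>Categories\<close>

text \<open>
  Categories and 2-categories have explicit carriers inside HOL types.  Operations are total
  functions that are only constrained on the carriers; composition is written in
  applicative order.
\<close>

record ('x, 'm) cat =
  Ob  :: "'x set"
  Arr :: "'m set"
  Dom :: "'m \<Rightarrow> 'x"
  Cod :: "'m \<Rightarrow> 'x"
  Idn :: "'x \<Rightarrow> 'm"
  Cmp :: "'m \<Rightarrow> 'm \<Rightarrow> 'm"

definition Hom :: "('x, 'm) cat \<Rightarrow> 'x \<Rightarrow> 'x \<Rightarrow> 'm set" where
  "Hom C x y = {f \<in> Arr C. Dom C f = x \<and> Cod C f = y}"

locale category =
  fixes C :: "('x, 'm) cat"
  assumes Dom_Ob: "f \<in> Arr C \<Longrightarrow> Dom C f \<in> Ob C"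
    and Cod_Ob: "f \<in> Arr C \<Longrightarrow> Cod C f \<in> Ob C"
    and Idn_Hom: "x \<in> Ob C \<Longrightarrow> Idn C x \<in> Hom C x x"
    and Cmp_Hom: "f \<in> Hom C x y \<Longrightarrow> g \<in> Hom C y z \<Longrightarrow> Cmp C g f \<in> Hom C x z"
    and Cmp_Idn_left: "f \<in> Hom C x y \<Longrightarrow> Cmp C (Idn C y) f = f"
    and Cmp_Idn_right: "f \<in> Hom C x y \<Longrightarrow> Cmp C f (Idn C x) = f"
    and Cmp_assoc: "f \<in> Hom C w x \<Longrightarrow> g \<in> Hom C x y \<Longrightarrow> h \<in> Hom C y z
          \<Longrightarrow> Cmp C h (Cmp C g f) = Cmp C (Cmp C h g) f"

definition invertible :: "('x, 'm) cat \<Rightarrow> 'm \<Rightarrow> bool" where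
  "invertible C f \<longleftrightarrow> f \<in> Arr C \<and>
     (\<exists>g \<in> Hom C (Cod C f) (Dom C f).
        Cmp C g f = Idn C (Dom C f) \<and> Cmp C f g = Idn C (Cod C f))"

record ('x, 'm, 'y, 'n) cfunctor =
  onOb  :: "'x \<Rightarrow> 'y"
  onArr :: "'m \<Rightarrow> 'n"

definition is_functor :: "('x, 'm) cat \<Rightarrow> ('y, 'n) cat \<Rightarrow> ('x, 'm, 'y, 'n) cfunctor \<Rightarrow> bool" where
  "is_functor C D F \<longleftrightarrow>
     (\<forall>x \<in> Ob C. onOb F x \<in> Ob D) \<and>
     (\<forall>x \<in> Ob C. \<forall>y \<in> Ob C. \<forall>f \<in> Hom C x y. onArr F f \<in> Hom D (onOb F x) (onOb F y)) \<and>
     (\<forall>x \<in> Ob C. onArr F (Idn C x) = Idn D (onOb F x)) \<and>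
     (\<forall>f \<in> Arr C. \<forall>g \<in> Arr C. Dom C g = Cod C f \<longrightarrow>
        onArr F (Cmp C g f) = Cmp D (onArr F g) (onArr F f))"

definition id_functor :: "('x, 'm, 'x, 'm) cfunctor" where
  "id_functor = \<lparr>onOb = \<lambda>x. x, onArr = \<lambda>f. f\<rparr>"

definition comp_functor ::
    "('y, 'n, 'z, 'p) cfunctor \<Rightarrow> ('x, 'm, 'y, 'n) cfunctor \<Rightarrow> ('x, 'm, 'z, 'p) cfunctor" where
  "comp_functor G F = \<lparr>onOb = \<lambda>x. onOb G (onOb F x), onArr = \<lambda>f. onArr G (onArr F f)\<rparr>"

definition is_natural :: "('x, 'm) cat \<Rightarrow> ('y, 'n) cat \<Rightarrow>
    ('x, 'm, 'y, 'n) cfunctor \<Rightarrow> ('x, 'm, 'y, 'n) cfunctor \<Rightarrow> ('x \<Rightarrow> 'n) \<Rightarrow> bool" where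
  "is_natural C D F G t \<longleftrightarrow>
     (\<forall>x \<in> Ob C. t x \<in> Hom D (onOb F x) (onOb G x)) \<and>
     (\<forall>f \<in> Arr C. Cmp D (t (Cod C f)) (onArr F f) = Cmp D (onArr G f) (t (Dom C f)))"

definition is_natural_iso :: "('x, 'm) cat \<Rightarrow> ('y, 'n) cat \<Rightarrow>
    ('x, 'm, 'y, 'n) cfunctor \<Rightarrow> ('x, 'm, 'y, 'n) cfunctor \<Rightarrow> ('x \<Rightarrow> 'n) \<Rightarrow> bool" where
  "is_natural_iso C D F G t \<longleftrightarrow> is_natural C D F G t \<and> (\<forall>x \<in> Ob C. invertible D (t x))"

definition is_equivalence :: "('x, 'm) cat \<Rightarrow> ('y, 'n) cat \<Rightarrow> ('x, 'm, 'y, 'n) cfunctor \<Rightarrow> bool" where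
  "is_equivalence C D F \<longleftrightarrow> is_functor C D F \<and>
     (\<exists>G u v. is_functor D C G \<and>
        is_natural_iso C C id_functor (comp_functor G F) u \<and>
        is_natural_iso D D (comp_functor F G) id_functor v)"

text \<open>
  The categories of cocones below have as arrows triples consisting of a source, the
  underlying modification and a target, so that domain and codomain are determined.
\<close>

definition tagged_cat ::
    "'q set \<Rightarrow> ('q \<Rightarrow> 'q \<Rightarrow> 'm set) \<Rightarrow> ('q \<Rightarrow> 'm) \<Rightarrow> ('m \<Rightarrow> 'm \<Rightarrow> 'm) \<Rightarrow> ('q, 'q \<times> 'm \<times> 'q) cat" where
  "tagged_cat Q H e c =
     \<lparr>Ob = Q,
      Arr = {(p, m, q) | p m q. p \<in> Q \<and> q \<in> Q \<and> m \<in> H p q},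
      Dom = (\<lambda>(p, m, q). p),
      Cod = (\<lambda>(p, m, q). q),
      Idn = (\<lambda>q. (q, e q, q)),
      Cmp = (\<lambda>(_, n, r) (p, m, _). (p, c n m, r))\<rparr>"


section \<open>Strict 2-categories and 2-functors\<close>

record ('o, 'a, 'c) two_cat =
  Obj   :: "'o set"
  Cell1 :: "'a set"
  Cell2 :: "'c set"
  src1  :: "'a \<Rightarrow> 'o"
  trg1  :: "'a \<Rightarrow> 'o"
  src2  :: "'c \<Rightarrow> 'a"
  trg2  :: "'c \<Rightarrow> 'a"
  id1   :: "'o \<Rightarrow> 'a"
  id2   :: "'a \<Rightarrow> 'c"
  comp1 :: "'a \<Rightarrow> 'a \<Rightarrow> 'a"  (infixl "\<cdot>\<index>" 75)
  vcomp :: "'c \<Rightarrow> 'c \<Rightarrow> 'c"  (infixl "\<odot>\<index>" 65)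
  hcomp :: "'c \<Rightarrow> 'c \<Rightarrow> 'c"  (infixl "\<star>\<index>" 70)

definition cat1 :: "('o, 'a, 'c) two_cat \<Rightarrow> ('o, 'a) cat" where
  "cat1 K = \<lparr>Ob = Obj K, Arr = Cell1 K, Dom = src1 K, Cod = trg1 K, Idn = id1 K, Cmp = comp1 K\<rparr>"

definition vcat :: "('o, 'a, 'c) two_cat \<Rightarrow> ('a, 'c) cat" where
  "vcat K = \<lparr>Ob = Cell1 K, Arr = Cell2 K, Dom = src2 K, Cod = trg2 K, Idn = id2 K, Cmp = vcomp K\<rparr>"

definition hcat :: "('o, 'a, 'c) two_cat \<Rightarrow> ('o, 'c) cat" where
  "hcat K = \<lparr>Ob = Obj K, Arr = Cell2 K,
     Dom = (\<lambda>\<alpha>. src1 K (src2 K \<alpha>)), Cod = (\<lambda>\<alpha>. trg1 K (src2 K \<alpha>)),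
     Idn = (\<lambda>A. id2 K (id1 K A)), Cmp = hcomp K\<rparr>"

definition hom1 :: "('o, 'a, 'c) two_cat \<Rightarrow> 'o \<Rightarrow> 'o \<Rightarrow> 'a set" where
  "hom1 K A B = {f \<in> Cell1 K. src1 K f = A \<and> trg1 K f = B}"

definition hom2 :: "('o, 'a, 'c) two_cat \<Rightarrow> 'a \<Rightarrow> 'a \<Rightarrow> 'c set" where
  "hom2 K f g = {\<alpha> \<in> Cell2 K. src2 K \<alpha> = f \<and> trg2 K \<alpha> = g}"

definition invhom2 :: "('o, 'a, 'c) two_cat \<Rightarrow> 'a \<Rightarrow> 'a \<Rightarrow> 'c set" where
  "invhom2 K f g = {\<alpha> \<in> hom2 K f g. invertible (vcat K) \<alpha>}"

definition homcat :: "('o, 'a, 'c) two_cat \<Rightarrow> 'o \<Rightarrow> 'o \<Rightarrow> ('a, 'c) cat" where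
  "homcat K A B = \<lparr>Ob = hom1 K A B, Arr = {\<alpha> \<in> Cell2 K. src2 K \<alpha> \<in> hom1 K A B},
     Dom = src2 K, Cod = trg2 K, Idn = id2 K, Cmp = vcomp K\<rparr>"

definition lwhisker :: "('o, 'a, 'c) two_cat \<Rightarrow> 'a \<Rightarrow> 'c \<Rightarrow> 'c"  (infixr "\<triangleright>\<index>" 72) where
  "f \<triangleright>\<^bsub>K\<^esub> \<alpha> = id2 K f \<star>\<^bsub>K\<^esub> \<alpha>"

definition rwhisker :: "('o, 'a, 'c) two_cat \<Rightarrow> 'c \<Rightarrow> 'a \<Rightarrow> 'c"  (infixl "\<triangleleft>\<index>" 72) where
  "\<alpha> \<triangleleft>\<^bsub>K\<^esub> f = \<alpha> \<star>\<^bsub>K\<^esub> id2 K f"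

locale two_category =
  fixes K :: "('o, 'a, 'c) two_cat" (structure)
  assumes category_cat1: "category (cat1 K)"
    and category_vcat: "category (vcat K)"
    and category_hcat: "category (hcat K)"
    and src1_trg2: "\<alpha> \<in> Cell2 K \<Longrightarrow> src1 K (trg2 K \<alpha>) = src1 K (src2 K \<alpha>)"
    and trg1_trg2: "\<alpha> \<in> Cell2 K \<Longrightarrow> trg1 K (trg2 K \<alpha>) = trg1 K (src2 K \<alpha>)"
    and hcomp_hom2: "\<alpha> \<in> hom2 K f f' \<Longrightarrow> \<beta> \<in> hom2 K g g' \<Longrightarrow> src1 K g = trg1 K f
          \<Longrightarrow> \<beta> \<star> \<alpha> \<in> hom2 K (g \<cdot> f) (g' \<cdot> f')"
    and hcomp_id2: "f \<in> Cell1 K \<Longrightarrow> g \<in> Cell1 K \<Longrightarrow> src1 K g = trg1 K f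
          \<Longrightarrow> id2 K g \<star> id2 K f = id2 K (g \<cdot> f)"
    and interchange: "\<alpha> \<in> hom2 K f f' \<Longrightarrow> \<alpha>' \<in> hom2 K f' f''
          \<Longrightarrow> \<beta> \<in> hom2 K g g' \<Longrightarrow> \<beta>' \<in> hom2 K g' g'' \<Longrightarrow> src1 K g = trg1 K f
          \<Longrightarrow> (\<beta>' \<odot> \<beta>) \<star> (\<alpha>' \<odot> \<alpha>) = (\<beta>' \<star> \<alpha>') \<odot> (\<beta> \<star> \<alpha>)"

record ('i, 'd, 'e, 'o, 'a, 'c) two_fun =
  F0 :: "'i \<Rightarrow> 'o"
  F1 :: "'d \<Rightarrow> 'a"
  F2 :: "'e \<Rightarrow> 'c"

definition two_functor ::
    "('i, 'd, 'e) two_cat \<Rightarrow> ('o, 'a, 'c) two_cat \<Rightarrow> ('i, 'd, 'e, 'o, 'a, 'c) two_fun \<Rightarrow> bool" where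
  "two_functor I K F \<longleftrightarrow>
     is_functor (cat1 I) (cat1 K) \<lparr>onOb = F0 F, onArr = F1 F\<rparr> \<and>
     is_functor (vcat I) (vcat K) \<lparr>onOb = F1 F, onArr = F2 F\<rparr> \<and>
     is_functor (hcat I) (hcat K) \<lparr>onOb = F0 F, onArr = F2 F\<rparr>"


section \<open>Small weighted bicolimits\<close>

text \<open>
  Strict contravariant \<open>Cat\<close>-valued 2-functors \<open>W : I\<^sup>o\<^sup>p \<rightarrow> Cat\<close>, where \<open>op\<close> reverses 1-cells
  only: a 1-cell \<open>d : i \<rightarrow> j\<close> acts as a functor \<open>W j \<rightarrow> W i\<close>.
\<close>

record ('i, 'd, 'e, 'x, 'm) presheaf =
  pcat :: "'i \<Rightarrow> ('x, 'm) cat"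
  pfun :: "'d \<Rightarrow> ('x, 'm, 'x, 'm) cfunctor"
  pnat :: "'e \<Rightarrow> 'x \<Rightarrow> 'm"

definition is_presheaf :: "('i, 'd, 'e) two_cat \<Rightarrow> ('i, 'd, 'e, 'x, 'm) presheaf \<Rightarrow> bool" where
  "is_presheaf I W \<longleftrightarrow>
     (\<forall>i \<in> Obj I. category (pcat W i)) \<and>
     (\<forall>i \<in> Obj I. \<forall>j \<in> Obj I. \<forall>d \<in> hom1 I i j. is_functor (pcat W j) (pcat W i) (pfun W d)) \<and>
     (\<forall>i \<in> Obj I. \<forall>j \<in> Obj I. \<forall>d \<in> hom1 I i j. \<forall>e \<in> hom1 I i j. \<forall>\<sigma> \<in> hom2 I d e.
        is_natural (pcat W j) (pcat W i) (pfun W d) (pfun W e) (pnat W \<sigma>)) \<and>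
     (\<forall>i \<in> Obj I.
        (\<forall>x \<in> Ob (pcat W i). onOb (pfun W (id1 I i)) x = x) \<and>
        (\<forall>m \<in> Arr (pcat W i). onArr (pfun W (id1 I i)) m = m)) \<and>
     (\<forall>i \<in> Obj I. \<forall>j \<in> Obj I. \<forall>k \<in> Obj I. \<forall>d \<in> hom1 I i j. \<forall>d' \<in> hom1 I j k.
        (\<forall>x \<in> Ob (pcat W k). onOb (pfun W (d' \<cdot>\<^bsub>I\<^esub> d)) x = onOb (pfun W d) (onOb (pfun W d') x)) \<and>
        (\<forall>m \<in> Arr (pcat W k).
           onArr (pfun W (d' \<cdot>\<^bsub>I\<^esub> d)) m = onArr (pfun W d) (onArr (pfun W d') m))) \<and>
     (\<forall>i \<in> Obj I. \<forall>j \<in> Obj I. \<forall>d \<in> hom1 I i j. \<forall>x \<in> Ob (pcat W j).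
        pnat W (id2 I d) x = Idn (pcat W i) (onOb (pfun W d) x)) \<and>
     (\<forall>i \<in> Obj I. \<forall>j \<in> Obj I. \<forall>d \<in> hom1 I i j. \<forall>e \<in> hom1 I i j. \<forall>f \<in> hom1 I i j.
        \<forall>\<sigma> \<in> hom2 I d e. \<forall>\<tau> \<in> hom2 I e f. \<forall>x \<in> Ob (pcat W j).
        pnat W (\<tau> \<odot>\<^bsub>I\<^esub> \<sigma>) x = Cmp (pcat W i) (pnat W \<tau> x) (pnat W \<sigma> x)) \<and>
     (\<forall>i \<in> Obj I. \<forall>j \<in> Obj I. \<forall>k \<in> Obj I.
        \<forall>d \<in> hom1 I i j. \<forall>e \<in> hom1 I i j. \<forall>d' \<in> hom1 I j k. \<forall>e' \<in> hom1 I j k.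
        \<forall>\<sigma> \<in> hom2 I d e. \<forall>\<tau> \<in> hom2 I d' e'. \<forall>x \<in> Ob (pcat W k).
        pnat W (\<tau> \<star>\<^bsub>I\<^esub> \<sigma>) x =
          Cmp (pcat W i) (pnat W \<sigma> (onOb (pfun W e') x)) (onArr (pfun W d) (pnat W \<tau> x)))"

text \<open>The presheaf \<open>K[F -, B]\<close>.\<close>

definition repr_presheaf :: "('o, 'a, 'c) two_cat \<Rightarrow>
    ('i, 'd, 'e, 'o, 'a, 'c) two_fun \<Rightarrow> 'o \<Rightarrow> ('i, 'd, 'e, 'a, 'c) presheaf" where
  "repr_presheaf K F B =
     \<lparr>pcat = (\<lambda>i. homcat K (F0 F i) B),
      pfun = (\<lambda>d. \<lparr>onOb = \<lambda>q. q \<cdot>\<^bsub>K\<^esub> F1 F d, onArr = \<lambda>\<alpha>. \<alpha> \<triangleleft>\<^bsub>K\<^esub> F1 F d\<rparr>),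
      pnat = (\<lambda>\<sigma> q. q \<triangleright>\<^bsub>K\<^esub> F2 F \<sigma>)\<rparr>"

text \<open>
  Pseudonatural transformations \<open>t : V \<Rightarrow> W\<close> of presheaves: functors \<open>t\<^sub>i : V i \<rightarrow> W i\<close> and, for
  \<open>d : i \<rightarrow> j\<close>, natural isomorphisms with components
  \<open>t\<^sub>d\<^sub>,\<^sub>x : W(d)(t\<^sub>j x) \<rightarrow> t\<^sub>i(V(d) x)\<close> for \<open>x\<close> in \<open>V j\<close>.  All families are extensional (constantly
  \<^const>\<open>undefined\<close> off the carriers), so that equality of transformations, and of
  modifications, is equality of their components.
\<close>

datatype ('i, 'd, 'x, 'm, 'y, 'n) psnat =
  PsNat (psn_ob: "'i \<Rightarrow> 'x \<Rightarrow> 'y") (psn_arr: "'i \<Rightarrow> 'm \<Rightarrow> 'n") (psn_cell: "'d \<Rightarrow> 'x \<Rightarrow> 'n")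

abbreviation psn_functor ::
    "('i, 'd, 'x, 'm, 'y, 'n) psnat \<Rightarrow> 'i \<Rightarrow> ('x, 'm, 'y, 'n) cfunctor" where
  "psn_functor t i \<equiv> \<lparr>onOb = psn_ob t i, onArr = psn_arr t i\<rparr>"

definition pseudonatural :: "('i, 'd, 'e) two_cat \<Rightarrow> ('i, 'd, 'e, 'x, 'm) presheaf \<Rightarrow>
    ('i, 'd, 'e, 'y, 'n) presheaf \<Rightarrow> ('i, 'd, 'x, 'm, 'y, 'n) psnat \<Rightarrow> bool" where
  "pseudonatural I V W t \<longleftrightarrow>
     psn_ob t \<in> extensional (Obj I) \<and>
     psn_arr t \<in> extensional (Obj I) \<and>
     psn_cell t \<in> extensional (Cell1 I) \<and>
     (\<forall>i \<in> Obj I. psn_ob t i \<in> extensional (Ob (pcat V i)) \<and>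
                  psn_arr t i \<in> extensional (Arr (pcat V i))) \<and>
     (\<forall>d \<in> Cell1 I. psn_cell t d \<in> extensional (Ob (pcat V (trg1 I d)))) \<and>
     (\<forall>i \<in> Obj I. is_functor (pcat V i) (pcat W i) (psn_functor t i)) \<and>
     (\<forall>i \<in> Obj I. \<forall>j \<in> Obj I. \<forall>d \<in> hom1 I i j.
        is_natural_iso (pcat V j) (pcat W i)
          (comp_functor (pfun W d) (psn_functor t j))
          (comp_functor (psn_functor t i) (pfun V d))
          (psn_cell t d)) \<and>
     (\<forall>i \<in> Obj I. \<forall>x \<in> Ob (pcat V i).
        psn_cell t (id1 I i) x = Idn (pcat W i) (psn_ob t i x)) \<and>
     (\<forall>i \<in> Obj I. \<forall>j \<in> Obj I. \<forall>k \<in> Obj I. \<forall>d \<in> hom1 I i j. \<forall>d' \<in> hom1 I j k.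
        \<forall>x \<in> Ob (pcat V k).
        psn_cell t (d' \<cdot>\<^bsub>I\<^esub> d) x =
          Cmp (pcat W i) (psn_cell t d (onOb (pfun V d') x))
                         (onArr (pfun W d) (psn_cell t d' x))) \<and>
     (\<forall>i \<in> Obj I. \<forall>j \<in> Obj I. \<forall>d \<in> hom1 I i j. \<forall>e \<in> hom1 I i j. \<forall>\<sigma> \<in> hom2 I d e.
        \<forall>x \<in> Ob (pcat V j).
        Cmp (pcat W i) (psn_arr t i (pnat V \<sigma> x)) (psn_cell t d x) =
        Cmp (pcat W i) (psn_cell t e x) (pnat W \<sigma> (psn_ob t j x)))"

definition psnat_mods :: "('i, 'd, 'e) two_cat \<Rightarrow> ('i, 'd, 'e, 'x, 'm) presheaf \<Rightarrow>
    ('i, 'd, 'e, 'y, 'n) presheaf \<Rightarrow> ('i, 'd, 'x, 'm, 'y, 'n) psnat \<Rightarrow>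
    ('i, 'd, 'x, 'm, 'y, 'n) psnat \<Rightarrow> ('i \<Rightarrow> 'x \<Rightarrow> 'n) set" where
  "psnat_mods I V W s t =
     {m \<in> extensional (Obj I).
        (\<forall>i \<in> Obj I. m i \<in> extensional (Ob (pcat V i)) \<and>
           is_natural (pcat V i) (pcat W i) (psn_functor s i) (psn_functor t i) (m i)) \<and>
        (\<forall>i \<in> Obj I. \<forall>j \<in> Obj I. \<forall>d \<in> hom1 I i j. \<forall>x \<in> Ob (pcat V j).
           Cmp (pcat W i) (m i (onOb (pfun V d) x)) (psn_cell s d x) =
           Cmp (pcat W i) (psn_cell t d x) (onArr (pfun W d) (m j x)))}"

definition psnat_cat :: "('i, 'd, 'e) two_cat \<Rightarrow> ('i, 'd, 'e, 'x, 'm) presheaf \<Rightarrow>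
    ('i, 'd, 'e, 'y, 'n) presheaf \<Rightarrow>
    (('i, 'd, 'x, 'm, 'y, 'n) psnat,
     ('i, 'd, 'x, 'm, 'y, 'n) psnat \<times> ('i \<Rightarrow> 'x \<Rightarrow> 'n) \<times> ('i, 'd, 'x, 'm, 'y, 'n) psnat) cat" where
  "psnat_cat I V W = tagged_cat {t. pseudonatural I V W t} (psnat_mods I V W)
     (\<lambda>t. \<lambda>i\<in>Obj I. \<lambda>x\<in>Ob (pcat V i). Idn (pcat W i) (psn_ob t i x))
     (\<lambda>n m. \<lambda>i\<in>Obj I. \<lambda>x\<in>Ob (pcat V i). Cmp (pcat W i) (n i x) (m i x))"

text \<open>The functor \<open>K[L, B] \<rightarrow> Ps(W, K[F -, B])\<close> given by composition with \<open>t : W \<Rightarrow> K[F -, L]\<close>.\<close>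

definition weighted_postcomp_ob :: "('i, 'd, 'e) two_cat \<Rightarrow> ('o, 'a, 'c) two_cat \<Rightarrow>
    ('i, 'd, 'e, 'x, 'm) presheaf \<Rightarrow> ('i, 'd, 'x, 'm, 'a, 'c) psnat \<Rightarrow>
    'a \<Rightarrow> ('i, 'd, 'x, 'm, 'a, 'c) psnat" where
  "weighted_postcomp_ob I K W t u = PsNat
     (\<lambda>i\<in>Obj I. \<lambda>x\<in>Ob (pcat W i). u \<cdot>\<^bsub>K\<^esub> psn_ob t i x)
     (\<lambda>i\<in>Obj I. \<lambda>m\<in>Arr (pcat W i). u \<triangleright>\<^bsub>K\<^esub> psn_arr t i m)
     (\<lambda>d\<in>Cell1 I. \<lambda>x\<in>Ob (pcat W (trg1 I d)). u \<triangleright>\<^bsub>K\<^esub> psn_cell t d x)"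

definition weighted_postcomp :: "('i, 'd, 'e) two_cat \<Rightarrow> ('o, 'a, 'c) two_cat \<Rightarrow>
    ('i, 'd, 'e, 'x, 'm) presheaf \<Rightarrow> ('i, 'd, 'x, 'm, 'a, 'c) psnat \<Rightarrow>
    ('a, 'c, ('i, 'd, 'x, 'm, 'a, 'c) psnat,
     ('i, 'd, 'x, 'm, 'a, 'c) psnat \<times> ('i \<Rightarrow> 'x \<Rightarrow> 'c) \<times> ('i, 'd, 'x, 'm, 'a, 'c) psnat) cfunctor" where
  "weighted_postcomp I K W t =
     \<lparr>onOb = weighted_postcomp_ob I K W t,
      onArr = (\<lambda>\<alpha>. (weighted_postcomp_ob I K W t (src2 K \<alpha>),
                     \<lambda>i\<in>Obj I. \<lambda>x\<in>Ob (pcat W i). \<alpha> \<triangleleft>\<^bsub>K\<^esub> psn_ob t i x,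
                     weighted_postcomp_ob I K W t (trg2 K \<alpha>)))\<rparr>"

text \<open>
  Here and in the other universal properties below, naturality in \<open>B\<close> need not be asserted
  separately: the functors are given by composition with a fixed cocone, hence commute
  strictly with composition with any \<open>B \<rightarrow> B'\<close>.
\<close>

definition weighted_bicolimit :: "('i, 'd, 'e) two_cat \<Rightarrow> ('o, 'a, 'c) two_cat \<Rightarrow>
    ('i, 'd, 'e, 'x, 'm) presheaf \<Rightarrow> ('i, 'd, 'e, 'o, 'a, 'c) two_fun \<Rightarrow>
    'o \<Rightarrow> ('i, 'd, 'x, 'm, 'a, 'c) psnat \<Rightarrow> bool" where
  "weighted_bicolimit I K W F L t \<longleftrightarrow>
     L \<in> Obj K \<and>
     pseudonatural I W (repr_presheaf K F L) t \<and>
     (\<forall>B \<in> Obj K. is_equivalence (homcat K L B) (psnat_cat I W (repr_presheaf K F B))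
        (weighted_postcomp I K W t))"

text \<open>
  Smallness is relative to an infinite cardinal \<open>\<kappa>\<close>: a set is small if its cardinality is below
  \<open>\<kappa>\<close>.  Taking \<open>\<kappa>\<close> to be the cardinality of a Grothendieck universe gives the usual notion.
  Every small structure is isomorphic to one carried by subsets of the type underlying \<open>\<kappa>\<close>,
  so indexing 2-categories and weights may be taken there.
\<close>

definition small_category :: "'s rel \<Rightarrow> ('s, 's) cat \<Rightarrow> bool" where
  "small_category \<kappa> C \<longleftrightarrow> category C \<and> |Ob C| <o \<kappa> \<and> |Arr C| <o \<kappa>"

definition small_two_category :: "'s rel \<Rightarrow> ('s, 's, 's) two_cat \<Rightarrow> bool" where
  "small_two_category \<kappa> I \<longleftrightarrow>
     two_category I \<and> |Obj I| <o \<kappa> \<and> |Cell1 I| <o \<kappa> \<and> |Cell2 I| <o \<kappa>"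

definition bicocomplete :: "'s rel \<Rightarrow> ('o, 'a, 'c) two_cat \<Rightarrow> bool" where
  "bicocomplete \<kappa> K \<longleftrightarrow>
     (\<forall>(I :: ('s, 's, 's) two_cat) (W :: ('s, 's, 's, 's, 's) presheaf) F.
        small_two_category \<kappa> I \<and> is_presheaf I W \<and> (\<forall>i \<in> Obj I. small_category \<kappa> (pcat W i)) \<and>
        two_functor I K F \<longrightarrow> (\<exists>L t. weighted_bicolimit I K W F L t))"


section \<open>Oplax bicolimits\<close>

datatype ('i, 'd, 'a, 'c) oplax_cocone = OplaxCocone (leg: "'i \<Rightarrow> 'a") (leg_cell: "'d \<Rightarrow> 'c")

definition is_oplax_cocone :: "('i, 'd, 'e) two_cat \<Rightarrow> ('o, 'a, 'c) two_cat \<Rightarrow>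
    ('i, 'd, 'e, 'o, 'a, 'c) two_fun \<Rightarrow> 'o \<Rightarrow> ('i, 'd, 'a, 'c) oplax_cocone \<Rightarrow> bool" where
  "is_oplax_cocone I K F B q \<longleftrightarrow>
     leg q \<in> extensional (Obj I) \<and>
     leg_cell q \<in> extensional (Cell1 I) \<and>
     (\<forall>i \<in> Obj I. leg q i \<in> hom1 K (F0 F i) B) \<and>
     (\<forall>i \<in> Obj I. \<forall>j \<in> Obj I. \<forall>d \<in> hom1 I i j.
        leg_cell q d \<in> hom2 K (leg q j \<cdot>\<^bsub>K\<^esub> F1 F d) (leg q i)) \<and>
     (\<forall>i \<in> Obj I. leg_cell q (id1 I i) = id2 K (leg q i)) \<and>
     (\<forall>i \<in> Obj I. \<forall>j \<in> Obj I. \<forall>k \<in> Obj I. \<forall>d \<in> hom1 I i j. \<forall>d' \<in> hom1 I j k.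
        leg_cell q (d' \<cdot>\<^bsub>I\<^esub> d) = leg_cell q d \<odot>\<^bsub>K\<^esub> (leg_cell q d' \<triangleleft>\<^bsub>K\<^esub> F1 F d)) \<and>
     (\<forall>i \<in> Obj I. \<forall>j \<in> Obj I. \<forall>d \<in> hom1 I i j. \<forall>d' \<in> hom1 I i j. \<forall>\<sigma> \<in> hom2 I d d'.
        leg_cell q d' \<odot>\<^bsub>K\<^esub> (leg q j \<triangleright>\<^bsub>K\<^esub> F2 F \<sigma>) = leg_cell q d)"

definition oplax_mods :: "('i, 'd, 'e) two_cat \<Rightarrow> ('o, 'a, 'c) two_cat \<Rightarrow>
    ('i, 'd, 'e, 'o, 'a, 'c) two_fun \<Rightarrow> ('i, 'd, 'a, 'c) oplax_cocone \<Rightarrow>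
    ('i, 'd, 'a, 'c) oplax_cocone \<Rightarrow> ('i \<Rightarrow> 'c) set" where
  "oplax_mods I K F q r =
     {m \<in> extensional (Obj I).
        (\<forall>i \<in> Obj I. m i \<in> hom2 K (leg q i) (leg r i)) \<and>
        (\<forall>i \<in> Obj I. \<forall>j \<in> Obj I. \<forall>d \<in> hom1 I i j.
           m i \<odot>\<^bsub>K\<^esub> leg_cell q d = leg_cell r d \<odot>\<^bsub>K\<^esub> (m j \<triangleleft>\<^bsub>K\<^esub> F1 F d))}"

definition oplax_cocone_cat :: "('i, 'd, 'e) two_cat \<Rightarrow> ('o, 'a, 'c) two_cat \<Rightarrow>
    ('i, 'd, 'e, 'o, 'a, 'c) two_fun \<Rightarrow> 'o \<Rightarrow>
    (('i, 'd, 'a, 'c) oplax_cocone,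
     ('i, 'd, 'a, 'c) oplax_cocone \<times> ('i \<Rightarrow> 'c) \<times> ('i, 'd, 'a, 'c) oplax_cocone) cat" where
  "oplax_cocone_cat I K F B = tagged_cat {q. is_oplax_cocone I K F B q} (oplax_mods I K F)
     (\<lambda>q. \<lambda>i\<in>Obj I. id2 K (leg q i))
     (\<lambda>n m. \<lambda>i\<in>Obj I. n i \<odot>\<^bsub>K\<^esub> m i)"

definition oplax_postcomp_ob :: "('i, 'd, 'e) two_cat \<Rightarrow> ('o, 'a, 'c) two_cat \<Rightarrow>
    ('i, 'd, 'a, 'c) oplax_cocone \<Rightarrow> 'a \<Rightarrow> ('i, 'd, 'a, 'c) oplax_cocone" where
  "oplax_postcomp_ob I K q u = OplaxCocone
     (\<lambda>i\<in>Obj I. u \<cdot>\<^bsub>K\<^esub> leg q i)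
     (\<lambda>d\<in>Cell1 I. u \<triangleright>\<^bsub>K\<^esub> leg_cell q d)"

definition oplax_postcomp :: "('i, 'd, 'e) two_cat \<Rightarrow> ('o, 'a, 'c) two_cat \<Rightarrow>
    ('i, 'd, 'a, 'c) oplax_cocone \<Rightarrow>
    ('a, 'c, ('i, 'd, 'a, 'c) oplax_cocone,
     ('i, 'd, 'a, 'c) oplax_cocone \<times> ('i \<Rightarrow> 'c) \<times> ('i, 'd, 'a, 'c) oplax_cocone) cfunctor" where
  "oplax_postcomp I K q =
     \<lparr>onOb = oplax_postcomp_ob I K q,
      onArr = (\<lambda>\<alpha>. (oplax_postcomp_ob I K q (src2 K \<alpha>),
                     \<lambda>i\<in>Obj I. \<alpha> \<triangleleft>\<^bsub>K\<^esub> leg q i,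
                     oplax_postcomp_ob I K q (trg2 K \<alpha>)))\<rparr>"

definition oplax_bicolimit :: "('i, 'd, 'e) two_cat \<Rightarrow> ('o, 'a, 'c) two_cat \<Rightarrow>
    ('i, 'd, 'e, 'o, 'a, 'c) two_fun \<Rightarrow> 'o \<Rightarrow> ('i, 'd, 'a, 'c) oplax_cocone \<Rightarrow> bool" where
  "oplax_bicolimit I K F L q \<longleftrightarrow>
     L \<in> Obj K \<and>
     is_oplax_cocone I K F L q \<and>
     (\<forall>B \<in> Obj K. is_equivalence (homcat K L B) (oplax_cocone_cat I K F B) (oplax_postcomp I K q))"

definition has_oplax_bicolimits :: "'s rel \<Rightarrow> ('o, 'a, 'c) two_cat \<Rightarrow> bool" where
  "has_oplax_bicolimits \<kappa> K \<longleftrightarrow>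
     (\<forall>(I :: ('s, 's, 's) two_cat) F.
        small_two_category \<kappa> I \<and> two_functor I K F \<longrightarrow> (\<exists>L q. oplax_bicolimit I K F L q))"


section \<open>Codescent objects and bicoequalizers\<close>

record ('o, 'a, 'c) codescent =
  X0 :: 'o
  X1 :: 'o
  X2 :: 'o
  p0 :: 'a
  p1 :: 'a
  p2 :: 'a
  d0 :: 'a
  d1 :: 'a
  ii :: 'a
  n0 :: 'c
  n1 :: 'c
  th01 :: 'c
  th02 :: 'c
  th12 :: 'c

definition is_codescent :: "('o, 'a, 'c) two_cat \<Rightarrow> ('o, 'a, 'c) codescent \<Rightarrow> bool" where
  "is_codescent K X \<longleftrightarrow>
     X0 X \<in> Obj K \<and> X1 X \<in> Obj K \<and> X2 X \<in> Obj K \<and>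
     p0 X \<in> hom1 K (X2 X) (X1 X) \<and> p1 X \<in> hom1 K (X2 X) (X1 X) \<and> p2 X \<in> hom1 K (X2 X) (X1 X) \<and>
     d0 X \<in> hom1 K (X1 X) (X0 X) \<and> d1 X \<in> hom1 K (X1 X) (X0 X) \<and>
     ii X \<in> hom1 K (X0 X) (X1 X) \<and>
     n0 X \<in> invhom2 K (d0 X \<cdot>\<^bsub>K\<^esub> ii X) (id1 K (X0 X)) \<and>
     n1 X \<in> invhom2 K (d1 X \<cdot>\<^bsub>K\<^esub> ii X) (id1 K (X0 X)) \<and>
     th01 X \<in> invhom2 K (d0 X \<cdot>\<^bsub>K\<^esub> p0 X) (d0 X \<cdot>\<^bsub>K\<^esub> p1 X) \<and>
     th02 X \<in> invhom2 K (d1 X \<cdot>\<^bsub>K\<^esub> p0 X) (d0 X \<cdot>\<^bsub>K\<^esub> p2 X) \<and>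
     th12 X \<in> invhom2 K (d1 X \<cdot>\<^bsub>K\<^esub> p1 X) (d1 X \<cdot>\<^bsub>K\<^esub> p2 X)"

definition pseudocoequalizes :: "('o, 'a, 'c) two_cat \<Rightarrow> ('o, 'a, 'c) codescent \<Rightarrow>
    'o \<Rightarrow> 'a \<times> 'c \<Rightarrow> bool" where
  "pseudocoequalizes K X B = (\<lambda>(q, \<xi>).
     q \<in> hom1 K (X0 X) B \<and>
     \<xi> \<in> invhom2 K (q \<cdot>\<^bsub>K\<^esub> d0 X) (q \<cdot>\<^bsub>K\<^esub> d1 X) \<and>
     (q \<triangleright>\<^bsub>K\<^esub> n1 X) \<odot>\<^bsub>K\<^esub> (\<xi> \<triangleleft>\<^bsub>K\<^esub> ii X) = q \<triangleright>\<^bsub>K\<^esub> n0 X \<and>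
     (q \<triangleright>\<^bsub>K\<^esub> th12 X) \<odot>\<^bsub>K\<^esub> (\<xi> \<triangleleft>\<^bsub>K\<^esub> p1 X) \<odot>\<^bsub>K\<^esub> (q \<triangleright>\<^bsub>K\<^esub> th01 X) =
     (\<xi> \<triangleleft>\<^bsub>K\<^esub> p2 X) \<odot>\<^bsub>K\<^esub> (q \<triangleright>\<^bsub>K\<^esub> th02 X) \<odot>\<^bsub>K\<^esub> (\<xi> \<triangleleft>\<^bsub>K\<^esub> p0 X))"

definition pscoeq_mods :: "('o, 'a, 'c) two_cat \<Rightarrow> ('o, 'a, 'c) codescent \<Rightarrow>
    'a \<times> 'c \<Rightarrow> 'a \<times> 'c \<Rightarrow> 'c set" where
  "pscoeq_mods K X = (\<lambda>(q, \<xi>) (q', \<xi>').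
     {\<sigma> \<in> hom2 K q q'. (\<sigma> \<triangleleft>\<^bsub>K\<^esub> d1 X) \<odot>\<^bsub>K\<^esub> \<xi> = \<xi>' \<odot>\<^bsub>K\<^esub> (\<sigma> \<triangleleft>\<^bsub>K\<^esub> d0 X)})"

definition pscoeq_cat :: "('o, 'a, 'c) two_cat \<Rightarrow> ('o, 'a, 'c) codescent \<Rightarrow> 'o \<Rightarrow>
    ('a \<times> 'c, ('a \<times> 'c) \<times> 'c \<times> ('a \<times> 'c)) cat" where
  "pscoeq_cat K X B = tagged_cat {p. pseudocoequalizes K X B p} (pscoeq_mods K X)
     (\<lambda>(q, \<xi>). id2 K q) (vcomp K)"

definition pscoeq_postcomp :: "('o, 'a, 'c) two_cat \<Rightarrow> 'a \<times> 'c \<Rightarrow>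
    ('a, 'c, 'a \<times> 'c, ('a \<times> 'c) \<times> 'c \<times> ('a \<times> 'c)) cfunctor" where
  "pscoeq_postcomp K = (\<lambda>(q, \<xi>).
     \<lparr>onOb = (\<lambda>u. (u \<cdot>\<^bsub>K\<^esub> q, u \<triangleright>\<^bsub>K\<^esub> \<xi>)),
      onArr = (\<lambda>\<alpha>. ((src2 K \<alpha> \<cdot>\<^bsub>K\<^esub> q, src2 K \<alpha> \<triangleright>\<^bsub>K\<^esub> \<xi>),
                     \<alpha> \<triangleleft>\<^bsub>K\<^esub> q,
                     (trg2 K \<alpha> \<cdot>\<^bsub>K\<^esub> q, trg2 K \<alpha> \<triangleright>\<^bsub>K\<^esub> \<xi>)))\<rparr>)"

definition bicoequalizer :: "('o, 'a, 'c) two_cat \<Rightarrow> ('o, 'a, 'c) codescent \<Rightarrow>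
    'o \<Rightarrow> 'a \<times> 'c \<Rightarrow> bool" where
  "bicoequalizer K X L p \<longleftrightarrow>
     L \<in> Obj K \<and>
     pseudocoequalizes K X L p \<and>
     (\<forall>B \<in> Obj K. is_equivalence (homcat K L B) (pscoeq_cat K X B) (pscoeq_postcomp K p))"

definition has_bicoequalizers :: "('o, 'a, 'c) two_cat \<Rightarrow> bool" where
  "has_bicoequalizers K \<longleftrightarrow> (\<forall>X. is_codescent K X \<longrightarrow> (\<exists>L p. bicoequalizer K X L p))"


section \<open>Pseudomonads and pseudo-algebras\<close>

text \<open>
  Pseudonatural transformations between 2-functors \<open>F, G : K \<rightarrow> L\<close>, in two orientations of
  the invertible naturality cells at \<open>f : A \<rightarrow> B\<close>: \<open>G f \<cdot> \<sigma>\<^sub>A \<Rightarrow> \<sigma>\<^sub>B \<cdot> F f\<close>, used for the unit of a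
  pseudomonad, and \<open>\<sigma>\<^sub>B \<cdot> F f \<Rightarrow> G f \<cdot> \<sigma>\<^sub>A\<close>, used for its multiplication.
\<close>

definition pseudonat_to :: "('i, 'd, 'e) two_cat \<Rightarrow> ('o, 'a, 'c) two_cat \<Rightarrow>
    ('i, 'd, 'e, 'o, 'a, 'c) two_fun \<Rightarrow> ('i, 'd, 'e, 'o, 'a, 'c) two_fun \<Rightarrow>
    ('i \<Rightarrow> 'a) \<Rightarrow> ('d \<Rightarrow> 'c) \<Rightarrow> bool" where
  "pseudonat_to K L F G s t \<longleftrightarrow>
     (\<forall>A \<in> Obj K. s A \<in> hom1 L (F0 F A) (F0 G A)) \<and>
     (\<forall>A \<in> Obj K. \<forall>B \<in> Obj K. \<forall>f \<in> hom1 K A B.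
        t f \<in> invhom2 L (F1 G f \<cdot>\<^bsub>L\<^esub> s A) (s B \<cdot>\<^bsub>L\<^esub> F1 F f)) \<and>
     (\<forall>A \<in> Obj K. t (id1 K A) = id2 L (s A)) \<and>
     (\<forall>A \<in> Obj K. \<forall>B \<in> Obj K. \<forall>C \<in> Obj K. \<forall>f \<in> hom1 K A B. \<forall>g \<in> hom1 K B C.
        t (g \<cdot>\<^bsub>K\<^esub> f) = (t g \<triangleleft>\<^bsub>L\<^esub> F1 F f) \<odot>\<^bsub>L\<^esub> (F1 G g \<triangleright>\<^bsub>L\<^esub> t f)) \<and>
     (\<forall>A \<in> Obj K. \<forall>B \<in> Obj K. \<forall>f \<in> hom1 K A B. \<forall>g \<in> hom1 K A B. \<forall>\<alpha> \<in> hom2 K f g.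
        t g \<odot>\<^bsub>L\<^esub> (F2 G \<alpha> \<triangleleft>\<^bsub>L\<^esub> s A) = (s B \<triangleright>\<^bsub>L\<^esub> F2 F \<alpha>) \<odot>\<^bsub>L\<^esub> t f)"

definition pseudonat_from :: "('i, 'd, 'e) two_cat \<Rightarrow> ('o, 'a, 'c) two_cat \<Rightarrow>
    ('i, 'd, 'e, 'o, 'a, 'c) two_fun \<Rightarrow> ('i, 'd, 'e, 'o, 'a, 'c) two_fun \<Rightarrow>
    ('i \<Rightarrow> 'a) \<Rightarrow> ('d \<Rightarrow> 'c) \<Rightarrow> bool" where
  "pseudonat_from K L F G s t \<longleftrightarrow>
     (\<forall>A \<in> Obj K. s A \<in> hom1 L (F0 F A) (F0 G A)) \<and>
     (\<forall>A \<in> Obj K. \<forall>B \<in> Obj K. \<forall>f \<in> hom1 K A B.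
        t f \<in> invhom2 L (s B \<cdot>\<^bsub>L\<^esub> F1 F f) (F1 G f \<cdot>\<^bsub>L\<^esub> s A)) \<and>
     (\<forall>A \<in> Obj K. t (id1 K A) = id2 L (s A)) \<and>
     (\<forall>A \<in> Obj K. \<forall>B \<in> Obj K. \<forall>C \<in> Obj K. \<forall>f \<in> hom1 K A B. \<forall>g \<in> hom1 K B C.
        t (g \<cdot>\<^bsub>K\<^esub> f) = (F1 G g \<triangleright>\<^bsub>L\<^esub> t f) \<odot>\<^bsub>L\<^esub> (t g \<triangleleft>\<^bsub>L\<^esub> F1 F f)) \<and>
     (\<forall>A \<in> Obj K. \<forall>B \<in> Obj K. \<forall>f \<in> hom1 K A B. \<forall>g \<in> hom1 K A B. \<forall>\<alpha> \<in> hom2 K f g.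
        t g \<odot>\<^bsub>L\<^esub> (s B \<triangleright>\<^bsub>L\<^esub> F2 F \<alpha>) = (F2 G \<alpha> \<triangleleft>\<^bsub>L\<^esub> s A) \<odot>\<^bsub>L\<^esub> t f)"

definition id_two_fun :: "('o, 'a, 'c, 'o, 'a, 'c) two_fun" where
  "id_two_fun = \<lparr>F0 = \<lambda>A. A, F1 = \<lambda>f. f, F2 = \<lambda>\<alpha>. \<alpha>\<rparr>"

definition comp_two_fun :: "('o, 'a, 'c, 'u, 'v, 'w) two_fun \<Rightarrow> ('i, 'd, 'e, 'o, 'a, 'c) two_fun \<Rightarrow>
    ('i, 'd, 'e, 'u, 'v, 'w) two_fun" where
  "comp_two_fun G F =
     \<lparr>F0 = \<lambda>A. F0 G (F0 F A), F1 = \<lambda>f. F1 G (F1 F f), F2 = \<lambda>\<alpha>. F2 G (F2 F \<alpha>)\<rparr>"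

text \<open>
  \<open>eta\<close>, \<open>mu\<close> are the 1-cell components and \<open>eta_nat\<close>, \<open>mu_nat\<close> the naturality cells of the
  unit and multiplication.
\<close>

record ('o, 'a, 'c) psmonad_data =
  endo    :: "('o, 'a, 'c, 'o, 'a, 'c) two_fun"
  eta     :: "'o \<Rightarrow> 'a"
  eta_nat :: "'a \<Rightarrow> 'c"
  mu      :: "'o \<Rightarrow> 'a"
  mu_nat  :: "'a \<Rightarrow> 'c"
  xi      :: "'o \<Rightarrow> 'c"
  zeta    :: "'o \<Rightarrow> 'c"
  rho     :: "'o \<Rightarrow> 'c"

datatype ('o, 'a, 'c) psalg =
  PsAlg (alg_ob: 'o) (alg_act: 'a) (alg_unit: 'c) (alg_mult: 'c)

datatype ('o, 'a, 'c) psmor =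
  PsMor (mor_src: "('o, 'a, 'c) psalg") (mor_trg: "('o, 'a, 'c) psalg") (mor_fun: 'a) (mor_cell: 'c)

datatype ('o, 'a, 'c) pstrans =
  PsTrans (trans_src: "('o, 'a, 'c) psmor") (trans_trg: "('o, 'a, 'c) psmor") (trans_cell: 'c)

context
  fixes C :: "('o, 'a, 'c) two_cat" (structure) and M :: "('o, 'a, 'c) psmonad_data"
begin

abbreviation T0 :: "'o \<Rightarrow> 'o" where "T0 \<equiv> F0 (endo M)"
abbreviation T1 :: "'a \<Rightarrow> 'a" where "T1 \<equiv> F1 (endo M)"
abbreviation T2 :: "'c \<Rightarrow> 'c" where "T2 \<equiv> F2 (endo M)"
abbreviation \<eta> :: "'o \<Rightarrow> 'a" where "\<eta> \<equiv> eta M"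
abbreviation \<eta>n :: "'a \<Rightarrow> 'c" where "\<eta>n \<equiv> eta_nat M"
abbreviation \<mu> :: "'o \<Rightarrow> 'a" where "\<mu> \<equiv> mu M"
abbreviation \<mu>n :: "'a \<Rightarrow> 'c" where "\<mu>n \<equiv> mu_nat M"
abbreviation \<xi> :: "'o \<Rightarrow> 'c" where "\<xi> \<equiv> xi M"
abbreviation \<zeta> :: "'o \<Rightarrow> 'c" where "\<zeta> \<equiv> zeta M"
abbreviation \<rho> :: "'o \<Rightarrow> 'c" where "\<rho> \<equiv> rho M"

fun is_psalg :: "('o, 'a, 'c) psalg \<Rightarrow> bool" where
  "is_psalg (PsAlg A a \<alpha>t \<alpha>s) \<longleftrightarrow>
     A \<in> Obj C \<and>
     a \<in> hom1 C (T0 A) A \<and>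
     \<alpha>t \<in> invhom2 C (a \<cdot> \<eta> A) (id1 C A) \<and>
     \<alpha>s \<in> invhom2 C (a \<cdot> T1 a) (a \<cdot> \<mu> A) \<and>
     (a \<triangleright> \<zeta> A) \<odot> (\<alpha>s \<triangleleft> T1 (\<eta> A)) = a \<triangleright> T2 \<alpha>t \<and>
     (a \<triangleright> \<rho> A) \<odot> (\<alpha>s \<triangleleft> T1 (\<mu> A)) \<odot> (a \<triangleright> T2 \<alpha>s) =
     (\<alpha>s \<triangleleft> \<mu> (T0 A)) \<odot> (a \<triangleright> \<mu>n a) \<odot> (\<alpha>s \<triangleleft> T1 (T1 a))"

text \<open>
  The last three equations before the algebra axiom say that \<open>\<xi>\<close>, \<open>\<zeta>\<close> and \<open>\<rho>\<close> are
  modifications.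
\<close>

definition pseudomonad :: bool where
  "pseudomonad \<longleftrightarrow>
     two_functor C C (endo M) \<and>
     pseudonat_to C C id_two_fun (endo M) \<eta> \<eta>n \<and>
     pseudonat_from C C (comp_two_fun (endo M) (endo M)) (endo M) \<mu> \<mu>n \<and>
     (\<forall>A \<in> Obj C.
        \<xi> A \<in> invhom2 C (\<mu> A \<cdot> \<eta> (T0 A)) (id1 C (T0 A)) \<and>
        \<zeta> A \<in> invhom2 C (\<mu> A \<cdot> T1 (\<eta> A)) (id1 C (T0 A)) \<and>
        \<rho> A \<in> invhom2 C (\<mu> A \<cdot> T1 (\<mu> A)) (\<mu> A \<cdot> \<mu> (T0 A))) \<and>
     (\<forall>A \<in> Obj C. \<forall>B \<in> Obj C. \<forall>f \<in> hom1 C A B.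
        (\<xi> B \<triangleleft> T1 f) \<odot> (\<mu> B \<triangleright> \<eta>n (T1 f)) = (T1 f \<triangleright> \<xi> A) \<odot> (\<mu>n f \<triangleleft> \<eta> (T0 A)) \<and>
        (\<zeta> B \<triangleleft> T1 f) \<odot> (\<mu> B \<triangleright> T2 (\<eta>n f)) = (T1 f \<triangleright> \<zeta> A) \<odot> (\<mu>n f \<triangleleft> T1 (\<eta> A)) \<and>
        (\<mu>n f \<triangleleft> \<mu> (T0 A)) \<odot> (\<mu> B \<triangleright> \<mu>n (T1 f)) \<odot> (\<rho> B \<triangleleft> T1 (T1 (T1 f))) =
        (T1 f \<triangleright> \<rho> A) \<odot> (\<mu>n f \<triangleleft> T1 (\<mu> A)) \<odot> (\<mu> B \<triangleright> T2 (\<mu>n f))) \<and>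
     (\<forall>A \<in> Obj C. is_psalg (PsAlg (T0 A) (\<mu> A) (\<xi> A) (\<rho> A)))"

fun is_psmor :: "('o, 'a, 'c) psmor \<Rightarrow> bool" where
  "is_psmor (PsMor (PsAlg A a \<alpha>t \<alpha>s) (PsAlg B b \<beta>t \<beta>s) f \<phi>) \<longleftrightarrow>
     is_psalg (PsAlg A a \<alpha>t \<alpha>s) \<and>
     is_psalg (PsAlg B b \<beta>t \<beta>s) \<and>
     f \<in> hom1 C A B \<and>
     \<phi> \<in> invhom2 C (b \<cdot> T1 f) (f \<cdot> a) \<and>
     (f \<triangleright> \<alpha>t) \<odot> (\<phi> \<triangleleft> \<eta> A) = (\<beta>t \<triangleleft> f) \<odot> (b \<triangleright> \<eta>n f) \<and>
     (f \<triangleright> \<alpha>s) \<odot> (\<phi> \<triangleleft> T1 a) \<odot> (b \<triangleright> T2 \<phi>) =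
     (\<phi> \<triangleleft> \<mu> A) \<odot> (b \<triangleright> \<mu>n f) \<odot> (\<beta>s \<triangleleft> T1 (T1 f))"

definition is_pstrans :: "('o, 'a, 'c) pstrans \<Rightarrow> bool" where
  "is_pstrans \<Sigma> \<longleftrightarrow>
     (case \<Sigma> of PsTrans F G \<sigma> \<Rightarrow>
        is_psmor F \<and> is_psmor G \<and> mor_src F = mor_src G \<and> mor_trg F = mor_trg G \<and>
        \<sigma> \<in> hom2 C (mor_fun F) (mor_fun G) \<and>
        (\<sigma> \<triangleleft> alg_act (mor_src F)) \<odot> mor_cell F =
        mor_cell G \<odot> (alg_act (mor_trg F) \<triangleright> T2 \<sigma>))"

text \<open>The composite of pseudomorphisms is \<open>(g, \<gamma>)(f, \<phi>) = (g f, (g \<phi>) \<circ> (\<gamma> T f))\<close>.\<close>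

definition comp_psmor :: "('o, 'a, 'c) psmor \<Rightarrow> ('o, 'a, 'c) psmor \<Rightarrow> ('o, 'a, 'c) psmor" where
  "comp_psmor G F = PsMor (mor_src F) (mor_trg G) (mor_fun G \<cdot> mor_fun F)
     ((mor_fun G \<triangleright> mor_cell F) \<odot> (mor_cell G \<triangleleft> T1 (mor_fun F)))"

definition T_psAlg ::
    "(('o, 'a, 'c) psalg, ('o, 'a, 'c) psmor, ('o, 'a, 'c) pstrans) two_cat" where
  "T_psAlg =
     \<lparr>Obj = {X. is_psalg X},
      Cell1 = {F. is_psmor F},
      Cell2 = {\<Sigma>. is_pstrans \<Sigma>},
      src1 = mor_src,
      trg1 = mor_trg,
      src2 = trans_src,
      trg2 = trans_trg,
      id1 = (\<lambda>X. PsMor X X (id1 C (alg_ob X)) (id2 C (alg_act X))),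
      id2 = (\<lambda>F. PsTrans F F (id2 C (mor_fun F))),
      comp1 = comp_psmor,
      vcomp = (\<lambda>\<Sigma>' \<Sigma>. PsTrans (trans_src \<Sigma>) (trans_trg \<Sigma>') (trans_cell \<Sigma>' \<odot> trans_cell \<Sigma>)),
      hcomp = (\<lambda>\<Sigma>' \<Sigma>. PsTrans (comp_psmor (trans_src \<Sigma>') (trans_src \<Sigma>))
                              (comp_psmor (trans_trg \<Sigma>') (trans_trg \<Sigma>))
                              (trans_cell \<Sigma>' \<star> trans_cell \<Sigma>))\<rparr>"

end

end

theory Submission
  imports Defs
begin

text \<open>
  Let \<open>U\<close> be the forgetful 2-functor to \<open>C\<close>.  An oplax cocone on \<open>F : I \<rightarrow> T-psAlg\<close> with tip \<open>B\<close> is an oplax cocone on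
  \<open>U F\<close> with tip \<open>U B\<close> whose legs carry pseudomorphism structure, compatibly with the cocone cells.  The
  structure cells form an invertible modification between cocones on \<open>T U F\<close>, and their multiplication laws
  compare cocones on \<open>T T U F\<close>.  All three kinds of cocones in \<open>C\<close> are classified by pseudomorphisms out of the free
  algebras on the oplax bicolimits of \<open>U F\<close>, \<open>T U F\<close> and \<open>T T U F\<close>.  These free algebras form a codescent object whose
  pseudocoequalizing pairs with tip \<open>B\<close> are, up to equivalence, the oplax cocones on \<open>F\<close> with tip \<open>B\<close>, so its
  bicoequalizer is the oplax bicolimit of \<open>F\<close>.
\<close>

section \<open>2-categories\<close>

text \<open>\<open>T\<close> need not preserve oplax bicolimits, so the bicolimits of
  \<open>T U F\<close> and \<open>T T U F\<close> are not obtained by applying \<open>T\<close> to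
  that of \<open>U F\<close>. Three separate bicolimits are taken, and the 1-cells between the free
  algebras on them come from universal properties, hence only with chosen invertible comparison
  modifications \<delta>, \<epsilon>, \<pi>. These cells are carried through the whole argument, and
  each 2-cell of the codescent object is defined by the equation that it has to satisfy on the legs.
  The universal property of a free algebra rests on full faithfulness of restriction along the unit,
  which is where the coherence of the pseudomonad is spent. Bicocompleteness speaks of weights and
  pseudonatural transformations, so oplax cocones have to be re-expressed by a small weight.
  Equivalences of categories are handled as fully faithful and essentially surjective functors,
  which compose easily. \<open>oplax_postcomp\<close> is, on the nose,
  \<open>pscoeq_postcomp\<close> followed by a comparison functor from pairs to cocones; if the
  latter is an equivalence, the universal property of the bicoequalizer transfers.\<close>

context two_category
begin

lemma Obj_src1: "f \<in> Cell1 K \<Longrightarrow> src1 K f \<in> Obj K"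
  using category.Dom_Ob[OF category_cat1] by (simp add: cat1_def)

lemma Obj_trg1: "f \<in> Cell1 K \<Longrightarrow> trg1 K f \<in> Obj K"
  using category.Cod_Ob[OF category_cat1] by (simp add: cat1_def)

lemma Cell1_src2: "\<alpha> \<in> Cell2 K \<Longrightarrow> src2 K \<alpha> \<in> Cell1 K"
  using category.Dom_Ob[OF category_vcat] by (simp add: vcat_def)

lemma Cell1_trg2: "\<alpha> \<in> Cell2 K \<Longrightarrow> trg2 K \<alpha> \<in> Cell1 K"
  using category.Cod_Ob[OF category_vcat] by (simp add: vcat_def)

lemma id1_typing:
  assumes "A \<in> Obj K"
  shows "id1 K A \<in> Cell1 K" "src1 K (id1 K A) = A" "trg1 K (id1 K A) = A"
  using category.Idn_Hom[OF category_cat1, of A] assms by (simp_all add: cat1_def Hom_def)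

lemma id2_typing:
  assumes "f \<in> Cell1 K"
  shows "id2 K f \<in> Cell2 K" "src2 K (id2 K f) = f" "trg2 K (id2 K f) = f"
  using category.Idn_Hom[OF category_vcat, of f] assms by (simp_all add: vcat_def Hom_def)

lemma comp1_typing:
  assumes "f \<in> Cell1 K" "g \<in> Cell1 K" "src1 K g = trg1 K f"
  shows "g \<cdot> f \<in> Cell1 K" "src1 K (g \<cdot> f) = src1 K f" "trg1 K (g \<cdot> f) = trg1 K g"
  using category.Cmp_Hom[OF category_cat1, of f _ _ g] assms by (auto simp: cat1_def Hom_def)

lemma comp1_assoc:
  assumes "f \<in> Cell1 K" "g \<in> Cell1 K" "h \<in> Cell1 K" "src1 K g = trg1 K f" "src1 K h = trg1 K g"
  shows "(h \<cdot> g) \<cdot> f = h \<cdot> (g \<cdot> f)"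
  using category.Cmp_assoc[OF category_cat1, of f _ _ g _ h] assms by (auto simp: cat1_def Hom_def)

lemma comp1_id_left: "f \<in> Cell1 K \<Longrightarrow> trg1 K f = A \<Longrightarrow> id1 K A \<cdot> f = f"
  using category.Cmp_Idn_left[OF category_cat1, of f "src1 K f" A]
  by (auto simp: cat1_def Hom_def)

lemma comp1_id_right: "f \<in> Cell1 K \<Longrightarrow> src1 K f = A \<Longrightarrow> f \<cdot> id1 K A = f"
  using category.Cmp_Idn_right[OF category_cat1, of f A "trg1 K f"]
  by (auto simp: cat1_def Hom_def)

lemma vcomp_typing:
  assumes "\<alpha> \<in> Cell2 K" "\<beta> \<in> Cell2 K" "src2 K \<beta> = trg2 K \<alpha>"
  shows "\<beta> \<odot> \<alpha> \<in> Cell2 K" "src2 K (\<beta> \<odot> \<alpha>) = src2 K \<alpha>" "trg2 K (\<beta> \<odot> \<alpha>) = trg2 K \<beta>"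
  using category.Cmp_Hom[OF category_vcat, of \<alpha> _ _ \<beta>] assms by (auto simp: vcat_def Hom_def)

lemma vcomp_assoc:
  assumes "\<alpha> \<in> Cell2 K" "\<beta> \<in> Cell2 K" "\<gamma> \<in> Cell2 K" "src2 K \<beta> = trg2 K \<alpha>" "src2 K \<gamma> = trg2 K \<beta>"
  shows "(\<gamma> \<odot> \<beta>) \<odot> \<alpha> = \<gamma> \<odot> (\<beta> \<odot> \<alpha>)"
  using category.Cmp_assoc[OF category_vcat, of \<alpha> _ _ \<beta> _ \<gamma>] assms by (auto simp: vcat_def Hom_def)

lemma vcomp_id_left: "\<alpha> \<in> Cell2 K \<Longrightarrow> trg2 K \<alpha> = f \<Longrightarrow> id2 K f \<odot> \<alpha> = \<alpha>"
  using category.Cmp_Idn_left[OF category_vcat, of \<alpha> "src2 K \<alpha>" f]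
  by (auto simp: vcat_def Hom_def)

lemma vcomp_id_right: "\<alpha> \<in> Cell2 K \<Longrightarrow> src2 K \<alpha> = f \<Longrightarrow> \<alpha> \<odot> id2 K f = \<alpha>"
  using category.Cmp_Idn_right[OF category_vcat, of \<alpha> f "trg2 K \<alpha>"]
  by (auto simp: vcat_def Hom_def)

lemma hcomp_typing:
  assumes "\<alpha> \<in> Cell2 K" "\<beta> \<in> Cell2 K" "src1 K (src2 K \<beta>) = trg1 K (src2 K \<alpha>)"
  shows "\<beta> \<star> \<alpha> \<in> Cell2 K" "src2 K (\<beta> \<star> \<alpha>) = src2 K \<beta> \<cdot> src2 K \<alpha>"
    "trg2 K (\<beta> \<star> \<alpha>) = trg2 K \<beta> \<cdot> trg2 K \<alpha>"
  using hcomp_hom2[of \<alpha> "src2 K \<alpha>" "trg2 K \<alpha>" \<beta> "src2 K \<beta>" "trg2 K \<beta>"] assms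
  by (simp_all add: hom2_def)

lemma hcomp_assoc:
  assumes "\<alpha> \<in> Cell2 K" "\<beta> \<in> Cell2 K" "\<gamma> \<in> Cell2 K"
    "src1 K (src2 K \<beta>) = trg1 K (src2 K \<alpha>)" "src1 K (src2 K \<gamma>) = trg1 K (src2 K \<beta>)"
  shows "(\<gamma> \<star> \<beta>) \<star> \<alpha> = \<gamma> \<star> (\<beta> \<star> \<alpha>)"
  using category.Cmp_assoc[OF category_hcat, of \<alpha> _ _ \<beta> _ \<gamma>] assms by (auto simp: hcat_def Hom_def)

lemma hcomp_id_left: "\<alpha> \<in> Cell2 K \<Longrightarrow> trg1 K (src2 K \<alpha>) = A \<Longrightarrow> id2 K (id1 K A) \<star> \<alpha> = \<alpha>"
  using category.Cmp_Idn_left[OF category_hcat, of \<alpha> "src1 K (src2 K \<alpha>)" A]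
  by (auto simp: hcat_def Hom_def)

lemma hcomp_id_right: "\<alpha> \<in> Cell2 K \<Longrightarrow> src1 K (src2 K \<alpha>) = A \<Longrightarrow> \<alpha> \<star> id2 K (id1 K A) = \<alpha>"
  using category.Cmp_Idn_right[OF category_hcat, of \<alpha> A "trg1 K (src2 K \<alpha>)"]
  by (auto simp: hcat_def Hom_def)

lemma hcomp_vcomp:
  assumes "\<alpha> \<in> Cell2 K" "\<alpha>' \<in> Cell2 K" "\<beta> \<in> Cell2 K" "\<beta>' \<in> Cell2 K"
    "src2 K \<alpha>' = trg2 K \<alpha>" "src2 K \<beta>' = trg2 K \<beta>" "src1 K (src2 K \<beta>) = trg1 K (src2 K \<alpha>)"
  shows "(\<beta>' \<odot> \<beta>) \<star> (\<alpha>' \<odot> \<alpha>) = (\<beta>' \<star> \<alpha>') \<odot> (\<beta> \<star> \<alpha>)"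
  using interchange[of \<alpha> _ _ \<alpha>' _ \<beta> _ _ \<beta>'] assms by (auto simp: hom2_def)

lemmas cell_typing =
  Obj_src1 Obj_trg1 Cell1_src2 Cell1_trg2 id1_typing id2_typing comp1_typing vcomp_typing
  src1_trg2 trg1_trg2

declare cell_typing [simp] comp1_assoc [simp] comp1_id_left [simp] comp1_id_right [simp]
  vcomp_assoc [simp] vcomp_id_left [simp] vcomp_id_right [simp]

lemma lwhisker_typing [simp]:
  assumes "\<alpha> \<in> Cell2 K" "f \<in> Cell1 K" "src1 K f = trg1 K (src2 K \<alpha>)"
  shows "f \<triangleright> \<alpha> \<in> Cell2 K" "src2 K (f \<triangleright> \<alpha>) = f \<cdot> src2 K \<alpha>" "trg2 K (f \<triangleright> \<alpha>) = f \<cdot> trg2 K \<alpha>"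
  using assms by (simp_all add: lwhisker_def hcomp_typing)

lemma rwhisker_typing [simp]:
  assumes "\<alpha> \<in> Cell2 K" "f \<in> Cell1 K" "src1 K (src2 K \<alpha>) = trg1 K f"
  shows "\<alpha> \<triangleleft> f \<in> Cell2 K" "src2 K (\<alpha> \<triangleleft> f) = src2 K \<alpha> \<cdot> f" "trg2 K (\<alpha> \<triangleleft> f) = trg2 K \<alpha> \<cdot> f"
  using assms by (simp_all add: rwhisker_def hcomp_typing)

lemma lwhisker_vcomp [simp]:
  assumes "\<alpha> \<in> Cell2 K" "\<beta> \<in> Cell2 K" "src2 K \<beta> = trg2 K \<alpha>" "f \<in> Cell1 K"
    "src1 K f = trg1 K (src2 K \<alpha>)"
  shows "f \<triangleright> (\<beta> \<odot> \<alpha>) = (f \<triangleright> \<beta>) \<odot> (f \<triangleright> \<alpha>)"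
  using hcomp_vcomp[of \<alpha> \<beta> "id2 K f" "id2 K f"] assms by (simp add: lwhisker_def)

lemma rwhisker_vcomp [simp]:
  assumes "\<alpha> \<in> Cell2 K" "\<beta> \<in> Cell2 K" "src2 K \<beta> = trg2 K \<alpha>" "f \<in> Cell1 K"
    "src1 K (src2 K \<alpha>) = trg1 K f"
  shows "(\<beta> \<odot> \<alpha>) \<triangleleft> f = (\<beta> \<triangleleft> f) \<odot> (\<alpha> \<triangleleft> f)"
  using hcomp_vcomp[of "id2 K f" "id2 K f" \<alpha> \<beta>] assms by (simp add: rwhisker_def)

lemma lwhisker_lwhisker [simp]:
  assumes "\<alpha> \<in> Cell2 K" "f \<in> Cell1 K" "g \<in> Cell1 K" "src1 K f = trg1 K (src2 K \<alpha>)"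
    "src1 K g = trg1 K f"
  shows "g \<triangleright> (f \<triangleright> \<alpha>) = (g \<cdot> f) \<triangleright> \<alpha>"
  using assms by (simp add: lwhisker_def hcomp_assoc[symmetric] hcomp_id2)

lemma rwhisker_rwhisker [simp]:
  assumes "\<alpha> \<in> Cell2 K" "f \<in> Cell1 K" "g \<in> Cell1 K" "src1 K (src2 K \<alpha>) = trg1 K f"
    "src1 K f = trg1 K g"
  shows "(\<alpha> \<triangleleft> f) \<triangleleft> g = \<alpha> \<triangleleft> (f \<cdot> g)"
  using assms by (simp add: rwhisker_def hcomp_assoc hcomp_id2)

text \<open>With this rule the \<open>simp\<close> normal form of a pasting is fixed: vertical
  composites are nested to the right, and each factor has the shape
  \<open>f \<triangleright> (\<alpha> \<triangleleft> g)\<close> with the whiskering 1-cells merged.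
  Later proofs state their equations in this form, so that they act as rewrite rules.\<close>

lemma rwhisker_lwhisker [simp]:
  assumes "\<alpha> \<in> Cell2 K" "f \<in> Cell1 K" "g \<in> Cell1 K" "src1 K f = trg1 K (src2 K \<alpha>)"
    "src1 K (src2 K \<alpha>) = trg1 K g"
  shows "(f \<triangleright> \<alpha>) \<triangleleft> g = f \<triangleright> (\<alpha> \<triangleleft> g)"
  using assms by (simp add: rwhisker_def lwhisker_def hcomp_assoc)

lemma lwhisker_id1 [simp]: "\<alpha> \<in> Cell2 K \<Longrightarrow> trg1 K (src2 K \<alpha>) = A \<Longrightarrow> id1 K A \<triangleright> \<alpha> = \<alpha>"
  by (simp add: lwhisker_def hcomp_id_left)

lemma rwhisker_id1 [simp]: "\<alpha> \<in> Cell2 K \<Longrightarrow> src1 K (src2 K \<alpha>) = A \<Longrightarrow> \<alpha> \<triangleleft> id1 K A = \<alpha>"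
  by (simp add: rwhisker_def hcomp_id_right)

lemma lwhisker_id2 [simp]:
  "f \<in> Cell1 K \<Longrightarrow> g \<in> Cell1 K \<Longrightarrow> src1 K g = trg1 K f \<Longrightarrow> g \<triangleright> id2 K f = id2 K (g \<cdot> f)"
  by (simp add: lwhisker_def hcomp_id2)

lemma rwhisker_id2 [simp]:
  "f \<in> Cell1 K \<Longrightarrow> g \<in> Cell1 K \<Longrightarrow> src1 K g = trg1 K f \<Longrightarrow> id2 K g \<triangleleft> f = id2 K (g \<cdot> f)"
  by (simp add: rwhisker_def hcomp_id2)

text \<open>Interchange for \<open>\<beta> = \<beta> \<odot> id\<close> and
  \<open>\<alpha> = id \<odot> \<alpha>\<close>; \<open>hcomp_whisker'\<close> pads on the other
  sides.\<close>

lemma hcomp_whisker: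
  assumes "\<alpha> \<in> Cell2 K" "\<beta> \<in> Cell2 K" "src1 K (src2 K \<beta>) = trg1 K (src2 K \<alpha>)"
  shows "\<beta> \<star> \<alpha> = (\<beta> \<triangleleft> trg2 K \<alpha>) \<odot> (src2 K \<beta> \<triangleright> \<alpha>)"
  using hcomp_vcomp[of \<alpha> "id2 K (trg2 K \<alpha>)" "id2 K (src2 K \<beta>)" \<beta>] assms
  by (simp add: rwhisker_def lwhisker_def)

lemma hcomp_whisker':
  assumes "\<alpha> \<in> Cell2 K" "\<beta> \<in> Cell2 K" "src1 K (src2 K \<beta>) = trg1 K (src2 K \<alpha>)"
  shows "\<beta> \<star> \<alpha> = (trg2 K \<beta> \<triangleright> \<alpha>) \<odot> (\<beta> \<triangleleft> src2 K \<alpha>)"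
  using hcomp_vcomp[of "id2 K (src2 K \<alpha>)" \<alpha> \<beta> "id2 K (trg2 K \<beta>)"] assms
  by (simp add: rwhisker_def lwhisker_def)

text \<open>Both sides are \<open>\<beta> \<star> \<alpha>\<close>. Interchange is mostly used in
  this form: two cells sitting on different 1-cells slide past each other.\<close>

lemma swap:
  assumes "\<alpha> \<in> Cell2 K" "\<beta> \<in> Cell2 K" "src1 K (src2 K \<beta>) = trg1 K (src2 K \<alpha>)"
  shows "(trg2 K \<beta> \<triangleright> \<alpha>) \<odot> (\<beta> \<triangleleft> src2 K \<alpha>) = (\<beta> \<triangleleft> trg2 K \<alpha>) \<odot> (src2 K \<beta> \<triangleright> \<alpha>)"
  using assms hcomp_whisker hcomp_whisker' by simp

text \<open>As \<open>simp\<close> nests composites to the right, a two-factor equation matches only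
  at the very end of a composite. Prolonged by an arbitrary tail \<delta> it also rewrites in the
  middle; \<open>vcomp_eq_ext3\<close> does this for three factors.\<close>

lemma vcomp_eq_ext:
  assumes "\<beta> \<odot> \<alpha> = \<gamma>" "\<alpha> \<in> Cell2 K" "\<beta> \<in> Cell2 K" "src2 K \<beta> = trg2 K \<alpha>"
    and "\<delta> \<in> Cell2 K" "trg2 K \<delta> = src2 K \<alpha>"
  shows "\<beta> \<odot> (\<alpha> \<odot> \<delta>) = \<gamma> \<odot> \<delta>"
  using assms by (metis vcomp_assoc)

lemma vcomp_eq_ext3:
  assumes "\<gamma> \<odot> (\<beta> \<odot> \<alpha>) = \<epsilon>" "\<alpha> \<in> Cell2 K" "\<beta> \<in> Cell2 K" "\<gamma> \<in> Cell2 K"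
    "src2 K \<beta> = trg2 K \<alpha>" "src2 K \<gamma> = trg2 K \<beta>"
    and "\<delta> \<in> Cell2 K" "trg2 K \<delta> = src2 K \<alpha>"
  shows "\<gamma> \<odot> (\<beta> \<odot> (\<alpha> \<odot> \<delta>)) = \<epsilon> \<odot> \<delta>"
proof -
  have "(\<gamma> \<odot> (\<beta> \<odot> \<alpha>)) \<odot> \<delta> = \<gamma> \<odot> (\<beta> \<odot> (\<alpha> \<odot> \<delta>))"
    using assms(2-) by simp
  then show ?thesis
    using assms(1) by simp
qed

section \<open>Invertible 2-cells\<close>

abbreviation iso2 :: "'c \<Rightarrow> bool" where "iso2 \<alpha> \<equiv> invertible (vcat K) \<alpha>"

text \<open>Meaningful for invertible \<alpha>. Since \<open>iso2 \<alpha>\<close> includes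
  membership in \<open>Cell2 K\<close>, invertibility alone discharges the typing conditions of the
  rules about \<open>vinv\<close>.\<close>

definition vinv :: "'c \<Rightarrow> 'c" where
  "vinv \<alpha> = (SOME \<beta>. \<beta> \<in> Cell2 K \<and> src2 K \<beta> = trg2 K \<alpha> \<and> trg2 K \<beta> = src2 K \<alpha> \<and>
     \<beta> \<odot> \<alpha> = id2 K (src2 K \<alpha>) \<and> \<alpha> \<odot> \<beta> = id2 K (trg2 K \<alpha>))"

lemma iso2I:
  assumes "\<alpha> \<in> Cell2 K" "\<beta> \<in> Cell2 K" "src2 K \<beta> = trg2 K \<alpha>" "trg2 K \<beta> = src2 K \<alpha>"
    "\<beta> \<odot> \<alpha> = id2 K (src2 K \<alpha>)" "\<alpha> \<odot> \<beta> = id2 K (trg2 K \<alpha>)"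
  shows "iso2 \<alpha>"
  using assms by (auto simp: invertible_def vcat_def Hom_def)

lemma iso2_Cell2: "iso2 \<alpha> \<Longrightarrow> \<alpha> \<in> Cell2 K"
  by (simp add: invertible_def vcat_def)

lemma vinv_props:
  assumes "iso2 \<alpha>"
  shows "vinv \<alpha> \<in> Cell2 K \<and> src2 K (vinv \<alpha>) = trg2 K \<alpha> \<and> trg2 K (vinv \<alpha>) = src2 K \<alpha> \<and>
    vinv \<alpha> \<odot> \<alpha> = id2 K (src2 K \<alpha>) \<and> \<alpha> \<odot> vinv \<alpha> = id2 K (trg2 K \<alpha>)"
  unfolding vinv_def by (rule someI_ex) (use assms in \<open>auto simp: invertible_def vcat_def Hom_def\<close>)

declare iso2_Cell2 [simp]

lemma vinv_simps [simp]:
  assumes "iso2 \<alpha>"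
  shows "vinv \<alpha> \<in> Cell2 K" "src2 K (vinv \<alpha>) = trg2 K \<alpha>" "trg2 K (vinv \<alpha>) = src2 K \<alpha>"
    "vinv \<alpha> \<odot> \<alpha> = id2 K (src2 K \<alpha>)" "\<alpha> \<odot> vinv \<alpha> = id2 K (trg2 K \<alpha>)"
  using vinv_props[OF assms] by auto

lemma vinv_cancel [simp]:
  assumes "iso2 \<alpha>" "\<delta> \<in> Cell2 K"
  shows "trg2 K \<delta> = src2 K \<alpha> \<Longrightarrow> vinv \<alpha> \<odot> (\<alpha> \<odot> \<delta>) = \<delta>"
    and "trg2 K \<delta> = trg2 K \<alpha> \<Longrightarrow> \<alpha> \<odot> (vinv \<alpha> \<odot> \<delta>) = \<delta>"
  using assms vinv_props[OF assms(1)] iso2_Cell2[OF assms(1)]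
  by (metis vcomp_assoc vcomp_id_left)+

lemma iso2_vinv [simp]: "iso2 \<alpha> \<Longrightarrow> iso2 (vinv \<alpha>)"
  using iso2I[of "vinv \<alpha>" \<alpha>] iso2_Cell2[of \<alpha>] by simp

lemma iso2_id2 [simp]: "f \<in> Cell1 K \<Longrightarrow> iso2 (id2 K f)"
  using iso2I[of "id2 K f" "id2 K f"] by simp

lemma iso2_vcomp [simp]:
  assumes "iso2 \<alpha>" "iso2 \<beta>" "src2 K \<beta> = trg2 K \<alpha>"
  shows "iso2 (\<beta> \<odot> \<alpha>)"
  using iso2I[of "\<beta> \<odot> \<alpha>" "vinv \<alpha> \<odot> vinv \<beta>"] assms iso2_Cell2[OF assms(1)] iso2_Cell2[OF assms(2)]
  by simp

lemma vinv_lwhisker: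
  assumes "iso2 \<alpha>" "f \<in> Cell1 K" "src1 K f = trg1 K (src2 K \<alpha>)"
  shows "(f \<triangleright> vinv \<alpha>) \<odot> (f \<triangleright> \<alpha>) = id2 K (f \<cdot> src2 K \<alpha>)"
    "(f \<triangleright> \<alpha>) \<odot> (f \<triangleright> vinv \<alpha>) = id2 K (f \<cdot> trg2 K \<alpha>)"
  using assms iso2_Cell2[OF assms(1)] by (simp_all flip: lwhisker_vcomp)

lemma vinv_rwhisker:
  assumes "iso2 \<alpha>" "f \<in> Cell1 K" "src1 K (src2 K \<alpha>) = trg1 K f"
  shows "(vinv \<alpha> \<triangleleft> f) \<odot> (\<alpha> \<triangleleft> f) = id2 K (src2 K \<alpha> \<cdot> f)"
    "(\<alpha> \<triangleleft> f) \<odot> (vinv \<alpha> \<triangleleft> f) = id2 K (trg2 K \<alpha> \<cdot> f)"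
  using assms iso2_Cell2[OF assms(1)] by (simp_all flip: rwhisker_vcomp)

lemma iso2_lwhisker [simp]:
  assumes "iso2 \<alpha>" "f \<in> Cell1 K" "src1 K f = trg1 K (src2 K \<alpha>)"
  shows "iso2 (f \<triangleright> \<alpha>)"
  using assms iso2_Cell2[OF assms(1)] vinv_lwhisker[OF assms]
  by (intro iso2I[of "f \<triangleright> \<alpha>" "f \<triangleright> vinv \<alpha>"]) simp_all

lemma iso2_rwhisker [simp]:
  assumes "iso2 \<alpha>" "f \<in> Cell1 K" "src1 K (src2 K \<alpha>) = trg1 K f"
  shows "iso2 (\<alpha> \<triangleleft> f)"
  using assms iso2_Cell2[OF assms(1)] vinv_rwhisker[OF assms]
  by (intro iso2I[of "\<alpha> \<triangleleft> f" "vinv \<alpha> \<triangleleft> f"]) simp_all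

lemma iso2_cancel_left:
  assumes "\<gamma> \<odot> \<alpha> = \<gamma> \<odot> \<beta>" "iso2 \<gamma>" "\<alpha> \<in> Cell2 K" "\<beta> \<in> Cell2 K"
    "trg2 K \<alpha> = src2 K \<gamma>" "trg2 K \<beta> = src2 K \<gamma>"
  shows "\<alpha> = \<beta>"
  using assms vinv_cancel(1) by metis

lemma iso2_cancel_right:
  assumes "\<alpha> \<odot> \<gamma> = \<beta> \<odot> \<gamma>" "iso2 \<gamma>" "\<alpha> \<in> Cell2 K" "\<beta> \<in> Cell2 K"
    "src2 K \<alpha> = trg2 K \<gamma>" "src2 K \<beta> = trg2 K \<gamma>"
  shows "\<alpha> = \<beta>"
proof -
  have "(\<alpha> \<odot> \<gamma>) \<odot> vinv \<gamma> = (\<beta> \<odot> \<gamma>) \<odot> vinv \<gamma>"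
    using assms(1) by simp
  then show ?thesis
    using assms(2-) iso2_Cell2[OF assms(2)] by simp
qed

lemma category_homcat: "category (homcat K A B)"
  by unfold_locales (auto simp: homcat_def hom1_def Hom_def)

end

section \<open>Strict 2-functors and the cells they preserve\<close>

locale two_fun = I: two_category I + K: two_category K
  for I :: "('i, 'd, 'e) two_cat" and K :: "('o, 'a, 'c) two_cat" +
  fixes F :: "('i, 'd, 'e, 'o, 'a, 'c) two_fun"
  assumes two_functor: "two_functor I K F"
begin

lemma F0_Obj [simp]: "A \<in> Obj I \<Longrightarrow> F0 F A \<in> Obj K"
  using two_functor by (simp add: two_functor_def is_functor_def cat1_def)

lemma F1_typing [simp]:
  assumes "f \<in> Cell1 I"
  shows "F1 F f \<in> Cell1 K" "src1 K (F1 F f) = F0 F (src1 I f)" "trg1 K (F1 F f) = F0 F (trg1 I f)"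
proof -
  have "\<forall>x \<in> Ob (cat1 I). \<forall>y \<in> Ob (cat1 I). \<forall>f \<in> Hom (cat1 I) x y. F1 F f \<in> Hom (cat1 K) (F0 F x) (F0 F y)"
    using two_functor by (simp add: two_functor_def is_functor_def)
  from this[rule_format, of "src1 I f" "trg1 I f" f]
  show "F1 F f \<in> Cell1 K" "src1 K (F1 F f) = F0 F (src1 I f)" "trg1 K (F1 F f) = F0 F (trg1 I f)"
    using assms by (simp_all add: cat1_def Hom_def)
qed

lemma F1_id1 [simp]: "A \<in> Obj I \<Longrightarrow> F1 F (id1 I A) = id1 K (F0 F A)"
  using two_functor by (simp add: two_functor_def is_functor_def cat1_def)

lemma F1_comp1 [simp]:
  assumes "f \<in> Cell1 I" "g \<in> Cell1 I" "src1 I g = trg1 I f"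
  shows "F1 F (g \<cdot>\<^bsub>I\<^esub> f) = F1 F g \<cdot>\<^bsub>K\<^esub> F1 F f"
  using two_functor assms by (auto simp: two_functor_def is_functor_def cat1_def)

lemma F2_typing [simp]:
  assumes "\<alpha> \<in> Cell2 I"
  shows "F2 F \<alpha> \<in> Cell2 K" "src2 K (F2 F \<alpha>) = F1 F (src2 I \<alpha>)" "trg2 K (F2 F \<alpha>) = F1 F (trg2 I \<alpha>)"
proof -
  have "\<forall>x \<in> Ob (vcat I). \<forall>y \<in> Ob (vcat I). \<forall>f \<in> Hom (vcat I) x y. F2 F f \<in> Hom (vcat K) (F1 F x) (F1 F y)"
    using two_functor by (simp add: two_functor_def is_functor_def)
  from this[rule_format, of "src2 I \<alpha>" "trg2 I \<alpha>" \<alpha>]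
  show "F2 F \<alpha> \<in> Cell2 K" "src2 K (F2 F \<alpha>) = F1 F (src2 I \<alpha>)" "trg2 K (F2 F \<alpha>) = F1 F (trg2 I \<alpha>)"
    using assms by (simp_all add: vcat_def Hom_def)
qed

lemma F2_id2 [simp]: "f \<in> Cell1 I \<Longrightarrow> F2 F (id2 I f) = id2 K (F1 F f)"
  using two_functor by (simp add: two_functor_def is_functor_def vcat_def)

lemma F2_vcomp [simp]:
  assumes "\<alpha> \<in> Cell2 I" "\<beta> \<in> Cell2 I" "src2 I \<beta> = trg2 I \<alpha>"
  shows "F2 F (\<beta> \<odot>\<^bsub>I\<^esub> \<alpha>) = F2 F \<beta> \<odot>\<^bsub>K\<^esub> F2 F \<alpha>"
  using two_functor assms by (auto simp: two_functor_def is_functor_def vcat_def)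

lemma F2_hcomp:
  assumes "\<alpha> \<in> Cell2 I" "\<beta> \<in> Cell2 I" "src1 I (src2 I \<beta>) = trg1 I (src2 I \<alpha>)"
  shows "F2 F (\<beta> \<star>\<^bsub>I\<^esub> \<alpha>) = F2 F \<beta> \<star>\<^bsub>K\<^esub> F2 F \<alpha>"
  using two_functor assms by (auto simp: two_functor_def is_functor_def hcat_def)

lemma F2_lwhisker [simp]:
  assumes "\<alpha> \<in> Cell2 I" "f \<in> Cell1 I" "src1 I f = trg1 I (src2 I \<alpha>)"
  shows "F2 F (f \<triangleright>\<^bsub>I\<^esub> \<alpha>) = F1 F f \<triangleright>\<^bsub>K\<^esub> F2 F \<alpha>"
  using assms by (simp add: lwhisker_def F2_hcomp)

lemma F2_rwhisker [simp]:
  assumes "\<alpha> \<in> Cell2 I" "f \<in> Cell1 I" "src1 I (src2 I \<alpha>) = trg1 I f"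
  shows "F2 F (\<alpha> \<triangleleft>\<^bsub>I\<^esub> f) = F2 F \<alpha> \<triangleleft>\<^bsub>K\<^esub> F1 F f"
  using assms by (simp add: rwhisker_def F2_hcomp)

lemma F2_iso2 [simp]:
  assumes "I.iso2 \<alpha>"
  shows "K.iso2 (F2 F \<alpha>)"
proof (rule K.iso2I[of _ "F2 F (I.vinv \<alpha>)"])
  show "F2 F (I.vinv \<alpha>) \<odot>\<^bsub>K\<^esub> F2 F \<alpha> = id2 K (src2 K (F2 F \<alpha>))"
    using assms F2_vcomp[of \<alpha> "I.vinv \<alpha>"] by simp
  show "F2 F \<alpha> \<odot>\<^bsub>K\<^esub> F2 F (I.vinv \<alpha>) = id2 K (trg2 K (F2 F \<alpha>))"
    using assms F2_vcomp[of "I.vinv \<alpha>" \<alpha>] by simp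
qed (use assms in simp_all)

end

section \<open>Pseudo-algebras\<close>

locale psmonad = two_category C for C :: "('o, 'a, 'c) two_cat" (structure) +
  fixes M :: "('o, 'a, 'c) psmonad_data"
  assumes pseudomonad: "pseudomonad C M"
begin

sublocale T: two_fun C C "endo M"
  by unfold_locales (use pseudomonad in \<open>simp add: pseudomonad_def\<close>)

abbreviation "alg \<equiv> is_psalg C M"
abbreviation "mor \<equiv> is_psmor C M"
abbreviation "transf \<equiv> is_pstrans C M"

lemma pseudonat_eta: "pseudonat_to C C id_two_fun (endo M) (\<eta> M) (\<eta>n M)"
  and pseudonat_mu: "pseudonat_from C C (comp_two_fun (endo M) (endo M)) (endo M) (\<mu> M) (\<mu>n M)"
  using pseudomonad by (simp_all add: pseudomonad_def)

lemma eta_typing [simp]: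
  assumes "A \<in> Obj C"
  shows "\<eta> M A \<in> Cell1 C" "src1 C (\<eta> M A) = A" "trg1 C (\<eta> M A) = T0 M A"
  using pseudonat_eta assms by (auto simp: pseudonat_to_def id_two_fun_def hom1_def)

lemma mu_typing [simp]:
  assumes "A \<in> Obj C"
  shows "\<mu> M A \<in> Cell1 C" "src1 C (\<mu> M A) = T0 M (T0 M A)" "trg1 C (\<mu> M A) = T0 M A"
  using pseudonat_mu assms by (auto simp: pseudonat_from_def comp_two_fun_def hom1_def)

lemma eta_nat_typing [simp]:
  assumes "f \<in> Cell1 C"
  shows "iso2 (\<eta>n M f)" "src2 C (\<eta>n M f) = T1 M f \<cdot> \<eta> M (src1 C f)"
    "trg2 C (\<eta>n M f) = \<eta> M (trg1 C f) \<cdot> f"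
proof -
  have "f \<in> hom1 C (src1 C f) (trg1 C f)" "src1 C f \<in> Obj C" "trg1 C f \<in> Obj C"
    using assms by (auto simp: hom1_def)
  then have "\<eta>n M f \<in> invhom2 C (T1 M f \<cdot> \<eta> M (src1 C f)) (\<eta> M (trg1 C f) \<cdot> f)"
    using pseudonat_eta by (simp add: pseudonat_to_def id_two_fun_def)
  then show "iso2 (\<eta>n M f)" "src2 C (\<eta>n M f) = T1 M f \<cdot> \<eta> M (src1 C f)" "trg2 C (\<eta>n M f) = \<eta> M (trg1 C f) \<cdot> f"
    by (simp_all add: invhom2_def hom2_def)
qed

lemma mu_nat_typing [simp]:
  assumes "f \<in> Cell1 C"
  shows "iso2 (\<mu>n M f)" "src2 C (\<mu>n M f) = \<mu> M (trg1 C f) \<cdot> T1 M (T1 M f)"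
    "trg2 C (\<mu>n M f) = T1 M f \<cdot> \<mu> M (src1 C f)"
proof -
  have "f \<in> hom1 C (src1 C f) (trg1 C f)" "src1 C f \<in> Obj C" "trg1 C f \<in> Obj C"
    using assms by (auto simp: hom1_def)
  then have "\<mu>n M f \<in> invhom2 C (\<mu> M (trg1 C f) \<cdot> T1 M (T1 M f)) (T1 M f \<cdot> \<mu> M (src1 C f))"
    using pseudonat_mu by (simp add: pseudonat_from_def comp_two_fun_def)
  then show "iso2 (\<mu>n M f)" "src2 C (\<mu>n M f) = \<mu> M (trg1 C f) \<cdot> T1 M (T1 M f)" "trg2 C (\<mu>n M f) = T1 M f \<cdot> \<mu> M (src1 C f)"
    by (simp_all add: invhom2_def hom2_def)
qed

lemma eta_nat_id1 [simp]: "A \<in> Obj C \<Longrightarrow> \<eta>n M (id1 C A) = id2 C (\<eta> M A)"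
  using pseudonat_eta by (auto simp: pseudonat_to_def)

lemma mu_nat_id1 [simp]: "A \<in> Obj C \<Longrightarrow> \<mu>n M (id1 C A) = id2 C (\<mu> M A)"
  using pseudonat_mu by (auto simp: pseudonat_from_def)

lemma eta_nat_comp1 [simp]:
  assumes "f \<in> Cell1 C" "g \<in> Cell1 C" "src1 C g = trg1 C f"
  shows "\<eta>n M (g \<cdot> f) = (\<eta>n M g \<triangleleft> f) \<odot> (T1 M g \<triangleright> \<eta>n M f)"
proof -
  have "f \<in> hom1 C (src1 C f) (src1 C g)" "g \<in> hom1 C (src1 C g) (trg1 C g)"
    "src1 C f \<in> Obj C" "src1 C g \<in> Obj C" "trg1 C g \<in> Obj C"
    using assms by (auto simp: hom1_def)
  then show ?thesis
    using pseudonat_eta by (simp add: pseudonat_to_def id_two_fun_def)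
qed

lemma mu_nat_comp1 [simp]:
  assumes "f \<in> Cell1 C" "g \<in> Cell1 C" "src1 C g = trg1 C f"
  shows "\<mu>n M (g \<cdot> f) = (T1 M g \<triangleright> \<mu>n M f) \<odot> (\<mu>n M g \<triangleleft> T1 M (T1 M f))"
proof -
  have "f \<in> hom1 C (src1 C f) (src1 C g)" "g \<in> hom1 C (src1 C g) (trg1 C g)"
    "src1 C f \<in> Obj C" "src1 C g \<in> Obj C" "trg1 C g \<in> Obj C"
    using assms by (auto simp: hom1_def)
  then show ?thesis
    using pseudonat_mu by (simp add: pseudonat_from_def comp_two_fun_def)
qed

lemma eta_nat_2:
  assumes "\<alpha> \<in> Cell2 C" "src2 C \<alpha> = f" "trg2 C \<alpha> = g" "src1 C f = A" "trg1 C f = B"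
  shows "\<eta>n M g \<odot> (T2 M \<alpha> \<triangleleft> \<eta> M A) = (\<eta> M B \<triangleright> \<alpha>) \<odot> \<eta>n M f"
proof -
  have "f \<in> hom1 C A B" "g \<in> hom1 C A B" "\<alpha> \<in> hom2 C f g" "A \<in> Obj C" "B \<in> Obj C"
    using assms by (auto simp: hom1_def hom2_def)
  then show ?thesis
    using pseudonat_eta by (simp add: pseudonat_to_def id_two_fun_def)
qed

lemma mu_nat_2:
  assumes "\<alpha> \<in> Cell2 C" "src2 C \<alpha> = f" "trg2 C \<alpha> = g" "src1 C f = A" "trg1 C f = B"
  shows "\<mu>n M g \<odot> (\<mu> M B \<triangleright> T2 M (T2 M \<alpha>)) = (T2 M \<alpha> \<triangleleft> \<mu> M A) \<odot> \<mu>n M f"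
proof -
  have "f \<in> hom1 C A B" "g \<in> hom1 C A B" "\<alpha> \<in> hom2 C f g" "A \<in> Obj C" "B \<in> Obj C"
    using assms by (auto simp: hom1_def hom2_def)
  then show ?thesis
    using pseudonat_mu by (simp add: pseudonat_from_def comp_two_fun_def)
qed

lemma xi_typing [simp]:
  assumes "A \<in> Obj C"
  shows "iso2 (\<xi> M A)" "src2 C (\<xi> M A) = \<mu> M A \<cdot> \<eta> M (T0 M A)" "trg2 C (\<xi> M A) = id1 C (T0 M A)"
  using pseudomonad assms by (auto simp: pseudomonad_def hom2_def invhom2_def)

lemma zeta_typing [simp]:
  assumes "A \<in> Obj C"
  shows "iso2 (\<zeta> M A)" "src2 C (\<zeta> M A) = \<mu> M A \<cdot> T1 M (\<eta> M A)" "trg2 C (\<zeta> M A) = id1 C (T0 M A)"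
  using pseudomonad assms by (auto simp: pseudomonad_def hom2_def invhom2_def)

lemma rho_typing [simp]:
  assumes "A \<in> Obj C"
  shows "iso2 (\<rho> M A)" "src2 C (\<rho> M A) = \<mu> M A \<cdot> T1 M (\<mu> M A)"
    "trg2 C (\<rho> M A) = \<mu> M A \<cdot> \<mu> M (T0 M A)"
  using pseudomonad assms by (auto simp: pseudomonad_def hom2_def invhom2_def)

lemma xi_nat:
  assumes "f \<in> Cell1 C" "src1 C f = A" "trg1 C f = B"
  shows "(\<xi> M B \<triangleleft> T1 M f) \<odot> (\<mu> M B \<triangleright> \<eta>n M (T1 M f)) = (T1 M f \<triangleright> \<xi> M A) \<odot> (\<mu>n M f \<triangleleft> \<eta> M (T0 M A))"
proof -
  have "f \<in> hom1 C A B" "A \<in> Obj C" "B \<in> Obj C"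
    using assms by (auto simp: hom1_def)
  then show ?thesis
    using pseudomonad by (simp add: pseudomonad_def)
qed

lemma zeta_nat:
  assumes "f \<in> Cell1 C" "src1 C f = A" "trg1 C f = B"
  shows "(\<zeta> M B \<triangleleft> T1 M f) \<odot> (\<mu> M B \<triangleright> T2 M (\<eta>n M f)) = (T1 M f \<triangleright> \<zeta> M A) \<odot> (\<mu>n M f \<triangleleft> T1 M (\<eta> M A))"
proof -
  have "f \<in> hom1 C A B" "A \<in> Obj C" "B \<in> Obj C"
    using assms by (auto simp: hom1_def)
  then show ?thesis
    using pseudomonad by (simp add: pseudomonad_def)
qed

lemma rho_nat:
  assumes "f \<in> Cell1 C" "src1 C f = A" "trg1 C f = B"
  shows "(\<mu>n M f \<triangleleft> \<mu> M (T0 M A)) \<odot> ((\<mu> M B \<triangleright> \<mu>n M (T1 M f)) \<odot> (\<rho> M B \<triangleleft> T1 M (T1 M (T1 M f)))) =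
    (T1 M f \<triangleright> \<rho> M A) \<odot> ((\<mu>n M f \<triangleleft> T1 M (\<mu> M A)) \<odot> (\<mu> M B \<triangleright> T2 M (\<mu>n M f)))"
proof -
  have "f \<in> hom1 C A B" "A \<in> Obj C" "B \<in> Obj C"
    using assms by (auto simp: hom1_def)
  \<comment> \<open>The defining axiom nests composites to the left. It is extracted with
    \<open>vcomp_assoc\<close> switched off and only then brought to the right-nested normal
    form.\<close>
  then have "(\<mu>n M f \<triangleleft> \<mu> M (T0 M A)) \<odot> (\<mu> M B \<triangleright> \<mu>n M (T1 M f)) \<odot> (\<rho> M B \<triangleleft> T1 M (T1 M (T1 M f))) =
    (T1 M f \<triangleright> \<rho> M A) \<odot> (\<mu>n M f \<triangleleft> T1 M (\<mu> M A)) \<odot> (\<mu> M B \<triangleright> T2 M (\<mu>n M f))"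
    using pseudomonad by (simp add: pseudomonad_def del: vcomp_assoc)
  then show ?thesis
    using assms \<open>A \<in> Obj C\<close> \<open>B \<in> Obj C\<close> by simp
qed

section \<open>Pseudo-algebras, pseudomorphisms and transformations, unpacked\<close>

lemma alg_typing [simp]:
  assumes "alg X"
  shows "alg_ob X \<in> Obj C" "alg_act X \<in> Cell1 C" "src1 C (alg_act X) = T0 M (alg_ob X)"
    "trg1 C (alg_act X) = alg_ob X" "iso2 (alg_unit X)"
    "src2 C (alg_unit X) = alg_act X \<cdot> \<eta> M (alg_ob X)" "trg2 C (alg_unit X) = id1 C (alg_ob X)"
    "iso2 (alg_mult X)" "src2 C (alg_mult X) = alg_act X \<cdot> T1 M (alg_act X)"
    "trg2 C (alg_mult X) = alg_act X \<cdot> \<mu> M (alg_ob X)"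
  using assms by (cases X; auto simp: hom1_def hom2_def invhom2_def)+

lemma alg_A1:
  assumes "alg X" "A = alg_ob X" "a = alg_act X"
  shows "(a \<triangleright> \<zeta> M A) \<odot> (alg_mult X \<triangleleft> T1 M (\<eta> M A)) = a \<triangleright> T2 M (alg_unit X)"
  using assms by (cases X) auto

lemma alg_A2:
  assumes "alg X" "A = alg_ob X" "a = alg_act X"
  shows "(a \<triangleright> \<rho> M A) \<odot> ((alg_mult X \<triangleleft> T1 M (\<mu> M A)) \<odot> (a \<triangleright> T2 M (alg_mult X))) =
     (alg_mult X \<triangleleft> \<mu> M (T0 M A)) \<odot> ((a \<triangleright> \<mu>n M a) \<odot> (alg_mult X \<triangleleft> T1 M (T1 M a)))"
proof -
  have "(a \<triangleright> \<rho> M A) \<odot> (alg_mult X \<triangleleft> T1 M (\<mu> M A)) \<odot> (a \<triangleright> T2 M (alg_mult X)) =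
     (alg_mult X \<triangleleft> \<mu> M (T0 M A)) \<odot> (a \<triangleright> \<mu>n M a) \<odot> (alg_mult X \<triangleleft> T1 M (T1 M a))"
    using assms by (cases X) (simp del: vcomp_assoc)
  then show ?thesis
    using assms by simp
qed

lemma mor_typing [simp]:
  assumes "mor u"
  shows "alg (mor_src u)" "alg (mor_trg u)"
    "mor_fun u \<in> Cell1 C" "src1 C (mor_fun u) = alg_ob (mor_src u)" "trg1 C (mor_fun u) = alg_ob (mor_trg u)"
    "iso2 (mor_cell u)" "src2 C (mor_cell u) = alg_act (mor_trg u) \<cdot> T1 M (mor_fun u)"
    "trg2 C (mor_cell u) = mor_fun u \<cdot> alg_act (mor_src u)"
  using assms by (cases u; cases "mor_src u"; cases "mor_trg u"; auto simp: hom1_def hom2_def invhom2_def)+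

lemma mor_unit:
  assumes "mor u" "A = alg_ob (mor_src u)" "b = alg_act (mor_trg u)" "f = mor_fun u"
  shows "(f \<triangleright> alg_unit (mor_src u)) \<odot> (mor_cell u \<triangleleft> \<eta> M A) =
    (alg_unit (mor_trg u) \<triangleleft> f) \<odot> (b \<triangleright> \<eta>n M f)"
  using assms by (cases u; cases "mor_src u"; cases "mor_trg u") auto

lemma mor_mult:
  assumes "mor u" "A = alg_ob (mor_src u)" "a = alg_act (mor_src u)" "b = alg_act (mor_trg u)" "f = mor_fun u"
  shows "(f \<triangleright> alg_mult (mor_src u)) \<odot> ((mor_cell u \<triangleleft> T1 M a) \<odot> (b \<triangleright> T2 M (mor_cell u))) =
    (mor_cell u \<triangleleft> \<mu> M A) \<odot> ((b \<triangleright> \<mu>n M f) \<odot> (alg_mult (mor_trg u) \<triangleleft> T1 M (T1 M f)))"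
proof -
  have "(f \<triangleright> alg_mult (mor_src u)) \<odot> (mor_cell u \<triangleleft> T1 M a) \<odot> (b \<triangleright> T2 M (mor_cell u)) =
    (mor_cell u \<triangleleft> \<mu> M A) \<odot> (b \<triangleright> \<mu>n M f) \<odot> (alg_mult (mor_trg u) \<triangleleft> T1 M (T1 M f))"
    using assms by (cases u; cases "mor_src u"; cases "mor_trg u") (simp del: vcomp_assoc)
  then show ?thesis
    using assms by simp
qed

lemma morI:
  assumes "alg X" "alg Y" "f \<in> Cell1 C" "src1 C f = alg_ob X" "trg1 C f = alg_ob Y"
    "iso2 \<phi>" "src2 C \<phi> = alg_act Y \<cdot> T1 M f" "trg2 C \<phi> = f \<cdot> alg_act X"
    "(f \<triangleright> alg_unit X) \<odot> (\<phi> \<triangleleft> \<eta> M (alg_ob X)) = (alg_unit Y \<triangleleft> f) \<odot> (alg_act Y \<triangleright> \<eta>n M f)"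
    "(f \<triangleright> alg_mult X) \<odot> ((\<phi> \<triangleleft> T1 M (alg_act X)) \<odot> (alg_act Y \<triangleright> T2 M \<phi>)) =
    (\<phi> \<triangleleft> \<mu> M (alg_ob X)) \<odot> ((alg_act Y \<triangleright> \<mu>n M f) \<odot> (alg_mult Y \<triangleleft> T1 M (T1 M f)))"
  shows "mor (PsMor X Y f \<phi>)"
  using assms alg_typing[OF assms(1)] alg_typing[OF assms(2)]
  by (cases X; cases Y) (simp add: hom1_def hom2_def invhom2_def del: alg_typing)

text \<open>A pasting argument: each law for the composite is the law of \<open>F\<close> whiskered
  by \<open>g\<close> on the left, glued to the law of \<open>G\<close> whiskered by
  \<open>f\<close> (or \<open>TTf\<close>) on the right. In between, the structure cell of
  \<open>G\<close> is moved by interchange past the unit cell, the multiplication cell and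
  \<open>T\<close> of the structure cell of \<open>F\<close>.\<close>

lemma mor_comp_psmor:
  assumes "mor F" "mor G" "mor_src G = mor_trg F"
  shows "mor (comp_psmor C M G F)"
proof -
  let ?f = "mor_fun F" and ?g = "mor_fun G" and ?\<phi> = "mor_cell F" and ?\<gamma> = "mor_cell G"
    and ?X = "mor_src F" and ?Y = "mor_trg F" and ?Z = "mor_trg G"
  let ?a = "alg_act ?X" and ?b = "alg_act ?Y" and ?c = "alg_act ?Z" and ?A = "alg_ob ?X"
  note [simp] = assms
  have [simp]: "alg ?Y" using assms(1) mor_typing(2) by blast
  have u1: "(?g \<cdot> ?f \<triangleright> alg_unit ?X) \<odot> (?g \<triangleright> (?\<phi> \<triangleleft> \<eta> M ?A)) =
      (?g \<triangleright> (alg_unit ?Y \<triangleleft> ?f)) \<odot> (?g \<cdot> ?b \<triangleright> \<eta>n M ?f)"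
    using arg_cong[OF mor_unit[OF assms(1) refl refl refl], of "lwhisker C ?g"] by simp
  have u2: "(?g \<cdot> ?b \<triangleright> \<eta>n M ?f) \<odot> (?\<gamma> \<triangleleft> T1 M ?f \<cdot> \<eta> M ?A) =
      (?\<gamma> \<triangleleft> \<eta> M (alg_ob ?Y) \<cdot> ?f) \<odot> (?c \<cdot> T1 M ?g \<triangleright> \<eta>n M ?f)"
    using swap[of "\<eta>n M ?f" ?\<gamma>] by simp
  have u3: "(?g \<triangleright> (alg_unit ?Y \<triangleleft> ?f)) \<odot> (?\<gamma> \<triangleleft> \<eta> M (alg_ob ?Y) \<cdot> ?f) =
      (alg_unit ?Z \<triangleleft> ?g \<cdot> ?f) \<odot> (?c \<triangleright> (\<eta>n M ?g \<triangleleft> ?f))"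
    using arg_cong[OF mor_unit[OF assms(2) refl refl refl], of "\<lambda>z. rwhisker C z ?f"] by simp
  have m1: "(?\<gamma> \<triangleleft> T1 M ?f \<cdot> T1 M ?a) \<odot> (?c \<cdot> T1 M ?g \<triangleright> T2 M ?\<phi>) =
      (?g \<cdot> ?b \<triangleright> T2 M ?\<phi>) \<odot> (?\<gamma> \<triangleleft> T1 M ?b \<cdot> T1 M (T1 M ?f))"
    using swap[of "T2 M ?\<phi>" ?\<gamma>] by simp
  have m2: "(?g \<cdot> ?f \<triangleright> alg_mult ?X) \<odot> ((?g \<triangleright> (?\<phi> \<triangleleft> T1 M ?a)) \<odot> (?g \<cdot> ?b \<triangleright> T2 M ?\<phi>)) =
      (?g \<triangleright> (?\<phi> \<triangleleft> \<mu> M ?A)) \<odot> ((?g \<cdot> ?b \<triangleright> \<mu>n M ?f) \<odot> (?g \<triangleright> (alg_mult ?Y \<triangleleft> T1 M (T1 M ?f))))"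
    using arg_cong[OF mor_mult[OF assms(1) refl refl refl refl], of "lwhisker C ?g"] by simp
  have m3: "(?g \<triangleright> (alg_mult ?Y \<triangleleft> T1 M (T1 M ?f))) \<odot> ((?\<gamma> \<triangleleft> T1 M ?b \<cdot> T1 M (T1 M ?f)) \<odot>
        (?c \<triangleright> (T2 M ?\<gamma> \<triangleleft> T1 M (T1 M ?f)))) =
      (?\<gamma> \<triangleleft> \<mu> M (alg_ob ?Y) \<cdot> T1 M (T1 M ?f)) \<odot> ((?c \<triangleright> (\<mu>n M ?g \<triangleleft> T1 M (T1 M ?f))) \<odot>
        (alg_mult ?Z \<triangleleft> T1 M (T1 M ?g) \<cdot> T1 M (T1 M ?f)))"
    using arg_cong[OF mor_mult[OF assms(2) refl refl refl refl], of "\<lambda>z. rwhisker C z (T1 M (T1 M ?f))"]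
    by simp
  have m4: "(?g \<cdot> ?b \<triangleright> \<mu>n M ?f) \<odot> (?\<gamma> \<triangleleft> \<mu> M (alg_ob ?Y) \<cdot> T1 M (T1 M ?f)) =
      (?\<gamma> \<triangleleft> T1 M ?f \<cdot> \<mu> M ?A) \<odot> (?c \<cdot> T1 M ?g \<triangleright> \<mu>n M ?f)"
    using swap[of "\<mu>n M ?f" ?\<gamma>] by simp
  show ?thesis
    unfolding comp_psmor_def
    by (intro morI) (simp_all add: vcomp_eq_ext[OF u1] u2 vcomp_eq_ext[OF u3]
        vcomp_eq_ext[OF m1] vcomp_eq_ext3[OF m2] m3 vcomp_eq_ext[OF m4])
qed

text \<open>Selector form of the definition. The endpoints of the target 1-cell are oriented towards
  those of the source 1-cell, so that \<open>simp\<close> always speaks of the latter.\<close>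

lemma transf_iff:
  "transf \<Sigma> \<longleftrightarrow> mor (trans_src \<Sigma>) \<and> mor (trans_trg \<Sigma>) \<and>
     mor_src (trans_trg \<Sigma>) = mor_src (trans_src \<Sigma>) \<and> mor_trg (trans_trg \<Sigma>) = mor_trg (trans_src \<Sigma>) \<and>
     trans_cell \<Sigma> \<in> Cell2 C \<and>
     src2 C (trans_cell \<Sigma>) = mor_fun (trans_src \<Sigma>) \<and> trg2 C (trans_cell \<Sigma>) = mor_fun (trans_trg \<Sigma>) \<and>
     (trans_cell \<Sigma> \<triangleleft> alg_act (mor_src (trans_src \<Sigma>))) \<odot> mor_cell (trans_src \<Sigma>) =
     mor_cell (trans_trg \<Sigma>) \<odot> (alg_act (mor_trg (trans_src \<Sigma>)) \<triangleright> T2 M (trans_cell \<Sigma>))"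
  by (cases \<Sigma>) (auto simp: is_pstrans_def hom2_def)

lemma transf_typing [simp]:
  assumes "transf \<Sigma>"
  shows "mor (trans_src \<Sigma>)" "mor (trans_trg \<Sigma>)"
    "mor_src (trans_trg \<Sigma>) = mor_src (trans_src \<Sigma>)" "mor_trg (trans_trg \<Sigma>) = mor_trg (trans_src \<Sigma>)"
    "trans_cell \<Sigma> \<in> Cell2 C"
    "src2 C (trans_cell \<Sigma>) = mor_fun (trans_src \<Sigma>)" "trg2 C (trans_cell \<Sigma>) = mor_fun (trans_trg \<Sigma>)"
  using assms by (auto simp: transf_iff)

lemma transf_eq:
  assumes "transf \<Sigma>" "a = alg_act (mor_src (trans_src \<Sigma>))" "b = alg_act (mor_trg (trans_src \<Sigma>))"
  shows "(trans_cell \<Sigma> \<triangleleft> a) \<odot> mor_cell (trans_src \<Sigma>) = mor_cell (trans_trg \<Sigma>) \<odot> (b \<triangleright> T2 M (trans_cell \<Sigma>))"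
  using assms(1) unfolding assms(2,3) transf_iff by blast

lemma comp_psmor_simps [simp]:
  "mor_src (comp_psmor C M G F) = mor_src F" "mor_trg (comp_psmor C M G F) = mor_trg G"
  "mor_fun (comp_psmor C M G F) = mor_fun G \<cdot> mor_fun F"
  "mor_cell (comp_psmor C M G F) = (mor_fun G \<triangleright> mor_cell F) \<odot> (mor_cell G \<triangleleft> T1 M (mor_fun F))"
  by (simp_all add: comp_psmor_def)

section \<open>The 2-category of pseudo-algebras\<close>

abbreviation "Alg \<equiv> T_psAlg C M"

abbreviation id_mor :: "('o, 'a, 'c) psalg \<Rightarrow> ('o, 'a, 'c) psmor" where
  "id_mor X \<equiv> PsMor X X (id1 C (alg_ob X)) (id2 C (alg_act X))"

lemma Alg_simps [simp]:
  "Obj Alg = {X. alg X}" "Cell1 Alg = {F. mor F}" "Cell2 Alg = {\<Sigma>. transf \<Sigma>}"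
  "src1 Alg = mor_src" "trg1 Alg = mor_trg" "src2 Alg = trans_src" "trg2 Alg = trans_trg"
  "id1 Alg X = id_mor X" "id2 Alg F = PsTrans F F (id2 C (mor_fun F))"
  "comp1 Alg = comp_psmor C M"
  "vcomp Alg \<Sigma>' \<Sigma> = PsTrans (trans_src \<Sigma>) (trans_trg \<Sigma>') (trans_cell \<Sigma>' \<odot> trans_cell \<Sigma>)"
  "hcomp Alg \<Sigma>' \<Sigma> = PsTrans (comp_psmor C M (trans_src \<Sigma>') (trans_src \<Sigma>))
      (comp_psmor C M (trans_trg \<Sigma>') (trans_trg \<Sigma>)) (trans_cell \<Sigma>' \<star> trans_cell \<Sigma>)"
  by (simp_all add: T_psAlg_def)

lemma mor_id_mor: "alg X \<Longrightarrow> mor (id_mor X)"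
  by (intro morI) simp_all

lemma transf_id2: "mor F \<Longrightarrow> transf (PsTrans F F (id2 C (mor_fun F)))"
  by (simp add: transf_iff)

lemma transf_vcomp:
  assumes "transf \<Sigma>" "transf \<Sigma>'" "trans_src \<Sigma>' = trans_trg \<Sigma>"
  shows "transf (PsTrans (trans_src \<Sigma>) (trans_trg \<Sigma>') (trans_cell \<Sigma>' \<odot> trans_cell \<Sigma>))"
proof -
  note e = transf_eq[OF assms(1) refl refl] transf_eq[OF assms(2) refl refl, unfolded assms(3) transf_typing(3,4)[OF assms(1)]]
  have [simp]: "mor (trans_trg \<Sigma>)" "mor_src (trans_trg \<Sigma>') = mor_src (trans_src \<Sigma>)" 
    "mor_trg (trans_trg \<Sigma>') = mor_trg (trans_src \<Sigma>)"
    using assms transf_typing(2-4)[OF assms(1)] transf_typing(3,4)[OF assms(2)] by auto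
  show ?thesis
    using assms by (simp add: transf_iff[of "PsTrans _ _ _"] e vcomp_eq_ext[OF e(2)])
qed

text \<open>After splitting the horizontal composite into whiskerings, equations \<open>1\<close>
  and \<open>4\<close> are the whiskered conditions of the two factors, and \<open>2\<close> and
  \<open>3\<close> are interchanges with the structure cells that stand between them.\<close>

lemma transf_hcomp:
  assumes "transf \<Sigma>" "transf \<Sigma>'" "mor_src (trans_src \<Sigma>') = mor_trg (trans_src \<Sigma>)"
  shows "transf (PsTrans (comp_psmor C M (trans_src \<Sigma>') (trans_src \<Sigma>))
      (comp_psmor C M (trans_trg \<Sigma>') (trans_trg \<Sigma>)) (trans_cell \<Sigma>' \<star> trans_cell \<Sigma>))"
proof -
  note [simp] = assms(1,2)
  let ?f = "mor_fun (trans_src \<Sigma>)" and ?g = "mor_fun (trans_src \<Sigma>')"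
  and ?f' = "mor_fun (trans_trg \<Sigma>)" and ?g' = "mor_fun (trans_trg \<Sigma>')"
  and ?\<alpha> = "trans_cell \<Sigma>" and ?\<beta> = "trans_cell \<Sigma>'"
  let ?X = "mor_src (trans_src \<Sigma>)" and ?Y = "mor_trg (trans_src \<Sigma>)" and ?Z = "mor_trg (trans_src \<Sigma>')"
  have [simp]: "mor (trans_src \<Sigma>)" "mor (trans_trg \<Sigma>)" "mor (trans_src \<Sigma>')" "mor (trans_trg \<Sigma>')" 
    "alg ?X" "alg ?Y" "alg ?Z"
    using transf_typing(1,2)[OF assms(1)] transf_typing(1,2)[OF assms(2)] mor_typing(1,2) by blast+
  note [simp] = assms(3)
  have 1: "(?g \<triangleright> (?\<alpha> \<triangleleft> alg_act ?X)) \<odot> (?g \<triangleright> mor_cell (trans_src \<Sigma>)) =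
     (?g \<triangleright> mor_cell (trans_trg \<Sigma>)) \<odot> (?g \<cdot> alg_act ?Y \<triangleright> T2 M ?\<alpha>)"
    using arg_cong[OF transf_eq[OF assms(1) refl refl], of "lwhisker C ?g"] by simp
  have 2: "(?\<beta> \<triangleleft> ?f' \<cdot> alg_act ?X) \<odot> (?g \<triangleright> mor_cell (trans_trg \<Sigma>)) =
     (?g' \<triangleright> mor_cell (trans_trg \<Sigma>)) \<odot> (?\<beta> \<triangleleft> alg_act ?Y \<cdot> T1 M ?f')"
    using swap[of "mor_cell (trans_trg \<Sigma>)" ?\<beta>] by simp
  have 3: "(?g \<cdot> alg_act ?Y \<triangleright> T2 M ?\<alpha>) \<odot> (mor_cell (trans_src \<Sigma>') \<triangleleft> T1 M ?f) =
    (mor_cell (trans_src \<Sigma>') \<triangleleft> T1 M ?f') \<odot> (alg_act ?Z \<cdot> T1 M ?g \<triangleright> T2 M ?\<alpha>)"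
    using swap[of "T2 M ?\<alpha>" "mor_cell (trans_src \<Sigma>')"] by simp
  have 4: "(?\<beta> \<triangleleft> alg_act ?Y \<cdot> T1 M ?f') \<odot> (mor_cell (trans_src \<Sigma>') \<triangleleft> T1 M ?f') =
    (mor_cell (trans_trg \<Sigma>') \<triangleleft> T1 M ?f') \<odot> (alg_act ?Z \<triangleright> (T2 M ?\<beta> \<triangleleft> T1 M ?f'))"
    using arg_cong[OF transf_eq[OF assms(2) refl refl], of "\<lambda>z. rwhisker C z (T1 M ?f')"] by simp
  have [simp]: "mor (comp_psmor C M (trans_src \<Sigma>') (trans_src \<Sigma>))"
      "mor (comp_psmor C M (trans_trg \<Sigma>') (trans_trg \<Sigma>))"
    by (intro mor_comp_psmor; simp)+
  show ?thesis
    by (simp add: transf_iff[of "PsTrans _ _ _"] hcomp_whisker vcomp_eq_ext[OF 1]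
      vcomp_eq_ext[OF 2] 3 vcomp_eq_ext[OF 4])
qed

text \<open>Associativity is strict because the structure cells of the two bracketings have the same
  normal form.\<close>

lemma comp_psmor_assoc:
  assumes "mor F" "mor G" "mor H" "mor_src G = mor_trg F" "mor_src H = mor_trg G"
  shows "comp_psmor C M H (comp_psmor C M G F) = comp_psmor C M (comp_psmor C M H G) F"
  using assms mor_typing(1,2)[OF assms(1)] mor_typing(2)[OF assms(2)]
  by (intro psmor.expand) simp

lemma comp_psmor_id_mor:
  assumes "mor F"
  shows "mor_trg F = Y \<Longrightarrow> comp_psmor C M (id_mor Y) F = F" "mor_src F = X \<Longrightarrow> comp_psmor C M F (id_mor X) = F"
  using assms mor_typing(1,2)[OF assms(1)] by (intro psmor.expand; auto)+

sublocale Alg: two_category Alg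
proof
  show "Dom (cat1 Alg) f \<in> Ob (cat1 Alg)" "Cod (cat1 Alg) f \<in> Ob (cat1 Alg)" if "f \<in> Arr (cat1 Alg)" for f
    using that by (simp_all add: cat1_def)
  show "Idn (cat1 Alg) x \<in> Hom (cat1 Alg) x x" if "x \<in> Ob (cat1 Alg)" for x
    using that by (simp add: cat1_def Hom_def mor_id_mor)
  show "Cmp (cat1 Alg) g f \<in> Hom (cat1 Alg) x z" if "f \<in> Hom (cat1 Alg) x y" "g \<in> Hom (cat1 Alg) y z" for f g x y z
    using that by (auto simp add: cat1_def Hom_def mor_comp_psmor)
  show "Cmp (cat1 Alg) (Idn (cat1 Alg) y) f = f" if "f \<in> Hom (cat1 Alg) x y" for f x y
    using that comp_psmor_id_mor(1) by (simp add: cat1_def Hom_def)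
  show "Cmp (cat1 Alg) f (Idn (cat1 Alg) x) = f" if "f \<in> Hom (cat1 Alg) x y" for f x y
    using that comp_psmor_id_mor(2) by (simp add: cat1_def Hom_def)
  show "Cmp (cat1 Alg) h (Cmp (cat1 Alg) g f) = Cmp (cat1 Alg) (Cmp (cat1 Alg) h g) f"
    if "f \<in> Hom (cat1 Alg) w x" "g \<in> Hom (cat1 Alg) x y" "h \<in> Hom (cat1 Alg) y z" for f g h w x y z
    using that comp_psmor_assoc[of f g h] by (simp add: cat1_def Hom_def)
  show "Dom (vcat Alg) f \<in> Ob (vcat Alg)" "Cod (vcat Alg) f \<in> Ob (vcat Alg)" if "f \<in> Arr (vcat Alg)" for f
    using that by (simp_all add: vcat_def)
  show "Idn (vcat Alg) x \<in> Hom (vcat Alg) x x" if "x \<in> Ob (vcat Alg)" for x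
    using that by (simp add: vcat_def Hom_def transf_id2)
  show "Cmp (vcat Alg) g f \<in> Hom (vcat Alg) x z" if "f \<in> Hom (vcat Alg) x y" "g \<in> Hom (vcat Alg) y z" for f g x y z
    using that transf_vcomp[of f g] by (auto simp add: vcat_def Hom_def)
  show "Cmp (vcat Alg) (Idn (vcat Alg) y) f = f" if "f \<in> Hom (vcat Alg) x y" for f x y
    using that by (intro pstrans.expand) (auto simp add: vcat_def Hom_def)
  show "Cmp (vcat Alg) f (Idn (vcat Alg) x) = f" if "f \<in> Hom (vcat Alg) x y" for f x y
    using that by (intro pstrans.expand) (auto simp add: vcat_def Hom_def)
  show "Cmp (vcat Alg) h (Cmp (vcat Alg) g f) = Cmp (vcat Alg) (Cmp (vcat Alg) h g) f"
    if "f \<in> Hom (vcat Alg) w x" "g \<in> Hom (vcat Alg) x y" "h \<in> Hom (vcat Alg) y z" for f g h w x y z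
    using that by (simp add: vcat_def Hom_def)
  show "Dom (hcat Alg) f \<in> Ob (hcat Alg)" "Cod (hcat Alg) f \<in> Ob (hcat Alg)" if "f \<in> Arr (hcat Alg)" for f
    using that by (simp_all add: hcat_def)
  show "Idn (hcat Alg) x \<in> Hom (hcat Alg) x x" if "x \<in> Ob (hcat Alg)" for x
    using that transf_id2[OF mor_id_mor] by (simp add: hcat_def Hom_def)
  show "Cmp (hcat Alg) g f \<in> Hom (hcat Alg) x z" if "f \<in> Hom (hcat Alg) x y" "g \<in> Hom (hcat Alg) y z" for f g x y z
    using that transf_hcomp[of f g] by (auto simp add: hcat_def Hom_def)
  show "Cmp (hcat Alg) (Idn (hcat Alg) y) f = f" if "f \<in> Hom (hcat Alg) x y" for f x y
    using that comp_psmor_id_mor(1) by (intro pstrans.expand) (auto simp add: hcat_def Hom_def hcomp_id_left)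
  show "Cmp (hcat Alg) f (Idn (hcat Alg) x) = f" if "f \<in> Hom (hcat Alg) x y" for f x y
    using that comp_psmor_id_mor(2) by (intro pstrans.expand) (auto simp add: hcat_def Hom_def hcomp_id_right)
  show "Cmp (hcat Alg) h (Cmp (hcat Alg) g f) = Cmp (hcat Alg) (Cmp (hcat Alg) h g) f"
    if "f \<in> Hom (hcat Alg) w x" "g \<in> Hom (hcat Alg) x y" "h \<in> Hom (hcat Alg) y z" for f g h w x y z
    using that by (simp add: hcat_def Hom_def comp_psmor_assoc hcomp_assoc)
  show "src1 Alg (trg2 Alg \<alpha>) = src1 Alg (src2 Alg \<alpha>)" "trg1 Alg (trg2 Alg \<alpha>) = trg1 Alg (src2 Alg \<alpha>)"
    if "\<alpha> \<in> Cell2 Alg" for \<alpha>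
    using that by simp_all
  show "\<beta> \<star>\<^bsub>Alg\<^esub> \<alpha> \<in> hom2 Alg (g \<cdot>\<^bsub>Alg\<^esub> f) (g' \<cdot>\<^bsub>Alg\<^esub> f')"
    if "\<alpha> \<in> hom2 Alg f f'" "\<beta> \<in> hom2 Alg g g'" "src1 Alg g = trg1 Alg f" for \<alpha> \<beta> f f' g g'
    using that transf_hcomp[of \<alpha> \<beta>] by (auto simp: hom2_def)
  show "id2 Alg g \<star>\<^bsub>Alg\<^esub> id2 Alg f = id2 Alg (g \<cdot>\<^bsub>Alg\<^esub> f)"
    if "f \<in> Cell1 Alg" "g \<in> Cell1 Alg" "src1 Alg g = trg1 Alg f" for f g
    using that by (simp add: hcomp_id2)
  show "(\<beta>' \<odot>\<^bsub>Alg\<^esub> \<beta>) \<star>\<^bsub>Alg\<^esub> (\<alpha>' \<odot>\<^bsub>Alg\<^esub> \<alpha>) = (\<beta>' \<star>\<^bsub>Alg\<^esub> \<alpha>') \<odot>\<^bsub>Alg\<^esub> (\<beta> \<star>\<^bsub>Alg\<^esub> \<alpha>)"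
    if "\<alpha> \<in> hom2 Alg f f'" "\<alpha>' \<in> hom2 Alg f' f''" "\<beta> \<in> hom2 Alg g g'" "\<beta>' \<in> hom2 Alg g' g''"
      "src1 Alg g = trg1 Alg f" for \<alpha> \<alpha>' \<beta> \<beta>' f f' f'' g g' g''
    using that by (auto simp: hom2_def hcomp_vcomp)
qed

lemma Alg_whisker [simp]:
  "mor u \<Longrightarrow> u \<triangleright>\<^bsub>Alg\<^esub> \<Sigma> = PsTrans (comp_psmor C M u (trans_src \<Sigma>)) (comp_psmor C M u (trans_trg \<Sigma>)) (mor_fun u \<triangleright> trans_cell \<Sigma>)"
  "mor u \<Longrightarrow> \<Sigma> \<triangleleft>\<^bsub>Alg\<^esub> u = PsTrans (comp_psmor C M (trans_src \<Sigma>) u) (comp_psmor C M (trans_trg \<Sigma>) u) (trans_cell \<Sigma> \<triangleleft> mor_fun u)"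
  by (simp_all add: lwhisker_def rwhisker_def)

text \<open>If the underlying 2-cell of a transformation is invertible, conjugating the
  compatibility condition with the inverse shows that the inverse is a transformation too.
  Invertibility in \<open>Alg\<close> can thus be tested in \<open>C\<close>.\<close>

lemma iso2_Alg_iff:
  assumes "transf \<Sigma>"
  shows "Alg.iso2 \<Sigma> \<longleftrightarrow> iso2 (trans_cell \<Sigma>)"
proof
  assume *: "Alg.iso2 \<Sigma>"
  from Alg.vinv_props[OF *] assms have t: "transf (Alg.vinv \<Sigma>)"
    and e: "trans_src (Alg.vinv \<Sigma>) = trans_trg \<Sigma>" "trans_trg (Alg.vinv \<Sigma>) = trans_src \<Sigma>"
      "trans_cell (Alg.vinv \<Sigma>) \<odot> trans_cell \<Sigma> = id2 C (mor_fun (trans_src \<Sigma>))"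
      "trans_cell \<Sigma> \<odot> trans_cell (Alg.vinv \<Sigma>) = id2 C (mor_fun (trans_trg \<Sigma>))"
    by auto
  show "iso2 (trans_cell \<Sigma>)"
    by (rule iso2I[of _ "trans_cell (Alg.vinv \<Sigma>)"]) (use t e assms in simp_all)
next
  assume i: "iso2 (trans_cell \<Sigma>)"
  let ?a = "alg_act (mor_src (trans_src \<Sigma>))" and ?b = "alg_act (mor_trg (trans_src \<Sigma>))" and ?s = "trans_cell \<Sigma>"
  let ?\<Sigma>' = "PsTrans (trans_trg \<Sigma>) (trans_src \<Sigma>) (vinv ?s)"
  note [simp] = assms i
  have [simp]: "mor (trans_src \<Sigma>)" "mor (trans_trg \<Sigma>)" "alg (mor_src (trans_src \<Sigma>))" "alg (mor_trg (trans_src \<Sigma>))"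
    using transf_typing(1,2)[OF assms] mor_typing by auto
  have "(vinv ?s \<triangleleft> ?a) \<odot> mor_cell (trans_trg \<Sigma>) = mor_cell (trans_src \<Sigma>) \<odot> (?b \<triangleright> T2 M (vinv ?s))"
  proof (rule iso2_cancel_left[of "?s \<triangleleft> ?a"])
    have 1: "(?s \<triangleleft> ?a) \<odot> (vinv ?s \<triangleleft> ?a) = id2 C (trg2 C ?s \<cdot> ?a)"
      by (rule vinv_rwhisker) simp_all
    have 2: "T2 M ?s \<odot> T2 M (vinv ?s) = id2 C (T1 M (trg2 C ?s))"
      using T.F2_vcomp[of "vinv ?s" ?s] by simp
    have 3: "(?b \<triangleright> T2 M ?s) \<odot> (?b \<triangleright> T2 M (vinv ?s)) = id2 C (?b \<cdot> T1 M (trg2 C ?s))"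
      using arg_cong[OF 2, of "lwhisker C ?b"] by simp
    show "(?s \<triangleleft> ?a) \<odot> ((vinv ?s \<triangleleft> ?a) \<odot> mor_cell (trans_trg \<Sigma>)) =
       (?s \<triangleleft> ?a) \<odot> (mor_cell (trans_src \<Sigma>) \<odot> (?b \<triangleright> T2 M (vinv ?s)))"
      by (simp add: vcomp_eq_ext[OF 1] vcomp_eq_ext[OF transf_eq[OF assms refl refl]] 3)
  qed simp_all
  then have "transf ?\<Sigma>'"
    by (simp add: transf_iff[of "PsTrans _ _ _"])
  then show "Alg.iso2 \<Sigma>"
    by (intro Alg.iso2I[of \<Sigma> ?\<Sigma>']) simp_all
qed

end

section \<open>Free pseudo-algebras\<close>

context psmonad
begin

abbreviation free :: "'o \<Rightarrow> ('o, 'a, 'c) psalg" where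
  "free A \<equiv> PsAlg (T0 M A) (\<mu> M A) (\<xi> M A) (\<rho> M A)"

lemma alg_free: "A \<in> Obj C \<Longrightarrow> alg (free A)"
  using pseudomonad by (simp add: pseudomonad_def)

text \<open>The isomorphism \<open>b Tg \<eta> \<Rightarrow> b \<eta> g \<Rightarrow> g\<close>. It
  recovers \<open>g\<close> from its extension \<open>b Tg\<close> to the free algebra, and it is
  also the right-hand side of the unit law of a pseudomorphism with underlying 1-cell
  \<open>g\<close>.\<close>

definition ev :: "('o, 'a, 'c) psalg \<Rightarrow> 'a \<Rightarrow> 'c" where
  "ev Y g = (alg_unit Y \<triangleleft> g) \<odot> (alg_act Y \<triangleright> \<eta>n M g)"

lemma ev_typing [simp]:
  assumes "alg Y" "g \<in> Cell1 C" "trg1 C g = alg_ob Y"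
  shows "iso2 (ev Y g)" "src2 C (ev Y g) = alg_act Y \<cdot> (T1 M g \<cdot> \<eta> M (src1 C g))" "trg2 C (ev Y g) = g"
  using assms by (simp_all add: ev_def)

lemma ev_nat:
  assumes "alg Y" "\<sigma> \<in> Cell2 C" "src2 C \<sigma> = f" "trg2 C \<sigma> = g" "trg1 C f = alg_ob Y" "src1 C f = A"
    "b = alg_act Y"
  shows "ev Y g \<odot> (b \<triangleright> (T2 M \<sigma> \<triangleleft> \<eta> M A)) = \<sigma> \<odot> ev Y f"
proof -
  have [simp]: "f \<in> Cell1 C" "g \<in> Cell1 C" "A \<in> Obj C" "src1 C g = A" "trg1 C g = alg_ob Y"
    using assms(2-) by auto
  note [simp] = assms
  have 1: "(b \<triangleright> \<eta>n M g) \<odot> (b \<triangleright> (T2 M \<sigma> \<triangleleft> \<eta> M A)) = (b \<cdot> \<eta> M (alg_ob Y) \<triangleright> \<sigma>) \<odot> (b \<triangleright> \<eta>n M f)"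
    using arg_cong[OF eta_nat_2[of \<sigma> f g A "alg_ob Y"], of "lwhisker C b"] by simp
  have 2: "(alg_unit Y \<triangleleft> g) \<odot> (b \<cdot> \<eta> M (alg_ob Y) \<triangleright> \<sigma>) = \<sigma> \<odot> (alg_unit Y \<triangleleft> f)"
    using swap[of \<sigma> "alg_unit Y"] by simp
  show ?thesis
    by (simp add: ev_def 1[simplified] vcomp_eq_ext[OF 2[simplified]])
qed

text \<open>By naturality of \<open>ev\<close>, \<sigma> is the conjugate by \<open>ev\<close> of
  the restriction of \<open>b T\<sigma>\<close> along \<open>\<eta>\<close>.\<close>

lemma act_faithful:
  assumes "alg Y" "\<sigma> \<in> Cell2 C" "\<tau> \<in> Cell2 C" "src2 C \<sigma> = src2 C \<tau>" "trg2 C \<sigma> = trg2 C \<tau>"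
    "trg1 C (src2 C \<tau>) = alg_ob Y"
    and "alg_act Y \<triangleright> T2 M \<sigma> = alg_act Y \<triangleright> T2 M \<tau>"
  shows "\<sigma> = \<tau>"
proof (rule iso2_cancel_right[of _ "ev Y (src2 C \<tau>)"])
  let ?A = "src1 C (src2 C \<tau>)" and ?b = "alg_act Y"
  have "?b \<triangleright> (T2 M \<sigma> \<triangleleft> \<eta> M ?A) = (?b \<triangleright> T2 M \<sigma>) \<triangleleft> \<eta> M ?A"
    using assms(1-6) by simp
  also have "\<dots> = ?b \<triangleright> (T2 M \<tau> \<triangleleft> \<eta> M ?A)"
    unfolding assms(7) using assms(1-6) by simp
  finally show "\<sigma> \<odot> ev Y (src2 C \<tau>) = \<tau> \<odot> ev Y (src2 C \<tau>)"
    using assms(1-6) ev_nat[of Y \<sigma> "src2 C \<tau>" "trg2 C \<tau>" ?A ?b] ev_nat[of Y \<tau> "src2 C \<tau>" "trg2 C \<tau>" ?A ?b]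
    by simp
qed (use assms in simp_all)

text \<open>The unit coherence on the other side, which (A1) does not state but which follows from
  (A1) and (A2), as the extra unit triangles of a monoidal category follow from triangle and
  pentagon. By \<open>act_faithful\<close> it suffices to compare after applying \<open>b T\<close>,
  and the invertible \<open>\<alpha>\<^sup>s\<close> may be prefixed.\<close>

lemma alg_unit_left:
  assumes "alg Y" "B = alg_ob Y" "b = alg_act Y"
  shows "(b \<triangleright> \<xi> M B) \<odot> (alg_mult Y \<triangleleft> \<eta> M (T0 M B)) = (alg_unit Y \<triangleleft> b) \<odot> (b \<triangleright> \<eta>n M b)"
proof (rule act_faithful[OF assms(1)])
  note [simp] = assms
  let ?s = "alg_mult Y" and ?t = "alg_unit Y"
  note A1 = alg_A1[OF assms(1) refl refl] and A2 = alg_A2[OF assms(1) refl refl]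
  have 1: "(b \<triangleright> (\<zeta> M B \<triangleleft> T1 M b)) \<odot> (?s \<triangleleft> T1 M (\<eta> M B) \<cdot> T1 M b) = b \<triangleright> (T2 M ?t \<triangleleft> T1 M b)"
    using arg_cong[OF A1, of "\<lambda>z. rwhisker C z (T1 M b)"] by simp
  have 2: "(?s \<triangleleft> T1 M (\<eta> M B) \<cdot> T1 M b) \<odot> (b \<cdot> T1 M b \<triangleright> T2 M (\<eta>n M b)) =
      (b \<cdot> \<mu> M B \<triangleright> T2 M (\<eta>n M b)) \<odot> (?s \<triangleleft> T1 M (T1 M b) \<cdot> T1 M (\<eta> M (T0 M B)))"
    using swap[of "T2 M (\<eta>n M b)" ?s] by simp
  have 3: "(b \<triangleright> (\<zeta> M B \<triangleleft> T1 M b)) \<odot> (b \<cdot> \<mu> M B \<triangleright> T2 M (\<eta>n M b)) =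
      (b \<cdot> T1 M b \<triangleright> \<zeta> M (T0 M B)) \<odot> (b \<triangleright> (\<mu>n M b \<triangleleft> T1 M (\<eta> M (T0 M B))))"
    using arg_cong[OF zeta_nat[of b "T0 M B" B], of "lwhisker C b"] by simp
  \<comment> \<open>The right-hand side under \<open>b T\<close>: (A1) for \<open>Y\<close> trades
    \<open>T\<close> of the unit cell for \<open>\<zeta>\<close> and the multiplication cell, and
    naturality of \<open>\<zeta>\<close> at \<open>b\<close> moves \<open>\<zeta>\<close> to
    \<open>T0 M B\<close>.\<close>
  have R: "b \<triangleright> T2 M ((?t \<triangleleft> b) \<odot> (b \<triangleright> \<eta>n M b)) = (b \<cdot> T1 M b \<triangleright> \<zeta> M (T0 M B)) \<odot>
      ((b \<triangleright> (\<mu>n M b \<triangleleft> T1 M (\<eta> M (T0 M B)))) \<odot> (?s \<triangleleft> T1 M (T1 M b) \<cdot> T1 M (\<eta> M (T0 M B))))"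
    using 1[symmetric] 2 3 by (simp add: vcomp_eq_ext[OF 3[simplified]])
  have 5: "?s \<odot> (b \<cdot> T1 M b \<triangleright> T2 M (\<xi> M B)) =
      (b \<cdot> \<mu> M B \<triangleright> T2 M (\<xi> M B)) \<odot> (?s \<triangleleft> T1 M (\<mu> M B) \<cdot> T1 M (\<eta> M (T0 M B)))"
    using swap[of "T2 M (\<xi> M B)" ?s] by simp
  \<comment> \<open>(A1) for the free algebra on \<open>B\<close>: it trades \<open>T \<xi>\<close>
    for \<open>\<zeta>\<close> and \<open>\<rho>\<close>, and the \<open>\<rho>\<close> so produced
    is what (A2) for \<open>Y\<close> consumes in the next equation.\<close>
  have 6: "b \<cdot> \<mu> M B \<triangleright> T2 M (\<xi> M B) =
      (b \<cdot> \<mu> M B \<triangleright> \<zeta> M (T0 M B)) \<odot> (b \<triangleright> (\<rho> M B \<triangleleft> T1 M (\<eta> M (T0 M B))))"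
    using arg_cong[OF alg_A1[OF alg_free[of B] refl refl], of "lwhisker C b"] by simp
  have 7: "(b \<triangleright> (\<rho> M B \<triangleleft> T1 M (\<eta> M (T0 M B)))) \<odot> ((?s \<triangleleft> T1 M (\<mu> M B) \<cdot> T1 M (\<eta> M (T0 M B))) \<odot>
        (b \<triangleright> (T2 M ?s \<triangleleft> T1 M (\<eta> M (T0 M B))))) =
      (?s \<triangleleft> \<mu> M (T0 M B) \<cdot> T1 M (\<eta> M (T0 M B))) \<odot> ((b \<triangleright> (\<mu>n M b \<triangleleft> T1 M (\<eta> M (T0 M B)))) \<odot>
        (?s \<triangleleft> T1 M (T1 M b) \<cdot> T1 M (\<eta> M (T0 M B))))"
    using arg_cong[OF A2, of "\<lambda>z. rwhisker C z (T1 M (\<eta> M (T0 M B)))"] by simp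
  have 8: "(b \<cdot> \<mu> M B \<triangleright> \<zeta> M (T0 M B)) \<odot> (?s \<triangleleft> \<mu> M (T0 M B) \<cdot> T1 M (\<eta> M (T0 M B))) =
      ?s \<odot> (b \<cdot> T1 M b \<triangleright> \<zeta> M (T0 M B))"
    using swap[of "\<zeta> M (T0 M B)" ?s] by simp
  show "alg_act Y \<triangleright> T2 M ((b \<triangleright> \<xi> M B) \<odot> (?s \<triangleleft> \<eta> M (T0 M B))) =
      alg_act Y \<triangleright> T2 M ((?t \<triangleleft> b) \<odot> (b \<triangleright> \<eta>n M b))"
  proof (rule iso2_cancel_left[of ?s])
    have "?s \<odot> (b \<triangleright> T2 M ((b \<triangleright> \<xi> M B) \<odot> (?s \<triangleleft> \<eta> M (T0 M B)))) =
       ?s \<odot> ((b \<cdot> T1 M b \<triangleright> T2 M (\<xi> M B)) \<odot> (b \<triangleright> (T2 M ?s \<triangleleft> T1 M (\<eta> M (T0 M B)))))"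
      by simp
    also have "\<dots> = (b \<cdot> \<mu> M B \<triangleright> \<zeta> M (T0 M B)) \<odot> ((b \<triangleright> (\<rho> M B \<triangleleft> T1 M (\<eta> M (T0 M B)))) \<odot>
        ((?s \<triangleleft> T1 M (\<mu> M B) \<cdot> T1 M (\<eta> M (T0 M B))) \<odot> (b \<triangleright> (T2 M ?s \<triangleleft> T1 M (\<eta> M (T0 M B))))))"
      by (subst vcomp_eq_ext[OF 5]) (simp_all add: 6[simplified])
    also have "\<dots> = ?s \<odot> (b \<triangleright> T2 M ((?t \<triangleleft> b) \<odot> (b \<triangleright> \<eta>n M b)))"
      unfolding 7 R by (subst vcomp_eq_ext[OF 8]) simp_all
    finally show "?s \<odot> (alg_act Y \<triangleright> T2 M ((b \<triangleright> \<xi> M B) \<odot> (?s \<triangleleft> \<eta> M (T0 M B)))) =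
       ?s \<odot> (alg_act Y \<triangleright> T2 M ((?t \<triangleleft> b) \<odot> (b \<triangleright> \<eta>n M b)))"
      by simp
  qed simp_all
qed (use assms in simp_all)

text \<open>The mate of \<open>g : A \<rightarrow> alg_ob Y\<close> under the free-forgetful
  biadjunction. The structure cell \<open>b T(b Tg) \<Rightarrow> b Tg \<mu>\<close> is the
  multiplication of \<open>Y\<close> followed by the naturality cell of \<open>\<mu>\<close> at
  \<open>g\<close>.\<close>

definition ext :: "('o, 'a, 'c) psalg \<Rightarrow> 'a \<Rightarrow> ('o, 'a, 'c) psmor" where
  "ext Y g = PsMor (free (src1 C g)) Y (alg_act Y \<cdot> T1 M g)
     ((alg_act Y \<triangleright> \<mu>n M g) \<odot> (alg_mult Y \<triangleleft> T1 M (T1 M g)))"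

text \<open>The unit law combines naturality of \<open>\<xi>\<close> with
  \<open>alg_unit_left\<close>; the multiplication law combines naturality of \<open>\<rho>\<close>
  with (A2).\<close>

lemma mor_ext:
  assumes "alg Y" "g \<in> Cell1 C" "trg1 C g = alg_ob Y"
  shows "mor (ext Y g)"
  unfolding ext_def
proof (rule morI)
  note [simp] = assms
  let ?s = "alg_mult Y" and ?t = "alg_unit Y" and ?b = "alg_act Y" and ?X = "src1 C g" and ?B = "alg_ob Y"
  show "alg (free ?X)"
    by (simp add: alg_free del: is_psalg.simps)
  have 1: "(?b \<cdot> T1 M g \<triangleright> \<xi> M ?X) \<odot> (?b \<triangleright> (\<mu>n M g \<triangleleft> \<eta> M (T0 M ?X))) =
     (?b \<triangleright> (\<xi> M ?B \<triangleleft> T1 M g)) \<odot> (?b \<cdot> \<mu> M ?B \<triangleright> \<eta>n M (T1 M g))"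
    using arg_cong[OF xi_nat[of g ?X ?B], of "lwhisker C ?b"] by simp
  have 2: "(?b \<cdot> \<mu> M ?B \<triangleright> \<eta>n M (T1 M g)) \<odot> (?s \<triangleleft> T1 M (T1 M g) \<cdot> \<eta> M (T0 M ?X)) =
      (?s \<triangleleft> \<eta> M (T0 M ?B) \<cdot> T1 M g) \<odot> (?b \<cdot> T1 M ?b \<triangleright> \<eta>n M (T1 M g))"
    using swap[of "\<eta>n M (T1 M g)" ?s] by simp
  have 3: "(?b \<triangleright> (\<xi> M ?B \<triangleleft> T1 M g)) \<odot> (?s \<triangleleft> \<eta> M (T0 M ?B) \<cdot> T1 M g) =
      (?t \<triangleleft> ?b \<cdot> T1 M g) \<odot> (?b \<triangleright> (\<eta>n M ?b \<triangleleft> T1 M g))"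
    using arg_cong[OF alg_unit_left[OF assms(1) refl refl], of "\<lambda>z. rwhisker C z (T1 M g)"] by simp
  show "(?b \<cdot> T1 M g \<triangleright> alg_unit (free ?X)) \<odot>
      (((?b \<triangleright> \<mu>n M g) \<odot> (?s \<triangleleft> T1 M (T1 M g))) \<triangleleft> \<eta> M (alg_ob (free ?X))) =
    (?t \<triangleleft> ?b \<cdot> T1 M g) \<odot> (?b \<triangleright> \<eta>n M (?b \<cdot> T1 M g))"
    by (simp add: vcomp_eq_ext[OF 1] 2 vcomp_eq_ext[OF 3])
  have 4: "(?s \<triangleleft> T1 M (T1 M g) \<cdot> T1 M (\<mu> M ?X)) \<odot> (?b \<cdot> T1 M ?b \<triangleright> T2 M (\<mu>n M g)) =
      (?b \<cdot> \<mu> M ?B \<triangleright> T2 M (\<mu>n M g)) \<odot> (?s \<triangleleft> T1 M (\<mu> M ?B) \<cdot> T1 M (T1 M (T1 M g)))"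
    using swap[of "T2 M (\<mu>n M g)" ?s] by simp
  have 5: "(?b \<cdot> T1 M g \<triangleright> \<rho> M ?X) \<odot> ((?b \<triangleright> (\<mu>n M g \<triangleleft> T1 M (\<mu> M ?X))) \<odot> (?b \<cdot> \<mu> M ?B \<triangleright> T2 M (\<mu>n M g))) =
     (?b \<triangleright> (\<mu>n M g \<triangleleft> \<mu> M (T0 M ?X))) \<odot> ((?b \<cdot> \<mu> M ?B \<triangleright> \<mu>n M (T1 M g)) \<odot> (?b \<triangleright> (\<rho> M ?B \<triangleleft> T1 M (T1 M (T1 M g)))))"
    using arg_cong[OF rho_nat[of g ?X ?B], of "lwhisker C ?b"] by simp
  have 6: "(?b \<triangleright> (\<rho> M ?B \<triangleleft> T1 M (T1 M (T1 M g)))) \<odot> ((?s \<triangleleft> T1 M (\<mu> M ?B) \<cdot> T1 M (T1 M (T1 M g))) \<odot>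
       (?b \<triangleright> (T2 M ?s \<triangleleft> T1 M (T1 M (T1 M g))))) =
     (?s \<triangleleft> \<mu> M (T0 M ?B) \<cdot> T1 M (T1 M (T1 M g))) \<odot> ((?b \<triangleright> (\<mu>n M ?b \<triangleleft> T1 M (T1 M (T1 M g)))) \<odot>
       (?s \<triangleleft> T1 M (T1 M ?b) \<cdot> T1 M (T1 M (T1 M g))))"
    using arg_cong[OF alg_A2[OF assms(1) refl refl], of "\<lambda>z. rwhisker C z (T1 M (T1 M (T1 M g)))"] by simp
  have 7: "(?b \<cdot> \<mu> M ?B \<triangleright> \<mu>n M (T1 M g)) \<odot> (?s \<triangleleft> \<mu> M (T0 M ?B) \<cdot> T1 M (T1 M (T1 M g))) =
     (?s \<triangleleft> T1 M (T1 M g) \<cdot> \<mu> M (T0 M ?X)) \<odot> (?b \<cdot> T1 M ?b \<triangleright> \<mu>n M (T1 M g))"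
    using swap[of "\<mu>n M (T1 M g)" ?s] by simp
  show "(?b \<cdot> T1 M g \<triangleright> alg_mult (free ?X)) \<odot>
      ((((?b \<triangleright> \<mu>n M g) \<odot> (?s \<triangleleft> T1 M (T1 M g))) \<triangleleft> T1 M (alg_act (free ?X))) \<odot>
       (?b \<triangleright> T2 M ((?b \<triangleright> \<mu>n M g) \<odot> (?s \<triangleleft> T1 M (T1 M g))))) =
    (((?b \<triangleright> \<mu>n M g) \<odot> (?s \<triangleleft> T1 M (T1 M g))) \<triangleleft> \<mu> M (alg_ob (free ?X))) \<odot>
      ((?b \<triangleright> \<mu>n M (?b \<cdot> T1 M g)) \<odot> (?s \<triangleleft> T1 M (T1 M (?b \<cdot> T1 M g))))"
    by (simp add: vcomp_eq_ext[OF 4] vcomp_eq_ext3[OF 5] 6 vcomp_eq_ext[OF 7])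
qed (use assms in simp_all)

section \<open>Restriction along the unit is fully faithful on free algebras\<close>

text \<open>
  For a pseudomorphism \<open>u\<close> out of a free algebra, \<open>u\<close> is isomorphic to the extension of \<open>u \<eta>\<close>.
\<close>

definition coev :: "('o, 'a, 'c) psmor \<Rightarrow> 'o \<Rightarrow> 'c" where
  "coev u A = (mor_fun u \<triangleright> \<zeta> M A) \<odot> (mor_cell u \<triangleleft> T1 M (\<eta> M A))"

lemma coev_typing [simp]:
  assumes "mor u" "mor_src u = free A" "A \<in> Obj C"
  shows "iso2 (coev u A)" "src2 C (coev u A) = alg_act (mor_trg u) \<cdot> (T1 M (mor_fun u) \<cdot> T1 M (\<eta> M A))"
    "trg2 C (coev u A) = mor_fun u"
  using assms mor_typing(2)[OF assms(1)] by (simp_all add: coev_def)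

lemma coev_nat:
  assumes "transf \<Sigma>" "mor_src (trans_src \<Sigma>) = free A" "A \<in> Obj C"
    "trans_src \<Sigma> = u" "trans_trg \<Sigma> = v" "alg_act (mor_trg u) = b" "trans_cell \<Sigma> = \<sigma>"
  shows "coev v A \<odot> (b \<triangleright> (T2 M \<sigma> \<triangleleft> T1 M (\<eta> M A))) = \<sigma> \<odot> coev u A"
proof -
  note [simp] = assms(1-5,7)
  let ?b = "alg_act (mor_trg u)"
  have [simp]: "mor_src u = free A"
    using assms(2,4) by simp
  have [simp]: "mor u" "mor v" "mor_src v = free A" "mor_trg v = mor_trg u" "alg (mor_trg u)"
     "src2 C \<sigma> = mor_fun u" "trg2 C \<sigma> = mor_fun v" "\<sigma> \<in> Cell2 C"
    using transf_typing[OF assms(1)] by (auto simp del: transf_typing is_psalg.simps)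
  have 1: "(\<sigma> \<triangleleft> \<mu> M A \<cdot> T1 M (\<eta> M A)) \<odot> (mor_cell u \<triangleleft> T1 M (\<eta> M A)) =
     (mor_cell v \<triangleleft> T1 M (\<eta> M A)) \<odot> (?b \<triangleright> (T2 M \<sigma> \<triangleleft> T1 M (\<eta> M A)))"
    using arg_cong[OF transf_eq[OF assms(1) refl refl], of "\<lambda>z. rwhisker C z (T1 M (\<eta> M A))"] by simp
  have 2: "\<sigma> \<odot> (mor_fun u \<triangleright> \<zeta> M A) = (mor_fun v \<triangleright> \<zeta> M A) \<odot> (\<sigma> \<triangleleft> \<mu> M A \<cdot> T1 M (\<eta> M A))"
    using swap[of "\<zeta> M A" \<sigma>] by simp
  show ?thesis
    unfolding assms(6)[symmetric] by (simp add: coev_def vcomp_eq_ext[OF 2] 1)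
qed

text \<open>By naturality of \<open>coev\<close>, a transformation is the conjugate by
  \<open>coev\<close> of \<open>b T\<close> applied to its restriction along
  \<open>\<eta>\<close>.\<close>

lemma free_faithful:
  assumes "transf \<Sigma>" "transf \<Sigma>'" "mor_src (trans_src \<Sigma>) = free A" "A \<in> Obj C"
    "trans_src \<Sigma>' = trans_src \<Sigma>" "trans_trg \<Sigma>' = trans_trg \<Sigma>"
    "trans_cell \<Sigma> \<triangleleft> \<eta> M A = trans_cell \<Sigma>' \<triangleleft> \<eta> M A"
  shows "\<Sigma> = \<Sigma>'"
proof -
  let ?u = "trans_src \<Sigma>" and ?b = "alg_act (mor_trg (trans_src \<Sigma>))"
  note [simp] = assms
  have [simp]: "mor ?u" "alg (mor_trg ?u)"
    using transf_typing(1)[OF assms(1)] mor_typing(2) by (auto simp del: transf_typing is_psalg.simps)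
  have *: "trans_cell S \<odot> coev ?u A = coev (trans_trg S) A \<odot> (?b \<triangleright> T2 M (trans_cell S \<triangleleft> \<eta> M A))"
    if "transf S" "trans_src S = ?u" for S
    using coev_nat[of S A ?u "trans_trg S" ?b "trans_cell S"] that by (simp del: is_psalg.simps)
  have "trans_cell \<Sigma> = trans_cell \<Sigma>'"
    by (rule iso2_cancel_right[of _ "coev ?u A"]) (simp_all add: * del: is_psalg.simps T.F2_rwhisker)
  then show ?thesis
    using assms(5,6) by (intro pstrans.expand) simp
qed

text \<open>This is the condition that \<open>b T\<tau>\<close> be a transformation from
  \<open>ext Y g\<close> to \<open>ext Y h\<close>, spelled out on 2-cells of the base.\<close>

lemma ext_nat:
  assumes "alg Y" "\<tau> \<in> Cell2 C" "src2 C \<tau> = g" "trg2 C \<tau> = h" "src1 C g = A" "trg1 C g = alg_ob Y"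
    "alg_act Y = b" "alg_mult Y = s"
  shows "(b \<triangleright> (T2 M \<tau> \<triangleleft> \<mu> M A)) \<odot> ((b \<triangleright> \<mu>n M g) \<odot> (s \<triangleleft> T1 M (T1 M g))) =
    (b \<triangleright> \<mu>n M h) \<odot> ((s \<triangleleft> T1 M (T1 M h)) \<odot> (b \<cdot> T1 M b \<triangleright> T2 M (T2 M \<tau>)))"
proof -
  have [simp]: "g \<in> Cell1 C" "h \<in> Cell1 C" "A \<in> Obj C" "src1 C h = A" "trg1 C h = alg_ob Y"
    using assms(2-) by auto
  note [simp] = assms(1-6)
  let ?b = "alg_act Y" and ?s = "alg_mult Y"
  have 1: "(?b \<triangleright> \<mu>n M h) \<odot> (?b \<cdot> \<mu> M (alg_ob Y) \<triangleright> T2 M (T2 M \<tau>)) = (?b \<triangleright> (T2 M \<tau> \<triangleleft> \<mu> M A)) \<odot> (?b \<triangleright> \<mu>n M g)"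
    using arg_cong[OF mu_nat_2[of \<tau> g h A "alg_ob Y"], of "lwhisker C ?b"] by simp
  have 2: "(?s \<triangleleft> T1 M (T1 M h)) \<odot> (?b \<cdot> T1 M ?b \<triangleright> T2 M (T2 M \<tau>)) =
    (?b \<cdot> \<mu> M (alg_ob Y) \<triangleright> T2 M (T2 M \<tau>)) \<odot> (?s \<triangleleft> T1 M (T1 M g))"
    using swap[of "T2 M (T2 M \<tau>)" ?s] by simp
  show ?thesis
    unfolding assms(7,8)[symmetric] by (simp add: vcomp_eq_ext[OF 1] 2)
qed

text \<open>This lemma and \<open>coev_act\<close> compute the two sides of the condition for
  \<open>coev u A\<close> to be a transformation from \<open>ext Y (u \<eta>)\<close> to
  \<open>u\<close>. Both results end in the same composite of structure cells of \<open>u\<close>;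
  they differ only in the 2-cell whiskered by \<open>u\<close> in front of it.\<close>

lemma coev_mult:
  assumes "mor u" "mor_src u = free A" "A \<in> Obj C" "mor_trg u = Y"
  shows "(coev u A \<triangleleft> \<mu> M A) \<odot> ((alg_act Y \<triangleright> \<mu>n M (mor_fun u \<cdot> \<eta> M A)) \<odot> (alg_mult Y \<triangleleft> T1 M (T1 M (mor_fun u \<cdot> \<eta> M A)))) =
    (mor_fun u \<triangleright> ((\<zeta> M A \<triangleleft> \<mu> M A) \<odot> ((\<mu> M A \<triangleright> \<mu>n M (\<eta> M A)) \<odot> (\<rho> M A \<triangleleft> T1 M (T1 M (\<eta> M A)))))) \<odot>
    ((mor_cell u \<triangleleft> T1 M (\<mu> M A) \<cdot> T1 M (T1 M (\<eta> M A))) \<odot> (alg_act Y \<triangleright> (T2 M (mor_cell u) \<triangleleft> T1 M (T1 M (\<eta> M A)))))"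
proof -
  note [simp] = assms
  have [simp]: "alg Y"
    using mor_typing(2)[OF assms(1)] assms(4) by simp
  let ?f = "mor_fun u" and ?\<upsilon> = "mor_cell u" and ?b = "alg_act Y" and ?h = "\<eta> M A"
  have 1: "(?\<upsilon> \<triangleleft> T1 M ?h \<cdot> \<mu> M A) \<odot> (?b \<cdot> T1 M ?f \<triangleright> \<mu>n M ?h) =
      (?f \<cdot> \<mu> M A \<triangleright> \<mu>n M ?h) \<odot> (?\<upsilon> \<triangleleft> \<mu> M (T0 M A) \<cdot> T1 M (T1 M ?h))"
    using swap[of "\<mu>n M ?h" ?\<upsilon>] by simp
  have 2: "(?\<upsilon> \<triangleleft> \<mu> M (T0 M A) \<cdot> T1 M (T1 M ?h)) \<odot> ((?b \<triangleright> (\<mu>n M ?f \<triangleleft> T1 M (T1 M ?h))) \<odot>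
        (alg_mult Y \<triangleleft> T1 M (T1 M ?f) \<cdot> T1 M (T1 M ?h))) =
      (?f \<triangleright> (\<rho> M A \<triangleleft> T1 M (T1 M ?h))) \<odot> ((?\<upsilon> \<triangleleft> T1 M (\<mu> M A) \<cdot> T1 M (T1 M ?h)) \<odot> (?b \<triangleright> (T2 M ?\<upsilon> \<triangleleft> T1 M (T1 M ?h))))"
    using arg_cong[OF mor_mult[OF assms(1) refl refl refl refl], of "\<lambda>z. rwhisker C z (T1 M (T1 M ?h))"] by simp
  show ?thesis
    by (simp add: coev_def vcomp_eq_ext[OF 1] 2)
qed

lemma coev_act:
  assumes "mor u" "mor_src u = free A" "A \<in> Obj C" "mor_trg u = Y"
  shows "mor_cell u \<odot> (alg_act Y \<triangleright> T2 M (coev u A)) = (mor_fun u \<cdot> \<mu> M A \<triangleright> T2 M (\<zeta> M A)) \<odot>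
    ((mor_cell u \<triangleleft> T1 M (\<mu> M A) \<cdot> T1 M (T1 M (\<eta> M A))) \<odot> (alg_act Y \<triangleright> (T2 M (mor_cell u) \<triangleleft> T1 M (T1 M (\<eta> M A)))))"
proof -
  note [simp] = assms
  have [simp]: "alg Y"
    using mor_typing(2)[OF assms(1)] assms(4) by simp
  have 1: "mor_cell u \<odot> (alg_act Y \<cdot> T1 M (mor_fun u) \<triangleright> T2 M (\<zeta> M A)) = (mor_fun u \<cdot> \<mu> M A \<triangleright> T2 M (\<zeta> M A)) \<odot>
      (mor_cell u \<triangleleft> T1 M (\<mu> M A) \<cdot> T1 M (T1 M (\<eta> M A)))"
    using swap[of "T2 M (\<zeta> M A)" "mor_cell u"] by simp
  show ?thesis
    by (simp add: coev_def vcomp_eq_ext[OF 1])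
qed

text \<open>
  The comparison \<open>coev\<close> fails to be a transformation at most by a whiskered 2-cell between the
  structure cells \<open>\<zeta>\<mu> \<circ> \<mu>\<mu>\<^sub>\<eta> \<circ> \<rho>TT\<eta>\<close> and \<open>\<mu>T\<zeta>\<close>;
  this discrepancy cancels by interchange.
\<close>

lemma free_full:
  assumes "mor u" "mor v" "mor_src u = free A" "mor_src v = free A" "mor_trg u = Y" "mor_trg v = Y" "A \<in> Obj C"
    and \<tau>: "\<tau> \<in> Cell2 C" "src2 C \<tau> = mor_fun u \<cdot> \<eta> M A" "trg2 C \<tau> = mor_fun v \<cdot> \<eta> M A"
  shows "\<exists>\<Sigma>. transf \<Sigma> \<and> trans_src \<Sigma> = u \<and> trans_trg \<Sigma> = v \<and> trans_cell \<Sigma> \<triangleleft> \<eta> M A = \<tau>"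
proof -
  note [simp] = assms
  have [simp]: "alg Y"
    using mor_typing(2)[OF assms(1)] assms(5) by simp
  let ?b = "alg_act Y" and ?s = "alg_mult Y" and ?h = "\<eta> M A"
  let ?cu = "coev u A" and ?cv = "coev v A" and ?f = "mor_fun u" and ?g = "mor_fun v"
    and ?\<upsilon> = "mor_cell u" and ?\<nu> = "mor_cell v"
  let ?eu = "ev Y (?f \<cdot> ?h)" and ?ev = "ev Y (?g \<cdot> ?h)"
  let ?Kl = "(\<zeta> M A \<triangleleft> \<mu> M A) \<odot> ((\<mu> M A \<triangleright> \<mu>n M ?h) \<odot> (\<rho> M A \<triangleleft> T1 M (T1 M ?h)))"
    and ?Kr = "\<mu> M A \<triangleright> T2 M (\<zeta> M A)" and ?S = "\<mu> M A \<cdot> (T1 M (\<mu> M A) \<cdot> T1 M (T1 M ?h))"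
  \<comment> \<open>The obvious candidate \<open>b T\<tau>\<close>, conjugated by
    \<open>coev\<close>, need not restrict to \<tau>, as \<open>ev\<close> and the restriction of
    \<open>coev\<close> may differ. Correcting \<tau> by both beforehand makes the errors cancel: by
    \<open>ev_nat\<close>, restricting \<open>b Tt\<close> undoes the \<open>ev\<close>
    parts.\<close>
  define t where "t = ?ev \<odot> (vinv (?cv \<triangleleft> ?h) \<odot> (\<tau> \<odot> ((?cu \<triangleleft> ?h) \<odot> vinv ?eu)))"
  have [simp]: "t \<in> Cell2 C" "src2 C t = ?f \<cdot> ?h" "trg2 C t = ?g \<cdot> ?h"
    by (simp_all add: t_def)
  define \<sigma> where "\<sigma> = ?cv \<odot> ((?b \<triangleright> T2 M t) \<odot> vinv ?cu)"
  have [simp]: "\<sigma> \<in> Cell2 C" "src2 C \<sigma> = ?f" "trg2 C \<sigma> = ?g"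
    by (simp_all add: \<sigma>_def)
  have S: "\<sigma> \<odot> ?cu = ?cv \<odot> (?b \<triangleright> T2 M t)"
    by (simp add: \<sigma>_def)
  have "?ev \<odot> (?b \<triangleright> (T2 M t \<triangleleft> ?h)) = t \<odot> ?eu"
    by (rule ev_nat) simp_all
  also have "\<dots> = ?ev \<odot> (vinv (?cv \<triangleleft> ?h) \<odot> (\<tau> \<odot> (?cu \<triangleleft> ?h)))"
    by (simp add: t_def)
  finally have t: "?b \<triangleright> (T2 M t \<triangleleft> ?h) = vinv (?cv \<triangleleft> ?h) \<odot> (\<tau> \<odot> (?cu \<triangleleft> ?h))"
    by (rule iso2_cancel_left) simp_all
  have "\<sigma> \<triangleleft> ?h = \<tau>"
    by (simp add: \<sigma>_def t vinv_rwhisker)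
  moreover have "transf (PsTrans u v \<sigma>)"
  proof -
    let ?Pu = "(?\<upsilon> \<triangleleft> T1 M (\<mu> M A) \<cdot> T1 M (T1 M ?h)) \<odot> (?b \<triangleright> (T2 M ?\<upsilon> \<triangleleft> T1 M (T1 M ?h)))"
      and ?Pv = "(?\<nu> \<triangleleft> T1 M (\<mu> M A) \<cdot> T1 M (T1 M ?h)) \<odot> (?b \<triangleright> (T2 M ?\<nu> \<triangleleft> T1 M (T1 M ?h)))"
      and ?t2 = "?b \<cdot> T1 M ?b \<triangleright> T2 M (T2 M t)"
    let ?\<phi>u = "(?b \<triangleright> \<mu>n M (?f \<cdot> ?h)) \<odot> (?s \<triangleleft> T1 M (T1 M (?f \<cdot> ?h)))"
      and ?\<phi>v = "(?b \<triangleright> \<mu>n M (?g \<cdot> ?h)) \<odot> (?s \<triangleleft> T1 M (T1 M (?g \<cdot> ?h)))"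
    have s1: "(?g \<triangleright> ?Kl) \<odot> (\<sigma> \<triangleleft> ?S) = (\<sigma> \<triangleleft> \<mu> M A) \<odot> (?f \<triangleright> ?Kl)"
      using swap[of ?Kl \<sigma>] by simp
    have s2: "(?g \<triangleright> ?Kr) \<odot> (\<sigma> \<triangleleft> ?S) = (\<sigma> \<triangleleft> \<mu> M A) \<odot> (?f \<triangleright> ?Kr)"
      using swap[of ?Kr \<sigma>] by simp
    \<comment> \<open>This equation does not mention \<open>?Kl\<close> or \<open>?Kr\<close>. It is
      obtained by cancelling the invertible \<open>?g \<triangleright> ?Kl\<close> in the
      multiplicativity of extensions; putting \<open>?g \<triangleright> ?Kr\<close> in front
      instead turns it into the transformation law for \<sigma>.\<close>
    have P: "(\<sigma> \<triangleleft> ?S) \<odot> ?Pu = ?Pv \<odot> ?t2"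
    proof (rule iso2_cancel_left[of "?g \<triangleright> ?Kl"])
      have "(?g \<triangleright> ?Kl) \<odot> ((\<sigma> \<triangleleft> ?S) \<odot> ?Pu) = (\<sigma> \<triangleleft> \<mu> M A) \<odot> ((?f \<triangleright> ?Kl) \<odot> ?Pu)"
        by (subst vcomp_eq_ext[OF s1]) (simp_all del: lwhisker_vcomp)
      also have "\<dots> = (\<sigma> \<triangleleft> \<mu> M A) \<odot> ((?cu \<triangleleft> \<mu> M A) \<odot> ?\<phi>u)"
        by (subst coev_mult) simp_all
      also have "\<dots> = ((\<sigma> \<odot> ?cu) \<triangleleft> \<mu> M A) \<odot> ?\<phi>u"
        by simp
      also have "\<dots> = (?cv \<triangleleft> \<mu> M A) \<odot> ((?b \<triangleright> (T2 M t \<triangleleft> \<mu> M A)) \<odot> ?\<phi>u)"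
        unfolding S by simp
      also have "\<dots> = (?cv \<triangleleft> \<mu> M A) \<odot> (?\<phi>v \<odot> ?t2)"
        by (subst ext_nat[of Y t _ "?g \<cdot> ?h"]) simp_all
      also have "\<dots> = ((?cv \<triangleleft> \<mu> M A) \<odot> ?\<phi>v) \<odot> ?t2"
        by simp
      also have "\<dots> = (?g \<triangleright> ?Kl) \<odot> (?Pv \<odot> ?t2)"
        by (subst coev_mult) simp_all
      finally show "(?g \<triangleright> ?Kl) \<odot> ((\<sigma> \<triangleleft> ?S) \<odot> ?Pu) = (?g \<triangleright> ?Kl) \<odot> (?Pv \<odot> ?t2)" .
    qed simp_all
    have "(\<sigma> \<triangleleft> \<mu> M A) \<odot> ?\<upsilon> = ?\<nu> \<odot> (?b \<triangleright> T2 M \<sigma>)"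
    proof (rule iso2_cancel_right[of _ "?b \<triangleright> T2 M ?cu"])
      have "((\<sigma> \<triangleleft> \<mu> M A) \<odot> ?\<upsilon>) \<odot> (?b \<triangleright> T2 M ?cu) = (\<sigma> \<triangleleft> \<mu> M A) \<odot> (?\<upsilon> \<odot> (?b \<triangleright> T2 M ?cu))"
        by simp
      also have "\<dots> = (\<sigma> \<triangleleft> \<mu> M A) \<odot> ((?f \<triangleright> ?Kr) \<odot> ?Pu)"
        by (subst coev_act) simp_all
      also have "\<dots> = (?g \<triangleright> ?Kr) \<odot> ((\<sigma> \<triangleleft> ?S) \<odot> ?Pu)"
        by (subst vcomp_eq_ext[OF s2]) (simp_all del: lwhisker_lwhisker)
      also have "\<dots> = ((?g \<triangleright> ?Kr) \<odot> ?Pv) \<odot> ?t2"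
        unfolding P by simp
      also have "\<dots> = (?\<nu> \<odot> (?b \<triangleright> T2 M ?cv)) \<odot> ?t2"
        by (subst coev_act) simp_all
      also have "\<dots> = ?\<nu> \<odot> (?b \<triangleright> T2 M (?cv \<odot> (?b \<triangleright> T2 M t)))"
        by simp
      also have "\<dots> = (?\<nu> \<odot> (?b \<triangleright> T2 M \<sigma>)) \<odot> (?b \<triangleright> T2 M ?cu)"
        unfolding S[symmetric] by simp
      finally show "((\<sigma> \<triangleleft> \<mu> M A) \<odot> ?\<upsilon>) \<odot> (?b \<triangleright> T2 M ?cu) = (?\<nu> \<odot> (?b \<triangleright> T2 M \<sigma>)) \<odot> (?b \<triangleright> T2 M ?cu)" .
    qed simp_all
    then show ?thesis
      by (simp add: transf_iff[of "PsTrans _ _ _"])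
  qed
  ultimately show ?thesis
    by (intro exI[of _ "PsTrans u v \<sigma>"]) simp
qed

end

section \<open>Fully faithful and essentially surjective functors\<close>

context category
begin

lemma HomD: "f \<in> Hom C x y \<Longrightarrow> f \<in> Arr C \<and> Dom C f = x \<and> Cod C f = y \<and> x \<in> Ob C \<and> y \<in> Ob C"
  using Dom_Ob Cod_Ob by (auto simp: Hom_def)

lemma invertibleE:
  assumes "invertible C f" "f \<in> Hom C x y"
  obtains g where "g \<in> Hom C y x" "Cmp C g f = Idn C x" "Cmp C f g = Idn C y"
  using assms by (auto simp: invertible_def Hom_def)

lemma invertibleI:
  assumes "f \<in> Hom C x y" "g \<in> Hom C y x" "Cmp C g f = Idn C x" "Cmp C f g = Idn C y"
  shows "invertible C f"
  using assms by (auto simp: invertible_def Hom_def)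

lemma invertible_cancel_left:
  assumes "invertible C h" "h \<in> Hom C y z" "f \<in> Hom C x y" "g \<in> Hom C x y" "Cmp C h f = Cmp C h g"
  shows "f = g"
proof -
  obtain k where k: "k \<in> Hom C z y" "Cmp C k h = Idn C y"
    using assms(1,2) by (rule invertibleE)
  have "Cmp C (Cmp C k h) f = Cmp C (Cmp C k h) g"
    using assms(5) Cmp_assoc[OF assms(3) assms(2) k(1)] Cmp_assoc[OF assms(4) assms(2) k(1)] by simp
  then show ?thesis
    using k assms by (simp add: Cmp_Idn_left)
qed

lemma invertible_cancel_right:
  assumes "invertible C h" "h \<in> Hom C x y" "f \<in> Hom C y z" "g \<in> Hom C y z" "Cmp C f h = Cmp C g h"
  shows "f = g"
proof -
  obtain k where k: "k \<in> Hom C y x" "Cmp C h k = Idn C y"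
    using assms(1,2) by (rule invertibleE)
  have "Cmp C f (Cmp C h k) = Cmp C g (Cmp C h k)"
    using assms(5) Cmp_assoc[OF k(1) assms(2) assms(3)] Cmp_assoc[OF k(1) assms(2) assms(4)] by simp
  then show ?thesis
    using k assms by (metis Cmp_Idn_right)
qed

end

text \<open>Working form of equivalence: composites are immediate, and universal properties split
  into a statement about 1-cells and a bijection on 2-cells.\<close>

definition ff_eso :: "('x, 'm) cat \<Rightarrow> ('y, 'n) cat \<Rightarrow> ('x, 'm, 'y, 'n) cfunctor \<Rightarrow> bool" where
  "ff_eso C D F \<longleftrightarrow> is_functor C D F \<and>
     (\<forall>x \<in> Ob C. \<forall>y \<in> Ob C. bij_betw (onArr F) (Hom C x y) (Hom D (onOb F x) (onOb F y))) \<and>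
     (\<forall>z \<in> Ob D. \<exists>x \<in> Ob C. \<exists>k \<in> Hom D (onOb F x) z. invertible D k)"

lemma functorD:
  assumes "is_functor C D F" "category C"
  shows "x \<in> Ob C \<Longrightarrow> onOb F x \<in> Ob D"
    "f \<in> Hom C x y \<Longrightarrow> onArr F f \<in> Hom D (onOb F x) (onOb F y)"
    "x \<in> Ob C \<Longrightarrow> onArr F (Idn C x) = Idn D (onOb F x)"
    "f \<in> Hom C x y \<Longrightarrow> g \<in> Hom C y z \<Longrightarrow> onArr F (Cmp C g f) = Cmp D (onArr F g) (onArr F f)"
proof -
  note F = assms(1)[unfolded is_functor_def] and H = category.HomD[OF assms(2)]
  show "x \<in> Ob C \<Longrightarrow> onOb F x \<in> Ob D" "x \<in> Ob C \<Longrightarrow> onArr F (Idn C x) = Idn D (onOb F x)"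
    using F by blast+
  show "f \<in> Hom C x y \<Longrightarrow> onArr F f \<in> Hom D (onOb F x) (onOb F y)"
    using F H by blast
  show "f \<in> Hom C x y \<Longrightarrow> g \<in> Hom C y z \<Longrightarrow> onArr F (Cmp C g f) = Cmp D (onArr F g) (onArr F f)"
    using F H[of f x y] H[of g y z] by simp
qed

text \<open>The natural isomorphisms make both \<open>F\<close> and the quasi-inverse
  \<open>G\<close> faithful. Conjugating \<open>G k\<close> by \<open>u\<close> yields a preimage of
  \<open>k\<close>, because \<open>F\<close> of it and \<open>k\<close> agree under the faithful
  \<open>G\<close>.\<close>

lemma is_equivalence_imp_ff_eso:
  assumes C: "category C" and D: "category D" and "is_equivalence C D F"
  shows "ff_eso C D F"
proof -
  interpret C: category C by fact
  interpret D: category D by fact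
  obtain G u v where F: "is_functor C D F" and G: "is_functor D C G"
    and u: "is_natural_iso C C id_functor (comp_functor G F) u"
    and v: "is_natural_iso D D (comp_functor F G) id_functor v"
    using assms by (auto simp: is_equivalence_def)
  note F = functorD[OF F C] and G = functorD[OF G D]
  have u: "u x \<in> Hom C x (onOb G (onOb F x))" "invertible C (u x)" if "x \<in> Ob C" for x
    using u that by (auto simp: is_natural_iso_def is_natural_def id_functor_def comp_functor_def)
  have unat: "Cmp C (u y) f = Cmp C (onArr G (onArr F f)) (u x)" if "f \<in> Hom C x y" for f x y
    using \<open>is_natural_iso C C id_functor (comp_functor G F) u\<close> C.HomD[OF that]
    by (auto simp: is_natural_iso_def is_natural_def id_functor_def comp_functor_def)
  have v: "v x \<in> Hom D (onOb F (onOb G x)) x" "invertible D (v x)" if "x \<in> Ob D" for x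
    using v that by (auto simp: is_natural_iso_def is_natural_def id_functor_def comp_functor_def)
  have vnat: "Cmp D (v y) (onArr F (onArr G f)) = Cmp D f (v x)" if "f \<in> Hom D x y" for f x y
    using \<open>is_natural_iso D D (comp_functor F G) id_functor v\<close> D.HomD[OF that]
    by (auto simp: is_natural_iso_def is_natural_def id_functor_def comp_functor_def)
  have faithF: "f = g" if "f \<in> Hom C x y" "g \<in> Hom C x y" "onArr F f = onArr F g" for f g x y
    using that C.HomD[OF that(1)] unat[OF that(1)] unat[OF that(2)] u[of y]
    by (metis C.invertible_cancel_left)
  have faithG: "f = g" if "f \<in> Hom D x y" "g \<in> Hom D x y" "onArr G f = onArr G g" for f g x y
    using that D.HomD[OF that(1)] vnat[OF that(1)] vnat[OF that(2)] v[of x]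
    by (metis D.invertible_cancel_right)
  have full: "\<exists>f \<in> Hom C x y. onArr F f = k" if k: "k \<in> Hom D (onOb F x) (onOb F y)" and x: "x \<in> Ob C" and y: "y \<in> Ob C" for k x y
  proof -
    obtain w where w: "w \<in> Hom C (onOb G (onOb F y)) y" "Cmp C (u y) w = Idn C (onOb G (onOb F y))"
      using u[OF y] by (metis C.invertibleE)
    have Gk: "Cmp C (onArr G k) (u x) \<in> Hom C x (onOb G (onOb F y))"
      using C.Cmp_Hom u[OF x] G(2)[OF k] by blast
    define f where "f = Cmp C w (Cmp C (onArr G k) (u x))"
    have f: "f \<in> Hom C x y"
      unfolding f_def using C.Cmp_Hom Gk w by blast
    have "Cmp C (u y) f = Cmp C (onArr G k) (u x)"
      unfolding f_def using C.Cmp_assoc[OF Gk w(1) u(1)[OF y]] w(2) C.Cmp_Idn_left[OF Gk] by simp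
    \<comment> \<open>Naturality of \<open>u\<close> replaces \<open>u y\<close> after
      \<open>f\<close> by \<open>G (F f)\<close> after \<open>u x\<close>, and \<open>u x\<close> is
      cancelled.\<close>
    then have "onArr G (onArr F f) = onArr G k"
      using unat[OF f] C.invertible_cancel_right[OF u(2)[OF x] u(1)[OF x] G(2)[OF F(2)[OF f]] G(2)[OF k]] by simp
    then show ?thesis
      using faithG[OF F(2)[OF f] k] f by auto
  qed
  have "\<exists>x \<in> Ob C. \<exists>k \<in> Hom D (onOb F x) z. invertible D k" if "z \<in> Ob D" for z
    using v[OF that] G(1)[OF that] by blast
  moreover have "bij_betw (onArr F) (Hom C x y) (Hom D (onOb F x) (onOb F y))" if "x \<in> Ob C" "y \<in> Ob C" for x y
    unfolding bij_betw_def inj_on_def using faithF full that F(2) by blast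
  ultimately show ?thesis
    using \<open>is_functor C D F\<close> by (simp add: ff_eso_def)
qed

text \<open>\<open>G\<close> sends \<open>z\<close> to a chosen preimage up to isomorphism and an
  arrow to the unique lift of its conjugate by the chosen isomorphisms. Every equation in
  \<open>C\<close> is checked after applying the faithful \<open>F\<close>.\<close>

lemma ff_eso_imp_is_equivalence:
  assumes C: "category C" and D: "category D" and FE: "ff_eso C D F"
  shows "is_equivalence C D F"
proof -
  interpret C: category C by fact
  interpret D: category D by fact
  have F: "is_functor C D F"
    using FE by (simp add: ff_eso_def)
  note F' = functorD[OF F C]
  have bij: "bij_betw (onArr F) (Hom C x y) (Hom D (onOb F x) (onOb F y))" if "x \<in> Ob C" "y \<in> Ob C" for x y
    using FE that by (simp add: ff_eso_def)
  define lift where "lift x y = inv_into (Hom C x y) (onArr F)" for x y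
  have lift: "lift x y k \<in> Hom C x y" "onArr F (lift x y k) = k"
    if "k \<in> Hom D (onOb F x) (onOb F y)" "x \<in> Ob C" "y \<in> Ob C" for k x y
    using bij[OF that(2,3)] that(1) unfolding lift_def
    by (metis bij_betw_def inv_into_into, metis bij_betw_inv_into_right)
  have faith: "f = g" if "f \<in> Hom C x y" "g \<in> Hom C x y" "onArr F f = onArr F g" for f g x y
    using bij[of x y] C.HomD[OF that(1)] that by (auto simp: bij_betw_def inj_on_def)
  \<comment> \<open>Preimage, isomorphism and inverse are chosen together, so that \<open>v\<close>
    and \<open>w\<close> below are mutually inverse by choice.\<close>
  have "\<forall>z. \<exists>x k k'. z \<in> Ob D \<longrightarrow> x \<in> Ob C \<and> k \<in> Hom D (onOb F x) z \<and> k' \<in> Hom D z (onOb F x) \<and>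
     Cmp D k' k = Idn D (onOb F x) \<and> Cmp D k k' = Idn D z"
    using FE unfolding ff_eso_def by (metis D.invertibleE)
  then obtain g v w where *: "\<And>z. z \<in> Ob D \<Longrightarrow> g z \<in> Ob C \<and> v z \<in> Hom D (onOb F (g z)) z \<and> w z \<in> Hom D z (onOb F (g z)) \<and>
     Cmp D (w z) (v z) = Idn D (onOb F (g z)) \<and> Cmp D (v z) (w z) = Idn D z"
    by metis
  then have g: "\<And>z. z \<in> Ob D \<Longrightarrow> g z \<in> Ob C" and v: "\<And>z. z \<in> Ob D \<Longrightarrow> v z \<in> Hom D (onOb F (g z)) z"
    and w: "\<And>z. z \<in> Ob D \<Longrightarrow> w z \<in> Hom D z (onOb F (g z))"
    and wv: "\<And>z. z \<in> Ob D \<Longrightarrow> Cmp D (w z) (v z) = Idn D (onOb F (g z))"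
    and vw: "\<And>z. z \<in> Ob D \<Longrightarrow> Cmp D (v z) (w z) = Idn D z"
    by auto
  define G where "G = \<lparr>onOb = g, onArr = \<lambda>k. lift (g (Dom D k)) (g (Cod D k)) (Cmp D (w (Cod D k)) (Cmp D k (v (Dom D k))))\<rparr>"
  have conj: "Cmp D (w y) (Cmp D k (v x)) \<in> Hom D (onOb F (g x)) (onOb F (g y))" if "k \<in> Hom D x y" for k x y
    using that D.HomD[OF that] v w D.Cmp_Hom by metis
  have GA: "onArr G k \<in> Hom C (g x) (g y)" "onArr F (onArr G k) = Cmp D (w y) (Cmp D k (v x))" if "k \<in> Hom D x y" for k x y
    using lift[OF conj[OF that]] D.HomD[OF that] g by (simp_all add: G_def)
  have Gcmp: "onArr G (Cmp D l k) = Cmp C (onArr G l) (onArr G k)" if k: "k \<in> Hom D x y" and l: "l \<in> Hom D y z" for k l x y z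
  proof (rule faith)
    have ob: "x \<in> Ob D" "y \<in> Ob D" "z \<in> Ob D"
      using D.HomD[OF k] D.HomD[OF l] by auto
    have kv: "Cmp D k (v x) \<in> Hom D (onOb F (g x)) y" and lv: "Cmp D l (v y) \<in> Hom D (onOb F (g y)) z"
      using k l v ob D.Cmp_Hom by blast+
    have lk: "Cmp D l k \<in> Hom D x z"
      using k l D.Cmp_Hom by blast
    show "onArr G (Cmp D l k) \<in> Hom C (g x) (g z)"
      using GA lk by blast
    show "Cmp C (onArr G l) (onArr G k) \<in> Hom C (g x) (g z)"
      using GA k l C.Cmp_Hom by blast
    have "onArr F (Cmp C (onArr G l) (onArr G k)) = Cmp D (Cmp D (w z) (Cmp D l (v y))) (Cmp D (w y) (Cmp D k (v x)))"
      using F'(4)[OF GA(1)[OF k] GA(1)[OF l]] GA(2)[OF k] GA(2)[OF l] by simp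
    also have "\<dots> = Cmp D (w z) (Cmp D (Cmp D l (v y)) (Cmp D (w y) (Cmp D k (v x))))"
      using D.Cmp_assoc[OF conj[OF k] lv w[OF ob(3)]] by simp
    also have "Cmp D (Cmp D l (v y)) (Cmp D (w y) (Cmp D k (v x))) = Cmp D l (Cmp D (v y) (Cmp D (w y) (Cmp D k (v x))))"
      using D.Cmp_assoc[OF conj[OF k] v[OF ob(2)] l] by simp
    also have "Cmp D (v y) (Cmp D (w y) (Cmp D k (v x))) = Cmp D k (v x)"
      using D.Cmp_assoc[OF kv w[OF ob(2)] v[OF ob(2)]] vw[OF ob(2)] D.Cmp_Idn_left[OF kv] by simp
    also have "Cmp D l (Cmp D k (v x)) = Cmp D (Cmp D l k) (v x)"
      using D.Cmp_assoc[OF v[OF ob(1)] k l] by simp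
    finally show "onArr F (onArr G (Cmp D l k)) = onArr F (Cmp C (onArr G l) (onArr G k))"
      using GA(2)[OF lk] by simp
  qed
  have Gid: "onArr G (Idn D x) = Idn C (g x)" if x: "x \<in> Ob D" for x
  proof (rule faith)
    show "onArr F (onArr G (Idn D x)) = onArr F (Idn C (g x))"
      using GA(2)[OF D.Idn_Hom[OF x]] F'(3)[OF g[OF x]] wv[OF x] D.Cmp_Idn_left[OF v[OF x]] by simp
  qed (use GA D.Idn_Hom[OF x] C.Idn_Hom[OF g[OF x]] in blast)+
  have Gfun: "is_functor D C G"
    unfolding is_functor_def
  proof (intro conjI ballI impI)
    show "onArr G (Cmp D l k) = Cmp C (onArr G l) (onArr G k)"
      if "k \<in> Arr D" "l \<in> Arr D" "Dom D l = Cod D k" for k l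
      using Gcmp[of k "Dom D k" "Cod D k" l "Cod D l"] that by (simp add: Hom_def)
  qed (use GA Gid g in \<open>auto simp: G_def\<close>)
  \<comment> \<open>The unit at \<open>x\<close> lifts the inverse isomorphism \<open>w\<close> at
    \<open>F x\<close>; lifting \<open>v\<close> at \<open>F x\<close> gives its inverse.\<close>
  define u where "u x = lift x (g (onOb F x)) (w (onOb F x))" for x
  have u: "u x \<in> Hom C x (g (onOb F x))" "onArr F (u x) = w (onOb F x)" if "x \<in> Ob C" for x
    unfolding u_def using lift[of "w (onOb F x)" x "g (onOb F x)"] that F'(1) g w by auto
  have "is_natural_iso C C id_functor (comp_functor G F) u"
    unfolding is_natural_iso_def is_natural_def id_functor_def comp_functor_def cfunctor.simps
  proof (intro conjI ballI)
    show "u x \<in> Hom C x (onOb G (onOb F x))" if "x \<in> Ob C" for x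
      using u that by (simp add: G_def)
    show "Cmp C (u (Cod C f)) f = Cmp C (onArr G (onArr F f)) (u (Dom C f))" if fA: "f \<in> Arr C" for f
    proof -
      obtain x y where f: "f \<in> Hom C x y" and [simp]: "Dom C f = x" "Cod C f = y"
        using fA by (auto simp: Hom_def)
      have ob: "x \<in> Ob C" "y \<in> Ob C" "onOb F x \<in> Ob D" "onOb F y \<in> Ob D"
        using C.HomD[OF f] F' by auto
      have Ff: "onArr F f \<in> Hom D (onOb F x) (onOb F y)"
        using F' f by blast
      have GFf: "onArr G (onArr F f) \<in> Hom C (g (onOb F x)) (g (onOb F y))"
        using GA Ff by blast
      have 1: "onArr F (Cmp C (u y) f) = Cmp D (w (onOb F y)) (onArr F f)"
        using F'(4)[OF f u(1)[OF ob(2)]] u(2)[OF ob(2)] by simp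
      have kv: "Cmp D (onArr F f) (v (onOb F x)) \<in> Hom D (onOb F (g (onOb F x))) (onOb F y)"
        using Ff v ob D.Cmp_Hom by blast
      have 2: "onArr F (Cmp C (onArr G (onArr F f)) (u x)) =
         Cmp D (Cmp D (w (onOb F y)) (Cmp D (onArr F f) (v (onOb F x)))) (w (onOb F x))"
        using F'(4)[OF u(1)[OF ob(1)] GFf] GA(2)[OF Ff] u(2)[OF ob(1)] by simp
      also have "\<dots> = Cmp D (w (onOb F y)) (Cmp D (Cmp D (onArr F f) (v (onOb F x))) (w (onOb F x)))"
        using D.Cmp_assoc[OF w[OF ob(3)] kv w[OF ob(4)]] by simp
      also have "Cmp D (Cmp D (onArr F f) (v (onOb F x))) (w (onOb F x)) = onArr F f"
        using D.Cmp_assoc[OF w[OF ob(3)] v[OF ob(3)] Ff] vw[OF ob(3)] D.Cmp_Idn_right[OF Ff] by simp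
      finally have "onArr F (Cmp C (u y) f) = onArr F (Cmp C (onArr G (onArr F f)) (u x))"
        using 1 by simp
      then show ?thesis
        using faith[of "Cmp C (u y) f" x "g (onOb F y)"] C.Cmp_Hom[OF f u(1)[OF ob(2)]] C.Cmp_Hom[OF u(1)[OF ob(1)] GFf]
        by simp
    qed
    show "invertible C (u x)" if x: "x \<in> Ob C" for x
    proof -
      have o: "onOb F x \<in> Ob D" using F' x by blast
      let ?r = "lift (g (onOb F x)) x (v (onOb F x))"
      have r: "?r \<in> Hom C (g (onOb F x)) x" "onArr F ?r = v (onOb F x)"
        using lift[of "v (onOb F x)"] x g[OF o] v[OF o] by auto
      show ?thesis
      proof (rule C.invertibleI[OF u(1)[OF x] r(1)])
        show "Cmp C ?r (u x) = Idn C x"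
          by (rule faith[OF C.Cmp_Hom[OF u(1)[OF x] r(1)] C.Idn_Hom[OF x]])
            (use F'(4)[OF u(1)[OF x] r(1)] u(2)[OF x] r(2) vw[OF o] F'(3)[OF x] in simp)
        show "Cmp C (u x) ?r = Idn C (g (onOb F x))"
          by (rule faith[OF C.Cmp_Hom[OF r(1) u(1)[OF x]] C.Idn_Hom[OF g[OF o]]])
            (use F'(4)[OF r(1) u(1)[OF x]] u(2)[OF x] r(2) wv[OF o] F'(3)[OF g[OF o]] in simp)
      qed
    qed
  qed
  moreover have "is_natural_iso D D (comp_functor F G) id_functor v"
    unfolding is_natural_iso_def is_natural_def id_functor_def comp_functor_def cfunctor.simps
  proof (intro conjI ballI)
    show "v x \<in> Hom D (onOb F (onOb G x)) x" if "x \<in> Ob D" for x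
      using v that by (simp add: G_def)
    show "invertible D (v x)" if "x \<in> Ob D" for x
      using D.invertibleI[OF v w wv vw] that by simp
    show "Cmp D (v (Cod D k)) (onArr F (onArr G k)) = Cmp D k (v (Dom D k))" if fA: "k \<in> Arr D" for k
    proof -
      obtain x y where k: "k \<in> Hom D x y" and [simp]: "Dom D k = x" "Cod D k = y"
        using fA by (auto simp: Hom_def)
      have ob: "x \<in> Ob D" "y \<in> Ob D"
        using D.HomD[OF k] by auto
      have kv: "Cmp D k (v x) \<in> Hom D (onOb F (g x)) y"
        using k v ob D.Cmp_Hom by blast
      show ?thesis
        using D.Cmp_assoc[OF kv w[OF ob(2)] v[OF ob(2)]] vw[OF ob(2)] D.Cmp_Idn_left[OF kv] GA(2)[OF k] by simp
    qed
  qed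
  ultimately show ?thesis
    unfolding is_equivalence_def using F Gfun by blast
qed

text \<open>\<open>H\<close> has to agree with the composite on the carriers only, because
  operations are arbitrary off them. It is meant for a functor such as
  \<open>oplax_postcomp\<close>, which is given independently of its factors.\<close>

lemma ff_eso_comp:
  assumes "category C" "category D" "category E" "ff_eso C D F" "ff_eso D E G"
    and ob: "\<And>x. x \<in> Ob C \<Longrightarrow> onOb H x = onOb G (onOb F x)"
    and arr: "\<And>f. f \<in> Arr C \<Longrightarrow> onArr H f = onArr G (onArr F f)"
  shows "ff_eso C E H"
proof -
  interpret C: category C by fact
  interpret D: category D by fact
  interpret E: category E by fact
  have F: "is_functor C D F" and G: "is_functor D E G"
    using assms by (auto simp: ff_eso_def)
  note F = functorD[OF F assms(1)] and G = functorD[OF G assms(2)]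
  have arr': "onArr H f = onArr G (onArr F f)" if "f \<in> Hom C x y" for f x y
    using arr that by (simp add: Hom_def)
  have "is_functor C E H"
    unfolding is_functor_def
  proof (intro conjI ballI impI)
    show "onArr H (Cmp C g f) = Cmp E (onArr H g) (onArr H f)"
      if "f \<in> Arr C" "g \<in> Arr C" "Dom C g = Cod C f" for f g
    proof -
      have f: "f \<in> Hom C (Dom C f) (Cod C f)" and g: "g \<in> Hom C (Cod C f) (Cod C g)"
        using that by (auto simp: Hom_def)
      show ?thesis
        using F(4)[OF f g] G(4)[OF F(2)[OF f] F(2)[OF g]] arr'[OF f] arr'[OF g] arr'[OF C.Cmp_Hom[OF f g]] by simp
    qed
    show "onArr H (Idn C x) = Idn E (onOb H x)" if "x \<in> Ob C" for x
      using arr'[OF C.Idn_Hom[OF that]] F(3)[OF that] G(3)[OF F(1)[OF that]] ob[OF that] by simp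
    show "onArr H f \<in> Hom E (onOb H x) (onOb H y)" if "x \<in> Ob C" "y \<in> Ob C" "f \<in> Hom C x y" for x y f
      using arr'[OF that(3)] G(2)[OF F(2)[OF that(3)]] ob that by simp
  qed (use F G ob in simp)
  moreover have "bij_betw (onArr H) (Hom C x y) (Hom E (onOb H x) (onOb H y))" if "x \<in> Ob C" "y \<in> Ob C" for x y
  proof -
    have "bij_betw (onArr F) (Hom C x y) (Hom D (onOb F x) (onOb F y))"
      "bij_betw (onArr G) (Hom D (onOb F x) (onOb F y)) (Hom E (onOb H x) (onOb H y))"
      using assms(4,5) that F(1) ob by (auto simp: ff_eso_def)
    then have "bij_betw (onArr G \<circ> onArr F) (Hom C x y) (Hom E (onOb H x) (onOb H y))"
      by (rule bij_betw_trans)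
    then show ?thesis
      using bij_betw_cong[of "Hom C x y" "onArr H" "onArr G \<circ> onArr F"] arr' by simp
  qed
  moreover have "\<exists>x \<in> Ob C. \<exists>k \<in> Hom E (onOb H x) z. invertible E k" if zE: "z \<in> Ob E" for z
  proof -
    obtain y l where y: "y \<in> Ob D" "l \<in> Hom E (onOb G y) z" "invertible E l"
      using assms(5) zE unfolding ff_eso_def by blast
    obtain x k where x: "x \<in> Ob C" "k \<in> Hom D (onOb F x) y" "invertible D k"
      using assms(4) y(1) unfolding ff_eso_def by blast
    obtain k' where k': "k' \<in> Hom D y (onOb F x)" "Cmp D k' k = Idn D (onOb F x)" "Cmp D k k' = Idn D y"
      using x by (metis D.invertibleE)
    obtain l' where l': "l' \<in> Hom E z (onOb G y)" "Cmp E l' l = Idn E (onOb G y)" "Cmp E l l' = Idn E z"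
      using y by (metis E.invertibleE)
    let ?k = "onArr G k" and ?k' = "onArr G k'"
    have g: "?k \<in> Hom E (onOb G (onOb F x)) (onOb G y)" "?k' \<in> Hom E (onOb G y) (onOb G (onOb F x))"
      using G x k' by blast+
    have gk: "Cmp E ?k' ?k = Idn E (onOb G (onOb F x))" "Cmp E ?k ?k' = Idn E (onOb G y)"
      using G(4)[OF x(2) k'(1)] G(4)[OF k'(1) x(2)] k' G(3) F(1)[OF x(1)] y(1) by simp_all
    have lk: "Cmp E l ?k \<in> Hom E (onOb G (onOb F x)) z" "Cmp E ?k' l' \<in> Hom E z (onOb G (onOb F x))"
      using g y l' E.Cmp_Hom by blast+
    have "Cmp E (Cmp E ?k' l') (Cmp E l ?k) = Cmp E ?k' (Cmp E l' (Cmp E l ?k))"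
      using E.Cmp_assoc[OF lk(1) l'(1) g(2)] by simp
    also have "Cmp E l' (Cmp E l ?k) = ?k"
      using E.Cmp_assoc[OF g(1) y(2) l'(1)] l' E.Cmp_Idn_left[OF g(1)] by simp
    finally have 1: "Cmp E (Cmp E ?k' l') (Cmp E l ?k) = Idn E (onOb G (onOb F x))"
      using gk by simp
    have "Cmp E (Cmp E l ?k) (Cmp E ?k' l') = Cmp E l (Cmp E ?k (Cmp E ?k' l'))"
      using E.Cmp_assoc[OF lk(2) g(1) y(2)] by simp
    also have "Cmp E ?k (Cmp E ?k' l') = l'"
      using E.Cmp_assoc[OF l'(1) g(2) g(1)] gk E.Cmp_Idn_left[OF l'(1)] by simp
    finally have 2: "Cmp E (Cmp E l ?k) (Cmp E ?k' l') = Idn E z"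
      using l' by simp
    show ?thesis
      using E.invertibleI[OF lk 1 2] lk(1) x(1) ob by auto
  qed
  ultimately show ?thesis
    by (simp add: ff_eso_def)
qed

lemma category_tagged_cat:
  assumes "\<And>p. p \<in> Q \<Longrightarrow> e p \<in> H p p"
    and "\<And>p q r m n. p \<in> Q \<Longrightarrow> q \<in> Q \<Longrightarrow> r \<in> Q \<Longrightarrow> m \<in> H p q \<Longrightarrow> n \<in> H q r \<Longrightarrow> c n m \<in> H p r"
    and "\<And>p q m. p \<in> Q \<Longrightarrow> q \<in> Q \<Longrightarrow> m \<in> H p q \<Longrightarrow> c (e q) m = m"
    and "\<And>p q m. p \<in> Q \<Longrightarrow> q \<in> Q \<Longrightarrow> m \<in> H p q \<Longrightarrow> c m (e p) = m"
    and "\<And>p q r s m n k. p \<in> Q \<Longrightarrow> q \<in> Q \<Longrightarrow> r \<in> Q \<Longrightarrow> s \<in> Q \<Longrightarrow> m \<in> H p q \<Longrightarrow> n \<in> H q r \<Longrightarrow> k \<in> H r s \<Longrightarrow>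
       c k (c n m) = c (c k n) m"
  shows "category (tagged_cat Q H e c)"
  by unfold_locales (use assms in \<open>auto simp: tagged_cat_def Hom_def\<close>)

lemma Hom_tagged_cat: "Hom (tagged_cat Q H e c) p q = {(p, m, q) | m. p \<in> Q \<and> q \<in> Q \<and> m \<in> H p q}"
  by (auto simp: tagged_cat_def Hom_def)

section \<open>Oplax cocones and their weight\<close>

context two_fun
begin

text \<open>
  Cocones and modifications without the extensionality conditions, so that they can be given by
  arbitrary families.
\<close>

definition ococ :: "'o \<Rightarrow> ('i \<Rightarrow> 'a) \<Rightarrow> ('d \<Rightarrow> 'c) \<Rightarrow> bool" where
  "ococ B q qc \<longleftrightarrow>
     (\<forall>i \<in> Obj I. q i \<in> Cell1 K \<and> src1 K (q i) = F0 F i \<and> trg1 K (q i) = B) \<and>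
     (\<forall>d \<in> Cell1 I. qc d \<in> Cell2 K \<and> src2 K (qc d) = q (trg1 I d) \<cdot>\<^bsub>K\<^esub> F1 F d \<and> trg2 K (qc d) = q (src1 I d)) \<and>
     (\<forall>i \<in> Obj I. qc (id1 I i) = id2 K (q i)) \<and>
     (\<forall>d \<in> Cell1 I. \<forall>d' \<in> Cell1 I. src1 I d' = trg1 I d \<longrightarrow>
        qc (d' \<cdot>\<^bsub>I\<^esub> d) = qc d \<odot>\<^bsub>K\<^esub> (qc d' \<triangleleft>\<^bsub>K\<^esub> F1 F d)) \<and>
     (\<forall>\<sigma> \<in> Cell2 I. qc (trg2 I \<sigma>) \<odot>\<^bsub>K\<^esub> (q (trg1 I (src2 I \<sigma>)) \<triangleright>\<^bsub>K\<^esub> F2 F \<sigma>) = qc (src2 I \<sigma>))"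

definition omod :: "('i \<Rightarrow> 'a) \<Rightarrow> ('d \<Rightarrow> 'c) \<Rightarrow> ('i \<Rightarrow> 'a) \<Rightarrow> ('d \<Rightarrow> 'c) \<Rightarrow> ('i \<Rightarrow> 'c) \<Rightarrow> bool" where
  "omod q qc r rc m \<longleftrightarrow>
     (\<forall>i \<in> Obj I. m i \<in> Cell2 K \<and> src2 K (m i) = q i \<and> trg2 K (m i) = r i) \<and>
     (\<forall>d \<in> Cell1 I. m (src1 I d) \<odot>\<^bsub>K\<^esub> qc d = rc d \<odot>\<^bsub>K\<^esub> (m (trg1 I d) \<triangleleft>\<^bsub>K\<^esub> F1 F d))"

lemma ococ_typing:
  assumes "ococ B q qc"
  shows "i \<in> Obj I \<Longrightarrow> q i \<in> Cell1 K" "i \<in> Obj I \<Longrightarrow> src1 K (q i) = F0 F i" "i \<in> Obj I \<Longrightarrow> trg1 K (q i) = B"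
    "d \<in> Cell1 I \<Longrightarrow> qc d \<in> Cell2 K" "d \<in> Cell1 I \<Longrightarrow> src2 K (qc d) = q (trg1 I d) \<cdot>\<^bsub>K\<^esub> F1 F d"
    "d \<in> Cell1 I \<Longrightarrow> trg2 K (qc d) = q (src1 I d)" "i \<in> Obj I \<Longrightarrow> qc (id1 I i) = id2 K (q i)"
    "d \<in> Cell1 I \<Longrightarrow> d' \<in> Cell1 I \<Longrightarrow> src1 I d' = trg1 I d \<Longrightarrow>
        qc (d' \<cdot>\<^bsub>I\<^esub> d) = qc d \<odot>\<^bsub>K\<^esub> (qc d' \<triangleleft>\<^bsub>K\<^esub> F1 F d)"
  using assms by (simp_all add: ococ_def)

lemma ococ_2:
  assumes "ococ B q qc" "\<sigma> \<in> Cell2 I" "trg1 I (src2 I \<sigma>) = j"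
  shows "qc (trg2 I \<sigma>) \<odot>\<^bsub>K\<^esub> (q j \<triangleright>\<^bsub>K\<^esub> F2 F \<sigma>) = qc (src2 I \<sigma>)"
  using assms by (auto simp add: ococ_def)

lemma omod_typing:
  assumes "omod q qc r rc m" "i \<in> Obj I"
  shows "m i \<in> Cell2 K" "src2 K (m i) = q i" "trg2 K (m i) = r i"
  using assms by (simp_all add: omod_def)

lemma omod_nat:
  assumes "omod q qc r rc m" "d \<in> Cell1 I" "src1 I d = i" "trg1 I d = j"
  shows "m i \<odot>\<^bsub>K\<^esub> qc d = rc d \<odot>\<^bsub>K\<^esub> (m j \<triangleleft>\<^bsub>K\<^esub> F1 F d)"
  using assms by (auto simp add: omod_def)

text \<open>Trades the hom-set quantifiers of the definitions for quantifiers over 1-cells with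
  their own endpoints, the shape used by \<open>ococ\<close> and \<open>omod\<close>.\<close>

lemma ball_hom1: "(\<forall>i \<in> Obj I. \<forall>j \<in> Obj I. \<forall>d \<in> hom1 I i j. P i j d) \<longleftrightarrow> (\<forall>d \<in> Cell1 I. P (src1 I d) (trg1 I d) d)"
  by (auto simp: hom1_def)

lemma is_oplax_cocone_iff:
  "is_oplax_cocone I K F B p \<longleftrightarrow> leg p \<in> extensional (Obj I) \<and> leg_cell p \<in> extensional (Cell1 I) \<and>
     ococ B (leg p) (leg_cell p)" (is "?l \<longleftrightarrow> ?r")
proof
  assume l: ?l
  have c1: "leg_cell p (d' \<cdot>\<^bsub>I\<^esub> d) = leg_cell p d \<odot>\<^bsub>K\<^esub> (leg_cell p d' \<triangleleft>\<^bsub>K\<^esub> F1 F d)"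
    if "d \<in> Cell1 I" "d' \<in> Cell1 I" "src1 I d' = trg1 I d" for d d'
  proof -
    have "d \<in> hom1 I (src1 I d) (trg1 I d)" "d' \<in> hom1 I (trg1 I d) (trg1 I d')" "src1 I d \<in> Obj I" "trg1 I d \<in> Obj I" "trg1 I d' \<in> Obj I"
      using that by (auto simp: hom1_def)
    then show ?thesis using l unfolding is_oplax_cocone_def by blast
  qed
  have c2: "leg_cell p (trg2 I \<sigma>) \<odot>\<^bsub>K\<^esub> (leg p (trg1 I (src2 I \<sigma>)) \<triangleright>\<^bsub>K\<^esub> F2 F \<sigma>) = leg_cell p (src2 I \<sigma>)"
    if "\<sigma> \<in> Cell2 I" for \<sigma>
  proof -
    have "src2 I \<sigma> \<in> hom1 I (src1 I (src2 I \<sigma>)) (trg1 I (src2 I \<sigma>))"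
      "trg2 I \<sigma> \<in> hom1 I (src1 I (src2 I \<sigma>)) (trg1 I (src2 I \<sigma>))" "\<sigma> \<in> hom2 I (src2 I \<sigma>) (trg2 I \<sigma>)"
      "src1 I (src2 I \<sigma>) \<in> Obj I" "trg1 I (src2 I \<sigma>) \<in> Obj I"
      using that by (auto simp: hom1_def hom2_def)
    then show ?thesis using l unfolding is_oplax_cocone_def by blast
  qed
  have c3: "leg_cell p d \<in> hom2 K (leg p (trg1 I d) \<cdot>\<^bsub>K\<^esub> F1 F d) (leg p (src1 I d))" if "d \<in> Cell1 I" for d
    using l that unfolding is_oplax_cocone_def ball_hom1 by blast
  have c4: "leg p i \<in> hom1 K (F0 F i) B" "leg_cell p (id1 I i) = id2 K (leg p i)" if "i \<in> Obj I" for i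
    using l that unfolding is_oplax_cocone_def by blast+
  have c5: "leg p \<in> extensional (Obj I)" "leg_cell p \<in> extensional (Cell1 I)"
    using l by (auto simp: is_oplax_cocone_def)
  show ?r
    using c1 c2 c3 c4 c5 by (simp add: ococ_def hom1_def hom2_def)
next
  assume r: ?r
  then have o: "ococ B (leg p) (leg_cell p)"
    by simp
  show ?l
    unfolding is_oplax_cocone_def
  proof (intro conjI ballI)
    show "leg_cell p d' \<odot>\<^bsub>K\<^esub> (leg p j \<triangleright>\<^bsub>K\<^esub> F2 F \<sigma>) = leg_cell p d"
      if "i \<in> Obj I" "j \<in> Obj I" "d \<in> hom1 I i j" "d' \<in> hom1 I i j" "\<sigma> \<in> hom2 I d d'" for i j d d' \<sigma>
      using ococ_2[OF o, of \<sigma> j] that by (simp add: hom1_def hom2_def)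
  qed (use r ococ_typing[OF o] in \<open>auto simp: hom1_def hom2_def\<close>)
qed

lemma oplax_mods_iff:
  "m \<in> oplax_mods I K F p p' \<longleftrightarrow> m \<in> extensional (Obj I) \<and> omod (leg p) (leg_cell p) (leg p') (leg_cell p') m"
  unfolding oplax_mods_def omod_def mem_Collect_eq ball_hom1 by (auto simp: hom2_def)

lemma omod_id:
  assumes "ococ B q qc"
  shows "omod q qc q qc (\<lambda>i. id2 K (q i))"
  using ococ_typing[OF assms] by (simp add: omod_def)

lemma omod_comp:
  assumes "ococ B q qc" "ococ B r rc" "ococ B s sc" "omod q qc r rc m" "omod r rc s sc n"
  shows "omod q qc s sc (\<lambda>i. n i \<odot>\<^bsub>K\<^esub> m i)"
proof -
  note [simp] = ococ_typing(1-6)[OF assms(1)] ococ_typing(1-6)[OF assms(2)] ococ_typing(1-6)[OF assms(3)]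
    omod_typing[OF assms(4)] omod_typing[OF assms(5)]
  show ?thesis
    unfolding omod_def
  proof (intro conjI ballI)
    fix d assume [simp]: "d \<in> Cell1 I"
    let ?i = "src1 I d" and ?j = "trg1 I d"
    have "(n ?i \<odot>\<^bsub>K\<^esub> m ?i) \<odot>\<^bsub>K\<^esub> qc d = (n ?i \<odot>\<^bsub>K\<^esub> rc d) \<odot>\<^bsub>K\<^esub> (m ?j \<triangleleft>\<^bsub>K\<^esub> F1 F d)"
      using omod_nat[OF assms(4) _ refl refl, of d] by simp
    then show "(n ?i \<odot>\<^bsub>K\<^esub> m ?i) \<odot>\<^bsub>K\<^esub> qc d = sc d \<odot>\<^bsub>K\<^esub> ((n ?j \<odot>\<^bsub>K\<^esub> m ?j) \<triangleleft>\<^bsub>K\<^esub> F1 F d)"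
      using omod_nat[OF assms(5) _ refl refl, of d] by simp
  qed simp_all
qed

lemma omod_vinv:
  assumes "ococ B q qc" "ococ B r rc" "omod q qc r rc m" "\<And>i. i \<in> Obj I \<Longrightarrow> K.iso2 (m i)"
  shows "omod r rc q qc (\<lambda>i. K.vinv (m i))"
proof -
  note [simp] = ococ_typing(1-6)[OF assms(1)] ococ_typing(1-6)[OF assms(2)]
    omod_typing[OF assms(3)] assms(4)
  show ?thesis
    unfolding omod_def
  proof (intro conjI ballI)
    fix d assume [simp]: "d \<in> Cell1 I"
    let ?i = "src1 I d" and ?j = "trg1 I d"
    have 1: "(m ?j \<triangleleft>\<^bsub>K\<^esub> F1 F d) \<odot>\<^bsub>K\<^esub> (K.vinv (m ?j) \<triangleleft>\<^bsub>K\<^esub> F1 F d) = id2 K (r ?j \<cdot>\<^bsub>K\<^esub> F1 F d)"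
      using K.vinv_rwhisker(2)[of "m ?j" "F1 F d"] by simp
    have "K.vinv (m ?i) \<odot>\<^bsub>K\<^esub> rc d = K.vinv (m ?i) \<odot>\<^bsub>K\<^esub> ((rc d \<odot>\<^bsub>K\<^esub> (m ?j \<triangleleft>\<^bsub>K\<^esub> F1 F d)) \<odot>\<^bsub>K\<^esub> (K.vinv (m ?j) \<triangleleft>\<^bsub>K\<^esub> F1 F d))"
      by (simp add: 1)
    also have "\<dots> = qc d \<odot>\<^bsub>K\<^esub> (K.vinv (m ?j) \<triangleleft>\<^bsub>K\<^esub> F1 F d)"
      unfolding omod_nat[OF assms(3) \<open>d \<in> Cell1 I\<close> refl refl, symmetric] by simp
    finally show "K.vinv (m ?i) \<odot>\<^bsub>K\<^esub> rc d = qc d \<odot>\<^bsub>K\<^esub> (K.vinv (m ?j) \<triangleleft>\<^bsub>K\<^esub> F1 F d)" .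
  qed simp_all
qed

lemma ococ_lwhisker:
  assumes "ococ B q qc" "u \<in> Cell1 K" "src1 K u = B"
  shows "ococ (trg1 K u) (\<lambda>i. u \<cdot>\<^bsub>K\<^esub> q i) (\<lambda>d. u \<triangleright>\<^bsub>K\<^esub> qc d)"
proof -
  note [simp] = ococ_typing[OF assms(1)] assms(2,3)
  show ?thesis
    unfolding ococ_def
  proof (intro conjI ballI impI)
    fix \<sigma> assume [simp]: "\<sigma> \<in> Cell2 I"
    show "(u \<triangleright>\<^bsub>K\<^esub> qc (trg2 I \<sigma>)) \<odot>\<^bsub>K\<^esub> ((u \<cdot>\<^bsub>K\<^esub> q (trg1 I (src2 I \<sigma>))) \<triangleright>\<^bsub>K\<^esub> F2 F \<sigma>) = u \<triangleright>\<^bsub>K\<^esub> qc (src2 I \<sigma>)"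
      using arg_cong[OF ococ_2[OF assms(1) _ refl, of \<sigma>], of "lwhisker K u"] by simp
  qed simp_all
qed

lemma omod_lwhisker:
  assumes "ococ B q qc" "ococ B r rc" "omod q qc r rc m" "u \<in> Cell1 K" "src1 K u = B"
  shows "omod (\<lambda>i. u \<cdot>\<^bsub>K\<^esub> q i) (\<lambda>d. u \<triangleright>\<^bsub>K\<^esub> qc d) (\<lambda>i. u \<cdot>\<^bsub>K\<^esub> r i) (\<lambda>d. u \<triangleright>\<^bsub>K\<^esub> rc d) (\<lambda>i. u \<triangleright>\<^bsub>K\<^esub> m i)"
proof -
  note [simp] = ococ_typing(1-6)[OF assms(1)] ococ_typing(1-6)[OF assms(2)] omod_typing[OF assms(3)] assms(4,5)
  show ?thesis
    unfolding omod_def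
  proof (intro conjI ballI impI)
    fix d assume [simp]: "d \<in> Cell1 I"
    show "(u \<triangleright>\<^bsub>K\<^esub> m (src1 I d)) \<odot>\<^bsub>K\<^esub> (u \<triangleright>\<^bsub>K\<^esub> qc d) = (u \<triangleright>\<^bsub>K\<^esub> rc d) \<odot>\<^bsub>K\<^esub> ((u \<triangleright>\<^bsub>K\<^esub> m (trg1 I d)) \<triangleleft>\<^bsub>K\<^esub> F1 F d)"
      using arg_cong[OF omod_nat[OF assms(3) _ refl refl, of d], of "lwhisker K u"] by simp
  qed simp_all
qed

lemma omod_rwhisker:
  assumes "ococ B q qc" "\<sigma> \<in> Cell2 K" "src1 K (src2 K \<sigma>) = B" "src2 K \<sigma> = u" "trg2 K \<sigma> = v"
  shows "omod (\<lambda>i. u \<cdot>\<^bsub>K\<^esub> q i) (\<lambda>d. u \<triangleright>\<^bsub>K\<^esub> qc d) (\<lambda>i. v \<cdot>\<^bsub>K\<^esub> q i) (\<lambda>d. v \<triangleright>\<^bsub>K\<^esub> qc d) (\<lambda>i. \<sigma> \<triangleleft>\<^bsub>K\<^esub> q i)"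
proof -
  have [simp]: "u \<in> Cell1 K" "v \<in> Cell1 K" "src1 K u = B" "src1 K v = B"
    using assms(2-) by auto
  note [simp] = ococ_typing(1-6)[OF assms(1)] assms(2,4,5)
  show ?thesis
    unfolding omod_def
  proof (intro conjI ballI impI)
    fix d assume [simp]: "d \<in> Cell1 I"
    show "(\<sigma> \<triangleleft>\<^bsub>K\<^esub> q (src1 I d)) \<odot>\<^bsub>K\<^esub> (u \<triangleright>\<^bsub>K\<^esub> qc d) = (v \<triangleright>\<^bsub>K\<^esub> qc d) \<odot>\<^bsub>K\<^esub> ((\<sigma> \<triangleleft>\<^bsub>K\<^esub> q (trg1 I d)) \<triangleleft>\<^bsub>K\<^esub> F1 F d)"
      using K.swap[of "qc d" \<sigma>] by simp
  qed simp_all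
qed

lemma omod_cong:
  assumes "omod q qc r rc m" "\<And>i. i \<in> Obj I \<Longrightarrow> q i = q' i" "\<And>i. i \<in> Obj I \<Longrightarrow> r i = r' i"
    "\<And>i. i \<in> Obj I \<Longrightarrow> m i = m' i" "\<And>d. d \<in> Cell1 I \<Longrightarrow> qc d = qc' d" "\<And>d. d \<in> Cell1 I \<Longrightarrow> rc d = rc' d"
  shows "omod q' qc' r' rc' m'"
  using assms(1) unfolding omod_def using assms(2-) by simp

lemma ococ_cong:
  assumes "ococ B q qc" "\<And>i. i \<in> Obj I \<Longrightarrow> q i = q' i" "\<And>d. d \<in> Cell1 I \<Longrightarrow> qc d = qc' d"
  shows "ococ B q' qc'"
  using assms(1) unfolding ococ_def using assms(2-) by simp

end

text \<open>
  Oplax cocones on \<open>F\<close> are the pseudonatural transformations \<open>W \<Rightarrow> K[F -, B]\<close> up to equivalence, where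
  the objects of \<open>W i\<close> are the 1-cells \<open>d : i \<rightarrow> j\<close> and an arrow \<open>d' \<rightarrow> d\<close> is represented by a
  1-cell \<open>e\<close> with a 2-cell \<open>\<sigma> : d' \<Rightarrow> e d\<close>, modulo sliding 2-cells \<open>\<tau> : e \<Rightarrow> e'\<close> across.  The weight
  has to live in the type of \<open>I\<close>, so a class of such pairs is coded by a chosen representative, packed with \<open>d\<close>
  into one element by an injective pairing function.
\<close>

locale oplax_weight = two_category I for I :: "('s, 's, 's) two_cat" (structure) +
  fixes pr :: "'s \<times> 's \<Rightarrow> 's"
  assumes inj_pr: "inj pr"
begin

definition valid :: "'s \<Rightarrow> 's \<Rightarrow> 's \<Rightarrow> bool" where
  "valid d e \<sigma> \<longleftrightarrow> d \<in> Cell1 I \<and> e \<in> Cell1 I \<and> src1 I e = trg1 I d \<and> \<sigma> \<in> Cell2 I \<and> trg2 I \<sigma> = e \<cdot> d"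

definition slide :: "'s \<Rightarrow> ('s \<times> 's) rel" where
  "slide d = {((src2 I \<tau>, \<sigma>), (trg2 I \<tau>, (\<tau> \<triangleleft> d) \<odot> \<sigma>)) | \<tau> \<sigma>. \<tau> \<in> Cell2 I \<and> valid d (src2 I \<tau>) \<sigma>}"

definition class_rep :: "'s \<Rightarrow> 's \<times> 's \<Rightarrow> 's \<times> 's" where
  "class_rep d p = (SOME r. (p, r) \<in> (slide d \<union> (slide d)\<inverse>)\<^sup>*)"

definition mk_arr :: "'s \<Rightarrow> 's \<Rightarrow> 's \<Rightarrow> 's" where
  "mk_arr d e \<sigma> = pr (d, pr (class_rep d (e, \<sigma>)))"

definition arr_cod :: "'s \<Rightarrow> 's" where "arr_cod x = fst (inv pr x)"
text \<open>Decoding yields the chosen representative of the class, which may differ from the pair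
  that was encoded. Only functions invariant under \<open>slide\<close> may be read off from
  \<open>arr_mid\<close> and \<open>arr_cell\<close>.\<close>

definition arr_mid :: "'s \<Rightarrow> 's" where "arr_mid x = fst (inv pr (snd (inv pr x)))"
definition arr_cell :: "'s \<Rightarrow> 's" where "arr_cell x = snd (inv pr (snd (inv pr x)))"

lemma arr_cod_mk_arr [simp]: "arr_cod (mk_arr d e \<sigma>) = d"
  by (simp add: arr_cod_def mk_arr_def inj_pr)

text \<open>The universal property of the quotient: a function respecting the generating relation
  respects the generated equivalence, hence takes the same value at the chosen
  representative.\<close>

lemma mk_arr_lift:
  assumes "\<And>\<tau> \<sigma>. \<tau> \<in> Cell2 I \<Longrightarrow> valid d (src2 I \<tau>) \<sigma> \<Longrightarrow> h (src2 I \<tau>) \<sigma> = h (trg2 I \<tau>) ((\<tau> \<triangleleft> d) \<odot> \<sigma>)"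
  shows "h (arr_mid (mk_arr d e \<sigma>)) (arr_cell (mk_arr d e \<sigma>)) = h e \<sigma>"
proof -
  have *: "(p, r) \<in> (slide d \<union> (slide d)\<inverse>)\<^sup>* \<Longrightarrow> case_prod h p = case_prod h r" for p r
    by (induction rule: rtrancl_induct) (use assms in \<open>auto simp: slide_def\<close>)
  have "((e, \<sigma>), class_rep d (e, \<sigma>)) \<in> (slide d \<union> (slide d)\<inverse>)\<^sup>*"
    unfolding class_rep_def by (rule someI[of _ "(e, \<sigma>)"]) simp
  from *[OF this] show ?thesis
    by (simp add: arr_mid_def arr_cell_def mk_arr_def inj_pr case_prod_beta)
qed

text \<open>Equivalent pairs are related to the same pairs, so the choice operator is applied to the
  same predicate and returns the same representative.\<close>

lemma mk_arr_slide:
  assumes "\<tau> \<in> Cell2 I" "valid d (src2 I \<tau>) \<sigma>"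
  shows "mk_arr d (trg2 I \<tau>) ((\<tau> \<triangleleft> d) \<odot> \<sigma>) = mk_arr d (src2 I \<tau>) \<sigma>"
proof -
  let ?R = "(slide d \<union> (slide d)\<inverse>)\<^sup>*"
  have "sym ?R" "trans ?R"
    by (simp_all add: sym_Un_converse sym_rtrancl trans_rtrancl)
  moreover have "((src2 I \<tau>, \<sigma>), (trg2 I \<tau>, (\<tau> \<triangleleft> d) \<odot> \<sigma>)) \<in> ?R"
    using assms by (auto simp: slide_def)
  ultimately have "((src2 I \<tau>, \<sigma>), r) \<in> ?R \<longleftrightarrow> ((trg2 I \<tau>, (\<tau> \<triangleleft> d) \<odot> \<sigma>), r) \<in> ?R" for r
    by (meson symE transE)
  then show ?thesis
    by (simp add: mk_arr_def class_rep_def)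
qed

lemma mk_arr_sel:
  assumes "valid d e \<sigma>"
  shows "valid d (arr_mid (mk_arr d e \<sigma>)) (arr_cell (mk_arr d e \<sigma>))" "src2 I (arr_cell (mk_arr d e \<sigma>)) = src2 I \<sigma>"
proof -
  have "valid d (arr_mid (mk_arr d e \<sigma>)) (arr_cell (mk_arr d e \<sigma>)) = valid d e \<sigma>"
    by (rule mk_arr_lift) (auto simp: valid_def)
  then show "valid d (arr_mid (mk_arr d e \<sigma>)) (arr_cell (mk_arr d e \<sigma>))"
    using assms by simp
  show "src2 I (arr_cell (mk_arr d e \<sigma>)) = src2 I \<sigma>"
    by (rule mk_arr_lift[of _ "\<lambda>e. src2 I"]) (auto simp: valid_def)
qed

text \<open>An object \<open>d : i \<rightarrow> j\<close> stands for the 1-cell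
  \<open>q_j F(d)\<close> of a cocone. The arrow given by \<open>e : j \<rightarrow> j'\<close> and
  \<open>\<sigma> : d' \<Rightarrow> e d\<close> stands for \<open>q_j' F(d') \<Rightarrow> q_j'
  F(e) F(d) \<Rightarrow> q_j F(d)\<close>, that is, \<open>F \<sigma>\<close> followed by the
  cocone cell at \<open>e\<close>. Identifying pairs along \<open>slide\<close> encodes the 2-cell
  axiom of oplax cocones.\<close>

definition W :: "('s, 's, 's, 's, 's) presheaf" where
  "W = \<lparr>pcat = \<lambda>i. \<lparr>Ob = {d \<in> Cell1 I. src1 I d = i},
      Arr = {mk_arr d e \<sigma> | d e \<sigma>. valid d e \<sigma> \<and> src1 I d = i},
      Dom = \<lambda>x. src2 I (arr_cell x), Cod = arr_cod, Idn = \<lambda>d. mk_arr d (id1 I (trg1 I d)) (id2 I d),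
      Cmp = \<lambda>y x. mk_arr (arr_cod y) (arr_mid x \<cdot> arr_mid y) ((arr_mid x \<triangleright> arr_cell y) \<odot> arr_cell x)\<rparr>,
    pfun = \<lambda>c. \<lparr>onOb = \<lambda>d. d \<cdot> c, onArr = \<lambda>x. mk_arr (arr_cod x \<cdot> c) (arr_mid x) (arr_cell x \<triangleleft> c)\<rparr>,
    pnat = \<lambda>\<tau> d. mk_arr (d \<cdot> trg2 I \<tau>) (id1 I (trg1 I d)) (d \<triangleright> \<tau>)\<rparr>"

lemma W_simps:
  "Ob (pcat W i) = {d \<in> Cell1 I. src1 I d = i}"
  "Arr (pcat W i) = {mk_arr d e \<sigma> | d e \<sigma>. valid d e \<sigma> \<and> src1 I d = i}"
  "Idn (pcat W i) d = mk_arr d (id1 I (trg1 I d)) (id2 I d)"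
  "Cod (pcat W i) = arr_cod"
  "onOb (pfun W c) d = d \<cdot> c"
  "pnat W \<tau> d = mk_arr (d \<cdot> trg2 I \<tau>) (id1 I (trg1 I d)) (d \<triangleright> \<tau>)"
  by (simp_all add: W_def)

lemma Dom_W: "valid d e \<sigma> \<Longrightarrow> Dom (pcat W i) (mk_arr d e \<sigma>) = src2 I \<sigma>"
  by (simp add: W_def mk_arr_sel)

text \<open>Composition is defined on representatives; this computes it for arbitrary pairs.
  \<open>mk_arr_lift\<close> is applied twice, once for each argument.\<close>

lemma Cmp_W:
  assumes "valid d e \<sigma>" "valid (src2 I \<sigma>) e' \<sigma>'"
  shows "Cmp (pcat W i) (mk_arr d e \<sigma>) (mk_arr (src2 I \<sigma>) e' \<sigma>') = mk_arr d (e' \<cdot> e) ((e' \<triangleright> \<sigma>) \<odot> \<sigma>')"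
proof -
  let ?E = "arr_mid (mk_arr d e \<sigma>)" and ?S = "arr_cell (mk_arr d e \<sigma>)"
  have r: "valid d ?E ?S" "src2 I ?S = src2 I \<sigma>"
    using mk_arr_sel[OF assms(1)] by auto
  have "Cmp (pcat W i) (mk_arr d e \<sigma>) (mk_arr (src2 I \<sigma>) e' \<sigma>') =
      (\<lambda>e' \<sigma>'. mk_arr d (e' \<cdot> ?E) ((e' \<triangleright> ?S) \<odot> \<sigma>')) (arr_mid (mk_arr (src2 I \<sigma>) e' \<sigma>')) (arr_cell (mk_arr (src2 I \<sigma>) e' \<sigma>'))"
    by (simp add: W_def)
  also have "\<dots> = mk_arr d (e' \<cdot> ?E) ((e' \<triangleright> ?S) \<odot> \<sigma>')"
  proof (rule mk_arr_lift)
    fix \<tau> \<rho> assume t: "\<tau> \<in> Cell2 I" "valid (src2 I \<sigma>) (src2 I \<tau>) \<rho>"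
    have *: "?S \<in> Cell2 I" "trg2 I ?S = ?E \<cdot> d" "?E \<in> Cell1 I" "src1 I ?E = trg1 I d" "d \<in> Cell1 I" "\<rho> \<in> Cell2 I"
      "trg2 I \<rho> = src2 I \<tau> \<cdot> src2 I \<sigma>" "src1 I (src2 I \<tau>) = trg1 I (src2 I \<sigma>)" "\<sigma> \<in> Cell2 I"
      using r t assms(1) by (auto simp: valid_def)
    have 1: "trg1 I ?E = trg1 I (src2 I \<sigma>)"
      using trg1_trg2[OF *(1)] r(2) * by simp
    note [simp] = * 1 t(1) r(2)
    \<comment> \<open>Interchange moves \<tau> past the cell \<open>?S\<close>, so that the two
      composites differ by sliding \<open>\<tau> \<triangleleft> ?E\<close>.\<close>
    have "(trg2 I \<tau> \<triangleright> ?S) \<odot> ((\<tau> \<triangleleft> src2 I \<sigma>) \<odot> \<rho>) = ((\<tau> \<triangleleft> ?E) \<triangleleft> d) \<odot> ((src2 I \<tau> \<triangleright> ?S) \<odot> \<rho>)"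
      using vcomp_eq_ext[OF swap[of ?S \<tau>], of \<rho>] by simp
    then show "mk_arr d (src2 I \<tau> \<cdot> ?E) ((src2 I \<tau> \<triangleright> ?S) \<odot> \<rho>) = mk_arr d (trg2 I \<tau> \<cdot> ?E) ((trg2 I \<tau> \<triangleright> ?S) \<odot> ((\<tau> \<triangleleft> src2 I \<sigma>) \<odot> \<rho>))"
      using mk_arr_slide[of "\<tau> \<triangleleft> ?E" d "(src2 I \<tau> \<triangleright> ?S) \<odot> \<rho>"] by (simp add: valid_def)
  qed
  \<comment> \<open>\<open>mk_arr_lift\<close> asks for invariance on all pairs over
    \<open>d\<close>, whereas the composite with \<open>\<sigma>'\<close> is typed only if the first
    cell starts at \<open>src2 I \<sigma>\<close>. Sliding preserves the source, so the guard is
    harmless; the default value \<open>d\<close> is arbitrary.\<close>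
  also have "\<dots> = (\<lambda>e \<sigma>1. if src2 I \<sigma>1 = src2 I \<sigma> then mk_arr d (e' \<cdot> e) ((e' \<triangleright> \<sigma>1) \<odot> \<sigma>') else d) ?E ?S"
    using r(2) by simp
  also have "\<dots> = (\<lambda>e \<sigma>1. if src2 I \<sigma>1 = src2 I \<sigma> then mk_arr d (e' \<cdot> e) ((e' \<triangleright> \<sigma>1) \<odot> \<sigma>') else d) e \<sigma>"
  proof (rule mk_arr_lift)
    fix \<tau> \<rho> assume t: "\<tau> \<in> Cell2 I" "valid d (src2 I \<tau>) \<rho>"
    have *: "\<rho> \<in> Cell2 I" "d \<in> Cell1 I" "trg2 I \<rho> = src2 I \<tau> \<cdot> d" "src1 I (src2 I \<tau>) = trg1 I d"
      using t by (auto simp: valid_def)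
    note [simp] = * t(1)
    have "mk_arr d (e' \<cdot> src2 I \<tau>) ((e' \<triangleright> \<rho>) \<odot> \<sigma>') = mk_arr d (e' \<cdot> trg2 I \<tau>) ((e' \<triangleright> ((\<tau> \<triangleleft> d) \<odot> \<rho>)) \<odot> \<sigma>')"
      if h: "src2 I \<rho> = src2 I \<sigma>"
    proof -
      have **: "e' \<in> Cell1 I" "src1 I e' = trg1 I (src2 I \<sigma>)" "\<sigma>' \<in> Cell2 I" "trg2 I \<sigma>' = e' \<cdot> src2 I \<sigma>"
        using assms(2) by (auto simp: valid_def)
      have 1: "trg1 I (src2 I \<tau>) = trg1 I (src2 I \<sigma>)"
        using trg1_trg2[OF *(1)] h by simp
      note [simp] = ** 1 h
      show ?thesis
        using mk_arr_slide[of "e' \<triangleright> \<tau>" d "(e' \<triangleright> \<rho>) \<odot> \<sigma>'"] by (simp add: valid_def)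
    qed
    then show "(if src2 I \<rho> = src2 I \<sigma> then mk_arr d (e' \<cdot> src2 I \<tau>) ((e' \<triangleright> \<rho>) \<odot> \<sigma>') else d) =
      (if src2 I ((\<tau> \<triangleleft> d) \<odot> \<rho>) = src2 I \<sigma> then mk_arr d (e' \<cdot> trg2 I \<tau>) ((e' \<triangleright> ((\<tau> \<triangleleft> d) \<odot> \<rho>)) \<odot> \<sigma>') else d)"
      by simp
  qed
  finally show ?thesis
    by simp
qed

lemma onArr_W:
  assumes "valid d e \<sigma>" "c \<in> Cell1 I" "trg1 I c = src1 I d"
  shows "onArr (pfun W c) (mk_arr d e \<sigma>) = mk_arr (d \<cdot> c) e (\<sigma> \<triangleleft> c)"
proof -
  have "onArr (pfun W c) (mk_arr d e \<sigma>) = (\<lambda>e \<sigma>. mk_arr (d \<cdot> c) e (\<sigma> \<triangleleft> c)) (arr_mid (mk_arr d e \<sigma>)) (arr_cell (mk_arr d e \<sigma>))"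
    by (simp add: W_def)
  also have "\<dots> = mk_arr (d \<cdot> c) e (\<sigma> \<triangleleft> c)"
  proof (rule mk_arr_lift)
    fix \<tau> \<rho> assume t: "\<tau> \<in> Cell2 I" "valid d (src2 I \<tau>) \<rho>"
    have *: "\<rho> \<in> Cell2 I" "d \<in> Cell1 I" "trg2 I \<rho> = src2 I \<tau> \<cdot> d" "src1 I (src2 I \<tau>) = trg1 I d"
      using t by (auto simp: valid_def)
    have 1: "src1 I (src2 I \<rho>) = src1 I d"
      using src1_trg2[OF *(1)] * t(1) by simp
    note [simp] = * t(1) assms(2,3) 1
    show "mk_arr (d \<cdot> c) (src2 I \<tau>) (\<rho> \<triangleleft> c) = mk_arr (d \<cdot> c) (trg2 I \<tau>) (((\<tau> \<triangleleft> d) \<odot> \<rho>) \<triangleleft> c)"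
      using mk_arr_slide[of \<tau> "d \<cdot> c" "\<rho> \<triangleleft> c"] by (simp add: valid_def)
  qed
  finally show ?thesis .
qed

section \<open>Functoriality of the weight\<close>

lemma W_arrE:
  assumes "m \<in> Hom (pcat W i) x y"
  obtains e \<sigma> where "m = mk_arr y e \<sigma>" "valid y e \<sigma>" "src2 I \<sigma> = x" "src1 I y = i" "src1 I x = i" "x \<in> Cell1 I"
proof -
  obtain d e \<sigma> where m: "m = mk_arr d e \<sigma>" "valid d e \<sigma>" "src1 I d = i"
    using assms by (auto simp: Hom_def W_simps)
  have "y = d" "src2 I \<sigma> = x"
    using assms m Dom_W[OF m(2)] by (auto simp: Hom_def W_simps)
  moreover have "src1 I (src2 I \<sigma>) = i"
    using m(2,3) src1_trg2[of \<sigma>] by (simp add: valid_def)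
  moreover have "src2 I \<sigma> \<in> Cell1 I"
    using m(2) by (simp add: valid_def)
  ultimately show ?thesis
    using that m by auto
qed

lemma W_Hom: "valid d e \<sigma> \<Longrightarrow> src1 I d = i \<Longrightarrow> src2 I \<sigma> = d' \<Longrightarrow> mk_arr d e \<sigma> \<in> Hom (pcat W i) d' d"
  by (auto simp: Hom_def W_simps Dom_W)

lemma valid_src: "valid d e \<sigma> \<Longrightarrow> src1 I (src2 I \<sigma>) = src1 I d \<and> trg1 I (src2 I \<sigma>) = trg1 I e \<and> src2 I \<sigma> \<in> Cell1 I"
  using src1_trg2[of \<sigma>] trg1_trg2[of \<sigma>] by (simp add: valid_def)

lemma valid_Cmp:
  assumes "valid d e \<sigma>" "valid (src2 I \<sigma>) e' \<sigma>'"
  shows "valid d (e' \<cdot> e) ((e' \<triangleright> \<sigma>) \<odot> \<sigma>')" "src2 I ((e' \<triangleright> \<sigma>) \<odot> \<sigma>') = src2 I \<sigma>'"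
  using assms valid_src[OF assms(1)] valid_src[OF assms(2)] by (simp_all add: valid_def)

lemma valid_id: "d \<in> Cell1 I \<Longrightarrow> valid d (id1 I (trg1 I d)) (id2 I d)"
  by (simp add: valid_def)

lemma category_W: "category (pcat W i)"
proof
  show "Dom (pcat W i) f \<in> Ob (pcat W i)" "Cod (pcat W i) f \<in> Ob (pcat W i)" if "f \<in> Arr (pcat W i)" for f
    using that valid_src by (auto simp: W_simps Dom_W) (auto simp: valid_def)
  show "Idn (pcat W i) x \<in> Hom (pcat W i) x x" if "x \<in> Ob (pcat W i)" for x
    using that by (auto simp: W_simps valid_id intro!: W_Hom)
  show "Cmp (pcat W i) g f \<in> Hom (pcat W i) x z" if f: "f \<in> Hom (pcat W i) x y" and g: "g \<in> Hom (pcat W i) y z" for f g x y z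
  proof -
    from g obtain e \<sigma> where "g = mk_arr z e \<sigma>" "valid z e \<sigma>" "src2 I \<sigma> = y" "src1 I z = i" by (rule W_arrE)
    moreover from f obtain e' \<sigma>' where "f = mk_arr y e' \<sigma>'" "valid y e' \<sigma>'" "src2 I \<sigma>' = x" by (rule W_arrE)
    ultimately show ?thesis
      using valid_Cmp[of z e \<sigma> e' \<sigma>'] by (auto simp: Cmp_W intro!: W_Hom)
  qed
  show "Cmp (pcat W i) (Idn (pcat W i) y) f = f" if f: "f \<in> Hom (pcat W i) x y" for f x y
  proof -
    from f obtain e \<sigma> where "f = mk_arr y e \<sigma>" "valid y e \<sigma>" by (rule W_arrE)
    then show ?thesis
      using Cmp_W[of y "id1 I (trg1 I y)" "id2 I y" e \<sigma>] valid_id[of y] by (simp add: W_simps valid_def)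
  qed
  show "Cmp (pcat W i) f (Idn (pcat W i) x) = f" if f: "f \<in> Hom (pcat W i) x y" for f x y
  proof -
    from f obtain e \<sigma> where *: "f = mk_arr y e \<sigma>" "valid y e \<sigma>" "src2 I \<sigma> = x" "x \<in> Cell1 I" by (rule W_arrE)
    then show ?thesis
      using Cmp_W[of y e \<sigma> "id1 I (trg1 I x)" "id2 I x"] valid_id[of x] valid_src[OF *(2)] by (simp add: W_simps valid_def)
  qed
  show "Cmp (pcat W i) h (Cmp (pcat W i) g f) = Cmp (pcat W i) (Cmp (pcat W i) h g) f"
    if f: "f \<in> Hom (pcat W i) w x" and g: "g \<in> Hom (pcat W i) x y" and h: "h \<in> Hom (pcat W i) y z" for f g h w x y z
  proof -
    from h obtain e \<sigma> where h: "h = mk_arr z e \<sigma>" "valid z e \<sigma>" "src2 I \<sigma> = y" by (rule W_arrE)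
    from g obtain e' \<sigma>' where g: "g = mk_arr y e' \<sigma>'" "valid y e' \<sigma>'" "src2 I \<sigma>' = x" by (rule W_arrE)
    from f obtain e'' \<sigma>'' where f: "f = mk_arr x e'' \<sigma>''" "valid x e'' \<sigma>''" "src2 I \<sigma>'' = w" by (rule W_arrE)
    have c1: "Cmp (pcat W i) g f = mk_arr y (e'' \<cdot> e') ((e'' \<triangleright> \<sigma>') \<odot> \<sigma>'')"
      using Cmp_W[of y e' \<sigma>' e'' \<sigma>''] f g by simp
    have c2: "Cmp (pcat W i) h g = mk_arr z (e' \<cdot> e) ((e' \<triangleright> \<sigma>) \<odot> \<sigma>')"
      using Cmp_W[of z e \<sigma> e' \<sigma>'] h g by simp
    have v1: "valid y (e'' \<cdot> e') ((e'' \<triangleright> \<sigma>') \<odot> \<sigma>'')"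
      using valid_Cmp[of y e' \<sigma>' e'' \<sigma>''] f g by simp
    have v2: "valid z (e' \<cdot> e) ((e' \<triangleright> \<sigma>) \<odot> \<sigma>')" "src2 I ((e' \<triangleright> \<sigma>) \<odot> \<sigma>') = x"
      using valid_Cmp[of z e \<sigma> e' \<sigma>'] h g by simp_all
    have "Cmp (pcat W i) h (Cmp (pcat W i) g f) = mk_arr z ((e'' \<cdot> e') \<cdot> e) (((e'' \<cdot> e') \<triangleright> \<sigma>) \<odot> ((e'' \<triangleright> \<sigma>') \<odot> \<sigma>''))"
      unfolding c1 using Cmp_W[of z e \<sigma> "e'' \<cdot> e'" "(e'' \<triangleright> \<sigma>') \<odot> \<sigma>''"] v1 h by simp
    moreover have "Cmp (pcat W i) (Cmp (pcat W i) h g) f = mk_arr z (e'' \<cdot> (e' \<cdot> e)) ((e'' \<triangleright> ((e' \<triangleright> \<sigma>) \<odot> \<sigma>')) \<odot> \<sigma>'')"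
      unfolding c2 using Cmp_W[of z "e' \<cdot> e" "(e' \<triangleright> \<sigma>) \<odot> \<sigma>'" e'' \<sigma>''] v2 f by simp
    moreover have "mk_arr z ((e'' \<cdot> e') \<cdot> e) (((e'' \<cdot> e') \<triangleright> \<sigma>) \<odot> ((e'' \<triangleright> \<sigma>') \<odot> \<sigma>'')) = mk_arr z (e'' \<cdot> (e' \<cdot> e)) ((e'' \<triangleright> ((e' \<triangleright> \<sigma>) \<odot> \<sigma>')) \<odot> \<sigma>'')"
      using f(2,3) g(2,3) h(2,3) valid_src[OF f(2)] valid_src[OF g(2)] valid_src[OF h(2)] by (simp add: valid_def)
    ultimately show ?thesis by simp
  qed
qed

lemma is_functor_W:
  assumes "c \<in> Cell1 I" "src1 I c = i" "trg1 I c = j"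
  shows "is_functor (pcat W j) (pcat W i) (pfun W c)"
  unfolding is_functor_def
proof (intro conjI ballI impI)
  note [simp] = assms
  show "onOb (pfun W c) x \<in> Ob (pcat W i)" if "x \<in> Ob (pcat W j)" for x
    using that by (simp add: W_simps)
  show "onArr (pfun W c) f \<in> Hom (pcat W i) (onOb (pfun W c) x) (onOb (pfun W c) y)"
    if f: "f \<in> Hom (pcat W j) x y" for f x y
  proof -
    from f obtain e \<sigma> where *: "f = mk_arr y e \<sigma>" "valid y e \<sigma>" "src2 I \<sigma> = x" "src1 I y = j" "src1 I x = j" by (rule W_arrE)
    then show ?thesis
      using valid_src[OF *(2)] by (auto simp: onArr_W W_simps valid_def intro!: W_Hom)
  qed
  show "onArr (pfun W c) (Idn (pcat W j) x) = Idn (pcat W i) (onOb (pfun W c) x)" if "x \<in> Ob (pcat W j)" for x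
    using that valid_id[of x] by (simp add: W_simps onArr_W)
  show "onArr (pfun W c) (Cmp (pcat W j) g f) = Cmp (pcat W i) (onArr (pfun W c) g) (onArr (pfun W c) f)"
    if fg: "f \<in> Arr (pcat W j)" "g \<in> Arr (pcat W j)" "Dom (pcat W j) g = Cod (pcat W j) f" for f g
  proof -
    obtain y e' \<sigma>' where f: "f = mk_arr y e' \<sigma>'" "valid y e' \<sigma>'" "src1 I y = j"
      using fg(1) by (auto simp: W_simps)
    obtain z e \<sigma> where g: "g = mk_arr z e \<sigma>" "valid z e \<sigma>" "src1 I z = j"
      using fg(2) by (auto simp: W_simps)
    have y: "src2 I \<sigma> = y"
      using fg(3) f g by (simp add: W_simps Dom_W)
    have v: "valid z (e' \<cdot> e) ((e' \<triangleright> \<sigma>) \<odot> \<sigma>')"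
      using valid_Cmp[of z e \<sigma> e' \<sigma>'] f g y by simp
    have v1: "valid (z \<cdot> c) e (\<sigma> \<triangleleft> c)" "src2 I (\<sigma> \<triangleleft> c) = y \<cdot> c" and v2: "valid (y \<cdot> c) e' (\<sigma>' \<triangleleft> c)"
      using f g y valid_src[OF f(2)] valid_src[OF g(2)] by (simp_all add: valid_def)
    have "onArr (pfun W c) (Cmp (pcat W j) g f) = mk_arr (z \<cdot> c) (e' \<cdot> e) (((e' \<triangleright> \<sigma>) \<odot> \<sigma>') \<triangleleft> c)"
      using Cmp_W[of z e \<sigma> e' \<sigma>'] f g y onArr_W[OF v] by simp
    also have "((e' \<triangleright> \<sigma>) \<odot> \<sigma>') \<triangleleft> c = (e' \<triangleright> (\<sigma> \<triangleleft> c)) \<odot> (\<sigma>' \<triangleleft> c)"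
      using f g y valid_src[OF f(2)] valid_src[OF g(2)] by (simp add: valid_def)
    also have "mk_arr (z \<cdot> c) (e' \<cdot> e) ((e' \<triangleright> (\<sigma> \<triangleleft> c)) \<odot> (\<sigma>' \<triangleleft> c)) = Cmp (pcat W i) (mk_arr (z \<cdot> c) e (\<sigma> \<triangleleft> c)) (mk_arr (y \<cdot> c) e' (\<sigma>' \<triangleleft> c))"
      using Cmp_W[OF v1(1), of e' "\<sigma>' \<triangleleft> c"] v1 v2 by simp
    finally show ?thesis
      using f g by (simp add: onArr_W)
  qed
qed

lemma valid_pnat:
  assumes "\<tau> \<in> Cell2 I" "x \<in> Cell1 I" "src1 I x = trg1 I (src2 I \<tau>)"
  shows "valid (x \<cdot> trg2 I \<tau>) (id1 I (trg1 I x)) (x \<triangleright> \<tau>)"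
  using assms by (simp add: valid_def)

lemma is_presheaf_W: "is_presheaf I W"
  unfolding is_presheaf_def
proof (intro conjI ballI)
  show "category (pcat W i)" for i
    by (rule category_W)
  show "is_functor (pcat W j) (pcat W i) (pfun W d)" if "d \<in> hom1 I i j" for i j d
    using that is_functor_W by (simp add: hom1_def)
  show "onOb (pfun W (id1 I i)) x = x" if "i \<in> Obj I" "x \<in> Ob (pcat W i)" for i x
    using that by (simp add: W_simps)
  show "onArr (pfun W (id1 I i)) m = m" if "i \<in> Obj I" "m \<in> Arr (pcat W i)" for i m
  proof -
    obtain d e \<sigma> where *: "m = mk_arr d e \<sigma>" "valid d e \<sigma>" "src1 I d = i"
      using \<open>m \<in> Arr (pcat W i)\<close> by (auto simp: W_simps)
    then show ?thesis
      using \<open>i \<in> Obj I\<close> valid_src[OF *(2)] onArr_W[OF *(2), of "id1 I i"] by (simp add: valid_def)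
  qed
  show "onOb (pfun W (d' \<cdot> d)) x = onOb (pfun W d) (onOb (pfun W d') x)"
    if "d \<in> hom1 I i j" "d' \<in> hom1 I j k" "x \<in> Ob (pcat W k)" for i j k d d' x
    using that by (simp add: W_simps hom1_def)
  show "onArr (pfun W (d' \<cdot> d)) m = onArr (pfun W d) (onArr (pfun W d') m)"
    if "d \<in> hom1 I i j" "d' \<in> hom1 I j k" and m: "m \<in> Arr (pcat W k)" for i j k d d' m
  proof -
    obtain x e \<sigma> where *: "m = mk_arr x e \<sigma>" "valid x e \<sigma>" "src1 I x = k"
      using m by (auto simp: W_simps)
    have "valid (x \<cdot> d') e (\<sigma> \<triangleleft> d')"
      using * valid_src[OF *(2)] that by (simp add: valid_def hom1_def)
    then show ?thesis
      using * valid_src[OF *(2)] that onArr_W[of "x \<cdot> d'" e "\<sigma> \<triangleleft> d'" d] onArr_W[of x e \<sigma> "d' \<cdot> d"] onArr_W[of x e \<sigma> d']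
      by (simp add: hom1_def valid_def)
  qed
  show "pnat W (id2 I d) x = Idn (pcat W i) (onOb (pfun W d) x)"
    if "d \<in> hom1 I i j" "x \<in> Ob (pcat W j)" for i j d x
    using that by (simp add: W_simps hom1_def)
  show "pnat W (\<tau> \<odot> \<sigma>) x = Cmp (pcat W i) (pnat W \<tau> x) (pnat W \<sigma> x)"
    if "d \<in> hom1 I i j" "\<sigma> \<in> hom2 I d e" "\<tau> \<in> hom2 I e f" "x \<in> Ob (pcat W j)" for i j d e f \<sigma> \<tau> x
    using that valid_pnat[of \<tau> x] valid_pnat[of \<sigma> x] Cmp_W[of "x \<cdot> f" "id1 I (trg1 I x)" "x \<triangleright> \<tau>" "id1 I (trg1 I x)" "x \<triangleright> \<sigma>" i]
    by (auto simp: W_simps hom1_def hom2_def)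
  show "pnat W (\<tau> \<star> \<sigma>) x = Cmp (pcat W i) (pnat W \<sigma> (onOb (pfun W e') x)) (onArr (pfun W d) (pnat W \<tau> x))"
    if "d \<in> hom1 I i j" "d' \<in> hom1 I j k" "e' \<in> hom1 I j k" "\<sigma> \<in> hom2 I d e" "\<tau> \<in> hom2 I d' e'" "x \<in> Ob (pcat W k)"
    for i j k d e d' e' \<sigma> \<tau> x
  proof -
    have *: "d \<in> Cell1 I" "d' \<in> Cell1 I" "e' \<in> Cell1 I" "x \<in> Cell1 I" "\<sigma> \<in> Cell2 I" "\<tau> \<in> Cell2 I" "src2 I \<sigma> = d" "trg2 I \<sigma> = e"
      "src2 I \<tau> = d'" "trg2 I \<tau> = e'" "src1 I d = i" "trg1 I d = j" "src1 I d' = j" "trg1 I d' = k" "src1 I e' = j" "trg1 I e' = k"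
      "src1 I x = k"
      using that by (auto simp: hom1_def hom2_def W_simps)
    have "e \<in> Cell1 I" "src1 I e = i" "trg1 I e = j"
      using *(5,7,8,11,12) by auto
    note [simp] = * this
    have v: "valid (x \<cdot> e') (id1 I (trg1 I x)) (x \<triangleright> \<tau>)"
      by (simp add: valid_def)
    have v1: "valid (x \<cdot> (e' \<cdot> e)) (id1 I (trg1 I x)) (x \<cdot> e' \<triangleright> \<sigma>)"
      by (simp add: valid_def)
    have v2: "valid (x \<cdot> (e' \<cdot> d)) (id1 I (trg1 I x)) (x \<triangleright> (\<tau> \<triangleleft> d))"
      by (simp add: valid_def)
    show ?thesis
      using onArr_W[OF v, of d] Cmp_W[OF v1, of "id1 I (trg1 I x)" "x \<triangleright> (\<tau> \<triangleleft> d)" i] v2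
      by (simp add: W_simps hcomp_whisker')
  qed
  show "is_natural (pcat W j) (pcat W i) (pfun W d) (pfun W e) (pnat W \<tau>)"
    if "d \<in> hom1 I i j" "e \<in> hom1 I i j" "\<tau> \<in> hom2 I d e" for i j d e \<tau>
    unfolding is_natural_def
  proof (intro conjI ballI)
    have *: "d \<in> Cell1 I" "e \<in> Cell1 I" "\<tau> \<in> Cell2 I" "src2 I \<tau> = d" "trg2 I \<tau> = e" "src1 I d = i" "trg1 I d = j" "src1 I e = i" "trg1 I e = j"
      using that by (auto simp: hom1_def hom2_def)
    note [simp] = *
    show "pnat W \<tau> x \<in> Hom (pcat W i) (onOb (pfun W d) x) (onOb (pfun W e) x)" if "x \<in> Ob (pcat W j)" for x
      using that valid_pnat[of \<tau> x] by (auto simp: W_simps intro!: W_Hom)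
    show "Cmp (pcat W i) (pnat W \<tau> (Cod (pcat W j) f)) (onArr (pfun W d) f) =
       Cmp (pcat W i) (onArr (pfun W e) f) (pnat W \<tau> (Dom (pcat W j) f))" if f: "f \<in> Arr (pcat W j)" for f
    proof -
      obtain y a \<sigma> where y: "f = mk_arr y a \<sigma>" "valid y a \<sigma>" "src1 I y = j"
        using f by (auto simp: W_simps)
      have v: "y \<in> Cell1 I" "a \<in> Cell1 I" "src1 I a = trg1 I y" "\<sigma> \<in> Cell2 I" "trg2 I \<sigma> = a \<cdot> y" "src1 I (src2 I \<sigma>) = j"
         "trg1 I (src2 I \<sigma>) = trg1 I a"
        using y valid_src[OF y(2)] by (auto simp: valid_def)
      note [simp] = v y(3)
      have 1: "valid (y \<cdot> e) (id1 I (trg1 I y)) (y \<triangleright> \<tau>)" "valid (y \<cdot> d) a (\<sigma> \<triangleleft> d)"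
        "valid (y \<cdot> e) a (\<sigma> \<triangleleft> e)" "valid (src2 I \<sigma> \<cdot> e) (id1 I (trg1 I a)) (src2 I \<sigma> \<triangleright> \<tau>)"
        by (simp_all add: valid_def)
      show ?thesis
        using y(2) Cmp_W[OF 1(1), of a "\<sigma> \<triangleleft> d" i] Cmp_W[OF 1(3), of "id1 I (trg1 I a)" "src2 I \<sigma> \<triangleright> \<tau>" i] 1 swap[of \<tau> \<sigma>]
        by (simp add: y(1) onArr_W Dom_W W_simps)
    qed
  qed
qed

end

section \<open>Oplax bicolimits from weighted bicolimits\<close>

context two_category
begin

lemma Hom_homcat: "Hom (homcat K A B) f g = {\<alpha> \<in> hom2 K f g. f \<in> hom1 K A B}"
  by (auto simp: Hom_def homcat_def hom2_def)

lemma vinv_id2 [simp]: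
  assumes "f \<in> Cell1 K"
  shows "vinv (id2 K f) = id2 K f"
proof -
  have i: "iso2 (id2 K f)"
    using assms by simp
  have "vinv (id2 K f) = vinv (id2 K f) \<odot> id2 K f"
    using vcomp_id_right[of "vinv (id2 K f)" f] vinv_simps(1,2)[OF i] assms by simp
  also have "\<dots> = id2 K f"
    using vinv_simps(4)[OF i] assms by simp
  finally show ?thesis .
qed

lemma invertible_homcat:
  assumes "\<alpha> \<in> Hom (homcat K A B) f g"
  shows "invertible (homcat K A B) \<alpha> \<longleftrightarrow> iso2 \<alpha>"
proof
  interpret H: category "homcat K A B"
    by (rule category_homcat)
  assume "invertible (homcat K A B) \<alpha>"
  then obtain \<beta> where \<beta>: "\<beta> \<in> Hom (homcat K A B) g f" "Cmp (homcat K A B) \<beta> \<alpha> = Idn (homcat K A B) f"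
    "Cmp (homcat K A B) \<alpha> \<beta> = Idn (homcat K A B) g"
    using assms by (rule H.invertibleE)
  have "\<beta> \<in> hom2 K g f" "\<alpha> \<in> hom2 K f g"
    using assms \<beta>(1) by (simp_all add: Hom_homcat)
  moreover have "\<beta> \<odot> \<alpha> = id2 K f" "\<alpha> \<odot> \<beta> = id2 K g"
    using \<beta>(2,3) by (simp_all add: homcat_def)
  ultimately show "iso2 \<alpha>"
    by (intro iso2I[of \<alpha> \<beta>]) (simp_all add: hom2_def)
next
  interpret H: category "homcat K A B"
    by (rule category_homcat)
  assume i: "iso2 \<alpha>"
  have a: "src2 K \<alpha> = f" "trg2 K \<alpha> = g" "f \<in> hom1 K A B"
    using assms by (auto simp: Hom_homcat hom2_def)
  then have "g \<in> hom1 K A B"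
    using src1_trg2[of \<alpha>] trg1_trg2[of \<alpha>] i Cell1_trg2[of \<alpha>] by (auto simp: hom1_def)
  then have "vinv \<alpha> \<in> Hom (homcat K A B) g f"
    using i a by (simp add: Hom_homcat hom2_def)
  moreover have "vinv \<alpha> \<odot> \<alpha> = id2 K f" "\<alpha> \<odot> vinv \<alpha> = id2 K g"
    using i vinv_simps(4,5)[OF i] unfolding a by blast+
  then have "Cmp (homcat K A B) (vinv \<alpha>) \<alpha> = Idn (homcat K A B) f"
    "Cmp (homcat K A B) \<alpha> (vinv \<alpha>) = Idn (homcat K A B) g"
    by (simp_all add: homcat_def)
  ultimately show "invertible (homcat K A B) \<alpha>"
    by (rule H.invertibleI[OF assms])
qed

end

section \<open>Transformations out of the weight restrict to oplax cocones\<close>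

locale weighted = oplax_weight I pr + two_fun I K F
  for I :: "('s, 's, 's) two_cat" and pr and K :: "('o, 'a, 'c) two_cat" (structure)
    and F :: "('s, 's, 's, 'o, 'a, 'c) two_fun"
begin

abbreviation "pseudonat B t \<equiv> pseudonatural I W (repr_presheaf K F B) t"

lemma repr_simps:
  "pcat (repr_presheaf K F B) i = homcat K (F0 F i) B"
  "onOb (pfun (repr_presheaf K F B) d) q = q \<cdot> F1 F d"
  "onArr (pfun (repr_presheaf K F B) d) \<alpha> = \<alpha> \<triangleleft> F1 F d"
  "pnat (repr_presheaf K F B) \<sigma> q = q \<triangleright> F2 F \<sigma>"
  by (simp_all add: repr_presheaf_def)

text \<open>The definition unpacked on represented arrows. Later proofs cite the facts by position:
  1-3 objects, 4-6 arrows, 7 identities, 8 composition, 9-11 typing and invertibility of the cells,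
  12 their naturality, 13 their unit law, 14 their composition law, 15 compatibility with
  2-cells.\<close>

lemma psn_typing:
  assumes t: "pseudonat B t"
  shows psn_ob: "\<lbrakk>x \<in> Cell1 I; src1 I x = i\<rbrakk> \<Longrightarrow> psn_ob t i x \<in> Cell1 K"
      "\<lbrakk>x \<in> Cell1 I; src1 I x = i\<rbrakk> \<Longrightarrow> src1 K (psn_ob t i x) = F0 F i"
      "\<lbrakk>x \<in> Cell1 I; src1 I x = i\<rbrakk> \<Longrightarrow> trg1 K (psn_ob t i x) = B"
    and psn_arr: "\<lbrakk>valid y e \<sigma>; src1 I y = i\<rbrakk> \<Longrightarrow> psn_arr t i (mk_arr y e \<sigma>) \<in> Cell2 K"
      "\<lbrakk>valid y e \<sigma>; src1 I y = i\<rbrakk> \<Longrightarrow> src2 K (psn_arr t i (mk_arr y e \<sigma>)) = psn_ob t i (src2 I \<sigma>)"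
      "\<lbrakk>valid y e \<sigma>; src1 I y = i\<rbrakk> \<Longrightarrow> trg2 K (psn_arr t i (mk_arr y e \<sigma>)) = psn_ob t i y"
    and psn_arr_id: "\<lbrakk>x \<in> Cell1 I; src1 I x = i; trg1 I x = j\<rbrakk> \<Longrightarrow>
       psn_arr t i (mk_arr x (id1 I j) (id2 I x)) = id2 K (psn_ob t i x)"
    and psn_arr_comp: "\<lbrakk>valid y e \<sigma>; src1 I y = i; valid (src2 I \<sigma>) e' \<sigma>'\<rbrakk> \<Longrightarrow>
       psn_arr t i (mk_arr y (e' \<cdot>\<^bsub>I\<^esub> e) ((e' \<triangleright>\<^bsub>I\<^esub> \<sigma>) \<odot>\<^bsub>I\<^esub> \<sigma>')) = psn_arr t i (mk_arr y e \<sigma>) \<odot> psn_arr t i (mk_arr (src2 I \<sigma>) e' \<sigma>')"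
    and psn_cell: "\<lbrakk>d \<in> Cell1 I; x \<in> Cell1 I; src1 I x = trg1 I d\<rbrakk> \<Longrightarrow> K.iso2 (psn_cell t d x)"
      "\<lbrakk>d \<in> Cell1 I; x \<in> Cell1 I; src1 I x = trg1 I d\<rbrakk> \<Longrightarrow> src2 K (psn_cell t d x) = psn_ob t (trg1 I d) x \<cdot> F1 F d"
      "\<lbrakk>d \<in> Cell1 I; x \<in> Cell1 I; src1 I x = trg1 I d\<rbrakk> \<Longrightarrow> trg2 K (psn_cell t d x) = psn_ob t (src1 I d) (x \<cdot>\<^bsub>I\<^esub> d)"
    and psn_cell_nat: "\<lbrakk>d \<in> Cell1 I; valid y e \<sigma>; src1 I y = trg1 I d\<rbrakk> \<Longrightarrow>
       psn_cell t d y \<odot> (psn_arr t (trg1 I d) (mk_arr y e \<sigma>) \<triangleleft> F1 F d) =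
       psn_arr t (src1 I d) (mk_arr (y \<cdot>\<^bsub>I\<^esub> d) e (\<sigma> \<triangleleft>\<^bsub>I\<^esub> d)) \<odot> psn_cell t d (src2 I \<sigma>)"
    and psn_cell_id: "\<lbrakk>x \<in> Cell1 I; src1 I x = i\<rbrakk> \<Longrightarrow> psn_cell t (id1 I i) x = id2 K (psn_ob t i x)"
    and psn_cell_comp: "\<lbrakk>d \<in> Cell1 I; d' \<in> Cell1 I; x \<in> Cell1 I; src1 I d' = trg1 I d; src1 I x = trg1 I d'\<rbrakk> \<Longrightarrow>
       psn_cell t (d' \<cdot>\<^bsub>I\<^esub> d) x = psn_cell t d (x \<cdot>\<^bsub>I\<^esub> d') \<odot> (psn_cell t d' x \<triangleleft> F1 F d)"
    and psn_cell_2: "\<lbrakk>\<sigma> \<in> Cell2 I; x \<in> Cell1 I; src1 I x = j; j = trg1 I (src2 I \<sigma>); i = src1 I (src2 I \<sigma>)\<rbrakk> \<Longrightarrow>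
       psn_arr t i (mk_arr (x \<cdot>\<^bsub>I\<^esub> trg2 I \<sigma>) (id1 I (trg1 I x)) (x \<triangleright>\<^bsub>I\<^esub> \<sigma>)) \<odot> psn_cell t (src2 I \<sigma>) x =
       psn_cell t (trg2 I \<sigma>) x \<odot> (psn_ob t j x \<triangleright> F2 F \<sigma>)"
proof -
  note T = t[unfolded pseudonatural_def]
  have fn: "is_functor (pcat W i) (homcat K (F0 F i) B) (psn_functor t i)" if "i \<in> Obj I" for i
    using T that unfolding repr_simps by blast
  note fn' = functorD[OF fn category_W]
  have ob: "psn_ob t i x \<in> hom1 K (F0 F i) B" if "x \<in> Cell1 I" "src1 I x = i" for x i
    using fn'(1)[of i x] that by (auto simp: W_simps homcat_def)
  then show o: "\<lbrakk>x \<in> Cell1 I; src1 I x = i\<rbrakk> \<Longrightarrow> psn_ob t i x \<in> Cell1 K"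
      "\<lbrakk>x \<in> Cell1 I; src1 I x = i\<rbrakk> \<Longrightarrow> src1 K (psn_ob t i x) = F0 F i"
      "\<lbrakk>x \<in> Cell1 I; src1 I x = i\<rbrakk> \<Longrightarrow> trg1 K (psn_ob t i x) = B" for x i
    by (auto simp: hom1_def)
  have arr: "psn_arr t i (mk_arr y e \<sigma>) \<in> hom2 K (psn_ob t i (src2 I \<sigma>)) (psn_ob t i y)" if "valid y e \<sigma>" "src1 I y = i" for y e \<sigma> i
  proof -
    have "i \<in> Obj I"
      using that by (auto simp: valid_def)
    from fn'(2)[OF this W_Hom[OF that refl]] show ?thesis
      by (simp add: K.Hom_homcat)
  qed
  then show "\<lbrakk>valid y e \<sigma>; src1 I y = i\<rbrakk> \<Longrightarrow> psn_arr t i (mk_arr y e \<sigma>) \<in> Cell2 K"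
      "\<lbrakk>valid y e \<sigma>; src1 I y = i\<rbrakk> \<Longrightarrow> src2 K (psn_arr t i (mk_arr y e \<sigma>)) = psn_ob t i (src2 I \<sigma>)"
      "\<lbrakk>valid y e \<sigma>; src1 I y = i\<rbrakk> \<Longrightarrow> trg2 K (psn_arr t i (mk_arr y e \<sigma>)) = psn_ob t i y"
    by (auto simp: hom2_def)
  show "\<lbrakk>x \<in> Cell1 I; src1 I x = i; trg1 I x = j\<rbrakk> \<Longrightarrow> psn_arr t i (mk_arr x (id1 I j) (id2 I x)) = id2 K (psn_ob t i x)"
    using fn'(3)[of i x] by (auto simp: W_simps homcat_def)
  show "psn_arr t i (mk_arr y (e' \<cdot>\<^bsub>I\<^esub> e) ((e' \<triangleright>\<^bsub>I\<^esub> \<sigma>) \<odot>\<^bsub>I\<^esub> \<sigma>')) = psn_arr t i (mk_arr y e \<sigma>) \<odot> psn_arr t i (mk_arr (src2 I \<sigma>) e' \<sigma>')"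
    if v: "valid y e \<sigma>" "src1 I y = i" "valid (src2 I \<sigma>) e' \<sigma>'"
  proof -
    have i: "i \<in> Obj I"
      using v by (auto simp: valid_def)
    have "src1 I (src2 I \<sigma>) = i"
      using valid_src[OF v(1)] v(2) by simp
    from fn'(4)[OF i W_Hom[OF v(3) this refl] W_Hom[OF v(1,2) refl]] show ?thesis
      using Cmp_W[OF v(1,3), of i] by (simp add: homcat_def)
  qed
  have nat: "is_natural_iso (pcat W (trg1 I d)) (homcat K (F0 F (src1 I d)) B)
     (comp_functor (pfun (repr_presheaf K F B) d) (psn_functor t (trg1 I d))) (comp_functor (psn_functor t (src1 I d)) (pfun W d)) (psn_cell t d)"
    if "d \<in> Cell1 I" for d
    using T that unfolding repr_simps ball_hom1 by blast
  have c1: "psn_cell t d x \<in> Hom (homcat K (F0 F (src1 I d)) B) (psn_ob t (trg1 I d) x \<cdot> F1 F d) (psn_ob t (src1 I d) (x \<cdot>\<^bsub>I\<^esub> d))"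
    "invertible (homcat K (F0 F (src1 I d)) B) (psn_cell t d x)"
    if "d \<in> Cell1 I" "x \<in> Cell1 I" "src1 I x = trg1 I d" for d x
    using nat[OF that(1)] that unfolding is_natural_iso_def is_natural_def comp_functor_def by (auto simp: repr_simps W_simps)
  show "\<lbrakk>d \<in> Cell1 I; x \<in> Cell1 I; src1 I x = trg1 I d\<rbrakk> \<Longrightarrow> K.iso2 (psn_cell t d x)"
    using c1[of d x] K.invertible_homcat[OF c1(1), of d x] by simp
  show "\<lbrakk>d \<in> Cell1 I; x \<in> Cell1 I; src1 I x = trg1 I d\<rbrakk> \<Longrightarrow> src2 K (psn_cell t d x) = psn_ob t (trg1 I d) x \<cdot> F1 F d"
      "\<lbrakk>d \<in> Cell1 I; x \<in> Cell1 I; src1 I x = trg1 I d\<rbrakk> \<Longrightarrow> trg2 K (psn_cell t d x) = psn_ob t (src1 I d) (x \<cdot>\<^bsub>I\<^esub> d)"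
    using c1[of d x] by (simp_all add: K.Hom_homcat hom2_def)
  show "psn_cell t d y \<odot> (psn_arr t (trg1 I d) (mk_arr y e \<sigma>) \<triangleleft> F1 F d) =
       psn_arr t (src1 I d) (mk_arr (y \<cdot>\<^bsub>I\<^esub> d) e (\<sigma> \<triangleleft>\<^bsub>I\<^esub> d)) \<odot> psn_cell t d (src2 I \<sigma>)"
    if v: "d \<in> Cell1 I" "valid y e \<sigma>" "src1 I y = trg1 I d"
  proof -
    have a: "mk_arr y e \<sigma> \<in> Arr (pcat W (trg1 I d))" 
      using v by (auto simp: W_simps)
    have "\<forall>f \<in> Arr (pcat W (trg1 I d)). Cmp (homcat K (F0 F (src1 I d)) B) (psn_cell t d (Cod (pcat W (trg1 I d)) f))
       (psn_arr t (trg1 I d) f \<triangleleft> F1 F d) = Cmp (homcat K (F0 F (src1 I d)) B) (psn_arr t (src1 I d) (onArr (pfun W d) f)) (psn_cell t d (Dom (pcat W (trg1 I d)) f))"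
      using nat[OF v(1)] unfolding is_natural_iso_def is_natural_def comp_functor_def by (simp add: repr_simps)
    from this[rule_format, OF a] show ?thesis
      using v by (simp add: W_simps(4) Dom_W onArr_W homcat_def)
  qed
  show "psn_cell t (id1 I i) x = id2 K (psn_ob t i x)" if "x \<in> Cell1 I" "src1 I x = i"
  proof -
    have "i \<in> Obj I" "x \<in> Ob (pcat W i)"
      using that by (auto simp: W_simps)
    then show ?thesis
      using T by (simp add: repr_simps homcat_def)
  qed
  show "psn_cell t (d' \<cdot>\<^bsub>I\<^esub> d) x = psn_cell t d (x \<cdot>\<^bsub>I\<^esub> d') \<odot> (psn_cell t d' x \<triangleleft> F1 F d)"
    if "d \<in> Cell1 I" "d' \<in> Cell1 I" "x \<in> Cell1 I" "src1 I d' = trg1 I d" "src1 I x = trg1 I d'"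
  proof -
    have *: "d \<in> hom1 I (src1 I d) (trg1 I d)" "d' \<in> hom1 I (trg1 I d) (trg1 I d')" "x \<in> Ob (pcat W (trg1 I d'))"
      "src1 I d \<in> Obj I" "trg1 I d \<in> Obj I" "trg1 I d' \<in> Obj I"
      using that by (auto simp: W_simps hom1_def)
    have "psn_cell t (d' \<cdot>\<^bsub>I\<^esub> d) x = Cmp (pcat (repr_presheaf K F B) (src1 I d)) (psn_cell t d (onOb (pfun W d') x))
       (onArr (pfun (repr_presheaf K F B) d) (psn_cell t d' x))"
      using T * by blast
    then show ?thesis
      by (simp add: repr_simps homcat_def W_simps)
  qed
  show "psn_arr t i (mk_arr (x \<cdot>\<^bsub>I\<^esub> trg2 I \<sigma>) (id1 I (trg1 I x)) (x \<triangleright>\<^bsub>I\<^esub> \<sigma>)) \<odot> psn_cell t (src2 I \<sigma>) x =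
       psn_cell t (trg2 I \<sigma>) x \<odot> (psn_ob t j x \<triangleright> F2 F \<sigma>)"
    if "\<sigma> \<in> Cell2 I" "x \<in> Cell1 I" "src1 I x = j" "j = trg1 I (src2 I \<sigma>)" "i = src1 I (src2 I \<sigma>)"
  proof -
    have *: "src2 I \<sigma> \<in> hom1 I i j" "trg2 I \<sigma> \<in> hom1 I i j" "\<sigma> \<in> hom2 I (src2 I \<sigma>) (trg2 I \<sigma>)" "x \<in> Ob (pcat W j)" "i \<in> Obj I" "j \<in> Obj I"
      using that by (auto simp: W_simps hom1_def hom2_def)
    have "Cmp (pcat (repr_presheaf K F B) i) (psn_arr t i (pnat W \<sigma> x)) (psn_cell t (src2 I \<sigma>) x) =
        Cmp (pcat (repr_presheaf K F B) i) (psn_cell t (trg2 I \<sigma>) x) (pnat (repr_presheaf K F B) \<sigma> (psn_ob t j x))"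
      using T * by blast
    then show ?thesis
      by (simp add: repr_simps homcat_def W_simps)
  qed
qed

definition colim_leg :: "('s, 's, 's, 's, 'a, 'c) psnat \<Rightarrow> 's \<Rightarrow> 'a" where
  "colim_leg t i = psn_ob t i (id1 I i)"

text \<open>The composite \<open>t_j(1_j) F(d) \<Rightarrow> t_i(d) \<Rightarrow> t_i(1_i)\<close>
  for \<open>d : i \<rightarrow> j\<close>: the cell of \<open>t\<close> at \<open>d\<close>, then
  the image of the arrow \<open>d \<rightarrow> 1_i\<close> of \<open>W i\<close> represented by
  \<open>d\<close> with its identity 2-cell.\<close>

definition colim_cell :: "('s, 's, 's, 's, 'a, 'c) psnat \<Rightarrow> 's \<Rightarrow> 'c" where
  "colim_cell t d = psn_arr t (src1 I d) (mk_arr (id1 I (src1 I d)) d (id2 I d)) \<odot> psn_cell t d (id1 I (trg1 I d))"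

lemma valid_colim: "d \<in> Cell1 I \<Longrightarrow> src1 I d = i \<Longrightarrow> valid (id1 I i) d (id2 I d)"
  by (auto simp: valid_def)

lemma ococ_colim:
  assumes "pseudonat B t"
  shows "ococ B (colim_leg t) (colim_cell t)"
  unfolding ococ_def
proof (intro conjI ballI impI)
  note [simp] = psn_typing(1-6,9-11)[OF assms] valid_colim colim_leg_def
  fix i assume [simp]: "i \<in> Obj I"
  show "colim_leg t i \<in> Cell1 K" "src1 K (colim_leg t i) = F0 F i" "trg1 K (colim_leg t i) = B"
    by simp_all
  show "colim_cell t (id1 I i) = id2 K (colim_leg t i)"
    using psn_typing(7)[OF assms, of "id1 I i" i i] psn_typing(13)[OF assms, of "id1 I i" i] by (simp add: colim_cell_def)
next
  note [simp] = psn_typing(1-6,9-11)[OF assms] valid_colim colim_leg_def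
  fix d assume [simp]: "d \<in> Cell1 I"
  show "colim_cell t d \<in> Cell2 K" "src2 K (colim_cell t d) = colim_leg t (trg1 I d) \<cdot> F1 F d" "trg2 K (colim_cell t d) = colim_leg t (src1 I d)"
    by (simp_all add: colim_cell_def)
  fix d' assume [simp]: "d' \<in> Cell1 I" "src1 I d' = trg1 I d"
  let ?i = "src1 I d" and ?j = "trg1 I d" and ?k = "trg1 I d'"
  have v: "valid d d' (id2 I (d' \<cdot>\<^bsub>I\<^esub> d))"
    by (simp add: valid_def)
  note [simp] = v
  have 1: "psn_cell t d (id1 I ?j) \<odot> (psn_arr t ?j (mk_arr (id1 I ?j) d' (id2 I d')) \<triangleleft> F1 F d) =
     psn_arr t ?i (mk_arr d d' (id2 I (d' \<cdot>\<^bsub>I\<^esub> d))) \<odot> psn_cell t d d'"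
    using psn_typing(12)[OF assms, of d "id1 I ?j" d' "id2 I d'"] by simp
  have 2: "psn_arr t ?i (mk_arr (id1 I ?i) (d' \<cdot>\<^bsub>I\<^esub> d) (id2 I (d' \<cdot>\<^bsub>I\<^esub> d))) = psn_arr t ?i (mk_arr (id1 I ?i) d (id2 I d)) \<odot> psn_arr t ?i (mk_arr d d' (id2 I (d' \<cdot>\<^bsub>I\<^esub> d)))"
    using psn_typing(8)[OF assms, of "id1 I ?i" d "id2 I d" ?i d' "id2 I (d' \<cdot>\<^bsub>I\<^esub> d)"] by simp
  have 3: "psn_cell t (d' \<cdot>\<^bsub>I\<^esub> d) (id1 I ?k) = psn_cell t d d' \<odot> (psn_cell t d' (id1 I ?k) \<triangleleft> F1 F d)"
    using psn_typing(14)[OF assms, of d d' "id1 I ?k"] by simp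
  show "colim_cell t (d' \<cdot>\<^bsub>I\<^esub> d) = colim_cell t d \<odot> (colim_cell t d' \<triangleleft> F1 F d)"
    by (simp add: colim_cell_def 2 3 K.vcomp_eq_ext[OF 1])
next
  note [simp] = psn_typing(1-6,9-11)[OF assms] valid_colim colim_leg_def
  fix \<sigma> assume [simp]: "\<sigma> \<in> Cell2 I"
  let ?d = "src2 I \<sigma>" and ?d' = "trg2 I \<sigma>"
  let ?i = "src1 I ?d" and ?j = "trg1 I ?d"
  have v: "valid ?d' (id1 I ?j) \<sigma>"
    by (simp add: valid_def)
  note [simp] = v
  have 1: "psn_arr t ?i (mk_arr ?d' (id1 I ?j) \<sigma>) \<odot> psn_cell t ?d (id1 I ?j) = psn_cell t ?d' (id1 I ?j) \<odot> (psn_ob t ?j (id1 I ?j) \<triangleright> F2 F \<sigma>)"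
    using psn_typing(15)[OF assms, of \<sigma> "id1 I ?j" ?j ?i] by simp
  have 2: "psn_arr t ?i (mk_arr (id1 I ?i) ?d' \<sigma>) = psn_arr t ?i (mk_arr (id1 I ?i) ?d' (id2 I ?d')) \<odot> psn_arr t ?i (mk_arr ?d' (id1 I ?j) \<sigma>)"
    using psn_typing(8)[OF assms, of "id1 I ?i" ?d' "id2 I ?d'" ?i "id1 I ?j" \<sigma>] by simp
  \<comment> \<open>Sliding \<sigma> across identifies the two arrows. Here the quotient in
    \<open>W\<close> yields the 2-cell axiom of the cocone.\<close>
  have 3: "mk_arr (id1 I ?i) ?d' \<sigma> = mk_arr (id1 I ?i) ?d (id2 I ?d)"
    using mk_arr_slide[of \<sigma> "id1 I ?i" "id2 I ?d"] by simp
  show "colim_cell t ?d' \<odot> (colim_leg t ?j \<triangleright> F2 F \<sigma>) = colim_cell t ?d"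
    using 2 3 by (simp add: colim_cell_def 1[symmetric])
qed

abbreviation "mods B \<equiv> psnat_mods I W (repr_presheaf K F B)"

lemma mods_typing:
  assumes m: "m \<in> mods B s t"
  shows "\<lbrakk>x \<in> Cell1 I; src1 I x = i\<rbrakk> \<Longrightarrow> m i x \<in> Cell2 K"
    "\<lbrakk>x \<in> Cell1 I; src1 I x = i\<rbrakk> \<Longrightarrow> src2 K (m i x) = psn_ob s i x"
    "\<lbrakk>x \<in> Cell1 I; src1 I x = i\<rbrakk> \<Longrightarrow> trg2 K (m i x) = psn_ob t i x"
    "\<lbrakk>valid y e \<sigma>; src1 I y = i\<rbrakk> \<Longrightarrow> m i y \<odot> psn_arr s i (mk_arr y e \<sigma>) = psn_arr t i (mk_arr y e \<sigma>) \<odot> m i (src2 I \<sigma>)"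
    "\<lbrakk>d \<in> Cell1 I; x \<in> Cell1 I; src1 I x = trg1 I d\<rbrakk> \<Longrightarrow>
       m (src1 I d) (x \<cdot>\<^bsub>I\<^esub> d) \<odot> psn_cell s d x = psn_cell t d x \<odot> (m (trg1 I d) x \<triangleleft> F1 F d)"
proof -
  have nat: "is_natural (pcat W i) (homcat K (F0 F i) B) (psn_functor s i) (psn_functor t i) (m i)" if "i \<in> Obj I" for i
    using m that by (simp add: psnat_mods_def repr_simps)
  have h: "m i x \<in> hom2 K (psn_ob s i x) (psn_ob t i x)" if "x \<in> Cell1 I" "src1 I x = i" for i x
    using nat[of i] that by (auto simp: is_natural_def W_simps K.Hom_homcat)
  then show "\<lbrakk>x \<in> Cell1 I; src1 I x = i\<rbrakk> \<Longrightarrow> m i x \<in> Cell2 K"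
    "\<lbrakk>x \<in> Cell1 I; src1 I x = i\<rbrakk> \<Longrightarrow> src2 K (m i x) = psn_ob s i x"
    "\<lbrakk>x \<in> Cell1 I; src1 I x = i\<rbrakk> \<Longrightarrow> trg2 K (m i x) = psn_ob t i x"
    by (auto simp: hom2_def)
  show "m i y \<odot> psn_arr s i (mk_arr y e \<sigma>) = psn_arr t i (mk_arr y e \<sigma>) \<odot> m i (src2 I \<sigma>)" if v: "valid y e \<sigma>" "src1 I y = i"
  proof -
    have i: "i \<in> Obj I" and a: "mk_arr y e \<sigma> \<in> Arr (pcat W i)"
      using v by (auto simp: valid_def W_simps)
    have "\<forall>f \<in> Arr (pcat W i). Cmp (homcat K (F0 F i) B) (m i (Cod (pcat W i) f)) (psn_arr s i f) =
       Cmp (homcat K (F0 F i) B) (psn_arr t i f) (m i (Dom (pcat W i) f))"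
      using nat[OF i] by (simp add: is_natural_def)
    from this[rule_format, OF a] show ?thesis
      using v by (simp add: W_simps(4) Dom_W homcat_def)
  qed
  show "m (src1 I d) (x \<cdot>\<^bsub>I\<^esub> d) \<odot> psn_cell s d x = psn_cell t d x \<odot> (m (trg1 I d) x \<triangleleft> F1 F d)"
    if "d \<in> Cell1 I" "x \<in> Cell1 I" "src1 I x = trg1 I d"
  proof -
    have "\<forall>d \<in> Cell1 I. \<forall>x \<in> Ob (pcat W (trg1 I d)).
        Cmp (pcat (repr_presheaf K F B) (src1 I d)) (m (src1 I d) (onOb (pfun W d) x)) (psn_cell s d x) =
        Cmp (pcat (repr_presheaf K F B) (src1 I d)) (psn_cell t d x) (onArr (pfun (repr_presheaf K F B) d) (m (trg1 I d) x))"
      using m unfolding psnat_mods_def mem_Collect_eq ball_hom1 by blast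
    then show ?thesis
      using that by (simp add: repr_simps homcat_def W_simps)
  qed
qed

lemma omod_colim:
  assumes "pseudonat B s" "pseudonat B t" "m \<in> mods B s t"
  shows "omod (colim_leg s) (colim_cell s) (colim_leg t) (colim_cell t) (\<lambda>i. m i (id1 I i))"
  unfolding omod_def
proof (intro conjI ballI)
  note [simp] = psn_typing(1-6,9-11)[OF assms(1)] psn_typing(1-6,9-11)[OF assms(2)] valid_colim colim_leg_def mods_typing(1-3)[OF assms(3)]
  show "m i (id1 I i) \<in> Cell2 K" "src2 K (m i (id1 I i)) = colim_leg s i" "trg2 K (m i (id1 I i)) = colim_leg t i" if "i \<in> Obj I" for i
    using that by simp_all
  fix d assume [simp]: "d \<in> Cell1 I"
  let ?i = "src1 I d" and ?j = "trg1 I d"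
  have 1: "m ?i (id1 I ?i) \<odot> psn_arr s ?i (mk_arr (id1 I ?i) d (id2 I d)) = psn_arr t ?i (mk_arr (id1 I ?i) d (id2 I d)) \<odot> m ?i d"
    using mods_typing(4)[OF assms(3), of "id1 I ?i" d "id2 I d" ?i] by simp
  have 2: "m ?i d \<odot> psn_cell s d (id1 I ?j) = psn_cell t d (id1 I ?j) \<odot> (m ?j (id1 I ?j) \<triangleleft> F1 F d)"
    using mods_typing(5)[OF assms(3), of d "id1 I ?j"] by simp
  show "m ?i (id1 I ?i) \<odot> colim_cell s d = colim_cell t d \<odot> (m ?j (id1 I ?j) \<triangleleft> F1 F d)"
    by (simp add: colim_cell_def K.vcomp_eq_ext[OF 1] 2)
qed

section \<open>Modifications out of the weight\<close>

text \<open>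
  A modification is determined by its values at identities, because the cell of a
  pseudonatural transformation at \<open>x : i \<rightarrow> j\<close> relates its values at \<open>x\<close> and at \<open>1\<^sub>j\<close>.
\<close>

definition extend :: "('s, 's, 's, 's, 'a, 'c) psnat \<Rightarrow> ('s, 's, 's, 's, 'a, 'c) psnat \<Rightarrow> ('s \<Rightarrow> 'c) \<Rightarrow> 's \<Rightarrow> 's \<Rightarrow> 'c" where
  "extend s t n = (\<lambda>i\<in>Obj I. \<lambda>x\<in>Ob (pcat W i).
     psn_cell t x (id1 I (trg1 I x)) \<odot> ((n (trg1 I x) \<triangleleft> F1 F x) \<odot> K.vinv (psn_cell s x (id1 I (trg1 I x)))))"

text \<open>Each arrow of \<open>W i\<close> is the arrow of an identity-middle pair
  \<open>(1, \<sigma>)\<close> followed by that of a pair \<open>(e, id)\<close>. Naturality is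
  checked for these two kinds in \<open>k1\<close> and \<open>k2\<close> and combined in
  \<open>k\<close>.\<close>

lemma extend_mods:
  assumes "pseudonat B s" "pseudonat B t" "omod (colim_leg s) (colim_cell s) (colim_leg t) (colim_cell t) n"
  shows "extend s t n \<in> mods B s t"
proof -
  note S = psn_typing[OF assms(1)] and T = psn_typing[OF assms(2)]
  have n: "n i \<in> Cell2 K" "src2 K (n i) = psn_ob s i (id1 I i)" "trg2 K (n i) = psn_ob t i (id1 I i)" if "i \<in> Obj I" for i
    using omod_typing[OF assms(3) that] by (simp_all add: colim_leg_def)
  note [simp] = S(1-6,9-11) T(1-6,9-11) n
  let ?m = "\<lambda>x. psn_cell t x (id1 I (trg1 I x)) \<odot> ((n (trg1 I x) \<triangleleft> F1 F x) \<odot> K.vinv (psn_cell s x (id1 I (trg1 I x))))"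
  have ext: "extend s t n i x = ?m x" if "x \<in> Cell1 I" "src1 I x = i" for i x
    using that by (auto simp: extend_def W_simps)
  have m [simp]: "?m x \<in> Cell2 K" "src2 K (?m x) = psn_ob s (src1 I x) x" "trg2 K (?m x) = psn_ob t (src1 I x) x" if "x \<in> Cell1 I" for x
    using that by simp_all
  have mc: "?m x \<odot> psn_cell s x (id1 I (trg1 I x)) = psn_cell t x (id1 I (trg1 I x)) \<odot> (n (trg1 I x) \<triangleleft> F1 F x)" if "x \<in> Cell1 I" for x
    using that by simp
  have k1: "?m (trg2 I \<sigma>) \<odot> psn_arr s (src1 I (src2 I \<sigma>)) (mk_arr (trg2 I \<sigma>) (id1 I (trg1 I (src2 I \<sigma>))) \<sigma>) = psn_arr t (src1 I (src2 I \<sigma>)) (mk_arr (trg2 I \<sigma>) (id1 I (trg1 I (src2 I \<sigma>))) \<sigma>) \<odot> ?m (src2 I \<sigma>)"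
    if [simp]: "\<sigma> \<in> Cell2 I" for \<sigma>
  proof (rule K.iso2_cancel_right[of _ "psn_cell s (src2 I \<sigma>) (id1 I (trg1 I (src2 I \<sigma>)))"])
    let ?i = "src1 I (src2 I \<sigma>)" and ?j = "trg1 I (src2 I \<sigma>)" and ?x = "src2 I \<sigma>" and ?x' = "trg2 I \<sigma>"
    have [simp]: "valid ?x' (id1 I ?j) \<sigma>"
      by (simp add: valid_def)
    have s: "psn_arr s ?i (mk_arr ?x' (id1 I ?j) \<sigma>) \<odot> psn_cell s ?x (id1 I ?j) = psn_cell s ?x' (id1 I ?j) \<odot> (psn_ob s ?j (id1 I ?j) \<triangleright> F2 F \<sigma>)"
      using S(15)[of \<sigma> "id1 I ?j" ?j ?i] by simp
    have t: "psn_arr t ?i (mk_arr ?x' (id1 I ?j) \<sigma>) \<odot> psn_cell t ?x (id1 I ?j) = psn_cell t ?x' (id1 I ?j) \<odot> (psn_ob t ?j (id1 I ?j) \<triangleright> F2 F \<sigma>)"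
      using T(15)[of \<sigma> "id1 I ?j" ?j ?i] by simp
    have w: "(n ?j \<triangleleft> F1 F ?x') \<odot> (psn_ob s ?j (id1 I ?j) \<triangleright> F2 F \<sigma>) = (psn_ob t ?j (id1 I ?j) \<triangleright> F2 F \<sigma>) \<odot> (n ?j \<triangleleft> F1 F ?x)"
      using K.swap[of "F2 F \<sigma>" "n ?j"] by simp
    show "(?m ?x' \<odot> psn_arr s ?i (mk_arr ?x' (id1 I ?j) \<sigma>)) \<odot> psn_cell s ?x (id1 I ?j) = (psn_arr t ?i (mk_arr ?x' (id1 I ?j) \<sigma>) \<odot> ?m ?x) \<odot> psn_cell s ?x (id1 I ?j)"
      by (simp add: s w K.vcomp_eq_ext[OF t])
  qed (simp_all add: valid_def)
  \<comment> \<open>For the arrows \<open>(e, id)\<close> the compatibility of \<open>n\<close> with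
    the cocone cells enters, through \<open>nn\<close>; the arrows treated in \<open>k1\<close>
    require interchange alone.\<close>
  have k2: "?m y \<odot> psn_arr s i (mk_arr y e (id2 I (e \<cdot>\<^bsub>I\<^esub> y))) = psn_arr t i (mk_arr y e (id2 I (e \<cdot>\<^bsub>I\<^esub> y))) \<odot> ?m (e \<cdot>\<^bsub>I\<^esub> y)"
    if [simp]: "y \<in> Cell1 I" "e \<in> Cell1 I" "src1 I e = trg1 I y" "i = src1 I y" for y e i
  proof (rule K.iso2_cancel_right[of _ "psn_cell s (e \<cdot>\<^bsub>I\<^esub> y) (id1 I (trg1 I e))"])
    have v [simp]: "valid y e (id2 I (e \<cdot>\<^bsub>I\<^esub> y))" "valid (id1 I (trg1 I y)) e (id2 I e)"
      by (simp_all add: valid_def)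
    have s1: "psn_cell s y (id1 I (trg1 I y)) \<odot> (psn_arr s (trg1 I y) (mk_arr (id1 I (trg1 I y)) e (id2 I e)) \<triangleleft> F1 F y) =
        psn_arr s i (mk_arr y e (id2 I (e \<cdot>\<^bsub>I\<^esub> y))) \<odot> psn_cell s y e"
      using S(12)[of y "id1 I (trg1 I y)" e "id2 I e"] by simp
    have t1: "psn_cell t y (id1 I (trg1 I y)) \<odot> (psn_arr t (trg1 I y) (mk_arr (id1 I (trg1 I y)) e (id2 I e)) \<triangleleft> F1 F y) =
        psn_arr t i (mk_arr y e (id2 I (e \<cdot>\<^bsub>I\<^esub> y))) \<odot> psn_cell t y e"
      using T(12)[of y "id1 I (trg1 I y)" e "id2 I e"] by simp
    have s2: "psn_cell s (e \<cdot>\<^bsub>I\<^esub> y) (id1 I (trg1 I e)) = psn_cell s y e \<odot> (psn_cell s e (id1 I (trg1 I e)) \<triangleleft> F1 F y)"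
      using S(14)[of y e "id1 I (trg1 I e)"] by simp
    have t2: "psn_cell t (e \<cdot>\<^bsub>I\<^esub> y) (id1 I (trg1 I e)) = psn_cell t y e \<odot> (psn_cell t e (id1 I (trg1 I e)) \<triangleleft> F1 F y)"
      using T(14)[of y e "id1 I (trg1 I e)"] by simp
    have nn: "n (trg1 I y) \<odot> colim_cell s e = colim_cell t e \<odot> (n (trg1 I e) \<triangleleft> F1 F e)"
      using omod_nat[OF assms(3), of e] by simp
    have nw: "(n (trg1 I y) \<triangleleft> F1 F y) \<odot> ((psn_arr s (trg1 I y) (mk_arr (id1 I (trg1 I y)) e (id2 I e)) \<triangleleft> F1 F y) \<odot> (psn_cell s e (id1 I (trg1 I e)) \<triangleleft> F1 F y)) =
       (psn_arr t (trg1 I y) (mk_arr (id1 I (trg1 I y)) e (id2 I e)) \<triangleleft> F1 F y) \<odot> ((psn_cell t e (id1 I (trg1 I e)) \<triangleleft> F1 F y) \<odot> (n (trg1 I e) \<triangleleft> F1 F e \<cdot> F1 F y))"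
      using arg_cong[OF nn, of "\<lambda>z. rwhisker K z (F1 F y)"] by (simp add: colim_cell_def)
    have "(?m y \<odot> psn_arr s i (mk_arr y e (id2 I (e \<cdot>\<^bsub>I\<^esub> y)))) \<odot> psn_cell s (e \<cdot>\<^bsub>I\<^esub> y) (id1 I (trg1 I e)) =
      (?m y \<odot> (psn_arr s i (mk_arr y e (id2 I (e \<cdot>\<^bsub>I\<^esub> y))) \<odot> psn_cell s y e)) \<odot> (psn_cell s e (id1 I (trg1 I e)) \<triangleleft> F1 F y)"
      by (simp add: s2)
    also have "\<dots> = psn_cell t y (id1 I (trg1 I y)) \<odot> ((n (trg1 I y) \<triangleleft> F1 F y) \<odot> ((psn_arr s (trg1 I y) (mk_arr (id1 I (trg1 I y)) e (id2 I e)) \<triangleleft> F1 F y) \<odot> (psn_cell s e (id1 I (trg1 I e)) \<triangleleft> F1 F y)))"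
      unfolding s1[symmetric] by simp
    also have "\<dots> = (psn_cell t y (id1 I (trg1 I y)) \<odot> (psn_arr t (trg1 I y) (mk_arr (id1 I (trg1 I y)) e (id2 I e)) \<triangleleft> F1 F y)) \<odot> ((psn_cell t e (id1 I (trg1 I e)) \<triangleleft> F1 F y) \<odot> (n (trg1 I e) \<triangleleft> F1 F e \<cdot> F1 F y))"
      unfolding nw by simp
    also have "\<dots> = (psn_arr t i (mk_arr y e (id2 I (e \<cdot>\<^bsub>I\<^esub> y))) \<odot> ?m (e \<cdot>\<^bsub>I\<^esub> y)) \<odot> psn_cell s (e \<cdot>\<^bsub>I\<^esub> y) (id1 I (trg1 I e))"
      unfolding t1 by (simp add: t2)
    finally show "(?m y \<odot> psn_arr s i (mk_arr y e (id2 I (e \<cdot>\<^bsub>I\<^esub> y)))) \<odot> psn_cell s (e \<cdot>\<^bsub>I\<^esub> y) (id1 I (trg1 I e)) =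
      (psn_arr t i (mk_arr y e (id2 I (e \<cdot>\<^bsub>I\<^esub> y))) \<odot> ?m (e \<cdot>\<^bsub>I\<^esub> y)) \<odot> psn_cell s (e \<cdot>\<^bsub>I\<^esub> y) (id1 I (trg1 I e))" .
  qed (simp_all add: valid_def)
  have k: "?m y \<odot> psn_arr s i (mk_arr y e \<sigma>) = psn_arr t i (mk_arr y e \<sigma>) \<odot> ?m (src2 I \<sigma>)" if v: "valid y e \<sigma>" "i = src1 I y" for y e \<sigma> i
  proof -
    have [simp]: "y \<in> Cell1 I" "e \<in> Cell1 I" "src1 I e = trg1 I y" "\<sigma> \<in> Cell2 I" "trg2 I \<sigma> = e \<cdot>\<^bsub>I\<^esub> y"
      using v by (auto simp: valid_def)
    have [simp]: "src1 I (src2 I \<sigma>) = src1 I y" "trg1 I (src2 I \<sigma>) = trg1 I e"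
      using valid_src[OF v(1)] by auto
    have w [simp]: "valid y e (id2 I (e \<cdot>\<^bsub>I\<^esub> y))" "valid (e \<cdot>\<^bsub>I\<^esub> y) (id1 I (trg1 I e)) \<sigma>"
      by (simp_all add: valid_def)
    have fs: "psn_arr s i (mk_arr y e \<sigma>) = psn_arr s i (mk_arr y e (id2 I (e \<cdot>\<^bsub>I\<^esub> y))) \<odot> psn_arr s i (mk_arr (e \<cdot>\<^bsub>I\<^esub> y) (id1 I (trg1 I e)) \<sigma>)"
      using S(8)[of y e "id2 I (e \<cdot>\<^bsub>I\<^esub> y)" i "id1 I (trg1 I e)" \<sigma>] v by simp
    have ft: "psn_arr t i (mk_arr y e \<sigma>) = psn_arr t i (mk_arr y e (id2 I (e \<cdot>\<^bsub>I\<^esub> y))) \<odot> psn_arr t i (mk_arr (e \<cdot>\<^bsub>I\<^esub> y) (id1 I (trg1 I e)) \<sigma>)"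
      using T(8)[of y e "id2 I (e \<cdot>\<^bsub>I\<^esub> y)" i "id1 I (trg1 I e)" \<sigma>] v by simp
    have a: "psn_arr s i (mk_arr y e (id2 I (e \<cdot>\<^bsub>I\<^esub> y))) \<in> Cell2 K" "psn_arr s i (mk_arr (e \<cdot>\<^bsub>I\<^esub> y) (id1 I (trg1 I e)) \<sigma>) \<in> Cell2 K"
      "psn_arr t i (mk_arr y e (id2 I (e \<cdot>\<^bsub>I\<^esub> y))) \<in> Cell2 K" "psn_arr t i (mk_arr (e \<cdot>\<^bsub>I\<^esub> y) (id1 I (trg1 I e)) \<sigma>) \<in> Cell2 K"
      using v by simp_all
    have "?m y \<odot> psn_arr s i (mk_arr y e \<sigma>) = (?m y \<odot> psn_arr s i (mk_arr y e (id2 I (e \<cdot>\<^bsub>I\<^esub> y)))) \<odot> psn_arr s i (mk_arr (e \<cdot>\<^bsub>I\<^esub> y) (id1 I (trg1 I e)) \<sigma>)"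
      unfolding fs by (rule K.vcomp_assoc[symmetric]) (use a v m in simp_all)
    also have "\<dots> = psn_arr t i (mk_arr y e (id2 I (e \<cdot>\<^bsub>I\<^esub> y))) \<odot> (?m (e \<cdot>\<^bsub>I\<^esub> y) \<odot> psn_arr s i (mk_arr (e \<cdot>\<^bsub>I\<^esub> y) (id1 I (trg1 I e)) \<sigma>))"
      unfolding k2[OF \<open>y \<in> Cell1 I\<close> \<open>e \<in> Cell1 I\<close> \<open>src1 I e = trg1 I y\<close> v(2)] by (rule K.vcomp_assoc) (use a v m[of "e \<cdot>\<^bsub>I\<^esub> y"] in simp_all)
    also have "?m (e \<cdot>\<^bsub>I\<^esub> y) \<odot> psn_arr s i (mk_arr (e \<cdot>\<^bsub>I\<^esub> y) (id1 I (trg1 I e)) \<sigma>) = psn_arr t i (mk_arr (e \<cdot>\<^bsub>I\<^esub> y) (id1 I (trg1 I e)) \<sigma>) \<odot> ?m (src2 I \<sigma>)"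
      using k1[of \<sigma>] v by simp
    also have "psn_arr t i (mk_arr y e (id2 I (e \<cdot>\<^bsub>I\<^esub> y))) \<odot> (psn_arr t i (mk_arr (e \<cdot>\<^bsub>I\<^esub> y) (id1 I (trg1 I e)) \<sigma>) \<odot> ?m (src2 I \<sigma>)) =
       psn_arr t i (mk_arr y e \<sigma>) \<odot> ?m (src2 I \<sigma>)"
      unfolding ft by (rule K.vcomp_assoc[symmetric]) (use a v m[of "src2 I \<sigma>"] in simp_all)
    finally show ?thesis .
  qed
  have cond: "?m (x \<cdot>\<^bsub>I\<^esub> d) \<odot> psn_cell s d x = psn_cell t d x \<odot> (?m x \<triangleleft> F1 F d)"
    if [simp]: "d \<in> Cell1 I" "x \<in> Cell1 I" "src1 I x = trg1 I d" for d x
  proof (rule K.iso2_cancel_right[of _ "psn_cell s x (id1 I (trg1 I x)) \<triangleleft> F1 F d"])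
    have s2: "psn_cell s (x \<cdot>\<^bsub>I\<^esub> d) (id1 I (trg1 I x)) = psn_cell s d x \<odot> (psn_cell s x (id1 I (trg1 I x)) \<triangleleft> F1 F d)"
      using S(14)[of d x "id1 I (trg1 I x)"] by simp
    have t2: "psn_cell t (x \<cdot>\<^bsub>I\<^esub> d) (id1 I (trg1 I x)) = psn_cell t d x \<odot> (psn_cell t x (id1 I (trg1 I x)) \<triangleleft> F1 F d)"
      using T(14)[of d x "id1 I (trg1 I x)"] by simp
    have "(?m (x \<cdot>\<^bsub>I\<^esub> d) \<odot> psn_cell s d x) \<odot> (psn_cell s x (id1 I (trg1 I x)) \<triangleleft> F1 F d) = ?m (x \<cdot>\<^bsub>I\<^esub> d) \<odot> psn_cell s (x \<cdot>\<^bsub>I\<^esub> d) (id1 I (trg1 I x))"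
      unfolding s2 by (rule K.vcomp_assoc) (use m[of "x \<cdot>\<^bsub>I\<^esub> d"] in simp_all)
    also have "\<dots> = psn_cell t (x \<cdot>\<^bsub>I\<^esub> d) (id1 I (trg1 I x)) \<odot> (n (trg1 I x) \<triangleleft> F1 F (x \<cdot>\<^bsub>I\<^esub> d))"
      using mc[of "x \<cdot>\<^bsub>I\<^esub> d"] by simp
    also have "\<dots> = (psn_cell t d x \<odot> (?m x \<triangleleft> F1 F d)) \<odot> (psn_cell s x (id1 I (trg1 I x)) \<triangleleft> F1 F d)"
      unfolding t2 by (simp add: K.vinv_rwhisker)
    finally show "(?m (x \<cdot>\<^bsub>I\<^esub> d) \<odot> psn_cell s d x) \<odot> (psn_cell s x (id1 I (trg1 I x)) \<triangleleft> F1 F d) =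
       (psn_cell t d x \<odot> (?m x \<triangleleft> F1 F d)) \<odot> (psn_cell s x (id1 I (trg1 I x)) \<triangleleft> F1 F d)" .
  qed simp_all
  show ?thesis
    unfolding psnat_mods_def mem_Collect_eq ball_hom1
  proof (intro conjI ballI)
    show "extend s t n \<in> extensional (Obj I)"
      by (simp add: extend_def)
    show "extend s t n i \<in> extensional (Ob (pcat W i))" if "i \<in> Obj I" for i
      using that by (simp add: extend_def)
    show "Cmp (pcat (repr_presheaf K F B) (src1 I d)) (extend s t n (src1 I d) (onOb (pfun W d) x)) (psn_cell s d x) =
        Cmp (pcat (repr_presheaf K F B) (src1 I d)) (psn_cell t d x) (onArr (pfun (repr_presheaf K F B) d) (extend s t n (trg1 I d) x))"
      if "d \<in> Cell1 I" "x \<in> Ob (pcat W (trg1 I d))" for d x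
      using that cond[of d x] ext[of x "trg1 I d"] ext[of "x \<cdot>\<^bsub>I\<^esub> d" "src1 I d"] by (simp add: repr_simps homcat_def W_simps)
    show "is_natural (pcat W i) (pcat (repr_presheaf K F B) i) (psn_functor s i) (psn_functor t i) (extend s t n i)"
      if "i \<in> Obj I" for i
      unfolding is_natural_def
    proof (intro conjI ballI)
      show "extend s t n i x \<in> Hom (pcat (repr_presheaf K F B) i) (onOb (psn_functor s i) x) (onOb (psn_functor t i) x)"
        if "x \<in> Ob (pcat W i)" for x
        using that ext[of x i] by (auto simp: repr_simps K.Hom_homcat hom1_def hom2_def W_simps)
      show "Cmp (pcat (repr_presheaf K F B) i) (extend s t n i (Cod (pcat W i) f)) (onArr (psn_functor s i) f) =
         Cmp (pcat (repr_presheaf K F B) i) (onArr (psn_functor t i) f) (extend s t n i (Dom (pcat W i) f))"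
        if f: "f \<in> Arr (pcat W i)" for f
      proof -
        obtain y e \<sigma> where y: "f = mk_arr y e \<sigma>" "valid y e \<sigma>" "src1 I y = i"
          using f by (auto simp: W_simps)
        have "y \<in> Cell1 I" "src2 I \<sigma> \<in> Cell1 I" "src1 I (src2 I \<sigma>) = i"
          using y valid_src[OF y(2)] by (auto simp: valid_def)
        then show ?thesis
          using k[OF y(2), of i] ext[of y i] ext[of "src2 I \<sigma>" i] y by (simp add: repr_simps homcat_def W_simps(4) Dom_W)
      qed
    qed
  qed
qed

lemma mods_unique:
  assumes "pseudonat B s" "pseudonat B t" "m \<in> mods B s t" "m' \<in> mods B s t"
    "\<And>i. i \<in> Obj I \<Longrightarrow> m i (id1 I i) = m' i (id1 I i)"
  shows "m = m'"
proof -
  note [simp] = psn_typing(1-6,9-11)[OF assms(1)] psn_typing(1-6,9-11)[OF assms(2)] mods_typing(1-3)[OF assms(3)] mods_typing(1-3)[OF assms(4)]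
  have *: "m i x = m' i x" if [simp]: "x \<in> Cell1 I" "src1 I x = i" for i x
  proof (rule K.iso2_cancel_right[of _ "psn_cell s x (id1 I (trg1 I x))"])
    show "m i x \<odot> psn_cell s x (id1 I (trg1 I x)) = m' i x \<odot> psn_cell s x (id1 I (trg1 I x))"
      using mods_typing(5)[OF assms(3), of x "id1 I (trg1 I x)"] mods_typing(5)[OF assms(4), of x "id1 I (trg1 I x)"]
        assms(5)[of "trg1 I x"] by simp
  qed simp_all
  have e: "m \<in> extensional (Obj I)" "m' \<in> extensional (Obj I)"
    "\<And>i. i \<in> Obj I \<Longrightarrow> m i \<in> extensional (Ob (pcat W i))" "\<And>i. i \<in> Obj I \<Longrightarrow> m' i \<in> extensional (Ob (pcat W i))"
    using assms(3,4) by (auto simp: psnat_mods_def)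
  show ?thesis
    by (rule extensionalityI[OF e(1,2)], rule extensionalityI[OF e(3,4)]) (auto simp: W_simps *)
qed

text \<open>The transformation of a cocone can be taken strict: restricting \<open>q_k F(x)\<close>
  along \<open>d\<close> gives \<open>q_k F(x) F(d)\<close>, which is its value at
  \<open>x d\<close>, so all cells are identities.\<close>

definition coc_psnat :: "('s \<Rightarrow> 'a) \<Rightarrow> ('s \<Rightarrow> 'c) \<Rightarrow> ('s, 's, 's, 's, 'a, 'c) psnat" where
  "coc_psnat q qc = PsNat
     (\<lambda>i\<in>Obj I. \<lambda>x\<in>Ob (pcat W i). q (trg1 I x) \<cdot> F1 F x)
     (\<lambda>i\<in>Obj I. \<lambda>m\<in>Arr (pcat W i). (qc (arr_mid m) \<triangleleft> F1 F (arr_cod m)) \<odot> (q (trg1 I (arr_mid m)) \<triangleright> F2 F (arr_cell m)))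
     (\<lambda>d\<in>Cell1 I. \<lambda>x\<in>Ob (pcat W (trg1 I d)). id2 K (q (trg1 I x) \<cdot> (F1 F x \<cdot> F1 F d)))"

text \<open>The formula on arrows depends only on the class, because the 2-cell axiom of the cocone
  absorbs a 2-cell that is slid across.\<close>

lemma coc_psnat_simps:
  assumes o: "ococ B q qc"
  shows "\<lbrakk>x \<in> Cell1 I; src1 I x = i\<rbrakk> \<Longrightarrow> psn_ob (coc_psnat q qc) i x = q (trg1 I x) \<cdot> F1 F x"
    "\<lbrakk>valid y e \<sigma>; src1 I y = i\<rbrakk> \<Longrightarrow> psn_arr (coc_psnat q qc) i (mk_arr y e \<sigma>) = (qc e \<triangleleft> F1 F y) \<odot> (q (trg1 I e) \<triangleright> F2 F \<sigma>)"
    "\<lbrakk>d \<in> Cell1 I; x \<in> Cell1 I; src1 I x = trg1 I d\<rbrakk> \<Longrightarrow> psn_cell (coc_psnat q qc) d x = id2 K (q (trg1 I x) \<cdot> (F1 F x \<cdot> F1 F d))"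
proof -
  show "\<lbrakk>x \<in> Cell1 I; src1 I x = i\<rbrakk> \<Longrightarrow> psn_ob (coc_psnat q qc) i x = q (trg1 I x) \<cdot> F1 F x"
    "\<lbrakk>d \<in> Cell1 I; x \<in> Cell1 I; src1 I x = trg1 I d\<rbrakk> \<Longrightarrow> psn_cell (coc_psnat q qc) d x = id2 K (q (trg1 I x) \<cdot> (F1 F x \<cdot> F1 F d))"
    by (auto simp: coc_psnat_def W_simps)
  assume v: "valid y e \<sigma>" "src1 I y = i"
  have "psn_arr (coc_psnat q qc) i (mk_arr y e \<sigma>) =
      (\<lambda>e \<sigma>. (qc e \<triangleleft> F1 F y) \<odot> (q (trg1 I e) \<triangleright> F2 F \<sigma>)) (arr_mid (mk_arr y e \<sigma>)) (arr_cell (mk_arr y e \<sigma>))"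
    using v by (auto simp: coc_psnat_def W_simps valid_def)
  also have "\<dots> = (qc e \<triangleleft> F1 F y) \<odot> (q (trg1 I e) \<triangleright> F2 F \<sigma>)"
  proof (rule mk_arr_lift)
    fix \<tau> \<rho> assume t: "\<tau> \<in> Cell2 I" "valid y (src2 I \<tau>) \<rho>"
    have *: "\<rho> \<in> Cell2 I" "y \<in> Cell1 I" "trg2 I \<rho> = src2 I \<tau> \<cdot>\<^bsub>I\<^esub> y" "src1 I (src2 I \<tau>) = trg1 I y"
      using t by (auto simp: valid_def)
    have 1: "trg1 I (src2 I \<rho>) = trg1 I (src2 I \<tau>)"
      using trg1_trg2[OF *(1)] * t(1) by simp
    note [simp] = * t(1) 1 ococ_typing(1-6)[OF o]
    have 2: "(qc (trg2 I \<tau>) \<triangleleft> F1 F y) \<odot> (q (trg1 I (src2 I \<tau>)) \<triangleright> (F2 F \<tau> \<triangleleft> F1 F y)) = qc (src2 I \<tau>) \<triangleleft> F1 F y"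
      using arg_cong[OF ococ_2[OF o t(1) refl], of "\<lambda>z. rwhisker K z (F1 F y)"] by simp
    show "(qc (src2 I \<tau>) \<triangleleft> F1 F y) \<odot> (q (trg1 I (src2 I \<tau>)) \<triangleright> F2 F \<rho>) =
       (qc (trg2 I \<tau>) \<triangleleft> F1 F y) \<odot> (q (trg1 I (trg2 I \<tau>)) \<triangleright> F2 F ((\<tau> \<triangleleft>\<^bsub>I\<^esub> y) \<odot>\<^bsub>I\<^esub> \<rho>))"
      by (simp add: K.vcomp_eq_ext[OF 2])
  qed
  finally show "psn_arr (coc_psnat q qc) i (mk_arr y e \<sigma>) = (qc e \<triangleleft> F1 F y) \<odot> (q (trg1 I e) \<triangleright> F2 F \<sigma>)" .
qed

lemma pseudonat_coc_psnat:
  assumes o: "ococ B q qc"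
  shows "pseudonat B (coc_psnat q qc)"
proof -
  let ?t = "coc_psnat q qc"
  note simps = coc_psnat_simps[OF o]
  note [simp] = ococ_typing[OF o] simps(1,3)
  have arr: "(qc e \<triangleleft> F1 F y) \<odot> (q (trg1 I e) \<triangleright> F2 F \<sigma>) \<in> hom2 K (q (trg1 I e) \<cdot> F1 F (src2 I \<sigma>)) (q (trg1 I y) \<cdot> F1 F y)"
    if "valid y e \<sigma>" for y e \<sigma>
    using that valid_src[OF that] by (simp add: valid_def hom2_def)
  show ?thesis
    unfolding pseudonatural_def ball_hom1
  proof (intro conjI ballI)
    show "psn_ob ?t \<in> extensional (Obj I)" "psn_arr ?t \<in> extensional (Obj I)" "psn_cell ?t \<in> extensional (Cell1 I)"
      by (simp_all add: coc_psnat_def)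
    show "psn_ob ?t i \<in> extensional (Ob (pcat W i))" "psn_arr ?t i \<in> extensional (Arr (pcat W i))" if "i \<in> Obj I" for i
      using that by (simp_all add: coc_psnat_def)
    show "psn_cell ?t d \<in> extensional (Ob (pcat W (trg1 I d)))" if "d \<in> Cell1 I" for d
      using that by (simp add: coc_psnat_def)
    show "is_functor (pcat W i) (pcat (repr_presheaf K F B) i) (psn_functor ?t i)" if i: "i \<in> Obj I" for i
      unfolding is_functor_def
    proof (intro conjI ballI impI)
      show "onOb (psn_functor ?t i) x \<in> Ob (pcat (repr_presheaf K F B) i)" if "x \<in> Ob (pcat W i)" for x
        using that by (auto simp: W_simps repr_simps homcat_def hom1_def)
      show "onArr (psn_functor ?t i) f \<in> Hom (pcat (repr_presheaf K F B) i) (onOb (psn_functor ?t i) x) (onOb (psn_functor ?t i) y)"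
        if f: "f \<in> Hom (pcat W i) x y" for f x y
      proof -
        from f obtain e \<sigma> where *: "f = mk_arr y e \<sigma>" "valid y e \<sigma>" "src2 I \<sigma> = x" "src1 I y = i" "src1 I x = i" "x \<in> Cell1 I" by (rule W_arrE)
        then have **: "y \<in> Cell1 I" "trg1 I x = trg1 I e"
          using valid_src[OF *(2)] by (auto simp: valid_def)
        have "q (trg1 I e) \<cdot> F1 F x \<in> hom1 K (F0 F i) B"
          using * ** by (auto simp: valid_def hom1_def)
        then show ?thesis
          using * ** arr[OF *(2)] simps(2)[OF *(2,4)] by (simp add: repr_simps K.Hom_homcat)
      qed
      show "onArr (psn_functor ?t i) (Idn (pcat W i) x) = Idn (pcat (repr_presheaf K F B) i) (onOb (psn_functor ?t i) x)"
        if "x \<in> Ob (pcat W i)" for x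
        using that simps(2)[of x "id1 I (trg1 I x)" "id2 I x" i] valid_id[of x] by (auto simp: W_simps repr_simps homcat_def)
      show "onArr (psn_functor ?t i) (Cmp (pcat W i) g f) = Cmp (pcat (repr_presheaf K F B) i) (onArr (psn_functor ?t i) g) (onArr (psn_functor ?t i) f)"
        if fg: "f \<in> Arr (pcat W i)" "g \<in> Arr (pcat W i)" "Dom (pcat W i) g = Cod (pcat W i) f" for f g
      proof -
        obtain y e' \<sigma>' where f: "f = mk_arr y e' \<sigma>'" "valid y e' \<sigma>'" "src1 I y = i"
          using fg(1) by (auto simp: W_simps)
        obtain z e \<sigma> where g: "g = mk_arr z e \<sigma>" "valid z e \<sigma>" "src1 I z = i"
          using fg(2) by (auto simp: W_simps)
        have y: "src2 I \<sigma> = y"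
          using fg(3) f g by (simp add: W_simps Dom_W)
        have v: "valid z (e' \<cdot>\<^bsub>I\<^esub> e) ((e' \<triangleright>\<^bsub>I\<^esub> \<sigma>) \<odot>\<^bsub>I\<^esub> \<sigma>')"
          using valid_Cmp[of z e \<sigma> e' \<sigma>'] f g y by simp
        have *: "y \<in> Cell1 I" "e' \<in> Cell1 I" "src1 I e' = trg1 I y" "\<sigma>' \<in> Cell2 I" "trg2 I \<sigma>' = e' \<cdot>\<^bsub>I\<^esub> y"
          "z \<in> Cell1 I" "e \<in> Cell1 I" "src1 I e = trg1 I z" "\<sigma> \<in> Cell2 I" "trg2 I \<sigma> = e \<cdot>\<^bsub>I\<^esub> z"
          "src1 I (src2 I \<sigma>') = src1 I y" "trg1 I (src2 I \<sigma>') = trg1 I e'" "trg1 I y = trg1 I e" "src1 I y = src1 I z"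
          using f g y valid_src[OF f(2)] valid_src[OF g(2)] by (auto simp: valid_def)
        note [simp] = * y
        have 1: "(qc e' \<triangleleft> F1 F e \<cdot> F1 F z) \<odot> (q (trg1 I e') \<cdot> F1 F e' \<triangleright> F2 F \<sigma>) = (q (trg1 I e) \<triangleright> F2 F \<sigma>) \<odot> (qc e' \<triangleleft> F1 F y)"
          using K.swap[of "F2 F \<sigma>" "qc e'"] by simp
        have "psn_arr ?t i (Cmp (pcat W i) g f) = psn_arr ?t i (mk_arr z (e' \<cdot>\<^bsub>I\<^esub> e) ((e' \<triangleright>\<^bsub>I\<^esub> \<sigma>) \<odot>\<^bsub>I\<^esub> \<sigma>'))"
          using Cmp_W[of z e \<sigma> e' \<sigma>' i] f g by simp
        also have "\<dots> = psn_arr ?t i g \<odot> psn_arr ?t i f"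
          unfolding f(1) g(1) simps(2)[OF v g(3)] simps(2)[OF f(2,3)] simps(2)[OF g(2,3)]
          by (simp add: K.vcomp_eq_ext[OF 1])
        finally show ?thesis
          by (simp add: repr_simps homcat_def)
      qed
    qed
    show "is_natural_iso (pcat W (trg1 I d)) (pcat (repr_presheaf K F B) (src1 I d))
       (comp_functor (pfun (repr_presheaf K F B) d) (psn_functor ?t (trg1 I d))) (comp_functor (psn_functor ?t (src1 I d)) (pfun W d)) (psn_cell ?t d)"
      if [simp]: "d \<in> Cell1 I" for d
      unfolding is_natural_iso_def is_natural_def comp_functor_def cfunctor.simps
    proof (intro conjI ballI)
      show c: "psn_cell ?t d x \<in> Hom (pcat (repr_presheaf K F B) (src1 I d)) (onOb (pfun (repr_presheaf K F B) d) (psn_ob ?t (trg1 I d) x))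
          (psn_ob ?t (src1 I d) (onOb (pfun W d) x))" if "x \<in> Ob (pcat W (trg1 I d))" for x
        using that by (auto simp: W_simps repr_simps K.Hom_homcat hom2_def hom1_def)
      show "invertible (pcat (repr_presheaf K F B) (src1 I d)) (psn_cell ?t d x)" if x: "x \<in> Ob (pcat W (trg1 I d))" for x
        using x K.invertible_homcat[OF c[OF x, unfolded repr_simps(1)]] by (auto simp: W_simps repr_simps)
      show "Cmp (pcat (repr_presheaf K F B) (src1 I d)) (psn_cell ?t d (Cod (pcat W (trg1 I d)) f))
          (onArr (pfun (repr_presheaf K F B) d) (psn_arr ?t (trg1 I d) f)) =
         Cmp (pcat (repr_presheaf K F B) (src1 I d)) (psn_arr ?t (src1 I d) (onArr (pfun W d) f)) (psn_cell ?t d (Dom (pcat W (trg1 I d)) f))"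
        if fA: "f \<in> Arr (pcat W (trg1 I d))" for f
      proof -
        obtain y e \<sigma> where f: "f = mk_arr y e \<sigma>" "valid y e \<sigma>" "src1 I y = trg1 I d"
          using fA by (auto simp: W_simps)
        have *: "y \<in> Cell1 I" "e \<in> Cell1 I" "src1 I e = trg1 I y" "\<sigma> \<in> Cell2 I" "trg2 I \<sigma> = e \<cdot>\<^bsub>I\<^esub> y" "src1 I (src2 I \<sigma>) = trg1 I d" "trg1 I (src2 I \<sigma>) = trg1 I e"
          using f valid_src[OF f(2)] by (auto simp: valid_def)
        note [simp] = * f(3)
        have v: "valid (y \<cdot>\<^bsub>I\<^esub> d) e (\<sigma> \<triangleleft>\<^bsub>I\<^esub> d)"
          by (simp add: valid_def)
        show ?thesis
          using simps(2)[OF f(2,3)] simps(2)[OF v] f(2) by (simp add: f(1) W_simps(4) onArr_W Dom_W repr_simps homcat_def W_simps(5))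
      qed
    qed
    show "psn_cell ?t (id1 I i) x = Idn (pcat (repr_presheaf K F B) i) (psn_ob ?t i x)" if "i \<in> Obj I" "x \<in> Ob (pcat W i)" for i x
      using that by (auto simp: W_simps repr_simps homcat_def)
    show "psn_cell ?t (d' \<cdot>\<^bsub>I\<^esub> d) x = Cmp (pcat (repr_presheaf K F B) i) (psn_cell ?t d (onOb (pfun W d') x))
         (onArr (pfun (repr_presheaf K F B) d) (psn_cell ?t d' x))"
      if "d \<in> hom1 I i j" "d' \<in> hom1 I j k" "x \<in> Ob (pcat W k)" for i j k d d' x
      using that by (simp add: W_simps repr_simps homcat_def hom1_def)
    show "Cmp (pcat (repr_presheaf K F B) (src1 I d)) (psn_arr ?t (src1 I d) (pnat W \<sigma> x)) (psn_cell ?t d x) =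
        Cmp (pcat (repr_presheaf K F B) (src1 I d)) (psn_cell ?t e x) (pnat (repr_presheaf K F B) \<sigma> (psn_ob ?t (trg1 I d) x))"
      if "d \<in> Cell1 I" "e \<in> hom1 I (src1 I d) (trg1 I d)" "\<sigma> \<in> hom2 I d e" "x \<in> Ob (pcat W (trg1 I d))" for d e \<sigma> x
    proof -
      have *: "d \<in> Cell1 I" "e \<in> Cell1 I" "src1 I e = src1 I d" "trg1 I e = trg1 I d" "\<sigma> \<in> Cell2 I" "src2 I \<sigma> = d" "trg2 I \<sigma> = e"
        "x \<in> Cell1 I" "src1 I x = trg1 I d"
        using that by (auto simp: hom1_def hom2_def W_simps)
      note [simp] = *
      have v: "valid (x \<cdot>\<^bsub>I\<^esub> e) (id1 I (trg1 I x)) (x \<triangleright>\<^bsub>I\<^esub> \<sigma>)"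
        by (simp add: valid_def)
      show ?thesis
        using simps(2)[OF v, of "src1 I d"] by (simp add: W_simps repr_simps homcat_def)
    qed
  qed
qed

lemma colim_coc_psnat:
  assumes o: "ococ B q qc"
  shows "i \<in> Obj I \<Longrightarrow> colim_leg (coc_psnat q qc) i = q i" "d \<in> Cell1 I \<Longrightarrow> colim_cell (coc_psnat q qc) d = qc d"
proof -
  note [simp] = ococ_typing(1-6)[OF o] coc_psnat_simps(1,3)[OF o]
  show "i \<in> Obj I \<Longrightarrow> colim_leg (coc_psnat q qc) i = q i"
    by (simp add: colim_leg_def)
  show "d \<in> Cell1 I \<Longrightarrow> colim_cell (coc_psnat q qc) d = qc d"
    by (simp add: colim_cell_def coc_psnat_simps(2)[OF o] valid_colim)
qed

lemma extend_colim:
  assumes "pseudonat B s" "pseudonat B t" "omod (colim_leg s) (colim_cell s) (colim_leg t) (colim_cell t) n" "i \<in> Obj I"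
  shows "extend s t n i (id1 I i) = n i"
proof -
  note [simp] = psn_typing(1-3)[OF assms(1)] psn_typing(1-3)[OF assms(2)] assms(4)
  have [simp]: "n i \<in> Cell2 K" "src2 K (n i) = psn_ob s i (id1 I i)" "trg2 K (n i) = psn_ob t i (id1 I i)"
    using omod_typing[OF assms(3,4)] by (simp_all add: colim_leg_def)
  show ?thesis
    using psn_typing(13)[OF assms(1), of "id1 I i" i] psn_typing(13)[OF assms(2), of "id1 I i" i]
    by (simp add: extend_def W_simps)
qed

lemma mods_eq_extend:
  assumes "pseudonat B s" "pseudonat B t" "m \<in> mods B s t"
  shows "m = extend s t (\<lambda>i. m i (id1 I i))"
  by (rule mods_unique[OF assms extend_mods[OF assms(1,2) omod_colim[OF assms]]])
    (simp add: extend_colim[OF assms(1,2) omod_colim[OF assms]])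

text \<open>Identities and composites are recognised as modifications by writing them as
  \<open>extend\<close> of the identity and composite modifications of the restricted cocones, so
  their axioms come from \<open>extend_mods\<close>.\<close>

lemma category_psnat_cat: "category (psnat_cat I W (repr_presheaf K F B))"
  unfolding psnat_cat_def
proof (rule category_tagged_cat)
  let ?e = "\<lambda>t. \<lambda>i\<in>Obj I. \<lambda>x\<in>Ob (pcat W i). Idn (pcat (repr_presheaf K F B) i) (psn_ob t i x)"
  let ?c = "\<lambda>n m. \<lambda>i\<in>Obj I. \<lambda>x\<in>Ob (pcat W i). Cmp (pcat (repr_presheaf K F B) i) (n i x) (m i x)"
  have ext: "m \<in> extensional (Obj I)" "i \<in> Obj I \<Longrightarrow> m i \<in> extensional (Ob (pcat W i))" if "m \<in> mods B s t" for s t m i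
    using that by (auto simp: psnat_mods_def)
  have eqI: "m = m'" if "m \<in> extensional (Obj I)" "m' \<in> extensional (Obj I)"
     "\<And>i. i \<in> Obj I \<Longrightarrow> m i \<in> extensional (Ob (pcat W i))" "\<And>i. i \<in> Obj I \<Longrightarrow> m' i \<in> extensional (Ob (pcat W i))"
     "\<And>x. x \<in> Cell1 I \<Longrightarrow> m (src1 I x) x = m' (src1 I x) x" for m m' :: "'s \<Rightarrow> 's \<Rightarrow> 'c"
    by (rule extensionalityI[OF that(1,2)], rule extensionalityI[OF that(3,4)]) (use that(5) in \<open>auto simp: W_simps\<close>)
  show "?e t \<in> mods B t t" if "t \<in> {t. pseudonat B t}" for t
  proof -
    have t: "pseudonat B t" using that by simp
    note [simp] = psn_typing(1-6,9-11)[OF t]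
    have "?e t = extend t t (\<lambda>i. id2 K (colim_leg t i))"
      by (rule eqI) (auto simp: extend_def W_simps repr_simps homcat_def colim_leg_def)
    then show ?thesis
      using extend_mods[OF t t omod_id[OF ococ_colim[OF t]]] by simp
  qed
  show "?c n m \<in> mods B s u" if "s \<in> {t. pseudonat B t}" "t \<in> {t. pseudonat B t}" "u \<in> {t. pseudonat B t}"
    "m \<in> mods B s t" "n \<in> mods B t u" for s t u m n
  proof -
    have p: "pseudonat B s" "pseudonat B t" "pseudonat B u" using that by auto
    note [simp] = psn_typing(1-6,9-11)[OF p(1)] psn_typing(1-6,9-11)[OF p(2)] psn_typing(1-6,9-11)[OF p(3)]
      mods_typing(1-3)[OF that(4)] mods_typing(1-3)[OF that(5)]
    have m: "m (src1 I x) x = extend s t (\<lambda>i. m i (id1 I i)) (src1 I x) x" and n: "n (src1 I x) x = extend t u (\<lambda>i. n i (id1 I i)) (src1 I x) x" for x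
      using mods_eq_extend[OF p(1,2) that(4)] mods_eq_extend[OF p(2,3) that(5)] by simp_all
    have "?c n m = extend s u (\<lambda>i. n i (id1 I i) \<odot> m i (id1 I i))"
    proof (rule eqI)
      fix x assume [simp]: "x \<in> Cell1 I"
      have "?c n m (src1 I x) x = n (src1 I x) x \<odot> m (src1 I x) x"
        by (simp add: W_simps repr_simps homcat_def)
      also have "\<dots> = extend s u (\<lambda>i. n i (id1 I i) \<odot> m i (id1 I i)) (src1 I x) x"
        unfolding m n by (simp add: extend_def W_simps)
      finally show "?c n m (src1 I x) x = extend s u (\<lambda>i. n i (id1 I i) \<odot> m i (id1 I i)) (src1 I x) x" .
    qed (simp_all add: extend_def)
    then show ?thesis
      using extend_mods[OF p(1,3) omod_comp[OF ococ_colim[OF p(1)] ococ_colim[OF p(2)] ococ_colim[OF p(3)] omod_colim[OF p(1,2) that(4)] omod_colim[OF p(2,3) that(5)]]]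
      by simp
  qed
  show "?c (?e t) m = m" "?c m (?e s) = m" if "s \<in> {t. pseudonat B t}" "t \<in> {t. pseudonat B t}" "m \<in> mods B s t" for s t m
    by (rule eqI; use that mods_typing(1-3)[OF that(3)] ext[OF that(3)] in \<open>auto simp: W_simps repr_simps homcat_def\<close>)+
  show "?c k (?c n m) = ?c (?c k n) m" if "m \<in> mods B s t" "n \<in> mods B t u" "k \<in> mods B u v" for s t u v m n k
    by (rule eqI; use mods_typing(1-3)[OF that(1)] mods_typing(1-3)[OF that(2)] mods_typing(1-3)[OF that(3)] in \<open>auto simp: W_simps repr_simps homcat_def\<close>)
qed

lemma weighted_postcomp_colim:
  assumes "pseudonat A t" "g \<in> Cell1 K" "src1 K g = A"
  shows "i \<in> Obj I \<Longrightarrow> colim_leg (weighted_postcomp_ob I K W t g) i = g \<cdot> colim_leg t i"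
    "d \<in> Cell1 I \<Longrightarrow> colim_cell (weighted_postcomp_ob I K W t g) d = g \<triangleright> colim_cell t d"
proof -
  note [simp] = psn_typing(1-6,9-11)[OF assms(1)] assms(2,3) valid_colim
  show "i \<in> Obj I \<Longrightarrow> colim_leg (weighted_postcomp_ob I K W t g) i = g \<cdot> colim_leg t i"
    by (simp add: weighted_postcomp_ob_def colim_leg_def W_simps)
  assume [simp]: "d \<in> Cell1 I"
  have "mk_arr (id1 I (src1 I d)) d (id2 I d) \<in> Arr (pcat W (src1 I d))"
    using W_Hom[OF valid_colim[OF \<open>d \<in> Cell1 I\<close> refl] _ refl, of "src1 I d"] by (simp add: Hom_def)
  then show "colim_cell (weighted_postcomp_ob I K W t g) d = g \<triangleright> colim_cell t d"
    by (simp add: weighted_postcomp_ob_def colim_cell_def W_simps(1))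
qed

end

text \<open>The universal property element by element, for families that need not be extensional:
  first essential surjectivity, then full faithfulness of composition with the cocone.\<close>

definition (in two_fun) ocolim :: "'o \<Rightarrow> ('i \<Rightarrow> 'a) \<Rightarrow> ('d \<Rightarrow> 'c) \<Rightarrow> bool" where
  "ocolim L q qc \<longleftrightarrow> L \<in> Obj K \<and> ococ L q qc \<and> (\<forall>B \<in> Obj K.
     (\<forall>r rc. ococ B r rc \<longrightarrow> (\<exists>g m. g \<in> hom1 K L B \<and>
        omod (\<lambda>i. g \<cdot>\<^bsub>K\<^esub> q i) (\<lambda>d. g \<triangleright>\<^bsub>K\<^esub> qc d) r rc m \<and> (\<forall>i \<in> Obj I. K.iso2 (m i)))) \<and>
     (\<forall>g h m. g \<in> hom1 K L B \<longrightarrow> h \<in> hom1 K L B \<longrightarrow>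
        omod (\<lambda>i. g \<cdot>\<^bsub>K\<^esub> q i) (\<lambda>d. g \<triangleright>\<^bsub>K\<^esub> qc d) (\<lambda>i. h \<cdot>\<^bsub>K\<^esub> q i) (\<lambda>d. h \<triangleright>\<^bsub>K\<^esub> qc d) m \<longrightarrow>
        (\<exists>!\<sigma>. \<sigma> \<in> hom2 K g h \<and> (\<forall>i \<in> Obj I. \<sigma> \<triangleleft>\<^bsub>K\<^esub> q i = m i))))"

context weighted
begin

text \<open>For a cocone, essential surjectivity is applied to its strict transformation
  \<open>coc_psnat\<close>, which restricts back to the cocone exactly. For 2-cells, modifications
  of cocones and of transformations correspond by \<open>extend\<close> and
  \<open>mods_unique\<close>.\<close>

lemma ocolim_weighted_bicolimit:
  assumes "weighted_bicolimit I K W F L t"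
  shows "ocolim L (colim_leg t) (colim_cell t)"
proof -
  have L: "L \<in> Obj K" and t: "pseudonat L t"
    and eq: "\<And>B. B \<in> Obj K \<Longrightarrow> is_equivalence (homcat K L B) (psnat_cat I W (repr_presheaf K F B)) (weighted_postcomp I K W t)"
    using assms by (auto simp: weighted_bicolimit_def)
  let ?wp = "weighted_postcomp_ob I K W t"
  note Lt = psn_typing(1-6,9-11)[OF t]
  have main: "(\<exists>g m. g \<in> hom1 K L B \<and> omod (\<lambda>i. g \<cdot> colim_leg t i) (\<lambda>d. g \<triangleright> colim_cell t d) r rc m \<and> (\<forall>i \<in> Obj I. K.iso2 (m i)))"
     if "ococ B r rc" "B \<in> Obj K" for B r rc
  proof -
    let ?D = "psnat_cat I W (repr_presheaf K F B)"
    interpret D: category ?D by (rule category_psnat_cat)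
    have FE: "ff_eso (homcat K L B) ?D (weighted_postcomp I K W t)"
      by (rule is_equivalence_imp_ff_eso[OF K.category_homcat category_psnat_cat eq[OF that(2)]])
    have p: "pseudonat B (coc_psnat r rc)"
      by (rule pseudonat_coc_psnat[OF that(1)])
    then have "coc_psnat r rc \<in> Ob ?D"
      by (simp add: psnat_cat_def tagged_cat_def)
    then obtain g k where g: "g \<in> Ob (homcat K L B)" and k: "k \<in> Hom ?D (onOb (weighted_postcomp I K W t) g) (coc_psnat r rc)" and ki: "invertible ?D k"
      using FE unfolding ff_eso_def by blast
    have g': "g \<in> hom1 K L B"
      using g by (simp add: homcat_def)
    have k: "k \<in> Hom ?D (?wp g) (coc_psnat r rc)"
      using k by (simp add: weighted_postcomp_def)
    then obtain m where m: "k = (?wp g, m, coc_psnat r rc)" "m \<in> mods B (?wp g) (coc_psnat r rc)" "pseudonat B (?wp g)"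
      by (auto simp: psnat_cat_def Hom_tagged_cat)
    obtain k' where k': "k' \<in> Hom ?D (coc_psnat r rc) (?wp g)" "Cmp ?D k' k = Idn ?D (?wp g)" "Cmp ?D k k' = Idn ?D (coc_psnat r rc)"
      using ki k by (rule D.invertibleE)
    then obtain m' where m': "k' = (coc_psnat r rc, m', ?wp g)" "m' \<in> mods B (coc_psnat r rc) (?wp g)"
      by (auto simp: psnat_cat_def Hom_tagged_cat)
    \<comment> \<open>An inverse arrow is a componentwise inverse modification; evaluating both
      identities at \<open>id1 I i\<close> produces the inverse of the 2-cell.\<close>
    have iso: "K.iso2 (m i (id1 I i))" if [simp]: "i \<in> Obj I" for i
    proof -
      note [simp] = mods_typing(1-3)[OF m(2)] mods_typing(1-3)[OF m'(2)]
      have "(\<lambda>i\<in>Obj I. \<lambda>x\<in>Ob (pcat W i). Cmp (pcat (repr_presheaf K F B) i) (m' i x) (m i x)) i (id1 I i) =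
          (\<lambda>i\<in>Obj I. \<lambda>x\<in>Ob (pcat W i). Idn (pcat (repr_presheaf K F B) i) (psn_ob (?wp g) i x)) i (id1 I i)"
        using k'(2) unfolding m m' by (simp add: psnat_cat_def tagged_cat_def)
      moreover have "(\<lambda>i\<in>Obj I. \<lambda>x\<in>Ob (pcat W i). Cmp (pcat (repr_presheaf K F B) i) (m i x) (m' i x)) i (id1 I i) =
          (\<lambda>i\<in>Obj I. \<lambda>x\<in>Ob (pcat W i). Idn (pcat (repr_presheaf K F B) i) (psn_ob (coc_psnat r rc) i x)) i (id1 I i)"
        using k'(3) unfolding m m' by (simp add: psnat_cat_def tagged_cat_def)
      ultimately show ?thesis
        by (intro K.iso2I[of _ "m' i (id1 I i)"]) (simp_all add: W_simps repr_simps homcat_def)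
    qed
    have "omod (\<lambda>i. g \<cdot> colim_leg t i) (\<lambda>d. g \<triangleright> colim_cell t d) r rc (\<lambda>i. m i (id1 I i))"
      by (rule omod_cong[OF omod_colim[OF m(3) p m(2)]])
        (use g' weighted_postcomp_colim[OF t] colim_coc_psnat[OF that(1)] in \<open>simp_all add: hom1_def\<close>)
    then show ?thesis
      using g' iso by blast
  qed
  moreover have "\<exists>!\<sigma>. \<sigma> \<in> hom2 K g h \<and> (\<forall>i \<in> Obj I. \<sigma> \<triangleleft> colim_leg t i = m i)"
    if g: "g \<in> hom1 K L B" and h: "h \<in> hom1 K L B" and B: "B \<in> Obj K"
      and om: "omod (\<lambda>i. g \<cdot> colim_leg t i) (\<lambda>d. g \<triangleright> colim_cell t d) (\<lambda>i. h \<cdot> colim_leg t i) (\<lambda>d. h \<triangleright> colim_cell t d) m" for B g h m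
  proof -
    let ?D = "psnat_cat I W (repr_presheaf K F B)" and ?P = "weighted_postcomp I K W t"
    have FE: "ff_eso (homcat K L B) ?D ?P"
      by (rule is_equivalence_imp_ff_eso[OF K.category_homcat category_psnat_cat eq[OF B]])
    have Ob: "g \<in> Ob (homcat K L B)" "h \<in> Ob (homcat K L B)"
      using g h by (simp_all add: homcat_def)
    have "is_functor (homcat K L B) ?D ?P"
      using FE by (simp add: ff_eso_def)
    note fn = functorD[OF this K.category_homcat]
    have p: "pseudonat B (?wp g)" "pseudonat B (?wp h)"
      using fn(1)[OF Ob(1)] fn(1)[OF Ob(2)] by (simp_all add: psnat_cat_def tagged_cat_def weighted_postcomp_def)
    have om': "omod (colim_leg (?wp g)) (colim_cell (?wp g)) (colim_leg (?wp h)) (colim_cell (?wp h)) m"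
      by (rule omod_cong[OF om]) (use g h weighted_postcomp_colim[OF t] in \<open>simp_all add: hom1_def\<close>)
    have bij: "bij_betw (onArr ?P) (Hom (homcat K L B) g h) (Hom ?D (?wp g) (?wp h))"
      using FE Ob unfolding ff_eso_def by (simp add: weighted_postcomp_def)
    have arr: "onArr ?P \<sigma> = (?wp g, \<lambda>i\<in>Obj I. \<lambda>x\<in>Ob (pcat W i). \<sigma> \<triangleleft> psn_ob t i x, ?wp h)" if "\<sigma> \<in> hom2 K g h" for \<sigma>
      using that by (simp add: weighted_postcomp_def hom2_def)
    have HomC: "\<sigma> \<in> Hom (homcat K L B) g h \<longleftrightarrow> \<sigma> \<in> hom2 K g h" for \<sigma>
      using g by (simp add: K.Hom_homcat)
    \<comment> \<open>\<open>m\<close> prescribes values at identities only. Its extension is an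
      arrow of the category of transformations, and the preimage of that arrow under the bijection
      is the required 2-cell.\<close>
    have "(?wp g, extend (?wp g) (?wp h) m, ?wp h) \<in> Hom ?D (?wp g) (?wp h)"
      using p extend_mods[OF p om'] by (simp add: psnat_cat_def Hom_tagged_cat)
    then have "(?wp g, extend (?wp g) (?wp h) m, ?wp h) \<in> onArr ?P ` Hom (homcat K L B) g h"
      unfolding bij_betw_imp_surj_on[OF bij] .
    then obtain \<sigma> where \<sigma>': "(?wp g, extend (?wp g) (?wp h) m, ?wp h) = onArr ?P \<sigma>" "\<sigma> \<in> Hom (homcat K L B) g h"
      by (rule imageE)
    note \<sigma> = \<sigma>'(2) \<sigma>'(1)[symmetric]
    have s2: "\<sigma> \<in> hom2 K g h"
      using \<sigma>(1) HomC by simp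
    show ?thesis
    proof (rule ex1I[of _ \<sigma>])
      have ev: "(\<lambda>i\<in>Obj I. \<lambda>x\<in>Ob (pcat W i). \<sigma> \<triangleleft> psn_ob t i x) i (id1 I i) = extend (?wp g) (?wp h) m i (id1 I i)" for i
        using \<sigma>(2) arr[OF s2] by simp
      have "\<sigma> \<triangleleft> colim_leg t i = m i" if "i \<in> Obj I" for i
        using ev[of i] extend_colim[OF p om' that] that by (simp add: W_simps(1) colim_leg_def)
      then show "\<sigma> \<in> hom2 K g h \<and> (\<forall>i\<in>Obj I. \<sigma> \<triangleleft> colim_leg t i = m i)"
        using s2 by simp
    next
      fix \<tau> assume \<tau>: "\<tau> \<in> hom2 K g h \<and> (\<forall>i\<in>Obj I. \<tau> \<triangleleft> colim_leg t i = m i)"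
      then have t2: "\<tau> \<in> hom2 K g h" by simp
      let ?a = "\<lambda>\<sigma>. \<lambda>i\<in>Obj I. \<lambda>x\<in>Ob (pcat W i). \<sigma> \<triangleleft> psn_ob t i x"
      have "onArr ?P \<tau> \<in> Hom ?D (?wp g) (?wp h)"
        using bij t2 HomC unfolding bij_betw_def by blast
      then have a: "?a \<tau> \<in> mods B (?wp g) (?wp h)"
        unfolding arr[OF t2] by (simp add: psnat_cat_def Hom_tagged_cat)
      have "?a \<tau> = extend (?wp g) (?wp h) m"
        by (rule mods_unique[OF p a extend_mods[OF p om']])
          (use \<tau> in \<open>simp add: extend_colim[OF p om'] W_simps(1) colim_leg_def\<close>)
      then have "onArr ?P \<tau> = onArr ?P \<sigma>"
        using arr[OF t2] \<sigma>(2) by simp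
      then show "\<tau> = \<sigma>"
        using bij t2 \<sigma>(1) HomC by (auto simp: bij_betw_def inj_on_def)
    qed
  qed
  ultimately show ?thesis
    using L ococ_colim[OF t] unfolding ocolim_def by blast
qed

end

section \<open>Smallness of the weight\<close>

lemma card_of_Times_ordLess:
  assumes "\<not> finite (Field \<kappa>)" "Card_order \<kappa>" "|A| <o \<kappa>" "|B| <o \<kappa>"
  shows "|A \<times> B| <o \<kappa>"
proof (cases "finite (A <+> B)")
  case True
  then have "finite (A \<times> B)"
    by (simp add: finite_Plus_iff)
  then show ?thesis
    using finite_ordLess_infinite[OF card_of_Well_order card_order_on_well_order_on[OF assms(2)] _ assms(1)]
    by (simp add: Field_card_of)
next
  case False
  \<comment> \<open>\<open>A \<times> B\<close> embeds into the square of \<open>A <+> B\<close>,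
    and an infinite set is equipollent to its square.\<close>
  have "|A \<times> B| \<le>o |(A <+> B) \<times> (A <+> B)|"
    using card_of_Times_mono1[OF card_of_Plus1] card_of_Times_mono2[OF card_of_Plus2] ordLeq_transitive by blast
  also have "|(A <+> B) \<times> (A <+> B)| =o |A <+> B|"
    by (rule card_of_Times_same_infinite[OF False])
  also have "|A <+> B| <o \<kappa>"
    by (rule card_of_Plus_ordLess_infinite_Field[OF assms])
  finally show ?thesis .
qed

text \<open>The weight lives in the type underlying \<kappa>, which is infinite and so admits a
  pairing function; it is small because its objects and arrows are bounded by products of the small
  sets of cells of \<open>I\<close>.\<close>

theorem ocolim_exists:
  fixes \<kappa> :: "'s rel" and I :: "('s, 's, 's) two_cat"
  assumes \<kappa>: "Cinfinite \<kappa>" and "two_category K" and bc: "bicocomplete \<kappa> K"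
    and small: "small_two_category \<kappa> I" and F: "two_functor I K F"
  shows "\<exists>L q qc. two_fun.ocolim I K F L q qc"
proof -
  have co: "Card_order \<kappa>" and inf: "\<not> finite (Field \<kappa>)"
    using \<kappa> by (auto simp: cinfinite_def)
  \<comment> \<open>\<open>Cinfinite \<kappa>\<close> makes the field of \<kappa>, hence the whole
    type, infinite; a bijection of the type with its square then serves as
    \<open>pr\<close>.\<close>
  have "infinite (UNIV :: 's set)"
    using inf finite_subset[OF subset_UNIV, of "Field \<kappa>"] by auto
  then have "|UNIV \<times> UNIV :: ('s \<times> 's) set| =o |UNIV :: 's set|"
    by (rule card_of_Times_same_infinite)
  then obtain pr :: "'s \<times> 's \<Rightarrow> 's" where pr: "inj pr"
    using card_of_ordIso[of "UNIV :: ('s \<times> 's) set" "UNIV :: 's set"] by (auto simp: bij_betw_def)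
  interpret weighted I pr K F
    using assms pr by (intro weighted.intro oplax_weight.intro two_fun.intro)
      (auto simp: small_two_category_def oplax_weight_axioms_def two_fun_axioms_def)
  have s: "|Cell1 I| <o \<kappa>" "|Cell2 I| <o \<kappa>"
    using small by (auto simp: small_two_category_def)
  have sC: "small_category \<kappa> (pcat W i)" for i
    unfolding small_category_def
  proof (intro conjI category_W)
    have "|Ob (pcat W i)| \<le>o |Cell1 I|"
      by (rule card_of_mono1) (auto simp: W_simps)
    then show "|Ob (pcat W i)| <o \<kappa>"
      using s(1) ordLeq_ordLess_trans by blast
    \<comment> \<open>Each arrow has a describing triple, so the arrows form part of the image of a
      small product; identifications made by the quotient only shrink this image.\<close>
    have "Arr (pcat W i) \<subseteq> (\<lambda>(d, e, \<sigma>). mk_arr d e \<sigma>) ` (Cell1 I \<times> Cell1 I \<times> Cell2 I)"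
    proof
      fix x assume "x \<in> Arr (pcat W i)"
      then obtain d e \<sigma> where "x = mk_arr d e \<sigma>" "valid d e \<sigma>"
        by (auto simp: W_simps)
      then show "x \<in> (\<lambda>(d, e, \<sigma>). mk_arr d e \<sigma>) ` (Cell1 I \<times> Cell1 I \<times> Cell2 I)"
        by (intro image_eqI[of _ _ "(d, e, \<sigma>)"]) (auto simp: valid_def)
    qed
    then have "|Arr (pcat W i)| \<le>o |Cell1 I \<times> Cell1 I \<times> Cell2 I|"
      using card_of_mono1 card_of_image ordLeq_transitive by blast
    moreover have "|Cell1 I \<times> Cell1 I \<times> Cell2 I| <o \<kappa>"
      by (intro card_of_Times_ordLess[OF inf co] s)
    ultimately show "|Arr (pcat W i)| <o \<kappa>"
      using ordLeq_ordLess_trans by blast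
  qed
  then obtain L t where "weighted_bicolimit I K W F L t"
    using bc small is_presheaf_W F unfolding bicocomplete_def by blast
  then show ?thesis
    using ocolim_weighted_bicolimit by blast
qed

section \<open>Cocones in the base and free algebras\<close>

context two_category
begin

lemma vinv_eqI:
  assumes "\<alpha> \<in> Cell2 K" "\<beta> \<in> Cell2 K" "src2 K \<beta> = trg2 K \<alpha>" "trg2 K \<beta> = src2 K \<alpha>"
    "\<beta> \<odot> \<alpha> = id2 K (src2 K \<alpha>)" "\<alpha> \<odot> \<beta> = id2 K (trg2 K \<alpha>)"
  shows "vinv \<alpha> = \<beta>"
proof -
  have i: "iso2 \<alpha>"
    using assms by (rule iso2I)
  show ?thesis
    by (rule iso2_cancel_left[of \<alpha>]) (use i assms in simp_all)
qed

lemma vinv_vcomp: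
  assumes "iso2 \<alpha>" "iso2 \<beta>" "src2 K \<beta> = trg2 K \<alpha>"
  shows "vinv (\<beta> \<odot> \<alpha>) = vinv \<alpha> \<odot> vinv \<beta>"
  by (rule vinv_eqI) (use assms in simp_all)

lemma vinv_of_lwhisker:
  assumes "iso2 \<alpha>" "f \<in> Cell1 K" "src1 K f = trg1 K (src2 K \<alpha>)"
  shows "vinv (f \<triangleright> \<alpha>) = f \<triangleright> vinv \<alpha>"
  by (rule vinv_eqI) (use assms vinv_lwhisker[OF assms] in simp_all)

lemma vinv_of_rwhisker:
  assumes "iso2 \<alpha>" "f \<in> Cell1 K" "src1 K (src2 K \<alpha>) = trg1 K f"
  shows "vinv (\<alpha> \<triangleleft> f) = vinv \<alpha> \<triangleleft> f"
  by (rule vinv_eqI) (use assms vinv_rwhisker[OF assms] in simp_all)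

end

section \<open>Pulling cocones back along transformations of diagrams\<close>

context two_fun
begin

text \<open>A transformation from \<open>D\<close> to \<open>F\<close> whose cells
  \<open>s_j D(d) \<Rightarrow> F(d) s_i\<close> point in the direction in which oplax cocones pull
  back: \<open>q_j s_j D(d) \<Rightarrow> q_j F(d) s_i \<Rightarrow> q_i s_i\<close>.\<close>

definition lax_nat :: "('i, 'd, 'e, 'o, 'a, 'c) two_fun \<Rightarrow> ('i \<Rightarrow> 'a) \<Rightarrow> ('d \<Rightarrow> 'c) \<Rightarrow> bool" where
  "lax_nat D s sc \<longleftrightarrow>
     (\<forall>i \<in> Obj I. s i \<in> Cell1 K \<and> src1 K (s i) = F0 D i \<and> trg1 K (s i) = F0 F i) \<and>
     (\<forall>d \<in> Cell1 I. sc d \<in> Cell2 K \<and> src2 K (sc d) = s (trg1 I d) \<cdot>\<^bsub>K\<^esub> F1 D d \<and>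
        trg2 K (sc d) = F1 F d \<cdot>\<^bsub>K\<^esub> s (src1 I d)) \<and>
     (\<forall>i \<in> Obj I. sc (id1 I i) = id2 K (s i)) \<and>
     (\<forall>d \<in> Cell1 I. \<forall>d' \<in> Cell1 I. src1 I d' = trg1 I d \<longrightarrow>
        sc (d' \<cdot>\<^bsub>I\<^esub> d) = (F1 F d' \<triangleright>\<^bsub>K\<^esub> sc d) \<odot>\<^bsub>K\<^esub> (sc d' \<triangleleft>\<^bsub>K\<^esub> F1 D d)) \<and>
     (\<forall>\<sigma> \<in> Cell2 I. sc (trg2 I \<sigma>) \<odot>\<^bsub>K\<^esub> (s (trg1 I (src2 I \<sigma>)) \<triangleright>\<^bsub>K\<^esub> F2 D \<sigma>) =
        (F2 F \<sigma> \<triangleleft>\<^bsub>K\<^esub> s (src1 I (src2 I \<sigma>))) \<odot>\<^bsub>K\<^esub> sc (src2 I \<sigma>))"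

lemma lax_nat_typing:
  assumes "lax_nat D s sc"
  shows "i \<in> Obj I \<Longrightarrow> s i \<in> Cell1 K" "i \<in> Obj I \<Longrightarrow> src1 K (s i) = F0 D i" "i \<in> Obj I \<Longrightarrow> trg1 K (s i) = F0 F i"
    "d \<in> Cell1 I \<Longrightarrow> sc d \<in> Cell2 K" "d \<in> Cell1 I \<Longrightarrow> src2 K (sc d) = s (trg1 I d) \<cdot>\<^bsub>K\<^esub> F1 D d"
    "d \<in> Cell1 I \<Longrightarrow> trg2 K (sc d) = F1 F d \<cdot>\<^bsub>K\<^esub> s (src1 I d)" "i \<in> Obj I \<Longrightarrow> sc (id1 I i) = id2 K (s i)"
    "d \<in> Cell1 I \<Longrightarrow> d' \<in> Cell1 I \<Longrightarrow> src1 I d' = trg1 I d \<Longrightarrow>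
        sc (d' \<cdot>\<^bsub>I\<^esub> d) = (F1 F d' \<triangleright>\<^bsub>K\<^esub> sc d) \<odot>\<^bsub>K\<^esub> (sc d' \<triangleleft>\<^bsub>K\<^esub> F1 D d)"
    "\<sigma> \<in> Cell2 I \<Longrightarrow> sc (trg2 I \<sigma>) \<odot>\<^bsub>K\<^esub> (s (trg1 I (src2 I \<sigma>)) \<triangleright>\<^bsub>K\<^esub> F2 D \<sigma>) =
        (F2 F \<sigma> \<triangleleft>\<^bsub>K\<^esub> s (src1 I (src2 I \<sigma>))) \<odot>\<^bsub>K\<^esub> sc (src2 I \<sigma>)"
  using assms by (simp_all add: lax_nat_def)

lemma ococ_restrict:
  assumes "two_fun I K D" "lax_nat D s sc" "ococ B q qc"
  shows "two_fun.ococ I K D B (\<lambda>i. q i \<cdot>\<^bsub>K\<^esub> s i) (\<lambda>d. (qc d \<triangleleft>\<^bsub>K\<^esub> s (src1 I d)) \<odot>\<^bsub>K\<^esub> (q (trg1 I d) \<triangleright>\<^bsub>K\<^esub> sc d))"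
proof -
  interpret D: two_fun I K D by fact
  note [simp] = lax_nat_typing(1-8)[OF assms(2)] ococ_typing[OF assms(3)]
  show ?thesis
    unfolding D.ococ_def
  proof (intro conjI ballI impI)
    fix d d' assume [simp]: "d \<in> Cell1 I" "d' \<in> Cell1 I" "src1 I d' = trg1 I d"
    have 1: "(q (trg1 I d) \<triangleright>\<^bsub>K\<^esub> sc d) \<odot>\<^bsub>K\<^esub> (qc d' \<triangleleft>\<^bsub>K\<^esub> s (trg1 I d) \<cdot>\<^bsub>K\<^esub> F1 D d) =
       (qc d' \<triangleleft>\<^bsub>K\<^esub> F1 F d \<cdot>\<^bsub>K\<^esub> s (src1 I d)) \<odot>\<^bsub>K\<^esub> (q (trg1 I d') \<cdot>\<^bsub>K\<^esub> F1 F d' \<triangleright>\<^bsub>K\<^esub> sc d)"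
      using K.swap[of "sc d" "qc d'"] by simp
    show "(qc (d' \<cdot>\<^bsub>I\<^esub> d) \<triangleleft>\<^bsub>K\<^esub> s (src1 I (d' \<cdot>\<^bsub>I\<^esub> d))) \<odot>\<^bsub>K\<^esub> (q (trg1 I (d' \<cdot>\<^bsub>I\<^esub> d)) \<triangleright>\<^bsub>K\<^esub> sc (d' \<cdot>\<^bsub>I\<^esub> d)) =
      ((qc d \<triangleleft>\<^bsub>K\<^esub> s (src1 I d)) \<odot>\<^bsub>K\<^esub> (q (trg1 I d) \<triangleright>\<^bsub>K\<^esub> sc d)) \<odot>\<^bsub>K\<^esub>
      (((qc d' \<triangleleft>\<^bsub>K\<^esub> s (src1 I d')) \<odot>\<^bsub>K\<^esub> (q (trg1 I d') \<triangleright>\<^bsub>K\<^esub> sc d')) \<triangleleft>\<^bsub>K\<^esub> F1 D d)"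
      by (simp add: K.vcomp_eq_ext[OF 1])
  next
    fix \<sigma> assume [simp]: "\<sigma> \<in> Cell2 I"
    let ?i = "src1 I (src2 I \<sigma>)" and ?j = "trg1 I (src2 I \<sigma>)"
    have 1: "(q ?j \<triangleright>\<^bsub>K\<^esub> sc (trg2 I \<sigma>)) \<odot>\<^bsub>K\<^esub> (q ?j \<cdot>\<^bsub>K\<^esub> s ?j \<triangleright>\<^bsub>K\<^esub> F2 D \<sigma>) =
       (q ?j \<triangleright>\<^bsub>K\<^esub> (F2 F \<sigma> \<triangleleft>\<^bsub>K\<^esub> s ?i)) \<odot>\<^bsub>K\<^esub> (q ?j \<triangleright>\<^bsub>K\<^esub> sc (src2 I \<sigma>))"
      using arg_cong[OF lax_nat_typing(9)[OF assms(2), of \<sigma>], of "lwhisker K (q ?j)"] by simp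
    have 2: "(qc (trg2 I \<sigma>) \<triangleleft>\<^bsub>K\<^esub> s ?i) \<odot>\<^bsub>K\<^esub> (q ?j \<triangleright>\<^bsub>K\<^esub> (F2 F \<sigma> \<triangleleft>\<^bsub>K\<^esub> s ?i)) = qc (src2 I \<sigma>) \<triangleleft>\<^bsub>K\<^esub> s ?i"
      using arg_cong[OF ococ_2[OF assms(3) _ refl, of \<sigma>], of "\<lambda>z. rwhisker K z (s ?i)"] by simp
    show "((qc (trg2 I \<sigma>) \<triangleleft>\<^bsub>K\<^esub> s (src1 I (trg2 I \<sigma>))) \<odot>\<^bsub>K\<^esub> (q (trg1 I (trg2 I \<sigma>)) \<triangleright>\<^bsub>K\<^esub> sc (trg2 I \<sigma>))) \<odot>\<^bsub>K\<^esub>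
      ((q ?j \<cdot>\<^bsub>K\<^esub> s ?j) \<triangleright>\<^bsub>K\<^esub> F2 D \<sigma>) = (qc (src2 I \<sigma>) \<triangleleft>\<^bsub>K\<^esub> s ?i) \<odot>\<^bsub>K\<^esub> (q ?j \<triangleright>\<^bsub>K\<^esub> sc (src2 I \<sigma>))"
      by (simp add: 1 K.vcomp_eq_ext[OF 2])
  qed simp_all
qed

lemma omod_restrict:
  assumes "two_fun I K D" "lax_nat D s sc" "ococ B q qc" "ococ B r rc" "omod q qc r rc m"
  shows "two_fun.omod I K D (\<lambda>i. q i \<cdot>\<^bsub>K\<^esub> s i) (\<lambda>d. (qc d \<triangleleft>\<^bsub>K\<^esub> s (src1 I d)) \<odot>\<^bsub>K\<^esub> (q (trg1 I d) \<triangleright>\<^bsub>K\<^esub> sc d))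
      (\<lambda>i. r i \<cdot>\<^bsub>K\<^esub> s i) (\<lambda>d. (rc d \<triangleleft>\<^bsub>K\<^esub> s (src1 I d)) \<odot>\<^bsub>K\<^esub> (r (trg1 I d) \<triangleright>\<^bsub>K\<^esub> sc d)) (\<lambda>i. m i \<triangleleft>\<^bsub>K\<^esub> s i)"
proof -
  interpret D: two_fun I K D by fact
  note [simp] = lax_nat_typing(1-6)[OF assms(2)] ococ_typing(1-6)[OF assms(3)] ococ_typing(1-6)[OF assms(4)] omod_typing[OF assms(5)]
  show ?thesis
    unfolding D.omod_def
  proof (intro conjI ballI impI)
    fix d assume [simp]: "d \<in> Cell1 I"
    let ?i = "src1 I d" and ?j = "trg1 I d"
    have 1: "(m ?i \<triangleleft>\<^bsub>K\<^esub> s ?i) \<odot>\<^bsub>K\<^esub> (qc d \<triangleleft>\<^bsub>K\<^esub> s ?i) = (rc d \<triangleleft>\<^bsub>K\<^esub> s ?i) \<odot>\<^bsub>K\<^esub> (m ?j \<triangleleft>\<^bsub>K\<^esub> F1 F d \<cdot>\<^bsub>K\<^esub> s ?i)"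
      using arg_cong[OF omod_nat[OF assms(5) _ refl refl, of d], of "\<lambda>z. rwhisker K z (s ?i)"] by simp
    have 2: "(m ?j \<triangleleft>\<^bsub>K\<^esub> F1 F d \<cdot>\<^bsub>K\<^esub> s ?i) \<odot>\<^bsub>K\<^esub> (q ?j \<triangleright>\<^bsub>K\<^esub> sc d) = (r ?j \<triangleright>\<^bsub>K\<^esub> sc d) \<odot>\<^bsub>K\<^esub> (m ?j \<triangleleft>\<^bsub>K\<^esub> s ?j \<cdot>\<^bsub>K\<^esub> F1 D d)"
      using K.swap[of "sc d" "m ?j"] by simp
    show "(m ?i \<triangleleft>\<^bsub>K\<^esub> s ?i) \<odot>\<^bsub>K\<^esub> ((qc d \<triangleleft>\<^bsub>K\<^esub> s ?i) \<odot>\<^bsub>K\<^esub> (q ?j \<triangleright>\<^bsub>K\<^esub> sc d)) =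
       ((rc d \<triangleleft>\<^bsub>K\<^esub> s ?i) \<odot>\<^bsub>K\<^esub> (r ?j \<triangleright>\<^bsub>K\<^esub> sc d)) \<odot>\<^bsub>K\<^esub> ((m ?j \<triangleleft>\<^bsub>K\<^esub> s ?j) \<triangleleft>\<^bsub>K\<^esub> F1 D d)"
      by (simp add: K.vcomp_eq_ext[OF 1] 2)
  qed simp_all
qed

end

text \<open>To be instantiated at \<open>U F\<close>, \<open>T U F\<close> and
  \<open>T T U F\<close>, the \<open>TD\<close> of one instance being the diagram of the
  next.\<close>

locale psmonad_diagram = psmonad C M + D: two_fun I C D
  for C :: "('o, 'a, 'c) two_cat" (structure) and M and I :: "('i, 'd, 'e) two_cat" and D
begin

abbreviation "TD \<equiv> comp_two_fun (endo M) D"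

lemma TD_simps [simp]:
  "F0 TD i = T0 M (F0 D i)" "F1 TD d = T1 M (F1 D d)" "F2 TD \<sigma> = T2 M (F2 D \<sigma>)"
  by (simp_all add: comp_two_fun_def)

lemma two_fun_TD: "two_fun I C TD"
proof
  show "two_functor I C TD"
    unfolding two_functor_def is_functor_def
    by (auto simp: cat1_def vcat_def hcat_def Hom_def D.F2_hcomp T.F2_hcomp)
qed

sublocale TD: two_fun I C TD
  by (rule two_fun_TD)

text \<open>
  The universal property that the free algebra on an oplax bicolimit of \<open>D\<close> has in the 2-category of
  pseudo-algebras, with respect to cocones on \<open>D\<close> in the base.
\<close>

definition fcolim :: "('o, 'a, 'c) psalg \<Rightarrow> ('i \<Rightarrow> 'a) \<Rightarrow> ('d \<Rightarrow> 'c) \<Rightarrow> bool" where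
  "fcolim X e ec \<longleftrightarrow> alg X \<and> D.ococ (alg_ob X) e ec \<and> (\<forall>B. alg B \<longrightarrow>
     (\<forall>r rc. D.ococ (alg_ob B) r rc \<longrightarrow> (\<exists>u m. mor u \<and> mor_src u = X \<and> mor_trg u = B \<and>
        D.omod (\<lambda>i. mor_fun u \<cdot> e i) (\<lambda>d. mor_fun u \<triangleright> ec d) r rc m \<and> (\<forall>i \<in> Obj I. iso2 (m i)))) \<and>
     (\<forall>u v m. mor u \<longrightarrow> mor v \<longrightarrow> mor_src u = X \<longrightarrow> mor_src v = X \<longrightarrow> mor_trg u = B \<longrightarrow> mor_trg v = B \<longrightarrow>
        D.omod (\<lambda>i. mor_fun u \<cdot> e i) (\<lambda>d. mor_fun u \<triangleright> ec d) (\<lambda>i. mor_fun v \<cdot> e i) (\<lambda>d. mor_fun v \<triangleright> ec d) m \<longrightarrow>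
        (\<exists>!\<Sigma>. transf \<Sigma> \<and> trans_src \<Sigma> = u \<and> trans_trg \<Sigma> = v \<and> (\<forall>i \<in> Obj I. trans_cell \<Sigma> \<triangleleft> e i = m i))))"

text \<open>Pseudomorphisms \<open>free L \<rightarrow> B\<close> are equivalent to 1-cells
  \<open>L \<rightarrow> alg_ob B\<close>: \<open>ext\<close> and \<open>ev\<close> give essential
  surjectivity, \<open>free_full\<close> and \<open>free_faithful\<close> the bijection on 2-cells.
  The universal property of \<open>L\<close> does the rest.\<close>

lemma fcolim_free:
  assumes "D.ocolim L q qc"
  shows "fcolim (free L) (\<lambda>i. \<eta> M L \<cdot> q i) (\<lambda>d. \<eta> M L \<triangleright> qc d)"
  unfolding fcolim_def
proof (intro conjI allI impI)
  have L [simp]: "L \<in> Obj C" and q: "D.ococ L q qc"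
    using assms by (auto simp: D.ocolim_def)
  note [simp] = D.ococ_typing(1-6)[OF q]
  show "alg (free L)"
    by (simp only: alg_free L)
  show "D.ococ (alg_ob (free L)) (\<lambda>i. \<eta> M L \<cdot> q i) (\<lambda>d. \<eta> M L \<triangleright> qc d)"
    using D.ococ_lwhisker[OF q, of "\<eta> M L"] by simp
  fix B assume B: "alg B"
  show "\<exists>u m. mor u \<and> mor_src u = free L \<and> mor_trg u = B \<and>
        D.omod (\<lambda>i. mor_fun u \<cdot> (\<eta> M L \<cdot> q i)) (\<lambda>d. mor_fun u \<triangleright> (\<eta> M L \<triangleright> qc d)) r rc m \<and> (\<forall>i \<in> Obj I. iso2 (m i))"
    if r: "D.ococ (alg_ob B) r rc" for r rc
  proof -
    obtain g m where g: "g \<in> hom1 C L (alg_ob B)" and m: "D.omod (\<lambda>i. g \<cdot> q i) (\<lambda>d. g \<triangleright> qc d) r rc m" "\<forall>i \<in> Obj I. iso2 (m i)"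
      using assms r alg_typing(1)[OF B] unfolding D.ocolim_def by blast
    have [simp]: "g \<in> Cell1 C" "src1 C g = L" "trg1 C g = alg_ob B"
      using g by (auto simp: hom1_def)
    note [simp] = B
    have gq: "D.ococ (alg_ob B) (\<lambda>i. g \<cdot> q i) (\<lambda>d. g \<triangleright> qc d)"
      using D.ococ_lwhisker[OF q, of g] by simp
    \<comment> \<open>\<open>?h\<close> is the restriction of \<open>ext B g\<close> along the unit,
      and \<open>ev B g\<close> compares it with \<open>g\<close>. Whiskered with the legs, this
      corrects the modification \<open>m\<close> supplied by \<open>L\<close>.\<close>
    let ?h = "alg_act B \<cdot> (T1 M g \<cdot> \<eta> M L)"
    have hq: "D.ococ (alg_ob B) (\<lambda>i. ?h \<cdot> q i) (\<lambda>d. ?h \<triangleright> qc d)"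
      using D.ococ_lwhisker[OF q, of ?h] by simp
    have "D.omod (\<lambda>i. ?h \<cdot> q i) (\<lambda>d. ?h \<triangleright> qc d) (\<lambda>i. g \<cdot> q i) (\<lambda>d. g \<triangleright> qc d) (\<lambda>i. ev B g \<triangleleft> q i)"
      by (rule D.omod_rwhisker[OF q]) simp_all
    from D.omod_comp[OF hq gq r this m(1)]
    have "D.omod (\<lambda>i. ?h \<cdot> q i) (\<lambda>d. ?h \<triangleright> qc d) r rc (\<lambda>i. m i \<odot> (ev B g \<triangleleft> q i))" .
    then have "D.omod (\<lambda>i. mor_fun (ext B g) \<cdot> (\<eta> M L \<cdot> q i)) (\<lambda>d. mor_fun (ext B g) \<triangleright> (\<eta> M L \<triangleright> qc d)) r rc (\<lambda>i. m i \<odot> (ev B g \<triangleleft> q i))"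
      by (rule D.omod_cong) (simp_all add: ext_def)
    moreover have "\<forall>i \<in> Obj I. iso2 (m i \<odot> (ev B g \<triangleleft> q i))"
      using m(2) D.omod_typing[OF m(1)] by simp
    ultimately show ?thesis
      by (intro exI[of _ "ext B g"] exI[of _ "\<lambda>i. m i \<odot> (ev B g \<triangleleft> q i)"]) (simp add: mor_ext, simp add: ext_def)
  qed
  show "\<exists>!\<Sigma>. transf \<Sigma> \<and> trans_src \<Sigma> = u \<and> trans_trg \<Sigma> = v \<and> (\<forall>i \<in> Obj I. trans_cell \<Sigma> \<triangleleft> (\<eta> M L \<cdot> q i) = m i)"
    if uv: "mor u" "mor v" "mor_src u = free L" "mor_src v = free L" "mor_trg u = B" "mor_trg v = B"
      and m: "D.omod (\<lambda>i. mor_fun u \<cdot> (\<eta> M L \<cdot> q i)) (\<lambda>d. mor_fun u \<triangleright> (\<eta> M L \<triangleright> qc d)) (\<lambda>i. mor_fun v \<cdot> (\<eta> M L \<cdot> q i)) (\<lambda>d. mor_fun v \<triangleright> (\<eta> M L \<triangleright> qc d)) m" for u v m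
  proof -
    note [simp] = B uv
    let ?g = "mor_fun u \<cdot> \<eta> M L" and ?h = "mor_fun v \<cdot> \<eta> M L"
    have "D.omod (\<lambda>i. ?g \<cdot> q i) (\<lambda>d. ?g \<triangleright> qc d) (\<lambda>i. ?h \<cdot> q i) (\<lambda>d. ?h \<triangleright> qc d) m"
      by (rule D.omod_cong[OF m]) simp_all
    moreover have "?g \<in> hom1 C L (alg_ob B)" "?h \<in> hom1 C L (alg_ob B)"
      by (simp_all add: hom1_def)
    ultimately have ex: "\<exists>!\<tau>. \<tau> \<in> hom2 C ?g ?h \<and> (\<forall>i \<in> Obj I. \<tau> \<triangleleft> q i = m i)"
      using assms alg_typing(1)[OF B] unfolding D.ocolim_def by blast
    then obtain \<tau> where \<tau>: "\<tau> \<in> hom2 C ?g ?h" "\<forall>i \<in> Obj I. \<tau> \<triangleleft> q i = m i"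
      by blast
    obtain \<Sigma> where \<Sigma>: "transf \<Sigma>" "trans_src \<Sigma> = u" "trans_trg \<Sigma> = v" "trans_cell \<Sigma> \<triangleleft> \<eta> M L = \<tau>"
      using free_full[OF uv(1-6) L, of \<tau>] \<tau>(1) by (auto simp: hom2_def)
    have w: "S \<triangleleft> (\<eta> M L \<cdot> q i) = (S \<triangleleft> \<eta> M L) \<triangleleft> q i" if "S \<in> Cell2 C" "src2 C S = mor_fun u" "i \<in> Obj I" for S i
      using that by simp
    show ?thesis
    proof (rule ex1I[of _ \<Sigma>])
      show "transf \<Sigma> \<and> trans_src \<Sigma> = u \<and> trans_trg \<Sigma> = v \<and> (\<forall>i\<in>Obj I. trans_cell \<Sigma> \<triangleleft> \<eta> M L \<cdot> q i = m i)"
        using \<Sigma> \<tau>(2) w[of "trans_cell \<Sigma>"] by simp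
    next
      fix S assume S: "transf S \<and> trans_src S = u \<and> trans_trg S = v \<and> (\<forall>i\<in>Obj I. trans_cell S \<triangleleft> \<eta> M L \<cdot> q i = m i)"
      then have s: "transf S" "trans_src S = u" "trans_trg S = v"
        by auto
      have "trans_cell S \<triangleleft> \<eta> M L \<in> hom2 C ?g ?h"
        using s by (simp add: hom2_def)
      moreover have "(trans_cell S \<triangleleft> \<eta> M L) \<triangleleft> q i = m i" if i: "i \<in> Obj I" for i
      proof -
        have "(trans_cell S \<triangleleft> \<eta> M L) \<triangleleft> q i = trans_cell S \<triangleleft> (\<eta> M L \<cdot> q i)"
          using s i by simp
        also have "\<dots> = m i"
          using S i by blast
        finally show ?thesis .
      qed
      ultimately have "trans_cell S \<triangleleft> \<eta> M L = \<tau>"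
        using ex \<tau> by blast
      then show "S = \<Sigma>"
        using free_faithful[OF s(1) \<Sigma>(1) _ L] s \<Sigma> by simp
    qed
  qed
qed

text \<open>Applying \<open>T\<close> and then the action of the tip sends cocones on
  \<open>D\<close> to cocones on \<open>T D\<close>. For a cocone of pseudomorphisms this is the
  domain of its structure cells.\<close>

lemma ococ_act:
  assumes "D.ococ (alg_ob B) q qc" "alg B"
  shows "TD.ococ (alg_ob B) (\<lambda>i. alg_act B \<cdot> T1 M (q i)) (\<lambda>d. alg_act B \<triangleright> T2 M (qc d))"
proof -
  note [simp] = D.ococ_typing[OF assms(1)] assms(2)
  show ?thesis
    unfolding TD.ococ_def
  proof (intro conjI ballI impI)
    fix \<sigma> assume [simp]: "\<sigma> \<in> Cell2 I"
    show "(alg_act B \<triangleright> T2 M (qc (trg2 I \<sigma>))) \<odot> ((alg_act B \<cdot> T1 M (q (trg1 I (src2 I \<sigma>)))) \<triangleright> F2 TD \<sigma>) = alg_act B \<triangleright> T2 M (qc (src2 I \<sigma>))"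
      using arg_cong[OF D.ococ_2[OF assms(1) _ refl, of \<sigma>], of "\<lambda>z. alg_act B \<triangleright> T2 M z"] by simp
  qed simp_all
qed

lemma omod_act:
  assumes "D.ococ (alg_ob B) q qc" "D.ococ (alg_ob B) r rc" "D.omod q qc r rc m" "alg B"
  shows "TD.omod (\<lambda>i. alg_act B \<cdot> T1 M (q i)) (\<lambda>d. alg_act B \<triangleright> T2 M (qc d)) (\<lambda>i. alg_act B \<cdot> T1 M (r i)) (\<lambda>d. alg_act B \<triangleright> T2 M (rc d))
    (\<lambda>i. alg_act B \<triangleright> T2 M (m i))"
proof -
  note [simp] = D.ococ_typing(1-6)[OF assms(1)] D.ococ_typing(1-6)[OF assms(2)] D.omod_typing[OF assms(3)] assms(4)
  show ?thesis
    unfolding TD.omod_def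
  proof (intro conjI ballI impI)
    fix d assume [simp]: "d \<in> Cell1 I"
    show "(alg_act B \<triangleright> T2 M (m (src1 I d))) \<odot> (alg_act B \<triangleright> T2 M (qc d)) = (alg_act B \<triangleright> T2 M (rc d)) \<odot> ((alg_act B \<triangleright> T2 M (m (trg1 I d))) \<triangleleft> F1 TD d)"
      using arg_cong[OF D.omod_nat[OF assms(3) _ refl refl, of d], of "\<lambda>z. alg_act B \<triangleright> T2 M z"] by simp
  qed simp_all
qed

text \<open>By interchange, the structure cell of a pseudomorphism \<open>u\<close> compares acting
  after \<open>u\<close> with acting before \<open>u\<close>, compatibly with the cocone
  cells.\<close>

lemma omod_mor_act:
  assumes "mor u" "mor_src u = X" "mor_trg u = B" "D.ococ (alg_ob X) s sc"
  shows "TD.omod (\<lambda>i. alg_act B \<cdot> T1 M (mor_fun u \<cdot> s i)) (\<lambda>d. alg_act B \<triangleright> T2 M (mor_fun u \<triangleright> sc d))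
    (\<lambda>i. mor_fun u \<cdot> (alg_act X \<cdot> T1 M (s i))) (\<lambda>d. mor_fun u \<triangleright> (alg_act X \<triangleright> T2 M (sc d))) (\<lambda>i. mor_cell u \<triangleleft> T1 M (s i))"
proof -
  have [simp]: "alg X" "alg B"
    using mor_typing(1,2)[OF assms(1)] assms(2,3) by auto
  note [simp] = assms(1-3) D.ococ_typing(1-6)[OF assms(4)]
  show ?thesis
    unfolding TD.omod_def
  proof (intro conjI ballI impI)
    fix d assume [simp]: "d \<in> Cell1 I"
    show "(mor_cell u \<triangleleft> T1 M (s (src1 I d))) \<odot> (alg_act B \<triangleright> T2 M (mor_fun u \<triangleright> sc d)) =
       (mor_fun u \<triangleright> (alg_act X \<triangleright> T2 M (sc d))) \<odot> ((mor_cell u \<triangleleft> T1 M (s (trg1 I d))) \<triangleleft> F1 TD d)"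
      using swap[of "T2 M (sc d)" "mor_cell u"] by simp
  qed simp_all
qed

lemma lax_nat_T:
  assumes "two_fun I C E" "D.lax_nat E s sc"
  shows "TD.lax_nat (comp_two_fun (endo M) E) (\<lambda>i. T1 M (s i)) (\<lambda>d. T2 M (sc d))"
proof -
  interpret E: two_fun I C E by fact
  note [simp] = D.lax_nat_typing(1-8)[OF assms(2)]
  have [simp]: "F0 (comp_two_fun (endo M) E) i = T0 M (F0 E i)" "F1 (comp_two_fun (endo M) E) d = T1 M (F1 E d)"
    "F2 (comp_two_fun (endo M) E) \<sigma> = T2 M (F2 E \<sigma>)" for i d \<sigma>
    by (simp_all add: comp_two_fun_def)
  show ?thesis
    unfolding TD.lax_nat_def
  proof (intro conjI ballI impI)
    fix \<sigma> assume [simp]: "\<sigma> \<in> Cell2 I"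
    show "T2 M (sc (trg2 I \<sigma>)) \<odot> (T1 M (s (trg1 I (src2 I \<sigma>))) \<triangleright> F2 (comp_two_fun (endo M) E) \<sigma>) =
       (F2 TD \<sigma> \<triangleleft> T1 M (s (src1 I (src2 I \<sigma>)))) \<odot> T2 M (sc (src2 I \<sigma>))"
      using arg_cong[OF D.lax_nat_typing(9)[OF assms(2), of \<sigma>], of "T2 M"] by simp
  qed simp_all
qed

text \<open>The naturality cells of the unit point from \<open>Tf \<eta>\<close> to
  \<open>\<eta> f\<close>, against the orientation of \<open>lax_nat\<close>, so their inverses are
  taken; those of \<open>\<mu>\<close> fit as they are.\<close>

lemma lax_nat_eta: "TD.lax_nat D (\<lambda>i. \<eta> M (F0 D i)) (\<lambda>d. vinv (\<eta>n M (F1 D d)))"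
  unfolding TD.lax_nat_def
proof (intro conjI ballI impI)
  fix \<sigma> assume [simp]: "\<sigma> \<in> Cell2 I"
  let ?i = "src1 I (src2 I \<sigma>)" and ?j = "trg1 I (src2 I \<sigma>)" and ?f = "F1 D (src2 I \<sigma>)" and ?g = "F1 D (trg2 I \<sigma>)"
  have 1: "\<eta>n M ?g \<odot> (T2 M (F2 D \<sigma>) \<triangleleft> \<eta> M (F0 D ?i)) = (\<eta> M (F0 D ?j) \<triangleright> F2 D \<sigma>) \<odot> \<eta>n M ?f"
    by (rule eta_nat_2) simp_all
  show "vinv (\<eta>n M ?g) \<odot> (\<eta> M (F0 D ?j) \<triangleright> F2 D \<sigma>) = (F2 TD \<sigma> \<triangleleft> \<eta> M (F0 D ?i)) \<odot> vinv (\<eta>n M ?f)"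
  proof (rule iso2_cancel_left[of "\<eta>n M ?g"])
    show "\<eta>n M ?g \<odot> (vinv (\<eta>n M ?g) \<odot> (\<eta> M (F0 D ?j) \<triangleright> F2 D \<sigma>)) = \<eta>n M ?g \<odot> ((F2 TD \<sigma> \<triangleleft> \<eta> M (F0 D ?i)) \<odot> vinv (\<eta>n M ?f))"
      by (simp add: vcomp_eq_ext[OF 1])
  qed simp_all
qed (simp_all add: vinv_vcomp vinv_of_lwhisker vinv_of_rwhisker vinv_id2)

lemma lax_nat_mu: "TD.lax_nat (comp_two_fun (endo M) TD) (\<lambda>i. \<mu> M (F0 D i)) (\<lambda>d. \<mu>n M (F1 D d))"
proof -
  have [simp]: "F0 (comp_two_fun (endo M) TD) i = T0 M (T0 M (F0 D i))" "F1 (comp_two_fun (endo M) TD) d = T1 M (T1 M (F1 D d))"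
    "F2 (comp_two_fun (endo M) TD) \<sigma> = T2 M (T2 M (F2 D \<sigma>))" for i d \<sigma>
    by (simp_all add: comp_two_fun_def)
  show ?thesis
    unfolding TD.lax_nat_def
  proof (intro conjI ballI impI)
    fix \<sigma> assume [simp]: "\<sigma> \<in> Cell2 I"
    show "\<mu>n M (F1 D (trg2 I \<sigma>)) \<odot> (\<mu> M (F0 D (trg1 I (src2 I \<sigma>))) \<triangleright> F2 (comp_two_fun (endo M) TD) \<sigma>) =
       (F2 TD \<sigma> \<triangleleft> \<mu> M (F0 D (src1 I (src2 I \<sigma>)))) \<odot> \<mu>n M (F1 D (src2 I \<sigma>))"
      using mu_nat_2[of "F2 D \<sigma>" "F1 D (src2 I \<sigma>)" "F1 D (trg2 I \<sigma>)" "F0 D (src1 I (src2 I \<sigma>))" "F0 D (trg1 I (src2 I \<sigma>))"] by simp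
  qed simp_all
qed

text \<open>The cocone \<open>b Tq\<close> on \<open>T D\<close>, pulled back along the unit, is
  isomorphic to \<open>q\<close> by \<open>ev\<close>. The cell \<open>N0\<close> of the resolution
  comes from this.\<close>

lemma omod_ev:
  assumes "D.ococ (alg_ob B) q qc" "alg B"
  shows "D.omod (\<lambda>i. (alg_act B \<cdot> T1 M (q i)) \<cdot> \<eta> M (F0 D i))
     (\<lambda>d. ((alg_act B \<triangleright> T2 M (qc d)) \<triangleleft> \<eta> M (F0 D (src1 I d))) \<odot> ((alg_act B \<cdot> T1 M (q (trg1 I d))) \<triangleright> vinv (\<eta>n M (F1 D d))))
     q qc (\<lambda>i. ev B (q i))"
proof -
  note [simp] = D.ococ_typing(1-6)[OF assms(1)] assms(2)
  show ?thesis
    unfolding D.omod_def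
  proof (intro conjI ballI impI)
    fix d assume [simp]: "d \<in> Cell1 I"
    let ?i = "src1 I d" and ?j = "trg1 I d" and ?b = "alg_act B"
    have 1: "ev B (q ?i) \<odot> (?b \<triangleright> (T2 M (qc d) \<triangleleft> \<eta> M (F0 D ?i))) = qc d \<odot> ev B (q ?j \<cdot> F1 D d)"
      by (rule ev_nat) simp_all
    have 2: "(?b \<cdot> T1 M (q ?j) \<triangleright> \<eta>n M (F1 D d)) \<odot> (?b \<cdot> T1 M (q ?j) \<triangleright> vinv (\<eta>n M (F1 D d))) =
       id2 C ((?b \<cdot> T1 M (q ?j)) \<cdot> (\<eta> M (F0 D ?j) \<cdot> F1 D d))"
      using vinv_lwhisker(2)[of "\<eta>n M (F1 D d)" "?b \<cdot> T1 M (q ?j)"] by simp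
    have 3: "ev B (q ?j \<cdot> F1 D d) \<odot> (?b \<cdot> T1 M (q ?j) \<triangleright> vinv (\<eta>n M (F1 D d))) = ev B (q ?j) \<triangleleft> F1 D d"
      using 2 by (simp add: ev_def)
    show "ev B (q ?i) \<odot> (((?b \<triangleright> T2 M (qc d)) \<triangleleft> \<eta> M (F0 D ?i)) \<odot> ((?b \<cdot> T1 M (q ?j)) \<triangleright> vinv (\<eta>n M (F1 D d)))) = qc d \<odot> (ev B (q ?j) \<triangleleft> F1 D d)"
      by (simp add: vcomp_eq_ext[OF 1] 3)
  qed simp_all
qed

text \<open>The structure cells of the extensions of the legs form a modification from acting twice
  on \<open>q\<close> to acting once and pulling back along \<open>\<mu>\<close>; compatibility with
  the cocone cells is \<open>ext_nat\<close>. The cell \<open>H01\<close> of the resolution comes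
  from this.\<close>

lemma omod_mult:
  assumes "D.ococ (alg_ob B) q qc" "alg B"
  shows "two_fun.omod I C (comp_two_fun (endo M) TD) (\<lambda>i. alg_act B \<cdot> T1 M (alg_act B \<cdot> T1 M (q i)))
     (\<lambda>d. alg_act B \<triangleright> T2 M (alg_act B \<triangleright> T2 M (qc d)))
     (\<lambda>i. (alg_act B \<cdot> T1 M (q i)) \<cdot> \<mu> M (F0 D i))
     (\<lambda>d. ((alg_act B \<triangleright> T2 M (qc d)) \<triangleleft> \<mu> M (F0 D (src1 I d))) \<odot> ((alg_act B \<cdot> T1 M (q (trg1 I d))) \<triangleright> \<mu>n M (F1 D d)))
     (\<lambda>i. (alg_act B \<triangleright> \<mu>n M (q i)) \<odot> (alg_mult B \<triangleleft> T1 M (T1 M (q i))))"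
proof -
  interpret TT: psmonad_diagram C M I TD ..
  note [simp] = D.ococ_typing(1-6)[OF assms(1)] assms(2)
  show ?thesis
    unfolding TT.TD.omod_def
  proof (intro conjI ballI impI)
    fix d assume [simp]: "d \<in> Cell1 I"
    let ?i = "src1 I d" and ?j = "trg1 I d" and ?b = "alg_act B" and ?s = "alg_mult B"
    have 1: "(?b \<triangleright> (T2 M (qc d) \<triangleleft> \<mu> M (F0 D ?i))) \<odot> ((?b \<triangleright> \<mu>n M (q ?j \<cdot> F1 D d)) \<odot> (?s \<triangleleft> T1 M (T1 M (q ?j \<cdot> F1 D d)))) =
      (?b \<triangleright> \<mu>n M (q ?i)) \<odot> ((?s \<triangleleft> T1 M (T1 M (q ?i))) \<odot> (?b \<cdot> T1 M ?b \<triangleright> T2 M (T2 M (qc d))))"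
      by (rule ext_nat[of B]) simp_all
    show "((?b \<triangleright> \<mu>n M (q ?i)) \<odot> (?s \<triangleleft> T1 M (T1 M (q ?i)))) \<odot> (?b \<triangleright> T2 M (?b \<triangleright> T2 M (qc d))) =
      (((?b \<triangleright> T2 M (qc d)) \<triangleleft> \<mu> M (F0 D ?i)) \<odot> ((?b \<cdot> T1 M (q ?j)) \<triangleright> \<mu>n M (F1 D d))) \<odot>
      (((?b \<triangleright> \<mu>n M (q ?j)) \<odot> (?s \<triangleleft> T1 M (T1 M (q ?j)))) \<triangleleft> F1 (comp_two_fun (endo M) TD) d)"
      using 1 by (simp add: TT.TD_simps)
  qed (simp_all add: TT.TD_simps)
qed

end

section \<open>Invertible modifications between cocones\<close>

context two_fun
begin

text \<open>Carries along that both ends are cocones, so that composition, inversion, whiskering and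
  pullback can be chained without further side conditions.\<close>

definition isomod :: "'o \<Rightarrow> ('i \<Rightarrow> 'a) \<Rightarrow> ('d \<Rightarrow> 'c) \<Rightarrow> ('i \<Rightarrow> 'a) \<Rightarrow> ('d \<Rightarrow> 'c) \<Rightarrow> ('i \<Rightarrow> 'c) \<Rightarrow> bool" where
  "isomod B q qc r rc m \<longleftrightarrow> ococ B q qc \<and> ococ B r rc \<and> omod q qc r rc m \<and> (\<forall>i \<in> Obj I. K.iso2 (m i))"

lemma isomodI:
  "ococ B q qc \<Longrightarrow> ococ B r rc \<Longrightarrow> omod q qc r rc m \<Longrightarrow> (\<And>i. i \<in> Obj I \<Longrightarrow> K.iso2 (m i)) \<Longrightarrow> isomod B q qc r rc m"
  by (simp add: isomod_def)

lemma isomodD: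
  assumes "isomod B q qc r rc m"
  shows "ococ B q qc" "ococ B r rc" "omod q qc r rc m" "i \<in> Obj I \<Longrightarrow> K.iso2 (m i)"
    "i \<in> Obj I \<Longrightarrow> src2 K (m i) = q i" "i \<in> Obj I \<Longrightarrow> trg2 K (m i) = r i"
  using assms omod_typing[of q qc r rc m i] by (simp_all add: isomod_def)

lemma isomod_id: "ococ B q qc \<Longrightarrow> isomod B q qc q qc (\<lambda>i. id2 K (q i))"
  using omod_id ococ_typing(1) by (simp add: isomod_def)

lemma isomod_comp: "isomod B q qc r rc m \<Longrightarrow> isomod B r rc s sc n \<Longrightarrow> isomod B q qc s sc (\<lambda>i. n i \<odot>\<^bsub>K\<^esub> m i)"
  using omod_comp[of B q qc r rc s sc m n] omod_typing[of q qc r rc m] omod_typing[of r rc s sc n]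
  by (simp add: isomod_def)

lemma isomod_vinv: "isomod B q qc r rc m \<Longrightarrow> isomod B r rc q qc (\<lambda>i. K.vinv (m i))"
  using omod_vinv[of B q qc r rc m] by (simp add: isomod_def)

lemma isomod_lwhisker:
  assumes "isomod B q qc r rc m" "u \<in> Cell1 K" "src1 K u = B" "trg1 K u = B'"
  shows "isomod B' (\<lambda>i. u \<cdot>\<^bsub>K\<^esub> q i) (\<lambda>d. u \<triangleright>\<^bsub>K\<^esub> qc d) (\<lambda>i. u \<cdot>\<^bsub>K\<^esub> r i) (\<lambda>d. u \<triangleright>\<^bsub>K\<^esub> rc d) (\<lambda>i. u \<triangleright>\<^bsub>K\<^esub> m i)"
proof -
  note [simp] = isomodD(4-)[OF assms(1)] assms(2,3) ococ_typing(1-6)[OF isomodD(1)[OF assms(1)]] ococ_typing(1-6)[OF isomodD(2)[OF assms(1)]]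
  show ?thesis
    using ococ_lwhisker[OF isomodD(1)[OF assms(1)] assms(2,3)] ococ_lwhisker[OF isomodD(2)[OF assms(1)] assms(2,3)]
      omod_lwhisker[OF isomodD(1,2,3)[OF assms(1)] assms(2,3)] assms(4)
    by (intro isomodI) simp_all
qed

lemma isomod_restrict:
  assumes "two_fun I K D" "lax_nat D s sc" "isomod B q qc r rc m"
  shows "two_fun.isomod I K D B (\<lambda>i. q i \<cdot>\<^bsub>K\<^esub> s i) (\<lambda>d. (qc d \<triangleleft>\<^bsub>K\<^esub> s (src1 I d)) \<odot>\<^bsub>K\<^esub> (q (trg1 I d) \<triangleright>\<^bsub>K\<^esub> sc d))
      (\<lambda>i. r i \<cdot>\<^bsub>K\<^esub> s i) (\<lambda>d. (rc d \<triangleleft>\<^bsub>K\<^esub> s (src1 I d)) \<odot>\<^bsub>K\<^esub> (r (trg1 I d) \<triangleright>\<^bsub>K\<^esub> sc d)) (\<lambda>i. m i \<triangleleft>\<^bsub>K\<^esub> s i)"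
proof -
  interpret D: two_fun I K D by fact
  note [simp] = isomodD(4-)[OF assms(3)] ococ_typing(1-6)[OF isomodD(1)[OF assms(3)]] ococ_typing(1-6)[OF isomodD(2)[OF assms(3)]]
    lax_nat_typing(1-3)[OF assms(2)]
  show ?thesis
    using ococ_restrict[OF assms(1,2) isomodD(1)[OF assms(3)]] ococ_restrict[OF assms(1,2) isomodD(2)[OF assms(3)]]
      omod_restrict[OF assms(1,2) isomodD(1,2,3)[OF assms(3)]]
    by (intro D.isomodI) simp_all
qed

lemma isomod_cong:
  assumes "isomod B q qc r rc m" "\<And>i. i \<in> Obj I \<Longrightarrow> q i = q' i" "\<And>i. i \<in> Obj I \<Longrightarrow> r i = r' i"
    "\<And>i. i \<in> Obj I \<Longrightarrow> m i = m' i" "\<And>d. d \<in> Cell1 I \<Longrightarrow> qc d = qc' d" "\<And>d. d \<in> Cell1 I \<Longrightarrow> rc d = rc' d"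
  shows "isomod B q' qc' r' rc' m'"
  using assms(1) ococ_cong[of B q qc q' qc'] ococ_cong[of B r rc r' rc'] omod_cong[of q qc r rc m q' r' m' qc' rc'] assms(2-)
  unfolding isomod_def by simp

text \<open>The solution is \<open>h\<^sup>-\<^sup>1 k g\<^sup>-\<^sup>1\<close>. The 2-cells of the
  resolution, and the cell of a pair with prescribed structure on the legs, are defined implicitly
  by equations of this shape.\<close>

lemma isomod_solve:
  assumes "isomod B p pc q qc g" "isomod B r rc s sc h" "isomod B p pc s sc k"
  obtains m where "isomod B q qc r rc m" "\<And>i. i \<in> Obj I \<Longrightarrow> h i \<odot>\<^bsub>K\<^esub> (m i \<odot>\<^bsub>K\<^esub> g i) = k i"
proof -
  have "isomod B q qc r rc (\<lambda>i. K.vinv (h i) \<odot>\<^bsub>K\<^esub> (k i \<odot>\<^bsub>K\<^esub> K.vinv (g i)))"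
    by (rule isomod_comp[OF isomod_comp[OF isomod_vinv[OF assms(1)] assms(3)] isomod_vinv[OF assms(2)]])
  moreover have "h i \<odot>\<^bsub>K\<^esub> ((K.vinv (h i) \<odot>\<^bsub>K\<^esub> (k i \<odot>\<^bsub>K\<^esub> K.vinv (g i))) \<odot>\<^bsub>K\<^esub> g i) = k i" if "i \<in> Obj I" for i
    using that isomodD(4-6)[OF assms(1), of i] isomodD(4-6)[OF assms(2), of i] isomodD(4-6)[OF assms(3), of i] by simp
  ultimately show ?thesis
    using that by blast
qed

end

section \<open>Lifting modifications to transformations of pseudomorphisms\<close>

context psmonad_diagram
begin

lemma isomod_act:
  assumes "D.isomod (alg_ob B) q qc r rc m" "alg B"
  shows "TD.isomod (alg_ob B) (\<lambda>i. alg_act B \<cdot> T1 M (q i)) (\<lambda>d. alg_act B \<triangleright> T2 M (qc d)) (\<lambda>i. alg_act B \<cdot> T1 M (r i)) (\<lambda>d. alg_act B \<triangleright> T2 M (rc d))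
    (\<lambda>i. alg_act B \<triangleright> T2 M (m i))"
proof -
  note [simp] = D.isomodD(4-)[OF assms(1)] assms(2) D.ococ_typing(1-6)[OF D.isomodD(1)[OF assms(1)]] D.ococ_typing(1-6)[OF D.isomodD(2)[OF assms(1)]]
  show ?thesis
    using ococ_act[OF D.isomodD(1)[OF assms(1)] assms(2)] ococ_act[OF D.isomodD(2)[OF assms(1)] assms(2)]
      omod_act[OF D.isomodD(1-3)[OF assms(1)] assms(2)]
    by (intro TD.isomodI) simp_all
qed

lemma isomod_mor_act:
  assumes "mor u" "mor_src u = X" "mor_trg u = B" "D.ococ (alg_ob X) s sc"
  shows "TD.isomod (alg_ob B) (\<lambda>i. alg_act B \<cdot> T1 M (mor_fun u \<cdot> s i)) (\<lambda>d. alg_act B \<triangleright> T2 M (mor_fun u \<triangleright> sc d))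
    (\<lambda>i. mor_fun u \<cdot> (alg_act X \<cdot> T1 M (s i))) (\<lambda>d. mor_fun u \<triangleright> (alg_act X \<triangleright> T2 M (sc d))) (\<lambda>i. mor_cell u \<triangleleft> T1 M (s i))"
proof (rule TD.isomodI[OF _ _ omod_mor_act[OF assms]])
  have [simp]: "alg X" "alg B"
    using mor_typing(1,2)[OF assms(1)] assms(2,3) by auto
  note [simp] = assms(1-3) D.ococ_typing(1-6)[OF assms(4)]
  have "D.ococ (alg_ob B) (\<lambda>i. mor_fun u \<cdot> s i) (\<lambda>d. mor_fun u \<triangleright> sc d)"
    using D.ococ_lwhisker[OF assms(4), of "mor_fun u"] by simp
  from ococ_act[OF this] show "TD.ococ (alg_ob B) (\<lambda>i. alg_act B \<cdot> T1 M (mor_fun u \<cdot> s i)) (\<lambda>d. alg_act B \<triangleright> T2 M (mor_fun u \<triangleright> sc d))"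
    by simp
  have "TD.ococ (alg_ob X) (\<lambda>i. alg_act X \<cdot> T1 M (s i)) (\<lambda>d. alg_act X \<triangleright> T2 M (sc d))"
    by (rule ococ_act[OF assms(4)]) simp
  from TD.ococ_lwhisker[OF this, of "mor_fun u"]
  show "TD.ococ (alg_ob B) (\<lambda>i. mor_fun u \<cdot> (alg_act X \<cdot> T1 M (s i))) (\<lambda>d. mor_fun u \<triangleright> (alg_act X \<triangleright> T2 M (sc d)))"
    by simp
  show "iso2 (mor_cell u \<triangleleft> T1 M (s i))" if "i \<in> Obj I" for i
    using that by simp
qed

lemma fcolim_ococ:
  assumes "fcolim X e ec"
  shows "alg X" "D.ococ (alg_ob X) e ec"
  using assms by (auto simp: fcolim_def)

lemma fcolim_ES:
  assumes X: "fcolim X e ec" and B: "alg B" and r: "D.ococ (alg_ob B) r rc"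
  obtains u m where "mor u" "mor_src u = X" "mor_trg u = B"
    "D.isomod (alg_ob B) (\<lambda>i. mor_fun u \<cdot> e i) (\<lambda>d. mor_fun u \<triangleright> ec d) r rc m"
proof -
  obtain u m where u: "mor u" "mor_src u = X" "mor_trg u = B"
    "D.omod (\<lambda>i. mor_fun u \<cdot> e i) (\<lambda>d. mor_fun u \<triangleright> ec d) r rc m" "\<forall>i \<in> Obj I. iso2 (m i)"
    using assms unfolding fcolim_def by metis
  have "D.ococ (alg_ob B) (\<lambda>i. mor_fun u \<cdot> e i) (\<lambda>d. mor_fun u \<triangleright> ec d)"
    using D.ococ_lwhisker[OF fcolim_ococ(2)[OF X], of "mor_fun u"] u(1-3) by simp
  then show ?thesis
    using that[OF u(1-3) D.isomodI[OF _ r u(4)]] u(5) by blast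
qed

lemma fcolim_FF:
  assumes X: "fcolim X e ec" and "mor u" "mor v" "mor_src u = X" "mor_src v = X" "mor_trg u = B" "mor_trg v = B"
    and m: "D.omod (\<lambda>i. mor_fun u \<cdot> e i) (\<lambda>d. mor_fun u \<triangleright> ec d) (\<lambda>i. mor_fun v \<cdot> e i) (\<lambda>d. mor_fun v \<triangleright> ec d) m"
  shows "\<exists>!\<Sigma>. transf \<Sigma> \<and> trans_src \<Sigma> = u \<and> trans_trg \<Sigma> = v \<and> (\<forall>i \<in> Obj I. trans_cell \<Sigma> \<triangleleft> e i = m i)"
proof -
  have "alg B"
    using mor_typing(2)[OF assms(2)] assms(6) by simp
  then show ?thesis
    using assms unfolding fcolim_def by blast
qed

lemma fcolim_eqI:
  assumes X: "fcolim X e ec" and "transf \<Sigma>" "transf \<Sigma>'" "mor_src (trans_src \<Sigma>) = X"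
    "trans_src \<Sigma>' = trans_src \<Sigma>" "trans_trg \<Sigma>' = trans_trg \<Sigma>"
    "\<And>i. i \<in> Obj I \<Longrightarrow> trans_cell \<Sigma> \<triangleleft> e i = trans_cell \<Sigma>' \<triangleleft> e i"
  shows "\<Sigma> = \<Sigma>'"
proof -
  have "D.omod (\<lambda>i. mor_fun (trans_src \<Sigma>) \<cdot> e i) (\<lambda>d. mor_fun (trans_src \<Sigma>) \<triangleright> ec d)
     (\<lambda>i. mor_fun (trans_trg \<Sigma>) \<cdot> e i) (\<lambda>d. mor_fun (trans_trg \<Sigma>) \<triangleright> ec d) (\<lambda>i. trans_cell \<Sigma> \<triangleleft> e i)"
    by (rule D.omod_rwhisker[OF fcolim_ococ(2)[OF X]]) (use assms(2,4) in simp_all)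
  from fcolim_FF[OF X _ _ _ _ refl _ this] show ?thesis
    using assms(2-) transf_typing[OF assms(2)] by auto
qed

text \<open>Both \<open>m\<close> and its pointwise inverse lift, and the two composites restrict to
  identities on the legs, so they are identities by uniqueness.\<close>

lemma fcolim_iso:
  assumes X: "fcolim X e ec" and u: "mor u" "mor v" "mor_src u = X" "mor_src v = X" "mor_trg u = B" "mor_trg v = B"
    and m: "D.isomod B' (\<lambda>i. mor_fun u \<cdot> e i) (\<lambda>d. mor_fun u \<triangleright> ec d) (\<lambda>i. mor_fun v \<cdot> e i) (\<lambda>d. mor_fun v \<triangleright> ec d) m"
  obtains \<Sigma> where "transf \<Sigma>" "trans_src \<Sigma> = u" "trans_trg \<Sigma> = v" "iso2 (trans_cell \<Sigma>)"
    "\<And>i. i \<in> Obj I \<Longrightarrow> trans_cell \<Sigma> \<triangleleft> e i = m i"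
proof -
  obtain S where S: "transf S" "trans_src S = u" "trans_trg S = v" "\<And>i. i \<in> Obj I \<Longrightarrow> trans_cell S \<triangleleft> e i = m i"
    using fcolim_FF[OF X u D.isomodD(3)[OF m]] by blast
  obtain R where R: "transf R" "trans_src R = v" "trans_trg R = u" "\<And>i. i \<in> Obj I \<Longrightarrow> trans_cell R \<triangleleft> e i = vinv (m i)"
    using fcolim_FF[OF X u(2,1,4,3,6,5) D.isomodD(3)[OF D.isomod_vinv[OF m]]] by blast
  note [simp] = D.ococ_typing(1-3)[OF fcolim_ococ(2)[OF X]] u S(1) R(1)
  have 1: "PsTrans u u (trans_cell R \<odot> trans_cell S) = PsTrans u u (id2 C (mor_fun u))"
  proof (rule fcolim_eqI[OF X])
    show "transf (PsTrans u u (trans_cell R \<odot> trans_cell S))"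
      using transf_vcomp[OF S(1) R(1)] S R by simp
    show "trans_cell (PsTrans u u (trans_cell R \<odot> trans_cell S)) \<triangleleft> e i = trans_cell (PsTrans u u (id2 C (mor_fun u))) \<triangleleft> e i"
      if "i \<in> Obj I" for i
      using that D.isomodD(4-)[OF m that] by (simp add: S R)
  qed (simp_all add: transf_id2)
  have 2: "PsTrans v v (trans_cell S \<odot> trans_cell R) = PsTrans v v (id2 C (mor_fun v))"
  proof (rule fcolim_eqI[OF X])
    show "transf (PsTrans v v (trans_cell S \<odot> trans_cell R))"
      using transf_vcomp[OF R(1) S(1)] S R by simp
    show "trans_cell (PsTrans v v (trans_cell S \<odot> trans_cell R)) \<triangleleft> e i = trans_cell (PsTrans v v (id2 C (mor_fun v))) \<triangleleft> e i"
      if "i \<in> Obj I" for i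
      using that D.isomodD(4-)[OF m that] by (simp add: S R)
  qed (simp_all add: transf_id2)
  have "iso2 (trans_cell S)"
    by (rule iso2I[of _ "trans_cell R"]) (use 1 2 in \<open>simp_all add: S R\<close>)
  then show ?thesis
    using that S by blast
qed

end

section \<open>The underlying diagram of a diagram of pseudo-algebras\<close>

locale alg_diagram = psmonad C M + F: two_fun I "T_psAlg C M" F
  for C :: "('o, 'a, 'c) two_cat" (structure) and M and I :: "('i, 'd, 'e) two_cat" and F
begin

abbreviation "Ao i \<equiv> alg_ob (F0 F i)"
abbreviation "Aa i \<equiv> alg_act (F0 F i)"
abbreviation "Ft d \<equiv> mor_fun (F1 F d)"
abbreviation "Fc d \<equiv> mor_cell (F1 F d)"

definition "U = \<lparr>F0 = \<lambda>i. alg_ob (F0 F i), F1 = \<lambda>d. mor_fun (F1 F d), F2 = \<lambda>\<sigma>. trans_cell (F2 F \<sigma>)\<rparr>"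

lemma U_simps [simp]: "F0 U i = Ao i" "F1 U d = Ft d" "F2 U \<sigma> = trans_cell (F2 F \<sigma>)"
  by (simp_all add: U_def)

lemma F_simps [simp]:
  "i \<in> Obj I \<Longrightarrow> alg (F0 F i)"
  "d \<in> Cell1 I \<Longrightarrow> mor (F1 F d)" "d \<in> Cell1 I \<Longrightarrow> mor_src (F1 F d) = F0 F (src1 I d)" "d \<in> Cell1 I \<Longrightarrow> mor_trg (F1 F d) = F0 F (trg1 I d)"
  "\<sigma> \<in> Cell2 I \<Longrightarrow> transf (F2 F \<sigma>)" "\<sigma> \<in> Cell2 I \<Longrightarrow> trans_src (F2 F \<sigma>) = F1 F (src2 I \<sigma>)" "\<sigma> \<in> Cell2 I \<Longrightarrow> trans_trg (F2 F \<sigma>) = F1 F (trg2 I \<sigma>)"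
  using F.F0_Obj[of i] F.F1_typing[of d] F.F2_typing[of \<sigma>] by simp_all

lemma F_comp [simp]:
  "d \<in> Cell1 I \<Longrightarrow> d' \<in> Cell1 I \<Longrightarrow> src1 I d' = trg1 I d \<Longrightarrow> F1 F (d' \<cdot>\<^bsub>I\<^esub> d) = comp_psmor C M (F1 F d') (F1 F d)"
  using F.F1_comp1[of d d'] by simp

lemma two_fun_U: "two_fun I C U"
proof
  show "two_functor I C U"
    unfolding two_functor_def is_functor_def
  proof (intro conjI ballI impI)
    show "onArr \<lparr>onOb = F0 U, onArr = F2 U\<rparr> (Cmp (hcat I) \<beta> \<alpha>) = Cmp (hcat C) (onArr \<lparr>onOb = F0 U, onArr = F2 U\<rparr> \<beta>) (onArr \<lparr>onOb = F0 U, onArr = F2 U\<rparr> \<alpha>)"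
      if "\<alpha> \<in> Arr (hcat I)" "\<beta> \<in> Arr (hcat I)" "Dom (hcat I) \<beta> = Cod (hcat I) \<alpha>" for \<alpha> \<beta>
      using that F.F2_hcomp[of \<alpha> \<beta>] by (simp add: hcat_def)
    show "onArr \<lparr>onOb = F1 U, onArr = F2 U\<rparr> (Cmp (vcat I) \<beta> \<alpha>) = Cmp (vcat C) (onArr \<lparr>onOb = F1 U, onArr = F2 U\<rparr> \<beta>) (onArr \<lparr>onOb = F1 U, onArr = F2 U\<rparr> \<alpha>)"
      if "\<alpha> \<in> Arr (vcat I)" "\<beta> \<in> Arr (vcat I)" "Dom (vcat I) \<beta> = Cod (vcat I) \<alpha>" for \<alpha> \<beta>
      using that F.F2_vcomp[of \<alpha> \<beta>] by (simp add: vcat_def)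
    show "onArr \<lparr>onOb = F1 U, onArr = F2 U\<rparr> (Idn (vcat I) f) = Idn (vcat C) (onOb \<lparr>onOb = F1 U, onArr = F2 U\<rparr> f)"
      if "f \<in> Ob (vcat I)" for f
      using that F.F2_id2[of f] by (simp add: vcat_def)
    show "onArr \<lparr>onOb = F0 U, onArr = F2 U\<rparr> (Idn (hcat I) i) = Idn (hcat C) (onOb \<lparr>onOb = F0 U, onArr = F2 U\<rparr> i)"
      if "i \<in> Ob (hcat I)" for i
      using that F.F2_id2[of "id1 I i"] by (simp add: hcat_def)
  qed (auto simp: cat1_def vcat_def hcat_def Hom_def)
qed

sublocale D0: psmonad_diagram C M I U
  by (intro psmonad_diagram.intro psmonad_axioms two_fun_U)

sublocale D1: psmonad_diagram C M I D0.TD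
  by (intro psmonad_diagram.intro psmonad_axioms D0.two_fun_TD)

sublocale D2: psmonad_diagram C M I D1.TD
  by (intro psmonad_diagram.intro psmonad_axioms D1.two_fun_TD)

abbreviation "oc0 \<equiv> D0.D.ococ"
abbreviation "oc1 \<equiv> D0.TD.ococ"
abbreviation "oc2 \<equiv> D1.TD.ococ"

text \<open>The actions form a transformation from \<open>T U F\<close> to \<open>U F\<close> with
  the structure cells of the \<open>F d\<close> as its cells: functoriality of \<open>F\<close>
  gives the laws for identities and composites, and each \<open>F \<sigma>\<close> being a
  transformation gives the law for 2-cells.\<close>

lemma lax_nat_act: "D0.D.lax_nat D0.TD (\<lambda>i. Aa i) (\<lambda>d. Fc d)"
  unfolding D0.D.lax_nat_def
proof (intro conjI ballI impI)
  fix \<sigma> assume [simp]: "\<sigma> \<in> Cell2 I"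
  show "Fc (trg2 I \<sigma>) \<odot> (Aa (trg1 I (src2 I \<sigma>)) \<triangleright> F2 D0.TD \<sigma>) = (F2 U \<sigma> \<triangleleft> Aa (src1 I (src2 I \<sigma>))) \<odot> Fc (src2 I \<sigma>)"
    using transf_eq[of "F2 F \<sigma>" "Aa (src1 I (src2 I \<sigma>))" "Aa (trg1 I (src2 I \<sigma>))"] by simp
qed simp_all

lemma lax_nat_Tact: "D0.TD.lax_nat D1.TD (\<lambda>i. T1 M (Aa i)) (\<lambda>d. T2 M (Fc d))"
  by (rule D0.lax_nat_T[OF D0.two_fun_TD lax_nat_act])

text \<open>Compatibility with the cocone cells is the unit law of the pseudomorphisms
  \<open>F d\<close>. The modification runs from \<open>q\<close>, pulled back along the actions and
  then the unit, to \<open>q\<close>; it yields \<open>N1\<close>.\<close>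

lemma omod_unit:
  assumes "oc0 B q qc"
  shows "D0.D.omod (\<lambda>i. (q i \<cdot> Aa i) \<cdot> \<eta> M (Ao i))
      (\<lambda>d. (((qc d \<triangleleft> Aa (src1 I d)) \<odot> (q (trg1 I d) \<triangleright> Fc d)) \<triangleleft> \<eta> M (Ao (src1 I d))) \<odot> ((q (trg1 I d) \<cdot> Aa (trg1 I d)) \<triangleright> vinv (\<eta>n M (Ft d))))
      q qc (\<lambda>i. q i \<triangleright> alg_unit (F0 F i))"
proof -
  note [simp] = D0.D.ococ_typing(1-6)[OF assms]
  show ?thesis
    unfolding D0.D.omod_def
  proof (intro conjI ballI impI)
    fix d assume [simp]: "d \<in> Cell1 I"
    let ?i = "src1 I d" and ?j = "trg1 I d"
    have 1: "(q ?i \<triangleright> alg_unit (F0 F ?i)) \<odot> (qc d \<triangleleft> Aa ?i \<cdot> \<eta> M (Ao ?i)) = qc d \<odot> (q ?j \<cdot> Ft d \<triangleright> alg_unit (F0 F ?i))"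
      using swap[of "alg_unit (F0 F ?i)" "qc d"] by simp
    have 2: "(q ?j \<cdot> Ft d \<triangleright> alg_unit (F0 F ?i)) \<odot> (q ?j \<triangleright> (Fc d \<triangleleft> \<eta> M (Ao ?i))) =
       (q ?j \<triangleright> (alg_unit (F0 F ?j) \<triangleleft> Ft d)) \<odot> (q ?j \<cdot> Aa ?j \<triangleright> \<eta>n M (Ft d))"
      using arg_cong[OF mor_unit[of "F1 F d" "Ao ?i" "Aa ?j" "Ft d"], of "lwhisker C (q ?j)"] by simp
    have 3: "(q ?j \<cdot> Aa ?j \<triangleright> \<eta>n M (Ft d)) \<odot> (q ?j \<cdot> Aa ?j \<triangleright> vinv (\<eta>n M (Ft d))) = id2 C ((q ?j \<cdot> Aa ?j) \<cdot> (\<eta> M (Ao ?j) \<cdot> Ft d))"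
      using vinv_lwhisker(2)[of "\<eta>n M (Ft d)" "q ?j \<cdot> Aa ?j"] by simp
    show "(q ?i \<triangleright> alg_unit (F0 F ?i)) \<odot> ((((qc d \<triangleleft> Aa ?i) \<odot> (q ?j \<triangleright> Fc d)) \<triangleleft> \<eta> M (Ao ?i)) \<odot> ((q ?j \<cdot> Aa ?j) \<triangleright> vinv (\<eta>n M (Ft d)))) =
      qc d \<odot> ((q ?j \<triangleright> alg_unit (F0 F ?j)) \<triangleleft> F1 U d)"
      using 3 by (simp add: vcomp_eq_ext[OF 1] vcomp_eq_ext[OF 2])
  qed simp_all
qed

text \<open>Compatibility with the cocone cells is the multiplication law of the pseudomorphisms
  \<open>F d\<close>. The modification compares the pullback of \<open>q\<close> along
  \<open>a Ta\<close> with that along \<open>a \<mu>\<close>; it yields \<open>H12\<close>.\<close>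

lemma omod_assoc:
  assumes "oc0 B q qc"
  shows "D1.TD.omod (\<lambda>i. (q i \<cdot> Aa i) \<cdot> T1 M (Aa i))
      (\<lambda>d. (((qc d \<triangleleft> Aa (src1 I d)) \<odot> (q (trg1 I d) \<triangleright> Fc d)) \<triangleleft> T1 M (Aa (src1 I d))) \<odot> ((q (trg1 I d) \<cdot> Aa (trg1 I d)) \<triangleright> T2 M (Fc d)))
      (\<lambda>i. (q i \<cdot> Aa i) \<cdot> \<mu> M (Ao i))
      (\<lambda>d. (((qc d \<triangleleft> Aa (src1 I d)) \<odot> (q (trg1 I d) \<triangleright> Fc d)) \<triangleleft> \<mu> M (Ao (src1 I d))) \<odot> ((q (trg1 I d) \<cdot> Aa (trg1 I d)) \<triangleright> \<mu>n M (Ft d)))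
      (\<lambda>i. q i \<triangleright> alg_mult (F0 F i))"
proof -
  note [simp] = D0.D.ococ_typing(1-6)[OF assms]
  show ?thesis
    unfolding D1.TD.omod_def
  proof (intro conjI ballI impI)
    fix d assume [simp]: "d \<in> Cell1 I"
    let ?i = "src1 I d" and ?j = "trg1 I d"
    let ?s = "alg_mult (F0 F ?i)" and ?t = "alg_mult (F0 F ?j)"
    have 1: "(q ?i \<triangleright> ?s) \<odot> (qc d \<triangleleft> Aa ?i \<cdot> T1 M (Aa ?i)) = (qc d \<triangleleft> Aa ?i \<cdot> \<mu> M (Ao ?i)) \<odot> (q ?j \<cdot> Ft d \<triangleright> ?s)"
      using swap[of ?s "qc d"] by simp
    have 2: "(q ?j \<cdot> Ft d \<triangleright> ?s) \<odot> ((q ?j \<triangleright> (Fc d \<triangleleft> T1 M (Aa ?i))) \<odot> (q ?j \<cdot> Aa ?j \<triangleright> T2 M (Fc d))) =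
      (q ?j \<triangleright> (Fc d \<triangleleft> \<mu> M (Ao ?i))) \<odot> ((q ?j \<cdot> Aa ?j \<triangleright> \<mu>n M (Ft d)) \<odot> (q ?j \<triangleright> (?t \<triangleleft> T1 M (T1 M (Ft d)))))"
      using arg_cong[OF mor_mult[of "F1 F d" "Ao ?i" "Aa ?i" "Aa ?j" "Ft d"], of "lwhisker C (q ?j)"] by simp
    show "(q ?i \<triangleright> ?s) \<odot> ((((qc d \<triangleleft> Aa ?i) \<odot> (q ?j \<triangleright> Fc d)) \<triangleleft> T1 M (Aa ?i)) \<odot> ((q ?j \<cdot> Aa ?j) \<triangleright> T2 M (Fc d))) =
      ((((qc d \<triangleleft> Aa ?i) \<odot> (q ?j \<triangleright> Fc d)) \<triangleleft> \<mu> M (Ao ?i)) \<odot> ((q ?j \<cdot> Aa ?j) \<triangleright> \<mu>n M (Ft d))) \<odot>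
      ((q ?j \<triangleright> ?t) \<triangleleft> F1 D1.TD d)"
      by (simp add: vcomp_eq_ext[OF 1] 2 D1.TD_simps)
  qed (simp_all add: D1.TD_simps)
qed

end

section \<open>The codescent resolution\<close>

text \<open>
  The codescent object of free algebras on the oplax bicolimits of \<open>U F\<close>, \<open>T U F\<close> and \<open>T T U F\<close>.  Its
  1-cells are determined up to isomorphism by their restrictions along the colimit cocones:
  \<open>d\<^sub>0\<close> and \<open>p\<^sub>0\<close> multiply out one \<open>T\<close>, \<open>d\<^sub>1\<close> and \<open>p\<^sub>2\<close> apply the actions of the algebras \<open>F i\<close>,
  \<open>p\<^sub>1\<close> applies \<open>\<mu>\<close> and \<open>i\<close> applies \<open>\<eta>\<close>.  The 2-cells are then determined by their restrictions.
\<close>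

locale resolution = alg_diagram C M I F
  for C :: "('o, 'a, 'c) two_cat" (structure) and M and I :: "('i, 'd, 'e) two_cat" and F +
  fixes B0 B1 B2 :: "('o, 'a, 'c) psalg"
    and e :: "'i \<Rightarrow> 'a" and ec :: "'d \<Rightarrow> 'c" and e1 :: "'i \<Rightarrow> 'a" and ec1 :: "'d \<Rightarrow> 'c"
    and e2 :: "'i \<Rightarrow> 'a" and ec2 :: "'d \<Rightarrow> 'c"
    and dd0 dd1 jj pp0 pp1 pp2 :: "('o, 'a, 'c) psmor"
    and \<delta>0 \<delta>1 \<epsilon> \<pi>0 \<pi>1 \<pi>2 :: "'i \<Rightarrow> 'c"
    and N0 N1 H01 H02 H12 :: "('o, 'a, 'c) pstrans"
  assumes f0: "D0.fcolim B0 e ec" and f1: "D1.fcolim B1 e1 ec1" and f2: "D2.fcolim B2 e2 ec2"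
    and mors [simp]: "mor dd0" "mor_src dd0 = B1" "mor_trg dd0 = B0" "mor dd1" "mor_src dd1 = B1" "mor_trg dd1 = B0"
      "mor jj" "mor_src jj = B0" "mor_trg jj = B1" "mor pp0" "mor_src pp0 = B2" "mor_trg pp0 = B1"
      "mor pp1" "mor_src pp1 = B2" "mor_trg pp1 = B1" "mor pp2" "mor_src pp2 = B2" "mor_trg pp2 = B1"
    and \<delta>0: "D0.TD.isomod (alg_ob B0) (\<lambda>i. alg_act B0 \<cdot> T1 M (e i)) (\<lambda>d. alg_act B0 \<triangleright> T2 M (ec d))
        (\<lambda>i. mor_fun dd0 \<cdot> e1 i) (\<lambda>d. mor_fun dd0 \<triangleright> ec1 d) \<delta>0"
    and \<delta>1: "D0.TD.isomod (alg_ob B0) (\<lambda>i. mor_fun dd1 \<cdot> e1 i) (\<lambda>d. mor_fun dd1 \<triangleright> ec1 d)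
        (\<lambda>i. e i \<cdot> Aa i) (\<lambda>d. (ec d \<triangleleft> Aa (src1 I d)) \<odot> (e (trg1 I d) \<triangleright> Fc d)) \<delta>1"
    and \<epsilon>: "D0.D.isomod (alg_ob B1) (\<lambda>i. e1 i \<cdot> \<eta> M (Ao i))
        (\<lambda>d. (ec1 d \<triangleleft> \<eta> M (Ao (src1 I d))) \<odot> (e1 (trg1 I d) \<triangleright> vinv (\<eta>n M (Ft d))))
        (\<lambda>i. mor_fun jj \<cdot> e i) (\<lambda>d. mor_fun jj \<triangleright> ec d) \<epsilon>"
    and \<pi>0: "D1.TD.isomod (alg_ob B1) (\<lambda>i. alg_act B1 \<cdot> T1 M (e1 i)) (\<lambda>d. alg_act B1 \<triangleright> T2 M (ec1 d))
        (\<lambda>i. mor_fun pp0 \<cdot> e2 i) (\<lambda>d. mor_fun pp0 \<triangleright> ec2 d) \<pi>0"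
    and \<pi>1: "D1.TD.isomod (alg_ob B1) (\<lambda>i. mor_fun pp1 \<cdot> e2 i) (\<lambda>d. mor_fun pp1 \<triangleright> ec2 d)
        (\<lambda>i. e1 i \<cdot> \<mu> M (Ao i)) (\<lambda>d. (ec1 d \<triangleleft> \<mu> M (Ao (src1 I d))) \<odot> (e1 (trg1 I d) \<triangleright> \<mu>n M (Ft d))) \<pi>1"
    and \<pi>2: "D1.TD.isomod (alg_ob B1) (\<lambda>i. mor_fun pp2 \<cdot> e2 i) (\<lambda>d. mor_fun pp2 \<triangleright> ec2 d)
        (\<lambda>i. e1 i \<cdot> T1 M (Aa i)) (\<lambda>d. (ec1 d \<triangleleft> T1 M (Aa (src1 I d))) \<odot> (e1 (trg1 I d) \<triangleright> T2 M (Fc d))) \<pi>2"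
    and N0 [simp]: "transf N0" "trans_src N0 = comp_psmor C M dd0 jj" "trans_trg N0 = id_mor B0" "iso2 (trans_cell N0)"
    and N0_eq: "i \<in> Obj I \<Longrightarrow> (trans_cell N0 \<triangleleft> e i) \<odot> ((mor_fun dd0 \<triangleright> \<epsilon> i) \<odot> (\<delta>0 i \<triangleleft> \<eta> M (Ao i))) = ev B0 (e i)"
    and N1 [simp]: "transf N1" "trans_src N1 = comp_psmor C M dd1 jj" "trans_trg N1 = id_mor B0" "iso2 (trans_cell N1)"
    and N1_eq: "i \<in> Obj I \<Longrightarrow> (trans_cell N1 \<triangleleft> e i) \<odot> (mor_fun dd1 \<triangleright> \<epsilon> i) = (e i \<triangleright> alg_unit (F0 F i)) \<odot> (\<delta>1 i \<triangleleft> \<eta> M (Ao i))"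
    and H01 [simp]: "transf H01" "trans_src H01 = comp_psmor C M dd0 pp0" "trans_trg H01 = comp_psmor C M dd0 pp1" "iso2 (trans_cell H01)"
    and H01_eq: "i \<in> Obj I \<Longrightarrow> (mor_fun dd0 \<triangleright> \<pi>1 i) \<odot> ((trans_cell H01 \<triangleleft> e2 i) \<odot>
        ((mor_fun dd0 \<triangleright> \<pi>0 i) \<odot> ((mor_cell dd0 \<triangleleft> T1 M (e1 i)) \<odot> (alg_act B0 \<triangleright> T2 M (\<delta>0 i))))) =
        (\<delta>0 i \<triangleleft> \<mu> M (Ao i)) \<odot> ((alg_act B0 \<triangleright> \<mu>n M (e i)) \<odot> (alg_mult B0 \<triangleleft> T1 M (T1 M (e i))))"
    and H02 [simp]: "transf H02" "trans_src H02 = comp_psmor C M dd1 pp0" "trans_trg H02 = comp_psmor C M dd0 pp2" "iso2 (trans_cell H02)"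
    and H02_eq: "i \<in> Obj I \<Longrightarrow> (mor_fun dd0 \<triangleright> \<pi>2 i) \<odot> ((trans_cell H02 \<triangleleft> e2 i) \<odot>
        ((mor_fun dd1 \<triangleright> \<pi>0 i) \<odot> (mor_cell dd1 \<triangleleft> T1 M (e1 i)))) = (\<delta>0 i \<triangleleft> T1 M (Aa i)) \<odot> (alg_act B0 \<triangleright> T2 M (\<delta>1 i))"
    and H12 [simp]: "transf H12" "trans_src H12 = comp_psmor C M dd1 pp1" "trans_trg H12 = comp_psmor C M dd1 pp2" "iso2 (trans_cell H12)"
    and H12_eq: "i \<in> Obj I \<Longrightarrow> (e i \<triangleright> alg_mult (F0 F i)) \<odot> ((\<delta>1 i \<triangleleft> T1 M (Aa i)) \<odot> ((mor_fun dd1 \<triangleright> \<pi>2 i) \<odot> (trans_cell H12 \<triangleleft> e2 i))) =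
        (\<delta>1 i \<triangleleft> \<mu> M (Ao i)) \<odot> (mor_fun dd1 \<triangleright> \<pi>1 i)"

section \<open>Existence of the resolution\<close>

context alg_diagram
begin

text \<open>Each 1-cell comes from essential surjectivity, applied to a cocone obtained by acting or
  pulling back. Each 2-cell is found on the legs by \<open>isomod_solve\<close> and lifted by
  \<open>fcolim_iso\<close>. The known side of its equation uses \<open>ev\<close> for
  \<open>N0\<close>, the units and multiplications of the algebras \<open>F i\<close> for
  \<open>N1\<close> and \<open>H12\<close>, the multiplication of \<open>B0\<close> for
  \<open>H01\<close>, and only the comparison cells for \<open>H02\<close>.\<close>

lemma resolution_exists:
  assumes f0: "D0.fcolim B0 e ec" and f1: "D1.fcolim B1 e1 ec1" and f2: "D2.fcolim B2 e2 ec2"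
  shows "\<exists>dd0 dd1 jj pp0 pp1 pp2 \<delta>0 \<delta>1 \<epsilon> \<pi>0 \<pi>1 \<pi>2 N0 N1 H01 H02 H12.
    resolution C M I F B0 B1 B2 e ec e1 ec1 e2 ec2 dd0 dd1 jj pp0 pp1 pp2 \<delta>0 \<delta>1 \<epsilon> \<pi>0 \<pi>1 \<pi>2 N0 N1 H01 H02 H12"
proof -
  let ?b0 = "alg_act B0" and ?b1 = "alg_act B1"
  have a [simp]: "alg B0" "alg B1" "alg B2"
    using D0.fcolim_ococ(1)[OF f0] D1.fcolim_ococ(1)[OF f1] D2.fcolim_ococ(1)[OF f2] .
  have o: "oc0 (alg_ob B0) e ec" and o1: "oc1 (alg_ob B1) e1 ec1" and o2: "oc2 (alg_ob B2) e2 ec2"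
    using D0.fcolim_ococ(2)[OF f0] D1.fcolim_ococ(2)[OF f1] D2.fcolim_ococ(2)[OF f2] .
  note [simp] = D0.D.ococ_typing(1-6)[OF o] D0.TD.ococ_typing(1-6)[OF o1] D1.TD.ococ_typing(1-6)[OF o2]
  obtain dd0 m where dd0 [simp]: "mor dd0" "mor_src dd0 = B1" "mor_trg dd0 = B0"
    and m: "D0.TD.isomod (alg_ob B0) (\<lambda>i. mor_fun dd0 \<cdot> e1 i) (\<lambda>d. mor_fun dd0 \<triangleright> ec1 d) (\<lambda>i. ?b0 \<cdot> T1 M (e i)) (\<lambda>d. ?b0 \<triangleright> T2 M (ec d)) m"
    using D1.fcolim_ES[OF f1 a(1) D0.ococ_act[OF o a(1)]] .
  \<comment> \<open>Essential surjectivity delivers the comparison in the other direction.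
    \<delta>0, and likewise \<epsilon> and \<pi>0, is inverted so that the composites in the
    defining equations run forwards.\<close>
  define \<delta>0 where "\<delta>0 = (\<lambda>i. vinv (m i))"
  have \<delta>0: "D0.TD.isomod (alg_ob B0) (\<lambda>i. ?b0 \<cdot> T1 M (e i)) (\<lambda>d. ?b0 \<triangleright> T2 M (ec d)) (\<lambda>i. mor_fun dd0 \<cdot> e1 i) (\<lambda>d. mor_fun dd0 \<triangleright> ec1 d) \<delta>0"
    unfolding \<delta>0_def by (rule D0.TD.isomod_vinv[OF m])
  obtain dd1 \<delta>1 where dd1 [simp]: "mor dd1" "mor_src dd1 = B1" "mor_trg dd1 = B0"
    and \<delta>1: "D0.TD.isomod (alg_ob B0) (\<lambda>i. mor_fun dd1 \<cdot> e1 i) (\<lambda>d. mor_fun dd1 \<triangleright> ec1 d)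
        (\<lambda>i. e i \<cdot> Aa i) (\<lambda>d. (ec d \<triangleleft> Aa (src1 I d)) \<odot> (e (trg1 I d) \<triangleright> Fc d)) \<delta>1"
    using D1.fcolim_ES[OF f1 a(1) D0.D.ococ_restrict[OF D0.two_fun_TD lax_nat_act o]] .
  have eeta: "oc0 (alg_ob B1) (\<lambda>i. e1 i \<cdot> \<eta> M (Ao i)) (\<lambda>d. (ec1 d \<triangleleft> \<eta> M (Ao (src1 I d))) \<odot> (e1 (trg1 I d) \<triangleright> vinv (\<eta>n M (Ft d))))"
    using D0.TD.ococ_restrict[OF two_fun_U D0.lax_nat_eta o1] by simp
  obtain jj m where jj [simp]: "mor jj" "mor_src jj = B0" "mor_trg jj = B1"
    and m: "D0.D.isomod (alg_ob B1) (\<lambda>i. mor_fun jj \<cdot> e i) (\<lambda>d. mor_fun jj \<triangleright> ec d) (\<lambda>i. e1 i \<cdot> \<eta> M (Ao i))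
        (\<lambda>d. (ec1 d \<triangleleft> \<eta> M (Ao (src1 I d))) \<odot> (e1 (trg1 I d) \<triangleright> vinv (\<eta>n M (Ft d)))) m"
    using D0.fcolim_ES[OF f0 a(2) eeta] .
  define \<epsilon> where "\<epsilon> = (\<lambda>i. vinv (m i))"
  have \<epsilon>: "D0.D.isomod (alg_ob B1) (\<lambda>i. e1 i \<cdot> \<eta> M (Ao i)) (\<lambda>d. (ec1 d \<triangleleft> \<eta> M (Ao (src1 I d))) \<odot> (e1 (trg1 I d) \<triangleright> vinv (\<eta>n M (Ft d))))
        (\<lambda>i. mor_fun jj \<cdot> e i) (\<lambda>d. mor_fun jj \<triangleright> ec d) \<epsilon>"
    unfolding \<epsilon>_def by (rule D0.D.isomod_vinv[OF m])
  obtain pp0 m where pp0 [simp]: "mor pp0" "mor_src pp0 = B2" "mor_trg pp0 = B1"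
    and m: "D1.TD.isomod (alg_ob B1) (\<lambda>i. mor_fun pp0 \<cdot> e2 i) (\<lambda>d. mor_fun pp0 \<triangleright> ec2 d) (\<lambda>i. ?b1 \<cdot> T1 M (e1 i)) (\<lambda>d. ?b1 \<triangleright> T2 M (ec1 d)) m"
    using D2.fcolim_ES[OF f2 a(2) D1.ococ_act[OF o1 a(2)]] .
  define \<pi>0 where "\<pi>0 = (\<lambda>i. vinv (m i))"
  have \<pi>0: "D1.TD.isomod (alg_ob B1) (\<lambda>i. ?b1 \<cdot> T1 M (e1 i)) (\<lambda>d. ?b1 \<triangleright> T2 M (ec1 d)) (\<lambda>i. mor_fun pp0 \<cdot> e2 i) (\<lambda>d. mor_fun pp0 \<triangleright> ec2 d) \<pi>0"
    unfolding \<pi>0_def by (rule D1.TD.isomod_vinv[OF m])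
  have emu: "oc2 (alg_ob B1) (\<lambda>i. e1 i \<cdot> \<mu> M (Ao i)) (\<lambda>d. (ec1 d \<triangleleft> \<mu> M (Ao (src1 I d))) \<odot> (e1 (trg1 I d) \<triangleright> \<mu>n M (Ft d)))"
    using D0.TD.ococ_restrict[OF D1.two_fun_TD D0.lax_nat_mu o1] by simp
  obtain pp1 \<pi>1 where pp1 [simp]: "mor pp1" "mor_src pp1 = B2" "mor_trg pp1 = B1"
    and \<pi>1: "D1.TD.isomod (alg_ob B1) (\<lambda>i. mor_fun pp1 \<cdot> e2 i) (\<lambda>d. mor_fun pp1 \<triangleright> ec2 d)
        (\<lambda>i. e1 i \<cdot> \<mu> M (Ao i)) (\<lambda>d. (ec1 d \<triangleleft> \<mu> M (Ao (src1 I d))) \<odot> (e1 (trg1 I d) \<triangleright> \<mu>n M (Ft d))) \<pi>1"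
    using D2.fcolim_ES[OF f2 a(2) emu] .
  have eTa: "oc2 (alg_ob B1) (\<lambda>i. e1 i \<cdot> T1 M (Aa i)) (\<lambda>d. (ec1 d \<triangleleft> T1 M (Aa (src1 I d))) \<odot> (e1 (trg1 I d) \<triangleright> T2 M (Fc d)))"
    using D0.TD.ococ_restrict[OF D1.two_fun_TD lax_nat_Tact o1] by simp
  obtain pp2 \<pi>2 where pp2 [simp]: "mor pp2" "mor_src pp2 = B2" "mor_trg pp2 = B1"
    and \<pi>2: "D1.TD.isomod (alg_ob B1) (\<lambda>i. mor_fun pp2 \<cdot> e2 i) (\<lambda>d. mor_fun pp2 \<triangleright> ec2 d)
        (\<lambda>i. e1 i \<cdot> T1 M (Aa i)) (\<lambda>d. (ec1 d \<triangleleft> T1 M (Aa (src1 I d))) \<odot> (e1 (trg1 I d) \<triangleright> T2 M (Fc d))) \<pi>2"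
    using D2.fcolim_ES[OF f2 a(2) eTa] .
  note [simp] = D0.TD.isomodD(4-)[OF \<delta>0] D0.TD.isomodD(4-)[OF \<delta>1] D0.D.isomodD(4-)[OF \<epsilon>]
    D1.TD.isomodD(4-)[OF \<pi>0] D1.TD.isomodD(4-)[OF \<pi>1] D1.TD.isomodD(4-)[OF \<pi>2]
  note \<delta>0\<eta> = D0.TD.isomod_restrict[OF two_fun_U D0.lax_nat_eta \<delta>0, simplified]
  note \<delta>1\<eta> = D0.TD.isomod_restrict[OF two_fun_U D0.lax_nat_eta \<delta>1, simplified]
  have mc: "mor (comp_psmor C M u v)" if "mor u" "mor v" "mor_src u = mor_trg v" for u v
    using mor_comp_psmor[OF that(2,1,3)] .

  have id0: "D0.D.isomod (alg_ob B0) e ec (\<lambda>i. mor_fun (id_mor B0) \<cdot> e i) (\<lambda>d. mor_fun (id_mor B0) \<triangleright> ec d) (\<lambda>i. id2 C (e i))"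
    by (rule D0.D.isomod_cong[OF D0.D.isomod_id[OF o]]) simp_all
  \<comment> \<open>The identity pseudomorphism restricts to the cocone \<open>e\<close> itself, so
    the comparison on the target side of \<open>N0\<close> and \<open>N1\<close> is an
    identity.\<close>
  have id0': "D0.D.isomod (alg_ob B0) (\<lambda>i. mor_fun (id_mor B0) \<cdot> e i) (\<lambda>d. mor_fun (id_mor B0) \<triangleright> ec d) e ec (\<lambda>i. id2 C (e i))"
    by (rule D0.D.isomod_cong[OF D0.D.isomod_id[OF o]]) simp_all
  have iN: "D0.D.isomod (alg_ob B0) (\<lambda>i. (?b0 \<cdot> T1 M (e i)) \<cdot> \<eta> M (Ao i))
     (\<lambda>d. ((?b0 \<triangleright> T2 M (ec d)) \<triangleleft> \<eta> M (Ao (src1 I d))) \<odot> ((?b0 \<cdot> T1 M (e (trg1 I d))) \<triangleright> vinv (\<eta>n M (Ft d)))) e ec (\<lambda>i. ev B0 (e i))"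
    using D0.TD.ococ_restrict[OF two_fun_U D0.lax_nat_eta D0.ococ_act[OF o a(1)]] o D0.omod_ev[OF o a(1)]
    by (intro D0.D.isomodI) simp_all
  have G: "D0.D.isomod (alg_ob B0) (\<lambda>i. (?b0 \<cdot> T1 M (e i)) \<cdot> \<eta> M (Ao i))
     (\<lambda>d. ((?b0 \<triangleright> T2 M (ec d)) \<triangleleft> \<eta> M (Ao (src1 I d))) \<odot> ((?b0 \<cdot> T1 M (e (trg1 I d))) \<triangleright> vinv (\<eta>n M (Ft d))))
     (\<lambda>i. mor_fun (comp_psmor C M dd0 jj) \<cdot> e i) (\<lambda>d. mor_fun (comp_psmor C M dd0 jj) \<triangleright> ec d)
     (\<lambda>i. (mor_fun dd0 \<triangleright> \<epsilon> i) \<odot> (\<delta>0 i \<triangleleft> \<eta> M (Ao i)))"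
  proof (rule D0.D.isomod_comp)
    show "D0.D.isomod (alg_ob B0) (\<lambda>i. (?b0 \<cdot> T1 M (e i)) \<cdot> \<eta> M (Ao i))
     (\<lambda>d. ((?b0 \<triangleright> T2 M (ec d)) \<triangleleft> \<eta> M (Ao (src1 I d))) \<odot> ((?b0 \<cdot> T1 M (e (trg1 I d))) \<triangleright> vinv (\<eta>n M (Ft d))))
     (\<lambda>i. mor_fun dd0 \<cdot> (e1 i \<cdot> \<eta> M (Ao i))) (\<lambda>d. mor_fun dd0 \<triangleright> ((ec1 d \<triangleleft> \<eta> M (Ao (src1 I d))) \<odot> (e1 (trg1 I d) \<triangleright> vinv (\<eta>n M (Ft d)))))
     (\<lambda>i. \<delta>0 i \<triangleleft> \<eta> M (Ao i))"
      by (rule D0.D.isomod_cong[OF \<delta>0\<eta>]) simp_all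
    show "D0.D.isomod (alg_ob B0) (\<lambda>i. mor_fun dd0 \<cdot> (e1 i \<cdot> \<eta> M (Ao i))) (\<lambda>d. mor_fun dd0 \<triangleright> ((ec1 d \<triangleleft> \<eta> M (Ao (src1 I d))) \<odot> (e1 (trg1 I d) \<triangleright> vinv (\<eta>n M (Ft d)))))
     (\<lambda>i. mor_fun (comp_psmor C M dd0 jj) \<cdot> e i) (\<lambda>d. mor_fun (comp_psmor C M dd0 jj) \<triangleright> ec d) (\<lambda>i. mor_fun dd0 \<triangleright> \<epsilon> i)"
      by (rule D0.D.isomod_cong[OF D0.D.isomod_lwhisker[OF \<epsilon>, of "mor_fun dd0" "alg_ob B0"]]) simp_all
  qed
  obtain n0 where n0: "D0.D.isomod (alg_ob B0) (\<lambda>i. mor_fun (comp_psmor C M dd0 jj) \<cdot> e i) (\<lambda>d. mor_fun (comp_psmor C M dd0 jj) \<triangleright> ec d)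
      (\<lambda>i. mor_fun (id_mor B0) \<cdot> e i) (\<lambda>d. mor_fun (id_mor B0) \<triangleright> ec d) n0"
    and n0e: "\<And>i. i \<in> Obj I \<Longrightarrow> id2 C (e i) \<odot> (n0 i \<odot> ((mor_fun dd0 \<triangleright> \<epsilon> i) \<odot> (\<delta>0 i \<triangleleft> \<eta> M (Ao i)))) = ev B0 (e i)"
    using D0.D.isomod_solve[OF G id0' iN] by blast
  obtain N0 where N0 [simp]: "transf N0" "trans_src N0 = comp_psmor C M dd0 jj" "trans_trg N0 = id_mor B0" "iso2 (trans_cell N0)"
    and N0e: "\<And>i. i \<in> Obj I \<Longrightarrow> trans_cell N0 \<triangleleft> e i = n0 i"
    using D0.fcolim_iso[OF f0 _ _ _ _ _ _ n0] by (metis mc mor_id_mor a(1) dd0 jj comp_psmor_simps(1,2) psmor.sel(1,2))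
  have N0_eq: "(trans_cell N0 \<triangleleft> e i) \<odot> ((mor_fun dd0 \<triangleright> \<epsilon> i) \<odot> (\<delta>0 i \<triangleleft> \<eta> M (Ao i))) = ev B0 (e i)" if "i \<in> Obj I" for i
    using n0e[OF that] D0.D.isomodD(4-)[OF n0 that] N0e[OF that] that by simp

  have iN: "D0.D.isomod (alg_ob B0) (\<lambda>i. (e i \<cdot> Aa i) \<cdot> \<eta> M (Ao i))
      (\<lambda>d. (((ec d \<triangleleft> Aa (src1 I d)) \<odot> (e (trg1 I d) \<triangleright> Fc d)) \<triangleleft> \<eta> M (Ao (src1 I d))) \<odot> ((e (trg1 I d) \<cdot> Aa (trg1 I d)) \<triangleright> vinv (\<eta>n M (Ft d))))
      e ec (\<lambda>i. e i \<triangleright> alg_unit (F0 F i))"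
    using D0.D.isomodD(2)[OF D0.TD.isomod_restrict[OF two_fun_U D0.lax_nat_eta \<delta>1]] o omod_unit[OF o]
    by (intro D0.D.isomodI) simp_all
  have d1eta: "D0.D.isomod (alg_ob B0) (\<lambda>i. mor_fun dd1 \<cdot> (e1 i \<cdot> \<eta> M (Ao i)))
      (\<lambda>d. mor_fun dd1 \<triangleright> ((ec1 d \<triangleleft> \<eta> M (Ao (src1 I d))) \<odot> (e1 (trg1 I d) \<triangleright> vinv (\<eta>n M (Ft d)))))
      (\<lambda>i. (e i \<cdot> Aa i) \<cdot> \<eta> M (Ao i))
      (\<lambda>d. (((ec d \<triangleleft> Aa (src1 I d)) \<odot> (e (trg1 I d) \<triangleright> Fc d)) \<triangleleft> \<eta> M (Ao (src1 I d))) \<odot> ((e (trg1 I d) \<cdot> Aa (trg1 I d)) \<triangleright> vinv (\<eta>n M (Ft d))))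
      (\<lambda>i. \<delta>1 i \<triangleleft> \<eta> M (Ao i))"
    by (rule D0.D.isomod_cong[OF D0.TD.isomod_restrict[OF two_fun_U D0.lax_nat_eta \<delta>1]]) simp_all
  have G: "D0.D.isomod (alg_ob B0) (\<lambda>i. mor_fun dd1 \<cdot> (e1 i \<cdot> \<eta> M (Ao i)))
      (\<lambda>d. mor_fun dd1 \<triangleright> ((ec1 d \<triangleleft> \<eta> M (Ao (src1 I d))) \<odot> (e1 (trg1 I d) \<triangleright> vinv (\<eta>n M (Ft d)))))
     (\<lambda>i. mor_fun (comp_psmor C M dd1 jj) \<cdot> e i) (\<lambda>d. mor_fun (comp_psmor C M dd1 jj) \<triangleright> ec d) (\<lambda>i. mor_fun dd1 \<triangleright> \<epsilon> i)"
    by (rule D0.D.isomod_cong[OF D0.D.isomod_lwhisker[OF \<epsilon>, of "mor_fun dd1" "alg_ob B0"]]) simp_all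
  obtain n1 where n1: "D0.D.isomod (alg_ob B0) (\<lambda>i. mor_fun (comp_psmor C M dd1 jj) \<cdot> e i) (\<lambda>d. mor_fun (comp_psmor C M dd1 jj) \<triangleright> ec d)
      (\<lambda>i. mor_fun (id_mor B0) \<cdot> e i) (\<lambda>d. mor_fun (id_mor B0) \<triangleright> ec d) n1"
    and n1e: "\<And>i. i \<in> Obj I \<Longrightarrow> id2 C (e i) \<odot> (n1 i \<odot> (mor_fun dd1 \<triangleright> \<epsilon> i)) = (e i \<triangleright> alg_unit (F0 F i)) \<odot> (\<delta>1 i \<triangleleft> \<eta> M (Ao i))"
    using D0.D.isomod_solve[OF G id0' D0.D.isomod_comp[OF d1eta iN]] by blast
  obtain N1 where N1 [simp]: "transf N1" "trans_src N1 = comp_psmor C M dd1 jj" "trans_trg N1 = id_mor B0" "iso2 (trans_cell N1)"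
    and N1e: "\<And>i. i \<in> Obj I \<Longrightarrow> trans_cell N1 \<triangleleft> e i = n1 i"
    using D0.fcolim_iso[OF f0 _ _ _ _ _ _ n1] by (metis mc mor_id_mor a(1) dd1 jj comp_psmor_simps(1,2) psmor.sel(1,2))
  have N1_eq: "(trans_cell N1 \<triangleleft> e i) \<odot> (mor_fun dd1 \<triangleright> \<epsilon> i) = (e i \<triangleright> alg_unit (F0 F i)) \<odot> (\<delta>1 i \<triangleleft> \<eta> M (Ao i))" if "i \<in> Obj I" for i
    using n1e[OF that] D0.D.isomodD(4-)[OF n1 that] N1e[OF that] that by simp

  have actact: "D1.TD.isomod (alg_ob B0) (\<lambda>i. ?b0 \<cdot> T1 M (?b0 \<cdot> T1 M (e i))) (\<lambda>d. ?b0 \<triangleright> T2 M (?b0 \<triangleright> T2 M (ec d)))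
      (\<lambda>i. ?b0 \<cdot> T1 M (mor_fun dd0 \<cdot> e1 i)) (\<lambda>d. ?b0 \<triangleright> T2 M (mor_fun dd0 \<triangleright> ec1 d)) (\<lambda>i. ?b0 \<triangleright> T2 M (\<delta>0 i))"
    by (rule D1.isomod_act[OF \<delta>0 a(1)])
  \<comment> \<open>The part \<open>b0 T(u e1) \<Rightarrow> u b1 T e1 \<Rightarrow> u p0 e2\<close>
    common to the equations of \<open>H01\<close> and \<open>H02\<close>, where \<open>u\<close> is
    \<open>dd0\<close> and \<open>dd1\<close> respectively.\<close>
  have psi0: "D1.TD.isomod (alg_ob B0) (\<lambda>i. ?b0 \<cdot> T1 M (mor_fun u \<cdot> e1 i)) (\<lambda>d. ?b0 \<triangleright> T2 M (mor_fun u \<triangleright> ec1 d))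
      (\<lambda>i. mor_fun (comp_psmor C M u pp0) \<cdot> e2 i) (\<lambda>d. mor_fun (comp_psmor C M u pp0) \<triangleright> ec2 d)
      (\<lambda>i. (mor_fun u \<triangleright> \<pi>0 i) \<odot> (mor_cell u \<triangleleft> T1 M (e1 i)))"
    if [simp]: "mor u" "mor_src u = B1" "mor_trg u = B0" for u
  proof (rule D1.TD.isomod_comp)
    show "D1.TD.isomod (alg_ob B0) (\<lambda>i. ?b0 \<cdot> T1 M (mor_fun u \<cdot> e1 i)) (\<lambda>d. ?b0 \<triangleright> T2 M (mor_fun u \<triangleright> ec1 d))
      (\<lambda>i. mor_fun u \<cdot> (?b1 \<cdot> T1 M (e1 i))) (\<lambda>d. mor_fun u \<triangleright> (?b1 \<triangleright> T2 M (ec1 d))) (\<lambda>i. mor_cell u \<triangleleft> T1 M (e1 i))"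
      by (rule D1.isomod_mor_act[OF that o1])
    show "D1.TD.isomod (alg_ob B0) (\<lambda>i. mor_fun u \<cdot> (?b1 \<cdot> T1 M (e1 i))) (\<lambda>d. mor_fun u \<triangleright> (?b1 \<triangleright> T2 M (ec1 d)))
      (\<lambda>i. mor_fun (comp_psmor C M u pp0) \<cdot> e2 i) (\<lambda>d. mor_fun (comp_psmor C M u pp0) \<triangleright> ec2 d) (\<lambda>i. mor_fun u \<triangleright> \<pi>0 i)"
      by (rule D1.TD.isomod_cong[OF D1.TD.isomod_lwhisker[OF \<pi>0, of "mor_fun u" "alg_ob B0"]]) simp_all
  qed
  have psi1: "D1.TD.isomod (alg_ob B0) (\<lambda>i. mor_fun (comp_psmor C M u pp1) \<cdot> e2 i) (\<lambda>d. mor_fun (comp_psmor C M u pp1) \<triangleright> ec2 d)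
      (\<lambda>i. (mor_fun u \<cdot> e1 i) \<cdot> \<mu> M (Ao i)) (\<lambda>d. ((mor_fun u \<triangleright> ec1 d) \<triangleleft> \<mu> M (Ao (src1 I d))) \<odot> ((mor_fun u \<cdot> e1 (trg1 I d)) \<triangleright> \<mu>n M (Ft d)))
      (\<lambda>i. mor_fun u \<triangleright> \<pi>1 i)"
    if [simp]: "mor u" "mor_src u = B1" "mor_trg u = B0" for u
    by (rule D1.TD.isomod_cong[OF D1.TD.isomod_lwhisker[OF \<pi>1, of "mor_fun u" "alg_ob B0"]]) simp_all
  have psi2: "D1.TD.isomod (alg_ob B0) (\<lambda>i. mor_fun (comp_psmor C M u pp2) \<cdot> e2 i) (\<lambda>d. mor_fun (comp_psmor C M u pp2) \<triangleright> ec2 d)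
      (\<lambda>i. (mor_fun u \<cdot> e1 i) \<cdot> T1 M (Aa i)) (\<lambda>d. ((mor_fun u \<triangleright> ec1 d) \<triangleleft> T1 M (Aa (src1 I d))) \<odot> ((mor_fun u \<cdot> e1 (trg1 I d)) \<triangleright> T2 M (Fc d)))
      (\<lambda>i. mor_fun u \<triangleright> \<pi>2 i)"
    if [simp]: "mor u" "mor_src u = B1" "mor_trg u = B0" for u
    by (rule D1.TD.isomod_cong[OF D1.TD.isomod_lwhisker[OF \<pi>2, of "mor_fun u" "alg_ob B0"]]) simp_all
  note \<delta>0\<mu> = D0.TD.isomod_restrict[OF D1.two_fun_TD D0.lax_nat_mu \<delta>0]
  note \<delta>1\<mu> = D0.TD.isomod_restrict[OF D1.two_fun_TD D0.lax_nat_mu \<delta>1]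
  note \<delta>0T = D0.TD.isomod_restrict[OF D1.two_fun_TD lax_nat_Tact \<delta>0]
  note \<delta>1T = D0.TD.isomod_restrict[OF D1.two_fun_TD lax_nat_Tact \<delta>1]

  \<comment> \<open>Multiplying out the action of \<open>B0\<close>, followed by \<delta>0 pulled
    back along \<open>\<mu>\<close>, is the right-hand side of the equation for
    \<open>H01\<close>.\<close>
  have "D1.TD.isomod (alg_ob B0) (\<lambda>i. ?b0 \<cdot> T1 M (?b0 \<cdot> T1 M (e i))) (\<lambda>d. ?b0 \<triangleright> T2 M (?b0 \<triangleright> T2 M (ec d)))
     (\<lambda>i. (?b0 \<cdot> T1 M (e i)) \<cdot> \<mu> M (F0 U i))
     (\<lambda>d. ((?b0 \<triangleright> T2 M (ec d)) \<triangleleft> \<mu> M (F0 U (src1 I d))) \<odot> ((?b0 \<cdot> T1 M (e (trg1 I d))) \<triangleright> \<mu>n M (F1 U d)))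
     (\<lambda>i. (?b0 \<triangleright> \<mu>n M (e i)) \<odot> (alg_mult B0 \<triangleleft> T1 M (T1 M (e i))))"
    by (rule D1.TD.isomodI[OF D1.TD.isomodD(1)[OF actact] D1.TD.isomodD(1)[OF \<delta>0\<mu>] D0.omod_mult[OF o a(1)]]) simp_all
  from D1.TD.isomod_comp[OF this \<delta>0\<mu>]
  have K: "D1.TD.isomod (alg_ob B0) (\<lambda>i. ?b0 \<cdot> T1 M (?b0 \<cdot> T1 M (e i))) (\<lambda>d. ?b0 \<triangleright> T2 M (?b0 \<triangleright> T2 M (ec d)))
     (\<lambda>i. (mor_fun dd0 \<cdot> e1 i) \<cdot> \<mu> M (Ao i)) (\<lambda>d. ((mor_fun dd0 \<triangleright> ec1 d) \<triangleleft> \<mu> M (Ao (src1 I d))) \<odot> ((mor_fun dd0 \<cdot> e1 (trg1 I d)) \<triangleright> \<mu>n M (Ft d)))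
     (\<lambda>i. (\<delta>0 i \<triangleleft> \<mu> M (Ao i)) \<odot> ((?b0 \<triangleright> \<mu>n M (e i)) \<odot> (alg_mult B0 \<triangleleft> T1 M (T1 M (e i)))))"
    by (simp only: U_simps)
  obtain h01 where h01: "D1.TD.isomod (alg_ob B0) (\<lambda>i. mor_fun (comp_psmor C M dd0 pp0) \<cdot> e2 i) (\<lambda>d. mor_fun (comp_psmor C M dd0 pp0) \<triangleright> ec2 d)
      (\<lambda>i. mor_fun (comp_psmor C M dd0 pp1) \<cdot> e2 i) (\<lambda>d. mor_fun (comp_psmor C M dd0 pp1) \<triangleright> ec2 d) h01"
    and h01e: "\<And>i. i \<in> Obj I \<Longrightarrow> (mor_fun dd0 \<triangleright> \<pi>1 i) \<odot> (h01 i \<odot> (((mor_fun dd0 \<triangleright> \<pi>0 i) \<odot> (mor_cell dd0 \<triangleleft> T1 M (e1 i))) \<odot> (?b0 \<triangleright> T2 M (\<delta>0 i)))) =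
        (\<delta>0 i \<triangleleft> \<mu> M (Ao i)) \<odot> ((?b0 \<triangleright> \<mu>n M (e i)) \<odot> (alg_mult B0 \<triangleleft> T1 M (T1 M (e i))))"
    using D1.TD.isomod_solve[OF D1.TD.isomod_comp[OF actact psi0[OF dd0]] psi1[OF dd0] K] by blast
  obtain H01 where H01 [simp]: "transf H01" "trans_src H01 = comp_psmor C M dd0 pp0" "trans_trg H01 = comp_psmor C M dd0 pp1" "iso2 (trans_cell H01)"
    and H01e: "\<And>i. i \<in> Obj I \<Longrightarrow> trans_cell H01 \<triangleleft> e2 i = h01 i"
    using D2.fcolim_iso[OF f2 _ _ _ _ _ _ h01] by (metis mc dd0 pp0 pp1 comp_psmor_simps(1,2))
  have H01_eq: "(mor_fun dd0 \<triangleright> \<pi>1 i) \<odot> ((trans_cell H01 \<triangleleft> e2 i) \<odot>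
        ((mor_fun dd0 \<triangleright> \<pi>0 i) \<odot> ((mor_cell dd0 \<triangleleft> T1 M (e1 i)) \<odot> (?b0 \<triangleright> T2 M (\<delta>0 i))))) =
        (\<delta>0 i \<triangleleft> \<mu> M (Ao i)) \<odot> ((?b0 \<triangleright> \<mu>n M (e i)) \<odot> (alg_mult B0 \<triangleleft> T1 M (T1 M (e i))))" if "i \<in> Obj I" for i
    using h01e[OF that] D1.TD.isomodD(4-)[OF h01 that] H01e[OF that] that by simp

  have "D1.TD.isomod (alg_ob B0) (\<lambda>i. ?b0 \<cdot> T1 M (mor_fun dd1 \<cdot> e1 i)) (\<lambda>d. ?b0 \<triangleright> T2 M (mor_fun dd1 \<triangleright> ec1 d))
     (\<lambda>i. (?b0 \<cdot> T1 M (e i)) \<cdot> T1 M (Aa i))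
     (\<lambda>d. ((?b0 \<triangleright> T2 M (ec d)) \<triangleleft> T1 M (Aa (src1 I d))) \<odot> ((?b0 \<cdot> T1 M (e (trg1 I d))) \<triangleright> T2 M (Fc d)))
     (\<lambda>i. ?b0 \<triangleright> T2 M (\<delta>1 i))"
    by (rule D1.TD.isomod_cong[OF D1.isomod_act[OF \<delta>1 a(1)]]) simp_all
  note K = D1.TD.isomod_comp[OF this \<delta>0T]
  obtain h02 where h02: "D1.TD.isomod (alg_ob B0) (\<lambda>i. mor_fun (comp_psmor C M dd1 pp0) \<cdot> e2 i) (\<lambda>d. mor_fun (comp_psmor C M dd1 pp0) \<triangleright> ec2 d)
      (\<lambda>i. mor_fun (comp_psmor C M dd0 pp2) \<cdot> e2 i) (\<lambda>d. mor_fun (comp_psmor C M dd0 pp2) \<triangleright> ec2 d) h02"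
    and h02e: "\<And>i. i \<in> Obj I \<Longrightarrow> (mor_fun dd0 \<triangleright> \<pi>2 i) \<odot> (h02 i \<odot> ((mor_fun dd1 \<triangleright> \<pi>0 i) \<odot> (mor_cell dd1 \<triangleleft> T1 M (e1 i)))) =
        (\<delta>0 i \<triangleleft> T1 M (Aa i)) \<odot> (?b0 \<triangleright> T2 M (\<delta>1 i))"
    using D1.TD.isomod_solve[OF psi0[OF dd1] psi2[OF dd0] K] by blast
  obtain H02 where H02 [simp]: "transf H02" "trans_src H02 = comp_psmor C M dd1 pp0" "trans_trg H02 = comp_psmor C M dd0 pp2" "iso2 (trans_cell H02)"
    and H02e: "\<And>i. i \<in> Obj I \<Longrightarrow> trans_cell H02 \<triangleleft> e2 i = h02 i"
    using D2.fcolim_iso[OF f2 _ _ _ _ _ _ h02] by (metis mc dd0 dd1 pp0 pp2 comp_psmor_simps(1,2))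
  have H02_eq: "(mor_fun dd0 \<triangleright> \<pi>2 i) \<odot> ((trans_cell H02 \<triangleleft> e2 i) \<odot>
        ((mor_fun dd1 \<triangleright> \<pi>0 i) \<odot> (mor_cell dd1 \<triangleleft> T1 M (e1 i)))) = (\<delta>0 i \<triangleleft> T1 M (Aa i)) \<odot> (?b0 \<triangleright> T2 M (\<delta>1 i))" if "i \<in> Obj I" for i
    using h02e[OF that] H02e[OF that] by simp

  have as: "D1.TD.isomod (alg_ob B0) (\<lambda>i. (e i \<cdot> Aa i) \<cdot> T1 M (Aa i))
      (\<lambda>d. (((ec d \<triangleleft> Aa (src1 I d)) \<odot> (e (trg1 I d) \<triangleright> Fc d)) \<triangleleft> T1 M (Aa (src1 I d))) \<odot> ((e (trg1 I d) \<cdot> Aa (trg1 I d)) \<triangleright> T2 M (Fc d)))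
      (\<lambda>i. (e i \<cdot> Aa i) \<cdot> \<mu> M (F0 U i))
      (\<lambda>d. (((ec d \<triangleleft> Aa (src1 I d)) \<odot> (e (trg1 I d) \<triangleright> Fc d)) \<triangleleft> \<mu> M (F0 U (src1 I d))) \<odot> ((e (trg1 I d) \<cdot> Aa (trg1 I d)) \<triangleright> \<mu>n M (F1 U d)))
      (\<lambda>i. e i \<triangleright> alg_mult (F0 F i))"
    using omod_assoc[OF o]
    by (intro D1.TD.isomodI[OF D1.TD.isomodD(2)[OF \<delta>1T] D1.TD.isomodD(2)[OF \<delta>1\<mu>]]) simp_all
  have K: "D1.TD.isomod (alg_ob B0) (\<lambda>i. mor_fun (comp_psmor C M dd1 pp1) \<cdot> e2 i) (\<lambda>d. mor_fun (comp_psmor C M dd1 pp1) \<triangleright> ec2 d)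
      (\<lambda>i. (e i \<cdot> Aa i) \<cdot> \<mu> M (F0 U i))
      (\<lambda>d. (((ec d \<triangleleft> Aa (src1 I d)) \<odot> (e (trg1 I d) \<triangleright> Fc d)) \<triangleleft> \<mu> M (F0 U (src1 I d))) \<odot> ((e (trg1 I d) \<cdot> Aa (trg1 I d)) \<triangleright> \<mu>n M (F1 U d)))
      (\<lambda>i. (\<delta>1 i \<triangleleft> \<mu> M (F0 U i)) \<odot> (mor_fun dd1 \<triangleright> \<pi>1 i))"
    by (rule D1.TD.isomod_comp[OF _ \<delta>1\<mu>]) (use psi1[OF dd1] in simp)
  \<comment> \<open>\<open>isomod_solve\<close> expects a known cell on each side of the unknown
    one. All known cells for \<open>H12\<close> stand after it, so the one before it is an
    identity.\<close>
  have id2': "D1.TD.isomod (alg_ob B0) (\<lambda>i. mor_fun (comp_psmor C M dd1 pp1) \<cdot> e2 i) (\<lambda>d. mor_fun (comp_psmor C M dd1 pp1) \<triangleright> ec2 d)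
      (\<lambda>i. mor_fun (comp_psmor C M dd1 pp1) \<cdot> e2 i) (\<lambda>d. mor_fun (comp_psmor C M dd1 pp1) \<triangleright> ec2 d) (\<lambda>i. id2 C (mor_fun (comp_psmor C M dd1 pp1) \<cdot> e2 i))"
    by (rule D1.TD.isomod_id[OF D1.TD.isomodD(1)[OF K]])
  obtain h12 where h12: "D1.TD.isomod (alg_ob B0) (\<lambda>i. mor_fun (comp_psmor C M dd1 pp1) \<cdot> e2 i) (\<lambda>d. mor_fun (comp_psmor C M dd1 pp1) \<triangleright> ec2 d)
      (\<lambda>i. mor_fun (comp_psmor C M dd1 pp2) \<cdot> e2 i) (\<lambda>d. mor_fun (comp_psmor C M dd1 pp2) \<triangleright> ec2 d) h12"
    and h12e: "\<And>i. i \<in> Obj I \<Longrightarrow> ((e i \<triangleright> alg_mult (F0 F i)) \<odot> ((\<delta>1 i \<triangleleft> T1 M (Aa i)) \<odot> (mor_fun dd1 \<triangleright> \<pi>2 i))) \<odot> (h12 i \<odot> id2 C (mor_fun (comp_psmor C M dd1 pp1) \<cdot> e2 i)) =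
        (\<delta>1 i \<triangleleft> \<mu> M (F0 U i)) \<odot> (mor_fun dd1 \<triangleright> \<pi>1 i)"
    using D1.TD.isomod_solve[OF id2' D1.TD.isomod_comp[OF D1.TD.isomod_comp[OF psi2[OF dd1] \<delta>1T] as] K] by blast
  obtain H12 where H12 [simp]: "transf H12" "trans_src H12 = comp_psmor C M dd1 pp1" "trans_trg H12 = comp_psmor C M dd1 pp2" "iso2 (trans_cell H12)"
    and H12e: "\<And>i. i \<in> Obj I \<Longrightarrow> trans_cell H12 \<triangleleft> e2 i = h12 i"
    using D2.fcolim_iso[OF f2 _ _ _ _ _ _ h12] by (metis mc dd1 pp1 pp2 comp_psmor_simps(1,2))
  have H12_eq: "(e i \<triangleright> alg_mult (F0 F i)) \<odot> ((\<delta>1 i \<triangleleft> T1 M (Aa i)) \<odot> ((mor_fun dd1 \<triangleright> \<pi>2 i) \<odot> (trans_cell H12 \<triangleleft> e2 i))) =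
        (\<delta>1 i \<triangleleft> \<mu> M (Ao i)) \<odot> (mor_fun dd1 \<triangleright> \<pi>1 i)" if "i \<in> Obj I" for i
    using h12e[OF that] D1.TD.isomodD(4-)[OF h12 that] H12e[OF that] that by simp

  have "resolution C M I F B0 B1 B2 e ec e1 ec1 e2 ec2 dd0 dd1 jj pp0 pp1 pp2 \<delta>0 \<delta>1 \<epsilon> \<pi>0 \<pi>1 \<pi>2 N0 N1 H01 H02 H12"
    by (intro resolution.intro alg_diagram_axioms resolution_axioms.intro)
      (fact f0 f1 f2 dd0 dd1 jj pp0 pp1 pp2 \<delta>0 \<delta>1 \<epsilon> \<pi>0 \<pi>1 \<pi>2 N0 N0_eq N1 N1_eq H01 H01_eq H02 H02_eq H12 H12_eq)+
  then show ?thesis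
    by blast
qed

end

section \<open>Pseudocoequalizing pairs and cocones of algebras\<close>

context psmonad
begin

text \<open>The unit law of \<open>q\<close>, whiskered by \<open>g\<close>, together with
  interchange of its structure cell with the unit cell at \<open>g\<close>.\<close>

lemma ev_mor:
  assumes "mor q" "mor_src q = X" "mor_trg q = B" "g \<in> Cell1 C" "trg1 C g = alg_ob X" "src1 C g = A"
  shows "(mor_fun q \<triangleright> ev X g) \<odot> (mor_cell q \<triangleleft> T1 M g \<cdot> \<eta> M A) = ev B (mor_fun q \<cdot> g)"
proof -
  have [simp]: "alg X" "alg B"
    using mor_typing(1,2)[OF assms(1)] assms(2,3) by auto
  have [simp]: "A \<in> Obj C"
    using assms(4,6) by auto
  note [simp] = assms
  have 1: "(mor_fun q \<cdot> alg_act X \<triangleright> \<eta>n M g) \<odot> (mor_cell q \<triangleleft> T1 M g \<cdot> \<eta> M A) =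
      (mor_cell q \<triangleleft> \<eta> M (alg_ob X) \<cdot> g) \<odot> (alg_act B \<cdot> T1 M (mor_fun q) \<triangleright> \<eta>n M g)"
    using swap[of "\<eta>n M g" "mor_cell q"] by simp
  have 2: "(mor_fun q \<triangleright> (alg_unit X \<triangleleft> g)) \<odot> (mor_cell q \<triangleleft> \<eta> M (alg_ob X) \<cdot> g) =
      (alg_unit B \<triangleleft> mor_fun q \<cdot> g) \<odot> (alg_act B \<triangleright> (\<eta>n M (mor_fun q) \<triangleleft> g))"
    using arg_cong[OF mor_unit[OF assms(1) refl refl refl], of "\<lambda>z. rwhisker C z g"] by simp
  show ?thesis
    by (simp add: ev_def 1 vcomp_eq_ext[OF 2])
qed

text \<open>Conjugating the structure cell of \<open>u\<close> by \<open>m\<close> gives structure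
  on the isomorphic 1-cell \<open>g\<close>. Each law is checked after composing with an invertible
  whiskering of \<open>m\<close>, which reduces it to the law of \<open>u\<close>.\<close>

lemma mor_transport:
  assumes "mor u" "mor_src u = X" "mor_trg u = B" "iso2 m" "src2 C m = g" "trg2 C m = mor_fun u"
  shows "mor (PsMor X B g ((vinv m \<triangleleft> alg_act X) \<odot> (mor_cell u \<odot> (alg_act B \<triangleright> T2 M m))))"
proof (rule morI)
  let ?a = "alg_act X" and ?b = "alg_act B" and ?f = "mor_fun u" and ?\<Phi> = "mor_cell u" and ?A = "alg_ob X"
  have [simp]: "alg X" "alg B"
    using mor_typing(1,2)[OF assms(1)] assms(2,3) by auto
  have m: "m \<in> Cell2 C"
    using assms(4) by simp
  have g [simp]: "g \<in> Cell1 C" "src1 C g = ?A" "trg1 C g = alg_ob B"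
    using Cell1_src2[OF m] src1_trg2[OF m] trg1_trg2[OF m] assms by auto
  note [simp] = assms
  show "alg X" "alg B" "g \<in> Cell1 C" "src1 C g = alg_ob X" "trg1 C g = alg_ob B"
    by simp_all
  show "iso2 ((vinv m \<triangleleft> ?a) \<odot> (?\<Phi> \<odot> (?b \<triangleright> T2 M m)))" "src2 C ((vinv m \<triangleleft> ?a) \<odot> (?\<Phi> \<odot> (?b \<triangleright> T2 M m))) = ?b \<cdot> T1 M g"
    "trg2 C ((vinv m \<triangleleft> ?a) \<odot> (?\<Phi> \<odot> (?b \<triangleright> T2 M m))) = g \<cdot> ?a"
    by simp_all
  have vw: "(m \<triangleleft> ?a \<cdot> h) \<odot> (vinv m \<triangleleft> ?a \<cdot> h) = id2 C (?f \<cdot> (?a \<cdot> h))" if "h \<in> Cell1 C" "trg1 C h = T0 M ?A" for h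
    using vinv_rwhisker(2)[of m "?a \<cdot> h"] that by simp
  have vT: "T2 M m \<odot> T2 M (vinv m) = id2 C (T1 M ?f)"
    using T.F2_vcomp[of "vinv m" m] by simp
  show "(g \<triangleright> alg_unit X) \<odot> (((vinv m \<triangleleft> ?a) \<odot> (?\<Phi> \<odot> (?b \<triangleright> T2 M m))) \<triangleleft> \<eta> M (alg_ob X)) = (alg_unit B \<triangleleft> g) \<odot> (?b \<triangleright> \<eta>n M g)"
  proof (rule iso2_cancel_left[of m])
    have 1: "m \<odot> (g \<triangleright> alg_unit X) = (?f \<triangleright> alg_unit X) \<odot> (m \<triangleleft> ?a \<cdot> \<eta> M ?A)"
      using swap[of "alg_unit X" m] by simp
    have 2: "(m \<triangleleft> ?a \<cdot> \<eta> M ?A) \<odot> (vinv m \<triangleleft> ?a \<cdot> \<eta> M ?A) = id2 C (?f \<cdot> (?a \<cdot> \<eta> M ?A))"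
      by (rule vw) simp_all
    have 3: "ev B ?f \<odot> (?b \<triangleright> (T2 M m \<triangleleft> \<eta> M ?A)) = m \<odot> ev B g"
      by (rule ev_nat) simp_all
    have 4: "(?f \<triangleright> alg_unit X) \<odot> (?\<Phi> \<triangleleft> \<eta> M ?A) = ev B ?f"
      using mor_unit[OF assms(1) refl refl refl] by (simp add: ev_def)
    have "m \<odot> ((g \<triangleright> alg_unit X) \<odot> (((vinv m \<triangleleft> ?a) \<odot> (?\<Phi> \<odot> (?b \<triangleright> T2 M m))) \<triangleleft> \<eta> M (alg_ob X))) = m \<odot> ev B g"
      by (simp add: vcomp_eq_ext[OF 1] vcomp_eq_ext[OF 2] vcomp_eq_ext[OF 4] 3)
    then show "m \<odot> ((g \<triangleright> alg_unit X) \<odot> (((vinv m \<triangleleft> ?a) \<odot> (?\<Phi> \<odot> (?b \<triangleright> T2 M m))) \<triangleleft> \<eta> M (alg_ob X))) = m \<odot> ((alg_unit B \<triangleleft> g) \<odot> (?b \<triangleright> \<eta>n M g))"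
      by (simp add: ev_def)
  qed simp_all
  show "(g \<triangleright> alg_mult X) \<odot> ((((vinv m \<triangleleft> ?a) \<odot> (?\<Phi> \<odot> (?b \<triangleright> T2 M m))) \<triangleleft> T1 M ?a) \<odot> (?b \<triangleright> T2 M ((vinv m \<triangleleft> ?a) \<odot> (?\<Phi> \<odot> (?b \<triangleright> T2 M m))))) =
    (((vinv m \<triangleleft> ?a) \<odot> (?\<Phi> \<odot> (?b \<triangleright> T2 M m))) \<triangleleft> \<mu> M (alg_ob X)) \<odot> ((?b \<triangleright> \<mu>n M g) \<odot> (alg_mult B \<triangleleft> T1 M (T1 M g)))"
  proof (rule iso2_cancel_left[of "m \<triangleleft> ?a \<cdot> \<mu> M ?A"])
    have 1: "(m \<triangleleft> ?a \<cdot> \<mu> M ?A) \<odot> (g \<triangleright> alg_mult X) = (?f \<triangleright> alg_mult X) \<odot> (m \<triangleleft> ?a \<cdot> T1 M ?a)"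
      using swap[of "alg_mult X" m] by simp
    have 2: "(m \<triangleleft> ?a \<cdot> T1 M ?a) \<odot> (vinv m \<triangleleft> ?a \<cdot> T1 M ?a) = id2 C (?f \<cdot> (?a \<cdot> T1 M ?a))"
      "(m \<triangleleft> ?a \<cdot> \<mu> M ?A) \<odot> (vinv m \<triangleleft> ?a \<cdot> \<mu> M ?A) = id2 C (?f \<cdot> (?a \<cdot> \<mu> M ?A))"
      by (rule vw; simp)+
    have 3: "(?b \<triangleright> (T2 M m \<triangleleft> T1 M ?a)) \<odot> (?b \<triangleright> (T2 M (vinv m) \<triangleleft> T1 M ?a)) = id2 C (?b \<cdot> (T1 M ?f \<cdot> T1 M ?a))"
      using arg_cong[OF vT, of "\<lambda>z. lwhisker C ?b (rwhisker C z (T1 M ?a))"] by simp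
    have 4: "(?f \<triangleright> alg_mult X) \<odot> ((?\<Phi> \<triangleleft> T1 M ?a) \<odot> (?b \<triangleright> T2 M ?\<Phi>)) = (?\<Phi> \<triangleleft> \<mu> M ?A) \<odot> ((?b \<triangleright> \<mu>n M ?f) \<odot> (alg_mult B \<triangleleft> T1 M (T1 M ?f)))"
      using mor_mult[OF assms(1) refl refl refl refl] by simp
    have 5: "(?b \<triangleright> (T2 M m \<triangleleft> \<mu> M ?A)) \<odot> ((?b \<triangleright> \<mu>n M g) \<odot> (alg_mult B \<triangleleft> T1 M (T1 M g))) =
      (?b \<triangleright> \<mu>n M ?f) \<odot> ((alg_mult B \<triangleleft> T1 M (T1 M ?f)) \<odot> (?b \<cdot> T1 M ?b \<triangleright> T2 M (T2 M m)))"
      by (rule ext_nat) simp_all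
    show "(m \<triangleleft> ?a \<cdot> \<mu> M ?A) \<odot> ((g \<triangleright> alg_mult X) \<odot> ((((vinv m \<triangleleft> ?a) \<odot> (?\<Phi> \<odot> (?b \<triangleright> T2 M m))) \<triangleleft> T1 M ?a) \<odot> (?b \<triangleright> T2 M ((vinv m \<triangleleft> ?a) \<odot> (?\<Phi> \<odot> (?b \<triangleright> T2 M m)))))) =
      (m \<triangleleft> ?a \<cdot> \<mu> M ?A) \<odot> ((((vinv m \<triangleleft> ?a) \<odot> (?\<Phi> \<odot> (?b \<triangleright> T2 M m))) \<triangleleft> \<mu> M (alg_ob X)) \<odot> ((?b \<triangleright> \<mu>n M g) \<odot> (alg_mult B \<triangleleft> T1 M (T1 M g))))"
      by (simp add: vcomp_eq_ext[OF 1] vcomp_eq_ext[OF 2(1)] vcomp_eq_ext[OF 2(2)] vcomp_eq_ext[OF 3] vcomp_eq_ext3[OF 4] 5)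
  qed simp_all
qed

end

section \<open>Pairs on the resolution and structure cells on the legs\<close>

context resolution
begin

lemma resolution_algs [simp]: "alg B0" "alg B1" "alg B2"
  using D0.fcolim_ococ(1)[OF f0] D1.fcolim_ococ(1)[OF f1] D2.fcolim_ococ(1)[OF f2] .

lemma e_ococ: "oc0 (alg_ob B0) e ec" "oc1 (alg_ob B1) e1 ec1" "oc2 (alg_ob B2) e2 ec2"
  using D0.fcolim_ococ(2)[OF f0] D1.fcolim_ococ(2)[OF f1] D2.fcolim_ococ(2)[OF f2] .

lemmas e_typing [simp] = D0.D.ococ_typing(1-6)[OF e_ococ(1)] D0.TD.ococ_typing(1-6)[OF e_ococ(2)] D1.TD.ococ_typing(1-6)[OF e_ococ(3)]

lemmas iso_typing [simp] = D0.TD.isomodD(4-6)[OF \<delta>0] D0.TD.isomodD(4-6)[OF \<delta>1] D0.D.isomodD(4-6)[OF \<epsilon>]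
    D1.TD.isomodD(4-6)[OF \<pi>0] D1.TD.isomodD(4-6)[OF \<pi>1] D1.TD.isomodD(4-6)[OF \<pi>2]

text \<open>
  A pseudocoequalizing pair \<open>(q, \<xi>)\<close> gives each restriction \<open>q e\<^sub>i\<close> the structure cell \<open>\<phi>\<close> of a
  pseudomorphism \<open>F i \<rightarrow> B\<close>.  Under this correspondence the two conditions on \<open>\<xi>\<close> are the unit and
  the multiplication law, and a 2-cell is compatible with \<open>\<xi>\<close> iff its restrictions are transformations.
\<close>

definition \<gamma>0 :: "('o, 'a, 'c) psmor \<Rightarrow> 'i \<Rightarrow> 'c" where
  "\<gamma>0 q i = (mor_fun q \<triangleright> \<delta>0 i) \<odot> (mor_cell q \<triangleleft> T1 M (e i))"

definition \<phi> :: "('o, 'a, 'c) psmor \<Rightarrow> 'c \<Rightarrow> 'i \<Rightarrow> 'c" where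
  "\<phi> q x i = (mor_fun q \<triangleright> \<delta>1 i) \<odot> ((x \<triangleleft> e1 i) \<odot> \<gamma>0 q i)"

text \<open>The data of a pseudocoequalizing pair, before its two equations are imposed.\<close>

definition pair :: "('o, 'a, 'c) psalg \<Rightarrow> ('o, 'a, 'c) psmor \<Rightarrow> ('o, 'a, 'c) pstrans \<Rightarrow> bool" where
  "pair B q \<Xi> \<longleftrightarrow> mor q \<and> mor_src q = B0 \<and> mor_trg q = B \<and> transf \<Xi> \<and> trans_src \<Xi> = comp_psmor C M q dd0 \<and>
     trans_trg \<Xi> = comp_psmor C M q dd1 \<and> iso2 (trans_cell \<Xi>)"

lemma pairD [simp]:
  assumes "pair B q \<Xi>"
  shows "mor q" "mor_src q = B0" "mor_trg q = B" "transf \<Xi>" "trans_src \<Xi> = comp_psmor C M q dd0"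
     "trans_trg \<Xi> = comp_psmor C M q dd1" "iso2 (trans_cell \<Xi>)" "src2 C (trans_cell \<Xi>) = mor_fun q \<cdot> mor_fun dd0"
     "trg2 C (trans_cell \<Xi>) = mor_fun q \<cdot> mor_fun dd1" "alg B"
  using assms mor_typing(2)[of q] transf_typing(6,7)[of \<Xi>] by (auto simp: pair_def)

lemma \<gamma>0_typing [simp]:
  assumes "mor q" "mor_src q = B0" "mor_trg q = B" "i \<in> Obj I"
  shows "iso2 (\<gamma>0 q i)" "src2 C (\<gamma>0 q i) = alg_act B \<cdot> (T1 M (mor_fun q) \<cdot> T1 M (e i))"
    "trg2 C (\<gamma>0 q i) = mor_fun q \<cdot> (mor_fun dd0 \<cdot> e1 i)"
  using assms mor_typing(2)[OF assms(1)] by (simp_all add: \<gamma>0_def)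

lemma \<phi>_typing [simp]:
  assumes "pair B q \<Xi>" "i \<in> Obj I"
  shows "iso2 (\<phi> q (trans_cell \<Xi>) i)" "src2 C (\<phi> q (trans_cell \<Xi>) i) = alg_act B \<cdot> (T1 M (mor_fun q) \<cdot> T1 M (e i))"
    "trg2 C (\<phi> q (trans_cell \<Xi>) i) = mor_fun q \<cdot> (e i \<cdot> Aa i)"
  using assms pairD[OF assms(1)] by (simp_all add: \<phi>_def)

text \<open>Precomposing both sides of the first condition with the same invertible cell gives the
  two sides of the unit law, by \<open>N1_eq\<close> and \<open>N0_eq\<close>; cancelling that cell
  gives the equivalence.\<close>

lemma leg_unit_iff:
  assumes p: "pair B q \<Xi>" and [simp]: "i \<in> Obj I"
  shows "(mor_fun q \<triangleright> (trans_cell N1 \<triangleleft> e i)) \<odot> (trans_cell \<Xi> \<triangleleft> mor_fun jj \<cdot> e i) = mor_fun q \<triangleright> (trans_cell N0 \<triangleleft> e i) \<longleftrightarrow>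
    (mor_fun q \<cdot> e i \<triangleright> alg_unit (F0 F i)) \<odot> (\<phi> q (trans_cell \<Xi>) i \<triangleleft> \<eta> M (Ao i)) = ev B (mor_fun q \<cdot> e i)" (is "?L = ?R \<longleftrightarrow> ?l = ?r")
proof -
  note [simp] = pairD[OF p]
  let ?f = "mor_fun q" and ?x = "trans_cell \<Xi>" and ?h = "\<eta> M (Ao i)"
  \<comment> \<open>The comparison of \<open>b T(q e) \<eta>\<close> with \<open>q d0 j e\<close>,
    through \<open>q d0 e1 \<eta>\<close>.\<close>
  let ?P = "(?f \<cdot> mor_fun dd0 \<triangleright> \<epsilon> i) \<odot> (\<gamma>0 q i \<triangleleft> ?h)"
  have 1: "(?f \<triangleright> (trans_cell N0 \<triangleleft> e i)) \<odot> ((?f \<cdot> mor_fun dd0 \<triangleright> \<epsilon> i) \<odot> (?f \<triangleright> (\<delta>0 i \<triangleleft> ?h))) = ?f \<triangleright> ev B0 (e i)"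
    using arg_cong[OF N0_eq[of i], of "lwhisker C ?f"] by simp
  have 2: "(?f \<triangleright> ev B0 (e i)) \<odot> (mor_cell q \<triangleleft> T1 M (e i) \<cdot> ?h) = ev B (?f \<cdot> e i)"
    by (rule ev_mor) simp_all
  have R: "?R \<odot> ?P = ?r"
    by (simp add: \<gamma>0_def vcomp_eq_ext3[OF 1] 2)
  have 3: "(?x \<triangleleft> mor_fun jj \<cdot> e i) \<odot> (?f \<cdot> mor_fun dd0 \<triangleright> \<epsilon> i) = (?f \<cdot> mor_fun dd1 \<triangleright> \<epsilon> i) \<odot> (?x \<triangleleft> e1 i \<cdot> ?h)"
    using swap[of "\<epsilon> i" ?x] by simp
  have 4: "(?f \<triangleright> (trans_cell N1 \<triangleleft> e i)) \<odot> (?f \<cdot> mor_fun dd1 \<triangleright> \<epsilon> i) = (?f \<cdot> e i \<triangleright> alg_unit (F0 F i)) \<odot> (?f \<triangleright> (\<delta>1 i \<triangleleft> ?h))"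
    using arg_cong[OF N1_eq[of i], of "lwhisker C ?f"] by simp
  have L: "?L \<odot> ?P = ?l"
    by (simp add: \<phi>_def vcomp_eq_ext[OF 3] vcomp_eq_ext[OF 4])
  have "?L \<odot> ?P = ?R \<odot> ?P \<longleftrightarrow> ?L = ?R"
  proof
    assume "?L \<odot> ?P = ?R \<odot> ?P"
    then show "?L = ?R"
      by (rule iso2_cancel_right) simp_all
  qed (simp only:)
  then show ?thesis
    unfolding L R by (rule sym)
qed

text \<open>Both sides of the second condition are enclosed between the same invertible cells
  \<open>?Post\<close> and \<open>?Pre\<close>. The side with \<open>H01\<close> and
  \<open>H12\<close> becomes the side of the multiplication law that involves \<open>\<mu>\<close>,
  and the side with \<open>H02\<close> becomes the one in which \<phi> is applied twice.\<close>

lemma leg_mult_iff: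
  assumes p: "pair B q \<Xi>" and [simp]: "i \<in> Obj I"
  shows "(mor_fun q \<triangleright> (trans_cell H12 \<triangleleft> e2 i)) \<odot> ((trans_cell \<Xi> \<triangleleft> mor_fun pp1 \<cdot> e2 i) \<odot> (mor_fun q \<triangleright> (trans_cell H01 \<triangleleft> e2 i))) =
    (trans_cell \<Xi> \<triangleleft> mor_fun pp2 \<cdot> e2 i) \<odot> ((mor_fun q \<triangleright> (trans_cell H02 \<triangleleft> e2 i)) \<odot> (trans_cell \<Xi> \<triangleleft> mor_fun pp0 \<cdot> e2 i)) \<longleftrightarrow>
    (mor_fun q \<cdot> e i \<triangleright> alg_mult (F0 F i)) \<odot> ((\<phi> q (trans_cell \<Xi>) i \<triangleleft> T1 M (Aa i)) \<odot> (alg_act B \<triangleright> T2 M (\<phi> q (trans_cell \<Xi>) i))) =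
    (\<phi> q (trans_cell \<Xi>) i \<triangleleft> \<mu> M (Ao i)) \<odot> ((alg_act B \<triangleright> \<mu>n M (mor_fun q \<cdot> e i)) \<odot> (alg_mult B \<triangleleft> T1 M (T1 M (mor_fun q \<cdot> e i))))"
    (is "?L = ?R \<longleftrightarrow> ?r = ?l")
proof -
  note [simp] = pairD[OF p]
  let ?f = "mor_fun q" and ?x = "trans_cell \<Xi>" and ?b = "alg_act B" and ?act = "alg_act B0" and ?d0 = "mor_fun dd0" and ?d1 = "mor_fun dd1"
  let ?a = "Aa i" and ?s = "alg_mult (F0 F i)"
  \<comment> \<open>\<open>?Pre\<close> compares \<open>b T(b T(q e))\<close> with
    \<open>q d0 p0 e2\<close>, and \<open>?Post\<close> compares \<open>q d1 p2 e2\<close> with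
    \<open>q e a \<mu>\<close> by way of \<open>q e a Ta\<close>.\<close>
  let ?Pre = "(?f \<cdot> ?d0 \<triangleright> \<pi>0 i) \<odot> ((?f \<triangleright> (mor_cell dd0 \<triangleleft> T1 M (e1 i))) \<odot> ((mor_cell q \<triangleleft> T1 M ?d0 \<cdot> T1 M (e1 i)) \<odot> (?b \<triangleright> T2 M (\<gamma>0 q i))))"
  let ?Post = "(?f \<cdot> e i \<triangleright> ?s) \<odot> ((?f \<triangleright> (\<delta>1 i \<triangleleft> T1 M ?a)) \<odot> (?f \<cdot> ?d1 \<triangleright> \<pi>2 i))"
  have a1: "(?f \<cdot> e i \<triangleright> ?s) \<odot> ((?f \<triangleright> (\<delta>1 i \<triangleleft> T1 M ?a)) \<odot> ((?f \<cdot> ?d1 \<triangleright> \<pi>2 i) \<odot> (?f \<triangleright> (trans_cell H12 \<triangleleft> e2 i)))) =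
      (?f \<triangleright> (\<delta>1 i \<triangleleft> \<mu> M (Ao i))) \<odot> (?f \<cdot> ?d1 \<triangleright> \<pi>1 i)"
    using arg_cong[OF H12_eq[of i], of "lwhisker C ?f"] by simp
  have a2: "(?f \<cdot> ?d1 \<triangleright> \<pi>1 i) \<odot> (?x \<triangleleft> mor_fun pp1 \<cdot> e2 i) = (?x \<triangleleft> e1 i \<cdot> \<mu> M (Ao i)) \<odot> (?f \<cdot> ?d0 \<triangleright> \<pi>1 i)"
    using swap[of "\<pi>1 i" ?x] by simp
  have a3: "(?f \<cdot> ?d0 \<triangleright> \<pi>1 i) \<odot> ((?f \<triangleright> (trans_cell H01 \<triangleleft> e2 i)) \<odot> ((?f \<cdot> ?d0 \<triangleright> \<pi>0 i) \<odot> ((?f \<triangleright> (mor_cell dd0 \<triangleleft> T1 M (e1 i))) \<odot> (?f \<cdot> ?act \<triangleright> T2 M (\<delta>0 i))))) =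
      (?f \<triangleright> (\<delta>0 i \<triangleleft> \<mu> M (Ao i))) \<odot> ((?f \<cdot> ?act \<triangleright> \<mu>n M (e i)) \<odot> (?f \<triangleright> (alg_mult B0 \<triangleleft> T1 M (T1 M (e i)))))"
    using arg_cong[OF H01_eq[of i], of "lwhisker C ?f"] by simp
  have a4: "(mor_cell q \<triangleleft> T1 M ?d0 \<cdot> T1 M (e1 i)) \<odot> (?b \<cdot> T1 M ?f \<triangleright> T2 M (\<delta>0 i)) =
      (?f \<cdot> ?act \<triangleright> T2 M (\<delta>0 i)) \<odot> (mor_cell q \<triangleleft> T1 M ?act \<cdot> T1 M (T1 M (e i)))"
    using swap[of "T2 M (\<delta>0 i)" "mor_cell q"] by simp
  have a5: "(?f \<triangleright> (alg_mult B0 \<triangleleft> T1 M (T1 M (e i)))) \<odot> ((mor_cell q \<triangleleft> T1 M ?act \<cdot> T1 M (T1 M (e i))) \<odot> (?b \<triangleright> (T2 M (mor_cell q) \<triangleleft> T1 M (T1 M (e i))))) =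
      (mor_cell q \<triangleleft> \<mu> M (alg_ob B0) \<cdot> T1 M (T1 M (e i))) \<odot> ((?b \<triangleright> (\<mu>n M ?f \<triangleleft> T1 M (T1 M (e i)))) \<odot> (alg_mult B \<triangleleft> T1 M (T1 M ?f) \<cdot> T1 M (T1 M (e i))))"
    using arg_cong[OF mor_mult[of q, OF _ refl refl refl refl], of "\<lambda>z. rwhisker C z (T1 M (T1 M (e i)))"] by simp
  have a6: "(?f \<cdot> ?act \<triangleright> \<mu>n M (e i)) \<odot> (mor_cell q \<triangleleft> \<mu> M (alg_ob B0) \<cdot> T1 M (T1 M (e i))) =
      (mor_cell q \<triangleleft> T1 M (e i) \<cdot> \<mu> M (Ao i)) \<odot> (?b \<cdot> T1 M ?f \<triangleright> \<mu>n M (e i))"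
    using swap[of "\<mu>n M (e i)" "mor_cell q"] by simp
  \<comment> \<open>The defining equation of \<open>H01\<close>, combined with the multiplication
    law of \<open>q\<close>, replaces multiplying out in \<open>B0\<close> by multiplying out in
    \<open>B\<close>.\<close>
  have a7: "(?f \<cdot> ?d0 \<triangleright> \<pi>1 i) \<odot> ((?f \<triangleright> (trans_cell H01 \<triangleleft> e2 i)) \<odot> ?Pre) =
      (\<gamma>0 q i \<triangleleft> \<mu> M (Ao i)) \<odot> ((?b \<triangleright> \<mu>n M (?f \<cdot> e i)) \<odot> (alg_mult B \<triangleleft> T1 M (T1 M (?f \<cdot> e i))))"
  proof -
    have "(?f \<cdot> ?d0 \<triangleright> \<pi>1 i) \<odot> ((?f \<triangleright> (trans_cell H01 \<triangleleft> e2 i)) \<odot> ?Pre) =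
      ((?f \<cdot> ?d0 \<triangleright> \<pi>1 i) \<odot> ((?f \<triangleright> (trans_cell H01 \<triangleleft> e2 i)) \<odot> ((?f \<cdot> ?d0 \<triangleright> \<pi>0 i) \<odot> ((?f \<triangleright> (mor_cell dd0 \<triangleleft> T1 M (e1 i))) \<odot> (?f \<cdot> ?act \<triangleright> T2 M (\<delta>0 i)))))) \<odot>
      ((mor_cell q \<triangleleft> T1 M ?act \<cdot> T1 M (T1 M (e i))) \<odot> (?b \<triangleright> (T2 M (mor_cell q) \<triangleleft> T1 M (T1 M (e i)))))"
      by (simp add: \<gamma>0_def vcomp_eq_ext[OF a4])
    also have "\<dots> = (\<gamma>0 q i \<triangleleft> \<mu> M (Ao i)) \<odot> ((?b \<triangleright> \<mu>n M (?f \<cdot> e i)) \<odot> (alg_mult B \<triangleleft> T1 M (T1 M (?f \<cdot> e i))))"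
      unfolding a3 by (simp add: \<gamma>0_def a5 vcomp_eq_ext[OF a6])
    finally show ?thesis .
  qed
  have A: "?Post \<odot> (?L \<odot> ?Pre) = ?l"
  proof -
    have "?Post \<odot> (?L \<odot> ?Pre) = ((?f \<cdot> e i \<triangleright> ?s) \<odot> ((?f \<triangleright> (\<delta>1 i \<triangleleft> T1 M ?a)) \<odot> ((?f \<cdot> ?d1 \<triangleright> \<pi>2 i) \<odot> (?f \<triangleright> (trans_cell H12 \<triangleleft> e2 i))))) \<odot>
      ((?x \<triangleleft> mor_fun pp1 \<cdot> e2 i) \<odot> ((?f \<triangleright> (trans_cell H01 \<triangleleft> e2 i)) \<odot> ?Pre))"
      by simp
    also have "\<dots> = (?f \<triangleright> (\<delta>1 i \<triangleleft> \<mu> M (Ao i))) \<odot> ((?x \<triangleleft> e1 i \<cdot> \<mu> M (Ao i)) \<odot> ((?f \<cdot> ?d0 \<triangleright> \<pi>1 i) \<odot> ((?f \<triangleright> (trans_cell H01 \<triangleleft> e2 i)) \<odot> ?Pre)))"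
      unfolding a1 by (simp add: vcomp_eq_ext[OF a2])
    also have "\<dots> = ?l"
      unfolding a7 by (simp add: \<phi>_def)
    finally show ?thesis .
  qed
  have b1: "(?f \<cdot> ?d1 \<triangleright> \<pi>2 i) \<odot> (?x \<triangleleft> mor_fun pp2 \<cdot> e2 i) = (?x \<triangleleft> e1 i \<cdot> T1 M ?a) \<odot> (?f \<cdot> ?d0 \<triangleright> \<pi>2 i)"
    using swap[of "\<pi>2 i" ?x] by simp
  have b2: "(?x \<triangleleft> mor_fun pp0 \<cdot> e2 i) \<odot> (?f \<cdot> ?d0 \<triangleright> \<pi>0 i) = (?f \<cdot> ?d1 \<triangleright> \<pi>0 i) \<odot> (?x \<triangleleft> alg_act B1 \<cdot> T1 M (e1 i))"
    using swap[of "\<pi>0 i" ?x] by simp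
  have b3: "(?x \<triangleleft> alg_act B1 \<cdot> T1 M (e1 i)) \<odot> ((?f \<triangleright> (mor_cell dd0 \<triangleleft> T1 M (e1 i))) \<odot> (mor_cell q \<triangleleft> T1 M ?d0 \<cdot> T1 M (e1 i))) =
      (?f \<triangleright> (mor_cell dd1 \<triangleleft> T1 M (e1 i))) \<odot> ((mor_cell q \<triangleleft> T1 M ?d1 \<cdot> T1 M (e1 i)) \<odot> (?b \<triangleright> (T2 M ?x \<triangleleft> T1 M (e1 i))))"
    using arg_cong[OF transf_eq[of \<Xi>, OF _ refl refl], of "\<lambda>z. rwhisker C z (T1 M (e1 i))"] by simp
  \<comment> \<open>The defining equation of \<open>H02\<close> contributes the comparison cells
    only. The two copies of \<xi>, one under \<open>b T\<close> and one pulled back along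
    \<open>Ta\<close>, then complete to the two copies of \<phi>.\<close>
  have b4: "(?f \<cdot> ?d0 \<triangleright> \<pi>2 i) \<odot> ((?f \<triangleright> (trans_cell H02 \<triangleleft> e2 i)) \<odot> ((?f \<cdot> ?d1 \<triangleright> \<pi>0 i) \<odot> (?f \<triangleright> (mor_cell dd1 \<triangleleft> T1 M (e1 i))))) =
      (?f \<triangleright> (\<delta>0 i \<triangleleft> T1 M ?a)) \<odot> (?f \<cdot> ?act \<triangleright> T2 M (\<delta>1 i))"
    using arg_cong[OF H02_eq[of i], of "lwhisker C ?f"] by simp
  have b5: "(?f \<cdot> ?act \<triangleright> T2 M (\<delta>1 i)) \<odot> (mor_cell q \<triangleleft> T1 M ?d1 \<cdot> T1 M (e1 i)) =
      (mor_cell q \<triangleleft> T1 M (e i) \<cdot> T1 M ?a) \<odot> (?b \<cdot> T1 M ?f \<triangleright> T2 M (\<delta>1 i))"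
    using swap[of "T2 M (\<delta>1 i)" "mor_cell q"] by simp
  have B: "?Post \<odot> (?R \<odot> ?Pre) = ?r"
  proof -
    have "?Post \<odot> (?R \<odot> ?Pre) = (?f \<cdot> e i \<triangleright> ?s) \<odot> ((?f \<triangleright> (\<delta>1 i \<triangleleft> T1 M ?a)) \<odot> ((?x \<triangleleft> e1 i \<cdot> T1 M ?a) \<odot>
      (((?f \<cdot> ?d0 \<triangleright> \<pi>2 i) \<odot> ((?f \<triangleright> (trans_cell H02 \<triangleleft> e2 i)) \<odot> ((?f \<cdot> ?d1 \<triangleright> \<pi>0 i) \<odot> (?f \<triangleright> (mor_cell dd1 \<triangleleft> T1 M (e1 i)))))) \<odot>
       ((mor_cell q \<triangleleft> T1 M ?d1 \<cdot> T1 M (e1 i)) \<odot> ((?b \<triangleright> (T2 M ?x \<triangleleft> T1 M (e1 i))) \<odot> (?b \<triangleright> T2 M (\<gamma>0 q i)))))))"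
      by (simp add: vcomp_eq_ext[OF b1] vcomp_eq_ext[OF b2] vcomp_eq_ext3[OF b3])
    also have "\<dots> = ?r"
      unfolding b4 by (simp add: \<phi>_def \<gamma>0_def vcomp_eq_ext[OF b5])
    finally show ?thesis .
  qed
  have "?Post \<odot> (?L \<odot> ?Pre) = ?Post \<odot> (?R \<odot> ?Pre) \<longleftrightarrow> ?L = ?R"
  proof
    assume "?Post \<odot> (?L \<odot> ?Pre) = ?Post \<odot> (?R \<odot> ?Pre)"
    then have "?L \<odot> ?Pre = ?R \<odot> ?Pre"
      by (rule iso2_cancel_left) simp_all
    then show "?L = ?R"
      by (rule iso2_cancel_right) simp_all
  qed (simp only:)
  then show ?thesis
    unfolding A B by (subst eq_commute[of ?r ?l]) (rule sym)
qed

text \<open>\<phi> is \<xi> on the legs between invertible cells natural in \<open>q\<close>: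
  interchange moves the 2-cell past \<delta>1 and \<delta>0, its transformation law past the
  structure cell of \<open>q\<close>, and the outer cells cancel.\<close>

lemma leg_trans_iff:
  assumes p: "pair B q \<Xi>" "pair B q' \<Xi>'" and [simp]: "i \<in> Obj I"
    and s: "transf \<Sigma>" "trans_src \<Sigma> = q" "trans_trg \<Sigma> = q'"
  shows "(trans_cell \<Sigma> \<triangleleft> mor_fun dd1 \<cdot> e1 i) \<odot> (trans_cell \<Xi> \<triangleleft> e1 i) = (trans_cell \<Xi>' \<triangleleft> e1 i) \<odot> (trans_cell \<Sigma> \<triangleleft> mor_fun dd0 \<cdot> e1 i) \<longleftrightarrow>
    (trans_cell \<Sigma> \<triangleleft> e i \<cdot> Aa i) \<odot> \<phi> q (trans_cell \<Xi>) i = \<phi> q' (trans_cell \<Xi>') i \<odot> (alg_act B \<triangleright> (T2 M (trans_cell \<Sigma>) \<triangleleft> T1 M (e i)))" (is "?L = ?R \<longleftrightarrow> ?l = ?r")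
proof -
  note [simp] = pairD[OF p(1)] pairD[OF p(2)] s
  let ?\<sigma> = "trans_cell \<Sigma>" and ?f = "mor_fun q" and ?f' = "mor_fun q'"
  have 1: "(?\<sigma> \<triangleleft> e i \<cdot> Aa i) \<odot> (?f \<triangleright> \<delta>1 i) = (?f' \<triangleright> \<delta>1 i) \<odot> (?\<sigma> \<triangleleft> mor_fun dd1 \<cdot> e1 i)"
    using swap[of "\<delta>1 i" ?\<sigma>] by simp
  have 2: "(?\<sigma> \<triangleleft> mor_fun dd0 \<cdot> e1 i) \<odot> (?f \<triangleright> \<delta>0 i) = (?f' \<triangleright> \<delta>0 i) \<odot> (?\<sigma> \<triangleleft> alg_act B0 \<cdot> T1 M (e i))"
    using swap[of "\<delta>0 i" ?\<sigma>] by simp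
  have 3: "(?\<sigma> \<triangleleft> alg_act B0 \<cdot> T1 M (e i)) \<odot> (mor_cell q \<triangleleft> T1 M (e i)) = (mor_cell q' \<triangleleft> T1 M (e i)) \<odot> (alg_act B \<triangleright> (T2 M ?\<sigma> \<triangleleft> T1 M (e i)))"
    using arg_cong[OF transf_eq[of \<Sigma>, OF _ refl refl], of "\<lambda>z. rwhisker C z (T1 M (e i))"] by simp
  have L: "(?f' \<triangleright> \<delta>1 i) \<odot> (?L \<odot> \<gamma>0 q i) = ?l"
    by (simp add: \<phi>_def vcomp_eq_ext[OF 1])
  have R: "(?f' \<triangleright> \<delta>1 i) \<odot> (?R \<odot> \<gamma>0 q i) = ?r"
    by (simp add: \<phi>_def \<gamma>0_def vcomp_eq_ext[OF 2] 3)
  have "(?f' \<triangleright> \<delta>1 i) \<odot> (?L \<odot> \<gamma>0 q i) = (?f' \<triangleright> \<delta>1 i) \<odot> (?R \<odot> \<gamma>0 q i) \<longleftrightarrow> ?L = ?R"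
  proof
    assume "(?f' \<triangleright> \<delta>1 i) \<odot> (?L \<odot> \<gamma>0 q i) = (?f' \<triangleright> \<delta>1 i) \<odot> (?R \<odot> \<gamma>0 q i)"
    then have "?L \<odot> \<gamma>0 q i = ?R \<odot> \<gamma>0 q i"
      by (rule iso2_cancel_left) simp_all
    then show "?L = ?R"
      by (rule iso2_cancel_right) simp_all
  qed (simp only:)
  then show ?thesis
    unfolding L R by (rule sym)
qed

end

section \<open>The categories of oplax cocones and of pairs\<close>

context two_fun
begin

lemma category_oplax: "category (oplax_cocone_cat I K F B)"
  unfolding oplax_cocone_cat_def
proof (rule category_tagged_cat)
  have Q: "ococ B (leg p) (leg_cell p)" if "p \<in> {q. is_oplax_cocone I K F B q}" for p
    using that by (simp add: is_oplax_cocone_iff)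
  have M: "m \<in> extensional (Obj I)" "omod (leg p) (leg_cell p) (leg q) (leg_cell q) m" if "m \<in> oplax_mods I K F p q" for m p q
    using that by (simp_all add: oplax_mods_iff)
  show "(\<lambda>i\<in>Obj I. id2 K (leg p i)) \<in> oplax_mods I K F p p" if p: "p \<in> {q. is_oplax_cocone I K F B q}" for p
    unfolding oplax_mods_iff using omod_cong[OF omod_id[OF Q[OF p]], of "leg p" "leg p"] by simp
  fix p q m
  assume p: "p \<in> {q. is_oplax_cocone I K F B q}" and q: "q \<in> {q. is_oplax_cocone I K F B q}" and m: "m \<in> oplax_mods I K F p q"
  show "(\<lambda>i\<in>Obj I. m i \<odot>\<^bsub>K\<^esub> (\<lambda>i\<in>Obj I. id2 K (leg p i)) i) = m"
    using M(1)[OF m] omod_typing[OF M(2)[OF m]] by (intro extensionalityI[of _ "Obj I"]) simp_all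
  show "(\<lambda>i\<in>Obj I. (\<lambda>i\<in>Obj I. id2 K (leg q i)) i \<odot>\<^bsub>K\<^esub> m i) = m"
    using M(1)[OF m] omod_typing[OF M(2)[OF m]] by (intro extensionalityI[of _ "Obj I"]) simp_all
  fix r n
  assume r: "r \<in> {q. is_oplax_cocone I K F B q}" and n: "n \<in> oplax_mods I K F q r"
  show "(\<lambda>i\<in>Obj I. n i \<odot>\<^bsub>K\<^esub> m i) \<in> oplax_mods I K F p r"
    unfolding oplax_mods_iff using omod_cong[OF omod_comp[OF Q[OF p] Q[OF q] Q[OF r] M(2)[OF m] M(2)[OF n]], of "leg p" "leg r"] by simp
  fix s k
  assume k: "k \<in> oplax_mods I K F r s"
  show "(\<lambda>i\<in>Obj I. k i \<odot>\<^bsub>K\<^esub> (\<lambda>i\<in>Obj I. n i \<odot>\<^bsub>K\<^esub> m i) i) = (\<lambda>i\<in>Obj I. (\<lambda>i\<in>Obj I. k i \<odot>\<^bsub>K\<^esub> n i) i \<odot>\<^bsub>K\<^esub> m i)"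
    using omod_typing[OF M(2)[OF m]] omod_typing[OF M(2)[OF n]] omod_typing[OF M(2)[OF k]] by (intro restrict_ext) simp
qed

lemma oplax_Hom_iff:
  "x \<in> Hom (oplax_cocone_cat I K F B) p r \<longleftrightarrow>
     (\<exists>m. x = (p, m, r) \<and> is_oplax_cocone I K F B p \<and> is_oplax_cocone I K F B r \<and> m \<in> extensional (Obj I) \<and>
       omod (leg p) (leg_cell p) (leg r) (leg_cell r) m)"
  unfolding oplax_cocone_cat_def Hom_tagged_cat by (auto simp: oplax_mods_iff)

text \<open>The pointwise inverse is a modification by \<open>isomod_vinv\<close>; restricting to
  \<open>Obj I\<close> supplies the extensionality that arrows of the cocone category have.\<close>

lemma oplax_invertible:
  assumes p: "is_oplax_cocone I K F B p" and r: "is_oplax_cocone I K F B r"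
    and m: "isomod B (leg p) (leg_cell p) (leg r) (leg_cell r) m"
  shows "(p, restrict m (Obj I), r) \<in> Hom (oplax_cocone_cat I K F B) p r"
    "invertible (oplax_cocone_cat I K F B) (p, restrict m (Obj I), r)"
proof -
  interpret O: category "oplax_cocone_cat I K F B"
    by (rule category_oplax)
  have H: "(p, restrict m (Obj I), r) \<in> Hom (oplax_cocone_cat I K F B) p r"
    if p: "is_oplax_cocone I K F B p" and r: "is_oplax_cocone I K F B r"
      and m: "isomod B (leg p) (leg_cell p) (leg r) (leg_cell r) m" for p r m
    unfolding oplax_Hom_iff using p r omod_cong[OF isomodD(3)[OF m], of "leg p" "leg r" "restrict m (Obj I)"] by simp
  show "(p, restrict m (Obj I), r) \<in> Hom (oplax_cocone_cat I K F B) p r"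
    by (rule H[OF p r m])
  show "invertible (oplax_cocone_cat I K F B) (p, restrict m (Obj I), r)"
    by (rule O.invertibleI[OF H[OF p r m] H[OF r p isomod_vinv[OF m]]])
      (use isomodD(4-6)[OF m] in \<open>auto simp: oplax_cocone_cat_def tagged_cat_def intro!: restrict_ext\<close>)
qed

end

lemma (in two_category) category_pscoeq:
  assumes X: "is_codescent K X"
  shows "category (pscoeq_cat K X B)"
proof -
  have [simp]: "X1 X \<in> Obj K" "d0 X \<in> Cell1 K" "src1 K (d0 X) = X1 X" "trg1 K (d0 X) = X0 X" "d1 X \<in> Cell1 K" "src1 K (d1 X) = X1 X" "trg1 K (d1 X) = X0 X"
    using X by (auto simp: is_codescent_def hom1_def)
  have pD: "q \<in> Cell1 K" "src1 K q = X0 X" "trg1 K q = B" "\<xi> \<in> Cell2 K" "src2 K \<xi> = q \<cdot> d0 X" "trg2 K \<xi> = q \<cdot> d1 X"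
    if "pseudocoequalizes K X B (q, \<xi>)" for q \<xi>
    using that by (auto simp: pseudocoequalizes_def hom1_def invhom2_def hom2_def)
  have mD: "m \<in> Cell2 K" "src2 K m = q" "trg2 K m = q'" "(m \<triangleleft> d1 X) \<odot> \<xi> = \<xi>' \<odot> (m \<triangleleft> d0 X)"
    if "m \<in> pscoeq_mods K X (q, \<xi>) (q', \<xi>')" for m q \<xi> q' \<xi>'
    using that by (auto simp: pscoeq_mods_def hom2_def)
  have mI: "m \<in> pscoeq_mods K X (q, \<xi>) (q', \<xi>')"
    if "m \<in> Cell2 K" "src2 K m = q" "trg2 K m = q'" "(m \<triangleleft> d1 X) \<odot> \<xi> = \<xi>' \<odot> (m \<triangleleft> d0 X)" for m q \<xi> q' \<xi>'
    using that by (auto simp: pscoeq_mods_def hom2_def)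
  show ?thesis
    unfolding pscoeq_cat_def
  proof (rule category_tagged_cat; clarsimp)
    fix q \<xi> assume p: "pseudocoequalizes K X B (q, \<xi>)"
    note [simp] = pD[OF p]
    show "id2 K q \<in> pscoeq_mods K X (q, \<xi>) (q, \<xi>)"
      by (rule mI) simp_all
    fix q' \<xi>' m assume p': "pseudocoequalizes K X B (q', \<xi>')" and m: "m \<in> pscoeq_mods K X (q, \<xi>) (q', \<xi>')"
    note [simp] = pD[OF p'] mD(1-3)[OF m]
    show "id2 K q' \<odot> m = m" "m \<odot> id2 K q = m"
      by simp_all
    fix q'' \<xi>'' n assume p'': "pseudocoequalizes K X B (q'', \<xi>'')" and n: "n \<in> pscoeq_mods K X (q', \<xi>') (q'', \<xi>'')"
    note [simp] = pD[OF p''] mD(1-3)[OF n]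
    show "n \<odot> m \<in> pscoeq_mods K X (q, \<xi>) (q'', \<xi>'')"
      by (rule mI) (simp_all add: mD(4)[OF m] vcomp_eq_ext[OF mD(4)[OF n]])
    fix q''' \<xi>''' k assume k: "k \<in> pscoeq_mods K X (q'', \<xi>'') (q''', \<xi>''')"
    show "k \<odot> (n \<odot> m) = (k \<odot> n) \<odot> m"
      using mD(1-3)[OF k] by simp
  qed
qed

section \<open>Cocones of pseudo-algebras in terms of the base\<close>

context alg_diagram
begin

text \<open>That the cocone cells are transformations is the same equation as that the structure
  cells of the legs form a modification from \<open>b TQ\<close> to \<open>Q\<close> pulled back
  along the actions. Hence the last two clauses: an underlying cocone and an invertible
  modification.\<close>

lemma Alg_ococD:
  assumes Q: "F.ococ B Q Qc" and [simp]: "alg B"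
  shows "i \<in> Obj I \<Longrightarrow> mor (Q i)" "i \<in> Obj I \<Longrightarrow> mor_src (Q i) = F0 F i" "i \<in> Obj I \<Longrightarrow> mor_trg (Q i) = B"
    "d \<in> Cell1 I \<Longrightarrow> transf (Qc d)" "d \<in> Cell1 I \<Longrightarrow> trans_src (Qc d) = comp_psmor C M (Q (trg1 I d)) (F1 F d)"
    "d \<in> Cell1 I \<Longrightarrow> trans_trg (Qc d) = Q (src1 I d)"
    "oc0 (alg_ob B) (\<lambda>i. mor_fun (Q i)) (\<lambda>d. trans_cell (Qc d))"
    "D0.TD.isomod (alg_ob B) (\<lambda>i. alg_act B \<cdot> T1 M (mor_fun (Q i))) (\<lambda>d. alg_act B \<triangleright> T2 M (trans_cell (Qc d)))
       (\<lambda>i. mor_fun (Q i) \<cdot> Aa i) (\<lambda>d. (trans_cell (Qc d) \<triangleleft> Aa (src1 I d)) \<odot> (mor_fun (Q (trg1 I d)) \<triangleright> Fc d)) (\<lambda>i. mor_cell (Q i))"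
proof -
  show 1: "i \<in> Obj I \<Longrightarrow> mor (Q i)" "i \<in> Obj I \<Longrightarrow> mor_src (Q i) = F0 F i" "i \<in> Obj I \<Longrightarrow> mor_trg (Q i) = B" for i
    using F.ococ_typing(1-3)[OF Q, of i] by simp_all
  show 2: "d \<in> Cell1 I \<Longrightarrow> transf (Qc d)" "d \<in> Cell1 I \<Longrightarrow> trans_src (Qc d) = comp_psmor C M (Q (trg1 I d)) (F1 F d)"
    "d \<in> Cell1 I \<Longrightarrow> trans_trg (Qc d) = Q (src1 I d)" for d
    using F.ococ_typing(4-6)[OF Q, of d] by simp_all
  note [simp] = 1 2
  show o: "oc0 (alg_ob B) (\<lambda>i. mor_fun (Q i)) (\<lambda>d. trans_cell (Qc d))"
    unfolding D0.D.ococ_def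
  proof (intro conjI ballI impI)
    show "trans_cell (Qc (id1 I i)) = id2 C (mor_fun (Q i))" if "i \<in> Obj I" for i
      using F.ococ_typing(7)[OF Q that] by simp
    show "trans_cell (Qc (d' \<cdot>\<^bsub>I\<^esub> d)) = trans_cell (Qc d) \<odot> (trans_cell (Qc d') \<triangleleft> F1 U d)"
      if "d \<in> Cell1 I" "d' \<in> Cell1 I" "src1 I d' = trg1 I d" for d d'
      using F.ococ_typing(8)[OF Q that] that by simp
    show "trans_cell (Qc (trg2 I \<sigma>)) \<odot> (mor_fun (Q (trg1 I (src2 I \<sigma>))) \<triangleright> F2 U \<sigma>) = trans_cell (Qc (src2 I \<sigma>))"
      if "\<sigma> \<in> Cell2 I" for \<sigma>
    proof -
      from that have "Qc (src2 I \<sigma>) = Qc (trg2 I \<sigma>) \<odot>\<^bsub>Alg\<^esub> (Q (trg1 I (src2 I \<sigma>)) \<triangleright>\<^bsub>Alg\<^esub> F2 F \<sigma>)"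
        using F.ococ_2[OF Q that refl] by simp
      then show ?thesis
        using that by simp
    qed
  qed simp_all
  show "D0.TD.isomod (alg_ob B) (\<lambda>i. alg_act B \<cdot> T1 M (mor_fun (Q i))) (\<lambda>d. alg_act B \<triangleright> T2 M (trans_cell (Qc d)))
       (\<lambda>i. mor_fun (Q i) \<cdot> Aa i) (\<lambda>d. (trans_cell (Qc d) \<triangleleft> Aa (src1 I d)) \<odot> (mor_fun (Q (trg1 I d)) \<triangleright> Fc d)) (\<lambda>i. mor_cell (Q i))"
  proof (rule D0.TD.isomodI)
    show "D0.TD.ococ (alg_ob B) (\<lambda>i. alg_act B \<cdot> T1 M (mor_fun (Q i))) (\<lambda>d. alg_act B \<triangleright> T2 M (trans_cell (Qc d)))"
      by (rule D0.ococ_act[OF o]) simp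
    show "D0.TD.ococ (alg_ob B) (\<lambda>i. mor_fun (Q i) \<cdot> Aa i) (\<lambda>d. (trans_cell (Qc d) \<triangleleft> Aa (src1 I d)) \<odot> (mor_fun (Q (trg1 I d)) \<triangleright> Fc d))"
      by (rule D0.D.ococ_restrict[OF D0.two_fun_TD lax_nat_act o])
    show "D0.TD.omod (\<lambda>i. alg_act B \<cdot> T1 M (mor_fun (Q i))) (\<lambda>d. alg_act B \<triangleright> T2 M (trans_cell (Qc d)))
       (\<lambda>i. mor_fun (Q i) \<cdot> Aa i) (\<lambda>d. (trans_cell (Qc d) \<triangleleft> Aa (src1 I d)) \<odot> (mor_fun (Q (trg1 I d)) \<triangleright> Fc d)) (\<lambda>i. mor_cell (Q i))"
      unfolding D0.TD.omod_def
    proof (intro conjI ballI)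
      fix d assume [simp]: "d \<in> Cell1 I"
      show "mor_cell (Q (src1 I d)) \<odot> (alg_act B \<triangleright> T2 M (trans_cell (Qc d))) =
        ((trans_cell (Qc d) \<triangleleft> Aa (src1 I d)) \<odot> (mor_fun (Q (trg1 I d)) \<triangleright> Fc d)) \<odot> (mor_cell (Q (trg1 I d)) \<triangleleft> F1 D0.TD d)"
        using transf_eq[of "Qc d", OF _ refl refl] by simp
    qed simp_all
  qed simp
qed

text \<open>Converse to \<open>Alg_ococD\<close>: the modification condition on \<open>f\<close>
  makes the cocone cells transformations, and the cocone equations are inherited from the base
  because \<open>Alg\<close> composes underlying cells.\<close>

lemma Alg_ococI:
  assumes [simp]: "alg B" and r: "oc0 (alg_ob B) r rc" and m: "\<And>i. i \<in> Obj I \<Longrightarrow> mor (PsMor (F0 F i) B (r i) (f i))"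
    and f: "D0.TD.omod (\<lambda>i. alg_act B \<cdot> T1 M (r i)) (\<lambda>d. alg_act B \<triangleright> T2 M (rc d))
       (\<lambda>i. r i \<cdot> Aa i) (\<lambda>d. (rc d \<triangleleft> Aa (src1 I d)) \<odot> (r (trg1 I d) \<triangleright> Fc d)) f"
  shows "F.ococ B (\<lambda>i. PsMor (F0 F i) B (r i) (f i))
    (\<lambda>d. PsTrans (comp_psmor C M (PsMor (F0 F (trg1 I d)) B (r (trg1 I d)) (f (trg1 I d))) (F1 F d))
       (PsMor (F0 F (src1 I d)) B (r (src1 I d)) (f (src1 I d))) (rc d))"
proof -
  note [simp] = m D0.D.ococ_typing[OF r] D0.TD.omod_typing[OF f]
  have t: "transf (PsTrans (comp_psmor C M (PsMor (F0 F (trg1 I d)) B (r (trg1 I d)) (f (trg1 I d))) (F1 F d))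
       (PsMor (F0 F (src1 I d)) B (r (src1 I d)) (f (src1 I d))) (rc d))" if [simp]: "d \<in> Cell1 I" for d
    using D0.TD.omod_nat[OF f that refl refl] mor_comp_psmor[of "F1 F d" "PsMor (F0 F (trg1 I d)) B (r (trg1 I d)) (f (trg1 I d))"]
    by (simp add: transf_iff[of "PsTrans _ _ _"])
  show ?thesis
    unfolding F.ococ_def
  proof (intro conjI ballI impI)
    fix i assume [simp]: "i \<in> Obj I"
    show "PsTrans (comp_psmor C M (PsMor (F0 F (trg1 I (id1 I i))) B (r (trg1 I (id1 I i))) (f (trg1 I (id1 I i)))) (F1 F (id1 I i)))
       (PsMor (F0 F (src1 I (id1 I i))) B (r (src1 I (id1 I i))) (f (src1 I (id1 I i)))) (rc (id1 I i)) =
      id2 Alg (PsMor (F0 F i) B (r i) (f i))"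
      using comp_psmor_id_mor(2)[OF m, of i "F0 F i"] by simp
  next
    fix d d' assume [simp]: "d \<in> Cell1 I" "d' \<in> Cell1 I" "src1 I d' = trg1 I d"
    show "PsTrans (comp_psmor C M (PsMor (F0 F (trg1 I (d' \<cdot>\<^bsub>I\<^esub> d))) B (r (trg1 I (d' \<cdot>\<^bsub>I\<^esub> d))) (f (trg1 I (d' \<cdot>\<^bsub>I\<^esub> d)))) (F1 F (d' \<cdot>\<^bsub>I\<^esub> d)))
       (PsMor (F0 F (src1 I (d' \<cdot>\<^bsub>I\<^esub> d))) B (r (src1 I (d' \<cdot>\<^bsub>I\<^esub> d))) (f (src1 I (d' \<cdot>\<^bsub>I\<^esub> d)))) (rc (d' \<cdot>\<^bsub>I\<^esub> d)) =
      PsTrans (comp_psmor C M (PsMor (F0 F (trg1 I d)) B (r (trg1 I d)) (f (trg1 I d))) (F1 F d))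
       (PsMor (F0 F (src1 I d)) B (r (src1 I d)) (f (src1 I d))) (rc d) \<odot>\<^bsub>Alg\<^esub>
      (PsTrans (comp_psmor C M (PsMor (F0 F (trg1 I d')) B (r (trg1 I d')) (f (trg1 I d'))) (F1 F d'))
       (PsMor (F0 F (src1 I d')) B (r (src1 I d')) (f (src1 I d'))) (rc d') \<triangleleft>\<^bsub>Alg\<^esub> F1 F d)"
      using comp_psmor_assoc[of "F1 F d" "F1 F d'" "PsMor (F0 F (trg1 I d')) B (r (trg1 I d')) (f (trg1 I d'))"] by simp
  next
    fix \<sigma> assume [simp]: "\<sigma> \<in> Cell2 I"
    show "PsTrans (comp_psmor C M (PsMor (F0 F (trg1 I (trg2 I \<sigma>))) B (r (trg1 I (trg2 I \<sigma>))) (f (trg1 I (trg2 I \<sigma>)))) (F1 F (trg2 I \<sigma>)))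
       (PsMor (F0 F (src1 I (trg2 I \<sigma>))) B (r (src1 I (trg2 I \<sigma>))) (f (src1 I (trg2 I \<sigma>)))) (rc (trg2 I \<sigma>)) \<odot>\<^bsub>Alg\<^esub>
      (PsMor (F0 F (trg1 I (src2 I \<sigma>))) B (r (trg1 I (src2 I \<sigma>))) (f (trg1 I (src2 I \<sigma>))) \<triangleright>\<^bsub>Alg\<^esub> F2 F \<sigma>) =
      PsTrans (comp_psmor C M (PsMor (F0 F (trg1 I (src2 I \<sigma>))) B (r (trg1 I (src2 I \<sigma>))) (f (trg1 I (src2 I \<sigma>)))) (F1 F (src2 I \<sigma>)))
       (PsMor (F0 F (src1 I (src2 I \<sigma>))) B (r (src1 I (src2 I \<sigma>))) (f (src1 I (src2 I \<sigma>)))) (rc (src2 I \<sigma>))"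
      using D0.D.ococ_2[OF r, of \<sigma>] by simp
  qed (use t in simp_all)
qed

text \<open>Vertical composition and whiskering in \<open>Alg\<close> are those of the underlying
  2-cells, and a transformation with given endpoints is determined by its 2-cell.\<close>

lemma Alg_omod_iff:
  assumes "F.ococ B Q Qc" "F.ococ B R Rc" "alg B"
  shows "F.omod Q Qc R Rc m \<longleftrightarrow> (\<forall>i \<in> Obj I. transf (m i) \<and> trans_src (m i) = Q i \<and> trans_trg (m i) = R i) \<and>
     D0.D.omod (\<lambda>i. mor_fun (Q i)) (\<lambda>d. trans_cell (Qc d)) (\<lambda>i. mor_fun (R i)) (\<lambda>d. trans_cell (Rc d)) (\<lambda>i. trans_cell (m i))"
proof (cases "\<forall>i \<in> Obj I. transf (m i) \<and> trans_src (m i) = Q i \<and> trans_trg (m i) = R i")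
  case True
  then have [simp]: "transf (m i)" "trans_src (m i) = Q i" "trans_trg (m i) = R i" if "i \<in> Obj I" for i
    using that by auto
  note [simp] = Alg_ococD(1-6)[OF assms(1,3)] Alg_ococD(1-6)[OF assms(2,3)]
  show ?thesis
    using True unfolding F.omod_def D0.D.omod_def by simp
next
  case False
  then show ?thesis
    unfolding F.omod_def by auto
qed

end

lemma (in psmonad_diagram) fcolim_eq_iff:
  assumes "fcolim X e ec" "transf \<Sigma>" "transf \<Sigma>'" "mor_src (trans_src \<Sigma>) = X"
    "trans_src \<Sigma>' = trans_src \<Sigma>" "trans_trg \<Sigma>' = trans_trg \<Sigma>"
  shows "\<Sigma> = \<Sigma>' \<longleftrightarrow> (\<forall>i \<in> Obj I. trans_cell \<Sigma> \<triangleleft> e i = trans_cell \<Sigma>' \<triangleleft> e i)"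
  using fcolim_eqI[OF assms] by metis

section \<open>The comparison functor from pseudocoequalizing pairs to oplax cocones\<close>

context resolution
begin

lemma \<gamma>0_isomod:
  assumes q [simp]: "mor q" "mor_src q = B0" "mor_trg q = B"
  shows "D0.TD.isomod (alg_ob B) (\<lambda>i. alg_act B \<cdot> T1 M (mor_fun q \<cdot> e i)) (\<lambda>d. alg_act B \<triangleright> T2 M (mor_fun q \<triangleright> ec d))
    (\<lambda>i. mor_fun q \<cdot> (mor_fun dd0 \<cdot> e1 i)) (\<lambda>d. mor_fun q \<triangleright> (mor_fun dd0 \<triangleright> ec1 d)) (\<gamma>0 q)"
  unfolding \<gamma>0_def
  by (rule D0.TD.isomod_comp[OF D0.isomod_mor_act[OF q e_ococ(1)] D0.TD.isomod_lwhisker[OF \<delta>0]]) simp_all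

lemma \<delta>1_isomod:
  assumes q [simp]: "mor q" "mor_src q = B0" "mor_trg q = B"
  shows "D0.TD.isomod (alg_ob B) (\<lambda>i. mor_fun q \<cdot> (mor_fun dd1 \<cdot> e1 i)) (\<lambda>d. mor_fun q \<triangleright> (mor_fun dd1 \<triangleright> ec1 d))
    (\<lambda>i. (mor_fun q \<cdot> e i) \<cdot> Aa i) (\<lambda>d. ((mor_fun q \<triangleright> ec d) \<triangleleft> Aa (src1 I d)) \<odot> (mor_fun q \<cdot> e (trg1 I d) \<triangleright> Fc d)) (\<lambda>i. mor_fun q \<triangleright> \<delta>1 i)"
proof (rule D0.TD.isomod_cong[OF D0.TD.isomod_lwhisker[OF \<delta>1, of "mor_fun q"]])
  have [simp]: "alg B"
    using mor_typing(2)[OF q(1)] by simp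
qed simp_all

text \<open>The three factors of \<phi> are separately compatible with the cocone cells: \<gamma>0,
  \<Xi> whiskered with the legs \<open>e1\<close>, and \<open>q \<delta>1\<close>.\<close>

lemma \<phi>_isomod:
  assumes p: "pair B q \<Xi>"
  shows "D0.TD.isomod (alg_ob B) (\<lambda>i. alg_act B \<cdot> T1 M (mor_fun q \<cdot> e i)) (\<lambda>d. alg_act B \<triangleright> T2 M (mor_fun q \<triangleright> ec d))
    (\<lambda>i. (mor_fun q \<cdot> e i) \<cdot> Aa i) (\<lambda>d. ((mor_fun q \<triangleright> ec d) \<triangleleft> Aa (src1 I d)) \<odot> (mor_fun q \<cdot> e (trg1 I d) \<triangleright> Fc d)) (\<phi> q (trans_cell \<Xi>))"
proof -
  note [simp] = pairD[OF p]
  have c: "D0.TD.ococ (alg_ob B) (\<lambda>i. mor_fun u \<cdot> e1 i) (\<lambda>d. mor_fun u \<triangleright> ec1 d)" if "mor u" "mor_src u = B1" "mor_trg u = B" for u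
    using D0.TD.ococ_lwhisker[OF e_ococ(2), of "mor_fun u"] that by simp
  have "D0.TD.isomod (alg_ob B) (\<lambda>i. (mor_fun q \<cdot> mor_fun dd0) \<cdot> e1 i) (\<lambda>d. (mor_fun q \<cdot> mor_fun dd0) \<triangleright> ec1 d)
     (\<lambda>i. (mor_fun q \<cdot> mor_fun dd1) \<cdot> e1 i) (\<lambda>d. (mor_fun q \<cdot> mor_fun dd1) \<triangleright> ec1 d) (\<lambda>i. trans_cell \<Xi> \<triangleleft> e1 i)"
    using c[of "comp_psmor C M q dd0"] c[of "comp_psmor C M q dd1"] D0.TD.omod_rwhisker[OF e_ococ(2), of "trans_cell \<Xi>"]
    by (intro D0.TD.isomodI) (simp_all add: mor_comp_psmor)
  then have "D0.TD.isomod (alg_ob B) (\<lambda>i. mor_fun q \<cdot> (mor_fun dd0 \<cdot> e1 i)) (\<lambda>d. mor_fun q \<triangleright> (mor_fun dd0 \<triangleright> ec1 d))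
     (\<lambda>i. mor_fun q \<cdot> (mor_fun dd1 \<cdot> e1 i)) (\<lambda>d. mor_fun q \<triangleright> (mor_fun dd1 \<triangleright> ec1 d)) (\<lambda>i. trans_cell \<Xi> \<triangleleft> e1 i)"
    by (rule D0.TD.isomod_cong) simp_all
  from D0.TD.isomod_comp[OF D0.TD.isomod_comp[OF \<gamma>0_isomod this] \<delta>1_isomod] show ?thesis
    unfolding \<phi>_def by simp
qed

definition Res :: "(('o, 'a, 'c) psalg, ('o, 'a, 'c) psmor, ('o, 'a, 'c) pstrans) codescent" where
  "Res = \<lparr>X0 = B0, X1 = B1, X2 = B2, p0 = pp0, p1 = pp1, p2 = pp2, d0 = dd0, d1 = dd1, ii = jj,
     n0 = N0, n1 = N1, th01 = H01, th02 = H02, th12 = H12\<rparr>"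

lemma Res_simps [simp]:
  "X0 Res = B0" "X1 Res = B1" "X2 Res = B2" "p0 Res = pp0" "p1 Res = pp1" "p2 Res = pp2" "d0 Res = dd0" "d1 Res = dd1" "ii Res = jj"
  "n0 Res = N0" "n1 Res = N1" "th01 Res = H01" "th02 Res = H02" "th12 Res = H12"
  by (simp_all add: Res_def)

lemma is_codescent_Res: "is_codescent Alg Res"
  by (simp add: is_codescent_def hom1_def invhom2_def hom2_def iso2_Alg_iff)

abbreviation leg_of :: "('o, 'a, 'c) psmor \<Rightarrow> ('o, 'a, 'c) pstrans \<Rightarrow> 'i \<Rightarrow> ('o, 'a, 'c) psmor" where
  "leg_of q \<Xi> i \<equiv> PsMor (F0 F i) (mor_trg q) (mor_fun q \<cdot> e i) (\<phi> q (trans_cell \<Xi>) i)"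

text \<open>The two conditions on \<Xi> at \<open>i\<close> are the unit and multiplication laws of
  the leg, by \<open>leg_unit_iff\<close> and \<open>leg_mult_iff\<close>; the typing part of being
  a pseudomorphism holds for every pair.\<close>

lemma leg_of_mor_iff:
  assumes p: "pair B q \<Xi>" and [simp]: "i \<in> Obj I"
  shows "mor (leg_of q \<Xi> i) \<longleftrightarrow>
    (mor_fun q \<triangleright> (trans_cell N1 \<triangleleft> e i)) \<odot> (trans_cell \<Xi> \<triangleleft> mor_fun jj \<cdot> e i) = mor_fun q \<triangleright> (trans_cell N0 \<triangleleft> e i) \<and>
    (mor_fun q \<triangleright> (trans_cell H12 \<triangleleft> e2 i)) \<odot> ((trans_cell \<Xi> \<triangleleft> mor_fun pp1 \<cdot> e2 i) \<odot> (mor_fun q \<triangleright> (trans_cell H01 \<triangleleft> e2 i))) =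
    (trans_cell \<Xi> \<triangleleft> mor_fun pp2 \<cdot> e2 i) \<odot> ((mor_fun q \<triangleright> (trans_cell H02 \<triangleleft> e2 i)) \<odot> (trans_cell \<Xi> \<triangleleft> mor_fun pp0 \<cdot> e2 i))"
  unfolding leg_unit_iff[OF p assms(2)] leg_mult_iff[OF p assms(2)] ev_def
proof (intro iffI conjI)
  note [simp] = pairD[OF p]
  let ?v = "leg_of q \<Xi> i"
  assume m: "mor ?v"
  show "(mor_fun q \<cdot> e i \<triangleright> alg_unit (F0 F i)) \<odot> (\<phi> q (trans_cell \<Xi>) i \<triangleleft> \<eta> M (Ao i)) =
      (alg_unit B \<triangleleft> mor_fun q \<cdot> e i) \<odot> (alg_act B \<triangleright> \<eta>n M (mor_fun q \<cdot> e i))"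
    using mor_unit[OF m refl refl refl] unfolding psmor.sel pairD(3)[OF p] .
  show "(mor_fun q \<cdot> e i \<triangleright> alg_mult (F0 F i)) \<odot> ((\<phi> q (trans_cell \<Xi>) i \<triangleleft> T1 M (Aa i)) \<odot> (alg_act B \<triangleright> T2 M (\<phi> q (trans_cell \<Xi>) i))) =
    (\<phi> q (trans_cell \<Xi>) i \<triangleleft> \<mu> M (Ao i)) \<odot> ((alg_act B \<triangleright> \<mu>n M (mor_fun q \<cdot> e i)) \<odot> (alg_mult B \<triangleleft> T1 M (T1 M (mor_fun q \<cdot> e i))))"
    using mor_mult[OF m refl refl refl refl] unfolding psmor.sel pairD(3)[OF p] .
next
  note [simp] = pairD[OF p]
  assume a: "(mor_fun q \<cdot> e i \<triangleright> alg_unit (F0 F i)) \<odot> (\<phi> q (trans_cell \<Xi>) i \<triangleleft> \<eta> M (Ao i)) =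
      (alg_unit B \<triangleleft> mor_fun q \<cdot> e i) \<odot> (alg_act B \<triangleright> \<eta>n M (mor_fun q \<cdot> e i)) \<and>
    (mor_fun q \<cdot> e i \<triangleright> alg_mult (F0 F i)) \<odot> ((\<phi> q (trans_cell \<Xi>) i \<triangleleft> T1 M (Aa i)) \<odot> (alg_act B \<triangleright> T2 M (\<phi> q (trans_cell \<Xi>) i))) =
    (\<phi> q (trans_cell \<Xi>) i \<triangleleft> \<mu> M (Ao i)) \<odot> ((alg_act B \<triangleright> \<mu>n M (mor_fun q \<cdot> e i)) \<odot> (alg_mult B \<triangleleft> T1 M (T1 M (mor_fun q \<cdot> e i))))"
  show "mor (leg_of q \<Xi> i)"
    unfolding pairD(3)[OF p]
    by (rule morI[OF _ _ _ _ _ _ _ _ conjunct1[OF a] conjunct2[OF a]]) (simp_all add: \<phi>_typing[OF p])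
qed

text \<open>The two equations are between transformations out of \<open>B0\<close> and
  \<open>B2\<close>, so by uniqueness they may be tested on the legs \<open>e\<close> and
  \<open>e2\<close>, where \<open>leg_of_mor_iff\<close> applies.\<close>

lemma pseudocoequalizes_iff:
  "pseudocoequalizes Alg Res B (q, \<Xi>) \<longleftrightarrow> pair B q \<Xi> \<and> (\<forall>i \<in> Obj I. mor (leg_of q \<Xi> i))"
proof (cases "pair B q \<Xi>")
  case False
  then show ?thesis
    unfolding pseudocoequalizes_def pair_def
    by (auto simp: hom1_def invhom2_def hom2_def iso2_Alg_iff)
next
  case True
  note [simp] = pairD[OF True]
  let ?L1 = "(q \<triangleright>\<^bsub>Alg\<^esub> N1) \<odot>\<^bsub>Alg\<^esub> (\<Xi> \<triangleleft>\<^bsub>Alg\<^esub> jj)" and ?R1 = "q \<triangleright>\<^bsub>Alg\<^esub> N0"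
  let ?L2 = "(q \<triangleright>\<^bsub>Alg\<^esub> H12) \<odot>\<^bsub>Alg\<^esub> (\<Xi> \<triangleleft>\<^bsub>Alg\<^esub> pp1) \<odot>\<^bsub>Alg\<^esub> (q \<triangleright>\<^bsub>Alg\<^esub> H01)"
    and ?R2 = "(\<Xi> \<triangleleft>\<^bsub>Alg\<^esub> pp2) \<odot>\<^bsub>Alg\<^esub> (q \<triangleright>\<^bsub>Alg\<^esub> H02) \<odot>\<^bsub>Alg\<^esub> (\<Xi> \<triangleleft>\<^bsub>Alg\<^esub> pp0)"
  \<comment> \<open>Brackets composites of pseudomorphisms to the left, so that the endpoints of the
    pasted transformations agree syntactically.\<close>
  have a [simp]: "comp_psmor C M q (comp_psmor C M u v) = comp_psmor C M (comp_psmor C M q u) v"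
    if "mor u" "mor_trg u = B0" "mor v" "mor_trg v = mor_src u" for u v
    using comp_psmor_assoc[of v u q] that by simp
  have t: "transf (q \<triangleright>\<^bsub>Alg\<^esub> \<Sigma>)" if "transf \<Sigma>" "mor_trg (trans_src \<Sigma>) = B0" for \<Sigma>
    using Alg.lwhisker_typing(1)[of \<Sigma> q] that by simp
  have t': "transf (\<Xi> \<triangleleft>\<^bsub>Alg\<^esub> u)" if "mor u" "mor_trg u = B1" for u
    using Alg.rwhisker_typing(1)[of \<Xi> u] that by simp
  have v: "transf (\<Sigma>' \<odot>\<^bsub>Alg\<^esub> \<Sigma>)" if "transf \<Sigma>" "transf \<Sigma>'" "trans_src \<Sigma>' = trans_trg \<Sigma>" for \<Sigma> \<Sigma>'
    using Alg.vcomp_typing(1)[of \<Sigma> \<Sigma>'] that by simp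
  have T: "transf ?L1" "transf ?R1" "transf ?L2" "transf ?R2"
    by (intro v t t'; simp)+
  have 1: "?L1 = ?R1 \<longleftrightarrow> (\<forall>i \<in> Obj I. (mor_fun q \<triangleright> (trans_cell N1 \<triangleleft> e i)) \<odot> (trans_cell \<Xi> \<triangleleft> mor_fun jj \<cdot> e i) = mor_fun q \<triangleright> (trans_cell N0 \<triangleleft> e i))"
  proof -
    have "?L1 = ?R1 \<longleftrightarrow> (\<forall>i \<in> Obj I. trans_cell ?L1 \<triangleleft> e i = trans_cell ?R1 \<triangleleft> e i)"
      by (rule D0.fcolim_eq_iff[OF f0 T(1,2)]) simp_all
    then show ?thesis
      by simp
  qed
  have 2: "?L2 = ?R2 \<longleftrightarrow> (\<forall>i \<in> Obj I. (mor_fun q \<triangleright> (trans_cell H12 \<triangleleft> e2 i)) \<odot> ((trans_cell \<Xi> \<triangleleft> mor_fun pp1 \<cdot> e2 i) \<odot> (mor_fun q \<triangleright> (trans_cell H01 \<triangleleft> e2 i))) =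
    (trans_cell \<Xi> \<triangleleft> mor_fun pp2 \<cdot> e2 i) \<odot> ((mor_fun q \<triangleright> (trans_cell H02 \<triangleleft> e2 i)) \<odot> (trans_cell \<Xi> \<triangleleft> mor_fun pp0 \<cdot> e2 i)))"
  proof -
    have "?L2 = ?R2 \<longleftrightarrow> (\<forall>i \<in> Obj I. trans_cell ?L2 \<triangleleft> e2 i = trans_cell ?R2 \<triangleleft> e2 i)"
      by (rule D2.fcolim_eq_iff[OF f2 T(3,4)]) simp_all
    then show ?thesis
      by simp
  qed
  have "pseudocoequalizes Alg Res B (q, \<Xi>) \<longleftrightarrow> ?L1 = ?R1 \<and> ?L2 = ?R2"
    unfolding pseudocoequalizes_def prod.case Res_simps
    by (simp add: hom1_def invhom2_def hom2_def iso2_Alg_iff del: Alg_whisker Alg_simps(11))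
  also have "\<dots> \<longleftrightarrow> (\<forall>i \<in> Obj I. mor (leg_of q \<Xi> i))"
    unfolding 1 2 using leg_of_mor_iff[OF True] by blast
  finally show ?thesis
    using True by blast
qed

text \<open>Compatibility with the cells of the pairs is an equation of transformations out of
  \<open>B1\<close>. Tested on the legs \<open>e1\<close>, it becomes the transformation law for
  each restriction, by \<open>leg_trans_iff\<close>.\<close>

lemma pscoeq_mods_iff:
  assumes p: "pseudocoequalizes Alg Res B (q, \<Xi>)" "pseudocoequalizes Alg Res B (q', \<Xi>')"
  shows "\<Sigma> \<in> pscoeq_mods Alg Res (q, \<Xi>) (q', \<Xi>') \<longleftrightarrow> transf \<Sigma> \<and> trans_src \<Sigma> = q \<and> trans_trg \<Sigma> = q' \<and>
    (\<forall>i \<in> Obj I. transf (PsTrans (leg_of q \<Xi> i) (leg_of q' \<Xi>' i) (trans_cell \<Sigma> \<triangleleft> e i)))"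
proof (cases "transf \<Sigma> \<and> trans_src \<Sigma> = q \<and> trans_trg \<Sigma> = q'")
  case False
  then show ?thesis
    by (auto simp: pscoeq_mods_def hom2_def)
next
  case True
  then have s [simp]: "transf \<Sigma>" "trans_src \<Sigma> = q" "trans_trg \<Sigma> = q'"
    by auto
  have p1: "pair B q \<Xi>" "pair B q' \<Xi>'" and m: "\<And>i. i \<in> Obj I \<Longrightarrow> mor (leg_of q \<Xi> i)" "\<And>i. i \<in> Obj I \<Longrightarrow> mor (leg_of q' \<Xi>' i)"
    using p by (simp_all only: pseudocoequalizes_iff)
  note [simp] = pairD[OF p1(1)] pairD[OF p1(2)]
  let ?L = "(\<Sigma> \<triangleleft>\<^bsub>Alg\<^esub> dd1) \<odot>\<^bsub>Alg\<^esub> \<Xi>" and ?R = "\<Xi>' \<odot>\<^bsub>Alg\<^esub> (\<Sigma> \<triangleleft>\<^bsub>Alg\<^esub> dd0)"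
  have t': "transf (\<Sigma> \<triangleleft>\<^bsub>Alg\<^esub> u)" if "mor u" "mor_trg u = B0" for u
    using Alg.rwhisker_typing(1)[of \<Sigma> u] that by simp
  have v: "transf (\<Sigma>' \<odot>\<^bsub>Alg\<^esub> \<Sigma>)" if "transf \<Sigma>" "transf \<Sigma>'" "trans_src \<Sigma>' = trans_trg \<Sigma>" for \<Sigma> \<Sigma>'
    using Alg.vcomp_typing(1)[of \<Sigma> \<Sigma>'] that by simp
  have T: "transf ?L" "transf ?R"
    by (intro v t'; simp)+
  have "?L = ?R \<longleftrightarrow> (\<forall>i \<in> Obj I. trans_cell ?L \<triangleleft> e1 i = trans_cell ?R \<triangleleft> e1 i)"
    by (rule D1.fcolim_eq_iff[OF f1 T]) simp_all
  also have "\<dots> \<longleftrightarrow> (\<forall>i \<in> Obj I. (trans_cell \<Sigma> \<triangleleft> mor_fun dd1 \<cdot> e1 i) \<odot> (trans_cell \<Xi> \<triangleleft> e1 i) = (trans_cell \<Xi>' \<triangleleft> e1 i) \<odot> (trans_cell \<Sigma> \<triangleleft> mor_fun dd0 \<cdot> e1 i))"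
    by simp
  also have "\<dots> \<longleftrightarrow> (\<forall>i \<in> Obj I. transf (PsTrans (leg_of q \<Xi> i) (leg_of q' \<Xi>' i) (trans_cell \<Sigma> \<triangleleft> e i)))"
    using m leg_trans_iff[OF p1 _ s] by (simp add: transf_iff[of "PsTrans _ _ _"])
  finally show ?thesis
    using True unfolding pscoeq_mods_def by (simp add: hom2_def del: Alg_whisker Alg_simps(11))
qed

definition to_cocone_ob :: "('o, 'a, 'c) psmor \<times> ('o, 'a, 'c) pstrans \<Rightarrow> ('i, 'd, ('o, 'a, 'c) psmor, ('o, 'a, 'c) pstrans) oplax_cocone" where
  "to_cocone_ob = (\<lambda>(q, \<Xi>). OplaxCocone (\<lambda>i\<in>Obj I. leg_of q \<Xi> i)
     (\<lambda>d\<in>Cell1 I. PsTrans (comp_psmor C M (leg_of q \<Xi> (trg1 I d)) (F1 F d)) (leg_of q \<Xi> (src1 I d)) (mor_fun q \<triangleright> ec d)))"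

text \<open>The arrow part consists of the restrictions of the underlying 2-cell to the legs; source
  and target are stored again because arrows of the cocone category are tagged triples.\<close>

definition to_cocone where
  "to_cocone = \<lparr>onOb = to_cocone_ob, onArr = (\<lambda>(p, \<Sigma>, p'). (to_cocone_ob p,
     \<lambda>i\<in>Obj I. PsTrans (leg_of (fst p) (snd p) i) (leg_of (fst p') (snd p') i) (trans_cell \<Sigma> \<triangleleft> e i), to_cocone_ob p'))\<rparr>"

lemma to_cocone_simps [simp]:
  "onOb to_cocone p = to_cocone_ob p"
  "onArr to_cocone ((q, \<Xi>), \<Sigma>, (q', \<Xi>')) = (to_cocone_ob (q, \<Xi>),
     \<lambda>i\<in>Obj I. PsTrans (leg_of q \<Xi> i) (leg_of q' \<Xi>' i) (trans_cell \<Sigma> \<triangleleft> e i), to_cocone_ob (q', \<Xi>'))"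
  "leg (to_cocone_ob (q, \<Xi>)) = (\<lambda>i\<in>Obj I. leg_of q \<Xi> i)"
  "leg_cell (to_cocone_ob (q, \<Xi>)) = (\<lambda>d\<in>Cell1 I. PsTrans (comp_psmor C M (leg_of q \<Xi> (trg1 I d)) (F1 F d)) (leg_of q \<Xi> (src1 I d)) (mor_fun q \<triangleright> ec d))"
  by (simp_all add: to_cocone_def to_cocone_ob_def)

lemma to_cocone_cocone:
  assumes "pseudocoequalizes Alg Res B (q, \<Xi>)"
  shows "is_oplax_cocone I Alg F B (to_cocone_ob (q, \<Xi>))"
proof -
  have p: "pair B q \<Xi>" and m: "\<And>i. i \<in> Obj I \<Longrightarrow> mor (leg_of q \<Xi> i)"
    using assms by (simp_all only: pseudocoequalizes_iff)
  note [simp] = pairD[OF p]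
  have o: "oc0 (alg_ob B) (\<lambda>i. mor_fun q \<cdot> e i) (\<lambda>d. mor_fun q \<triangleright> ec d)"
    using D0.D.ococ_lwhisker[OF e_ococ(1), of "mor_fun q"] by simp
  have "F.ococ B (\<lambda>i. PsMor (F0 F i) B (mor_fun q \<cdot> e i) (\<phi> q (trans_cell \<Xi>) i))
    (\<lambda>d. PsTrans (comp_psmor C M (PsMor (F0 F (trg1 I d)) B (mor_fun q \<cdot> e (trg1 I d)) (\<phi> q (trans_cell \<Xi>) (trg1 I d))) (F1 F d))
       (PsMor (F0 F (src1 I d)) B (mor_fun q \<cdot> e (src1 I d)) (\<phi> q (trans_cell \<Xi>) (src1 I d))) (mor_fun q \<triangleright> ec d))"
    by (rule Alg_ococI[OF pairD(10)[OF p] o _ D0.TD.isomodD(3)[OF \<phi>_isomod[OF p]]]) (use m in simp)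
  then have "F.ococ B (leg (to_cocone_ob (q, \<Xi>))) (leg_cell (to_cocone_ob (q, \<Xi>)))"
    by (rule F.ococ_cong) simp_all
  then show ?thesis
    by (simp add: F.is_oplax_cocone_iff)
qed

lemma to_cocone_omod_iff:
  assumes p: "pseudocoequalizes Alg Res B (q, \<Xi>)" and p': "pseudocoequalizes Alg Res B (q', \<Xi>')"
  shows "F.omod (leg (to_cocone_ob (q, \<Xi>))) (leg_cell (to_cocone_ob (q, \<Xi>))) (leg (to_cocone_ob (q', \<Xi>'))) (leg_cell (to_cocone_ob (q', \<Xi>'))) m \<longleftrightarrow>
    (\<forall>i \<in> Obj I. transf (m i) \<and> trans_src (m i) = leg_of q \<Xi> i \<and> trans_trg (m i) = leg_of q' \<Xi>' i) \<and>
     D0.D.omod (\<lambda>i. mor_fun q \<cdot> e i) (\<lambda>d. mor_fun q \<triangleright> ec d) (\<lambda>i. mor_fun q' \<cdot> e i) (\<lambda>d. mor_fun q' \<triangleright> ec d) (\<lambda>i. trans_cell (m i))"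
proof -
  have B: "alg B"
    using p unfolding pseudocoequalizes_iff by (auto dest: pairD(10))
  have "F.ococ B (leg (to_cocone_ob (q, \<Xi>))) (leg_cell (to_cocone_ob (q, \<Xi>)))" "F.ococ B (leg (to_cocone_ob (q', \<Xi>'))) (leg_cell (to_cocone_ob (q', \<Xi>')))"
    using to_cocone_cocone[OF p] to_cocone_cocone[OF p'] by (simp_all only: F.is_oplax_cocone_iff)
  from Alg_omod_iff[OF this B] show ?thesis
    by (simp add: D0.D.omod_def)
qed

lemma Hom_pscoeq_iff:
  "x \<in> Hom (pscoeq_cat Alg Res B) p p' \<longleftrightarrow> (\<exists>\<Sigma>. x = (p, \<Sigma>, p') \<and> pseudocoequalizes Alg Res B p \<and> pseudocoequalizes Alg Res B p' \<and>
     \<Sigma> \<in> pscoeq_mods Alg Res p p')"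
  unfolding pscoeq_cat_def Hom_tagged_cat by auto

lemma to_cocone_Hom:
  assumes "x \<in> Hom (pscoeq_cat Alg Res B) p p'"
  shows "onArr to_cocone x \<in> Hom (oplax_cocone_cat I Alg F B) (to_cocone_ob p) (to_cocone_ob p')"
proof -
  obtain q \<Xi> q' \<Xi>' where pq [simp]: "p = (q, \<Xi>)" "p' = (q', \<Xi>')"
    by (cases p; cases p')
  obtain \<Sigma> where x [simp]: "x = (p, \<Sigma>, p')" and p: "pseudocoequalizes Alg Res B (q, \<Xi>)" "pseudocoequalizes Alg Res B (q', \<Xi>')"
    and "\<Sigma> \<in> pscoeq_mods Alg Res (q, \<Xi>) (q', \<Xi>')"
    using assms by (auto simp: Hom_pscoeq_iff)
  then have s: "transf \<Sigma>" "trans_src \<Sigma> = q" "trans_trg \<Sigma> = q'"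
    "\<And>i. i \<in> Obj I \<Longrightarrow> transf (PsTrans (leg_of q \<Xi> i) (leg_of q' \<Xi>' i) (trans_cell \<Sigma> \<triangleleft> e i))"
    unfolding pscoeq_mods_iff[OF p] by auto
  have "pair B q \<Xi>"
    using p by (simp add: pseudocoequalizes_iff)
  note [simp] = pairD(1-3)[OF this]
  have "D0.D.omod (\<lambda>i. mor_fun q \<cdot> e i) (\<lambda>d. mor_fun q \<triangleright> ec d) (\<lambda>i. mor_fun q' \<cdot> e i) (\<lambda>d. mor_fun q' \<triangleright> ec d) (\<lambda>i. trans_cell \<Sigma> \<triangleleft> e i)"
    using s(1-3) by (intro D0.D.omod_rwhisker[OF e_ococ(1)]) simp_all
  then have "D0.D.omod (\<lambda>i. mor_fun q \<cdot> e i) (\<lambda>d. mor_fun q \<triangleright> ec d) (\<lambda>i. mor_fun q' \<cdot> e i) (\<lambda>d. mor_fun q' \<triangleright> ec d)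
     (\<lambda>i. trans_cell ((\<lambda>i\<in>Obj I. PsTrans (leg_of q \<Xi> i) (leg_of q' \<Xi>' i) (trans_cell \<Sigma> \<triangleleft> e i)) i))"
    by (rule D0.D.omod_cong) simp_all
  then show ?thesis
    using to_cocone_cocone[OF p(1)] to_cocone_cocone[OF p(2)] s(4) by (simp add: F.oplax_Hom_iff to_cocone_omod_iff[OF p] del: to_cocone_simps(3,4))
qed

lemma to_cocone_functor: "is_functor (pscoeq_cat Alg Res B) (oplax_cocone_cat I Alg F B) to_cocone"
  unfolding is_functor_def
proof (intro conjI ballI impI)
  show "onOb to_cocone p \<in> Ob (oplax_cocone_cat I Alg F B)" if "p \<in> Ob (pscoeq_cat Alg Res B)" for p
    using that to_cocone_cocone[of B "fst p" "snd p"] by (simp add: pscoeq_cat_def oplax_cocone_cat_def tagged_cat_def)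
  show "onArr to_cocone x \<in> Hom (oplax_cocone_cat I Alg F B) (onOb to_cocone p) (onOb to_cocone p')" if "x \<in> Hom (pscoeq_cat Alg Res B) p p'" for x p p'
    using to_cocone_Hom[OF that] by simp
  show "onArr to_cocone (Idn (pscoeq_cat Alg Res B) p) = Idn (oplax_cocone_cat I Alg F B) (onOb to_cocone p)" if "p \<in> Ob (pscoeq_cat Alg Res B)" for p
  proof -
    obtain q \<Xi> where p [simp]: "p = (q, \<Xi>)"
      by (cases p)
    have "pair B q \<Xi>"
      using that by (simp add: pscoeq_cat_def tagged_cat_def pseudocoequalizes_iff)
    note [simp] = pairD(1-3)[OF this]
    show ?thesis
      by (auto simp: pscoeq_cat_def oplax_cocone_cat_def tagged_cat_def intro!: restrict_ext)
  qed
  fix x y assume x: "x \<in> Arr (pscoeq_cat Alg Res B)" and y: "y \<in> Arr (pscoeq_cat Alg Res B)" and c: "Dom (pscoeq_cat Alg Res B) y = Cod (pscoeq_cat Alg Res B) x"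
  obtain q \<Xi> \<Sigma> q' \<Xi>' where x': "x = ((q, \<Xi>), \<Sigma>, (q', \<Xi>'))"
    by (cases x) auto
  with c obtain \<Sigma>' q'' \<Xi>'' where y': "y = ((q', \<Xi>'), \<Sigma>', (q'', \<Xi>''))"
    by (cases y) (auto simp: pscoeq_cat_def tagged_cat_def)
  have p: "pseudocoequalizes Alg Res B (q, \<Xi>)" "pseudocoequalizes Alg Res B (q', \<Xi>')" "pseudocoequalizes Alg Res B (q'', \<Xi>'')"
    "\<Sigma> \<in> pscoeq_mods Alg Res (q, \<Xi>) (q', \<Xi>')" "\<Sigma>' \<in> pscoeq_mods Alg Res (q', \<Xi>') (q'', \<Xi>'')"
    using x y unfolding x' y' by (auto simp: pscoeq_cat_def tagged_cat_def)
  have s [simp]: "transf \<Sigma>" "trans_src \<Sigma> = q" "trans_trg \<Sigma> = q'" "transf \<Sigma>'" "trans_src \<Sigma>' = q'" "trans_trg \<Sigma>' = q''"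
    using p(4,5) unfolding pscoeq_mods_iff[OF p(1,2)] pscoeq_mods_iff[OF p(2,3)] by auto
  have "pair B q \<Xi>" "pair B q' \<Xi>'"
    using p by (simp_all add: pseudocoequalizes_iff)
  note [simp] = pairD(1-3)[OF this(1)] pairD(1-3)[OF this(2)]
  show "onArr to_cocone (Cmp (pscoeq_cat Alg Res B) y x) = Cmp (oplax_cocone_cat I Alg F B) (onArr to_cocone y) (onArr to_cocone x)"
    unfolding x' y' by (auto simp: pscoeq_cat_def oplax_cocone_cat_def tagged_cat_def intro!: restrict_ext)
qed

text \<open>Restriction to the legs is bijective on transformations out of \<open>B0\<close> by the
  universal property of \<open>B0\<close>, and \<open>pscoeq_mods_iff\<close> matches the arrows of
  the two categories under it.\<close>

lemma to_cocone_bij: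
  assumes p: "p \<in> Ob (pscoeq_cat Alg Res B)" "p' \<in> Ob (pscoeq_cat Alg Res B)"
  shows "bij_betw (onArr to_cocone) (Hom (pscoeq_cat Alg Res B) p p') (Hom (oplax_cocone_cat I Alg F B) (to_cocone_ob p) (to_cocone_ob p'))"
proof -
  obtain q \<Xi> q' \<Xi>' where pq [simp]: "p = (q, \<Xi>)" "p' = (q', \<Xi>')"
    by (cases p; cases p')
  have c: "pseudocoequalizes Alg Res B (q, \<Xi>)" "pseudocoequalizes Alg Res B (q', \<Xi>')"
    using p by (simp_all add: pscoeq_cat_def tagged_cat_def)
  then have P: "pair B q \<Xi>" "pair B q' \<Xi>'"
    by (simp_all add: pseudocoequalizes_iff)
  note [simp] = pairD(1-3)[OF P(1)] pairD(1-3)[OF P(2)]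
  show ?thesis
    unfolding bij_betw_def
  proof (intro conjI inj_onI equalityI subsetI)
    fix x y assume x: "x \<in> Hom (pscoeq_cat Alg Res B) p p'" and y: "y \<in> Hom (pscoeq_cat Alg Res B) p p'" and xy: "onArr to_cocone x = onArr to_cocone y"
    obtain \<Sigma> where x': "x = (p, \<Sigma>, p')" "\<Sigma> \<in> pscoeq_mods Alg Res (q, \<Xi>) (q', \<Xi>')"
      using x by (auto simp: Hom_pscoeq_iff)
    obtain \<Sigma>' where y': "y = (p, \<Sigma>', p')" "\<Sigma>' \<in> pscoeq_mods Alg Res (q, \<Xi>) (q', \<Xi>')"
      using y by (auto simp: Hom_pscoeq_iff)
    have s: "transf \<Sigma>" "trans_src \<Sigma> = q" "trans_trg \<Sigma> = q'" "transf \<Sigma>'" "trans_src \<Sigma>' = q" "trans_trg \<Sigma>' = q'"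
      using x'(2) y'(2) unfolding pscoeq_mods_iff[OF c] by auto
    have E: "(\<lambda>i\<in>Obj I. PsTrans (leg_of q \<Xi> i) (leg_of q' \<Xi>' i) (trans_cell \<Sigma> \<triangleleft> e i)) =
       (\<lambda>i\<in>Obj I. PsTrans (leg_of q \<Xi> i) (leg_of q' \<Xi>' i) (trans_cell \<Sigma>' \<triangleleft> e i))"
      using xy unfolding x' y' by simp
    have "trans_cell \<Sigma> \<triangleleft> e i = trans_cell \<Sigma>' \<triangleleft> e i" if "i \<in> Obj I" for i
      using fun_cong[OF E, of i] that by simp
    then show "x = y"
      unfolding x' y' using D0.fcolim_eqI[OF f0 s(1,4)] s by simp
  next
    fix z assume "z \<in> onArr to_cocone ` Hom (pscoeq_cat Alg Res B) p p'"
    then show "z \<in> Hom (oplax_cocone_cat I Alg F B) (to_cocone_ob p) (to_cocone_ob p')"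
      using to_cocone_Hom by blast
  next
    fix z assume "z \<in> Hom (oplax_cocone_cat I Alg F B) (to_cocone_ob p) (to_cocone_ob p')"
    then obtain m where z: "z = (to_cocone_ob p, m, to_cocone_ob p')" and ext: "m \<in> extensional (Obj I)"
      and "F.omod (leg (to_cocone_ob (q, \<Xi>))) (leg_cell (to_cocone_ob (q, \<Xi>))) (leg (to_cocone_ob (q', \<Xi>'))) (leg_cell (to_cocone_ob (q', \<Xi>'))) m"
      unfolding F.oplax_Hom_iff pq by blast
    then have m: "\<And>i. i \<in> Obj I \<Longrightarrow> transf (m i) \<and> trans_src (m i) = leg_of q \<Xi> i \<and> trans_trg (m i) = leg_of q' \<Xi>' i"
      and o: "D0.D.omod (\<lambda>i. mor_fun q \<cdot> e i) (\<lambda>d. mor_fun q \<triangleright> ec d) (\<lambda>i. mor_fun q' \<cdot> e i) (\<lambda>d. mor_fun q' \<triangleright> ec d) (\<lambda>i. trans_cell (m i))"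
      unfolding to_cocone_omod_iff[OF c] by auto
    obtain \<Sigma> where S: "transf \<Sigma>" "trans_src \<Sigma> = q" "trans_trg \<Sigma> = q'" "\<And>i. i \<in> Obj I \<Longrightarrow> trans_cell \<Sigma> \<triangleleft> e i = trans_cell (m i)"
      using D0.fcolim_FF[OF f0 _ _ _ _ _ _ o, of B] by auto
    have mi: "m i = PsTrans (leg_of q \<Xi> i) (leg_of q' \<Xi>' i) (trans_cell \<Sigma> \<triangleleft> e i)" if "i \<in> Obj I" for i
      using m[OF that] S(4)[OF that] by (intro pstrans.expand) simp
    have "\<Sigma> \<in> pscoeq_mods Alg Res (q, \<Xi>) (q', \<Xi>')"
      unfolding pscoeq_mods_iff[OF c] using S(1-3) m mi by simp
    moreover have "onArr to_cocone (p, \<Sigma>, p') = z"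
      using mi ext unfolding z by (auto intro!: extensionalityI[of _ "Obj I"])
    ultimately show "z \<in> onArr to_cocone ` Hom (pscoeq_cat Alg Res B) p p'"
      using c by (intro image_eqI[of _ _ "(p, \<Sigma>, p')"]) (auto simp: Hom_pscoeq_iff)
  qed
qed

text \<open>A cocone of pseudomorphisms has an underlying cocone, which is classified by some
  \<open>q\<close> out of \<open>B0\<close>. The structure of its legs, transported to the
  isomorphic 1-cells \<open>q e\<close>, prescribes \<phi>, and this determines the cell of the
  pair.\<close>

lemma to_cocone_eso:
  assumes [simp]: "alg B" and z: "is_oplax_cocone I Alg F B z"
  shows "\<exists>p \<in> Ob (pscoeq_cat Alg Res B). \<exists>k \<in> Hom (oplax_cocone_cat I Alg F B) (to_cocone_ob p) z. invertible (oplax_cocone_cat I Alg F B) k"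
proof -
  define Q Qc where "Q = leg z" and "Qc = leg_cell z"
  have Q: "F.ococ B Q Qc"
    using z by (simp add: F.is_oplax_cocone_iff Q_def Qc_def)
  note QD = Alg_ococD[OF Q assms(1)]
  note [simp] = QD(1-6)
  obtain q m where q [simp]: "mor q" "mor_src q = B0" "mor_trg q = B"
    and m: "D0.D.isomod (alg_ob B) (\<lambda>i. mor_fun q \<cdot> e i) (\<lambda>d. mor_fun q \<triangleright> ec d) (\<lambda>i. mor_fun (Q i)) (\<lambda>d. trans_cell (Qc d)) m"
    using D0.fcolim_ES[OF f0 assms(1) QD(7)] by blast
  \<comment> \<open>The structure cell of \<open>Q i\<close> transported along \<open>m i\<close>,
    in the form produced by \<open>mor_transport\<close>.\<close>
  define \<phi>' where "\<phi>' = (\<lambda>i. (vinv (m i) \<triangleleft> Aa i) \<odot> (mor_cell (Q i) \<odot> (alg_act B \<triangleright> T2 M (m i))))"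
  note [simp] = D0.D.isomodD(4-6)[OF m]
  have "D0.TD.isomod (alg_ob B) (\<lambda>i. alg_act B \<cdot> T1 M (mor_fun q \<cdot> e i)) (\<lambda>d. alg_act B \<triangleright> T2 M (mor_fun q \<triangleright> ec d))
    (\<lambda>i. (mor_fun q \<cdot> e i) \<cdot> Aa i) (\<lambda>d. ((mor_fun q \<triangleright> ec d) \<triangleleft> Aa (src1 I d)) \<odot> (mor_fun q \<cdot> e (trg1 I d) \<triangleright> Fc d)) \<phi>'"
    unfolding \<phi>'_def
    by (rule D0.TD.isomod_comp[OF D0.TD.isomod_comp[OF D0.isomod_act[OF m assms(1)] QD(8)]
        D0.D.isomod_restrict[OF D0.two_fun_TD lax_nat_act D0.D.isomod_vinv[OF m]]])
  \<comment> \<open>\<phi> arises from the pair cell by composing with \<gamma>0 and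
    \<open>q \<delta>1\<close>, both invertible, so requiring it to equal \<open>\<phi>'\<close> can
    be solved for the restriction \<open>x\<close> of that cell to the legs.\<close>
  then obtain x where x: "D0.TD.isomod (alg_ob B) (\<lambda>i. mor_fun q \<cdot> (mor_fun dd0 \<cdot> e1 i)) (\<lambda>d. mor_fun q \<triangleright> (mor_fun dd0 \<triangleright> ec1 d))
     (\<lambda>i. mor_fun q \<cdot> (mor_fun dd1 \<cdot> e1 i)) (\<lambda>d. mor_fun q \<triangleright> (mor_fun dd1 \<triangleright> ec1 d)) x"
    and x\<phi>: "\<And>i. i \<in> Obj I \<Longrightarrow> (mor_fun q \<triangleright> \<delta>1 i) \<odot> (x i \<odot> \<gamma>0 q i) = \<phi>' i"
    using D0.TD.isomod_solve[OF \<gamma>0_isomod[OF q] \<delta>1_isomod[OF q]] by blast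
  have "D0.TD.isomod (alg_ob B) (\<lambda>i. mor_fun (comp_psmor C M q dd0) \<cdot> e1 i) (\<lambda>d. mor_fun (comp_psmor C M q dd0) \<triangleright> ec1 d)
     (\<lambda>i. mor_fun (comp_psmor C M q dd1) \<cdot> e1 i) (\<lambda>d. mor_fun (comp_psmor C M q dd1) \<triangleright> ec1 d) x"
    by (rule D0.TD.isomod_cong[OF x]) simp_all
  then obtain \<Xi> where \<Xi>: "transf \<Xi>" "trans_src \<Xi> = comp_psmor C M q dd0" "trans_trg \<Xi> = comp_psmor C M q dd1" "iso2 (trans_cell \<Xi>)"
    "\<And>i. i \<in> Obj I \<Longrightarrow> trans_cell \<Xi> \<triangleleft> e1 i = x i"
    using D1.fcolim_iso[OF f1, of "comp_psmor C M q dd0" "comp_psmor C M q dd1" B "alg_ob B" x] mor_comp_psmor[of dd0 q] mor_comp_psmor[of dd1 q]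
    by auto
  have P: "pair B q \<Xi>"
    unfolding pair_def using \<Xi> by simp
  have \<phi>: "\<phi> q (trans_cell \<Xi>) i = \<phi>' i" if "i \<in> Obj I" for i
    using x\<phi>[OF that] \<Xi>(5)[OF that] by (simp add: \<phi>_def)
  \<comment> \<open>The legs are pseudomorphisms by transport, and by
    \<open>pseudocoequalizes_iff\<close> this is what the two equations of a pseudocoequalizing pair
    amount to.\<close>
  have l: "mor (leg_of q \<Xi> i)" if "i \<in> Obj I" for i
    unfolding \<phi>[OF that] \<phi>'_def q(3) by (rule mor_transport) (use that in simp_all)
  have p: "pseudocoequalizes Alg Res B (q, \<Xi>)"
    using P l by (simp add: pseudocoequalizes_iff)
  let ?n = "\<lambda>i. PsTrans (leg_of q \<Xi> i) (Q i) (m i)"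
  have n: "transf (?n i)" if [simp]: "i \<in> Obj I" for i
  proof -
    have 1: "(m i \<triangleleft> Aa i) \<odot> (vinv (m i) \<triangleleft> Aa i) = id2 C (mor_fun (Q i) \<cdot> Aa i)"
      using vinv_rwhisker(2)[of "m i" "Aa i"] by simp
    show ?thesis
      using l[of i] by (simp add: transf_iff[of "PsTrans _ _ _"] \<phi> \<phi>'_def vcomp_eq_ext[OF 1])
  qed
  have "F.isomod B (leg (to_cocone_ob (q, \<Xi>))) (leg_cell (to_cocone_ob (q, \<Xi>))) (leg z) (leg_cell z) ?n"
  proof (rule F.isomodI)
    show 1: "F.ococ B (leg (to_cocone_ob (q, \<Xi>))) (leg_cell (to_cocone_ob (q, \<Xi>)))" and 2: "F.ococ B (leg z) (leg_cell z)"
      using to_cocone_cocone[OF p] z by (simp_all only: F.is_oplax_cocone_iff)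
    show "F.omod (leg (to_cocone_ob (q, \<Xi>))) (leg_cell (to_cocone_ob (q, \<Xi>))) (leg z) (leg_cell z) ?n"
      unfolding Alg_omod_iff[OF 1 2 assms(1)]
    proof (intro conjI ballI)
      show "D0.D.omod (\<lambda>i. mor_fun (leg (to_cocone_ob (q, \<Xi>)) i)) (\<lambda>d. trans_cell (leg_cell (to_cocone_ob (q, \<Xi>)) d))
         (\<lambda>i. mor_fun (leg z i)) (\<lambda>d. trans_cell (leg_cell z d)) (\<lambda>i. trans_cell (?n i))"
        by (rule D0.D.omod_cong[OF D0.D.isomodD(3)[OF m]]) (simp_all add: Q_def Qc_def)
    qed (use n in \<open>simp_all add: Q_def\<close>)
    show "Alg.iso2 (?n i)" if "i \<in> Obj I" for i
      using n[OF that] that by (simp add: iso2_Alg_iff)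
  qed
  from F.oplax_invertible[OF to_cocone_cocone[OF p] z this] show ?thesis
    using p by (intro bexI[of _ "(q, \<Xi>)"] bexI) (auto simp: pscoeq_cat_def tagged_cat_def)
qed

lemma to_cocone_ff_eso:
  assumes "alg B"
  shows "ff_eso (pscoeq_cat Alg Res B) (oplax_cocone_cat I Alg F B) to_cocone"
  unfolding ff_eso_def
proof (intro conjI ballI)
  show "\<exists>p \<in> Ob (pscoeq_cat Alg Res B). \<exists>k \<in> Hom (oplax_cocone_cat I Alg F B) (onOb to_cocone p) z. invertible (oplax_cocone_cat I Alg F B) k"
    if "z \<in> Ob (oplax_cocone_cat I Alg F B)" for z
    using to_cocone_eso[OF assms, of z] that by (simp add: oplax_cocone_cat_def tagged_cat_def)
qed (use to_cocone_functor to_cocone_bij in simp_all)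

text \<open>Equality on the nose: expanding \<phi> for the pair composed with \<open>u\<close>
  yields \<open>u \<phi>\<close> preceded by the structure cell of \<open>u\<close>, which is the
  structure cell of the composite of \<open>u\<close> with the leg.\<close>

lemma to_cocone_ob_postcomp:
  assumes p: "pseudocoequalizes Alg Res L (q, \<Xi>)" and u [simp]: "mor u" "mor_src u = L"
  shows "oplax_postcomp_ob I Alg (to_cocone_ob (q, \<Xi>)) u = to_cocone_ob (u \<cdot>\<^bsub>Alg\<^esub> q, u \<triangleright>\<^bsub>Alg\<^esub> \<Xi>)"
    and "i \<in> Obj I \<Longrightarrow> comp_psmor C M u (leg_of q \<Xi> i) = leg_of (comp_psmor C M u q) (u \<triangleright>\<^bsub>Alg\<^esub> \<Xi>) i"
proof -
  have P: "pair L q \<Xi>" and l: "\<And>i. i \<in> Obj I \<Longrightarrow> mor (leg_of q \<Xi> i)"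
    using p by (simp_all only: pseudocoequalizes_iff)
  note [simp] = pairD[OF P] l[unfolded pairD(3)[OF P]]
  have [simp]: "alg (mor_trg u)"
    using mor_typing(2)[OF u(1)] .
  show 1: "comp_psmor C M u (leg_of q \<Xi> i) = leg_of (comp_psmor C M u q) (u \<triangleright>\<^bsub>Alg\<^esub> \<Xi>) i" if "i \<in> Obj I" for i
    using that by (intro psmor.expand) (simp add: \<phi>_def \<gamma>0_def)
  have 2: "comp_psmor C M u (comp_psmor C M (leg_of q \<Xi> (trg1 I d)) (F1 F d)) =
      comp_psmor C M (leg_of (comp_psmor C M u q) (u \<triangleright>\<^bsub>Alg\<^esub> \<Xi>) (trg1 I d)) (F1 F d)" if "d \<in> Cell1 I" for d
    using comp_psmor_assoc[of "F1 F d" "leg_of q \<Xi> (trg1 I d)" u] 1[of "trg1 I d"] that by simp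
  show "oplax_postcomp_ob I Alg (to_cocone_ob (q, \<Xi>)) u = to_cocone_ob (u \<cdot>\<^bsub>Alg\<^esub> q, u \<triangleright>\<^bsub>Alg\<^esub> \<Xi>)"
    unfolding oplax_postcomp_ob_def to_cocone_ob_def prod.case oplax_cocone.inject
    using 1 2 by (auto intro!: restrict_ext)
qed

text \<open>Composition with the cocone is composition with the bicoequalizing pair followed by
  \<open>to_cocone\<close>. Both factors are fully faithful and essentially surjective, hence so is
  the composite.\<close>

theorem bicolimit_of_bicoequalizer:
  assumes b: "bicoequalizer Alg Res L (q, \<Xi>)"
  shows "oplax_bicolimit I Alg F L (to_cocone_ob (q, \<Xi>))"
  unfolding oplax_bicolimit_def
proof (intro conjI ballI)
  have p: "pseudocoequalizes Alg Res L (q, \<Xi>)"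
    using b by (simp add: bicoequalizer_def)
  then have P: "pair L q \<Xi>" and l: "\<And>i. i \<in> Obj I \<Longrightarrow> mor (leg_of q \<Xi> i)"
    by (simp_all only: pseudocoequalizes_iff)
  note [simp] = pairD[OF P] l[unfolded pairD(3)[OF P]]
  show "L \<in> Obj Alg" "is_oplax_cocone I Alg F L (to_cocone_ob (q, \<Xi>))"
    using to_cocone_cocone[OF p] by simp_all
  fix B assume "B \<in> Obj Alg"
  then have B: "alg B"
    by simp
  have c: "category (homcat Alg L B)" "category (pscoeq_cat Alg Res B)" "category (oplax_cocone_cat I Alg F B)"
    using Alg.category_homcat Alg.category_pscoeq[OF is_codescent_Res] F.category_oplax by auto
  have "ff_eso (homcat Alg L B) (oplax_cocone_cat I Alg F B) (oplax_postcomp I Alg (to_cocone_ob (q, \<Xi>)))"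
  proof (rule ff_eso_comp[OF c])
    show "ff_eso (homcat Alg L B) (pscoeq_cat Alg Res B) (pscoeq_postcomp Alg (q, \<Xi>))"
      using is_equivalence_imp_ff_eso[OF c(1,2)] b B by (simp add: bicoequalizer_def)
    show "ff_eso (pscoeq_cat Alg Res B) (oplax_cocone_cat I Alg F B) to_cocone"
      by (rule to_cocone_ff_eso[OF B])
    show "onOb (oplax_postcomp I Alg (to_cocone_ob (q, \<Xi>))) u = onOb to_cocone (onOb (pscoeq_postcomp Alg (q, \<Xi>)) u)"
      if "u \<in> Ob (homcat Alg L B)" for u
      using that to_cocone_ob_postcomp(1)[OF p, of u] by (simp add: oplax_postcomp_def pscoeq_postcomp_def homcat_def hom1_def)
    show "onArr (oplax_postcomp I Alg (to_cocone_ob (q, \<Xi>))) \<alpha> = onArr to_cocone (onArr (pscoeq_postcomp Alg (q, \<Xi>)) \<alpha>)"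
      if "\<alpha> \<in> Arr (homcat Alg L B)" for \<alpha>
    proof -
      have a [simp]: "transf \<alpha>" "mor_src (trans_src \<alpha>) = L"
        using that by (auto simp: homcat_def hom1_def)
      have "mor (trans_src \<alpha>)" "mor (trans_trg \<alpha>)" "mor_src (trans_trg \<alpha>) = L"
        using transf_typing[OF a(1)] by simp_all
      note [simp] = this and [simp] = to_cocone_ob_postcomp(2)[OF p this(1) a(2), unfolded pairD(3)[OF P]] to_cocone_ob_postcomp(2)[OF p this(2,3), unfolded pairD(3)[OF P]]
      show ?thesis
        using to_cocone_ob_postcomp(1)[OF p, of "trans_src \<alpha>"] to_cocone_ob_postcomp(1)[OF p, of "trans_trg \<alpha>"]
        by (auto simp: oplax_postcomp_def pscoeq_postcomp_def intro!: restrict_ext)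
    qed
  qed
  then show "is_equivalence (homcat Alg L B) (oplax_cocone_cat I Alg F B) (oplax_postcomp I Alg (to_cocone_ob (q, \<Xi>)))"
    by (rule ff_eso_imp_is_equivalence[OF c(1,3)])
qed

end

theorem corollary3p13:
  fixes \<kappa> :: "'s rel"
    and C :: "('o, 'a, 'c) two_cat"
    and M :: "('o, 'a, 'c) psmonad_data"
  assumes "Cinfinite \<kappa>"
    and "two_category C"
    and "bicocomplete \<kappa> C"
    and "pseudomonad C M"
    and "has_bicoequalizers (T_psAlg C M)"
  shows "has_oplax_bicolimits \<kappa> (T_psAlg C M)"
  unfolding has_oplax_bicolimits_def
proof (intro allI impI)
  fix I :: "('s, 's, 's) two_cat" and F
  assume F: "small_two_category \<kappa> I \<and> two_functor I (T_psAlg C M) F"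
  interpret P: psmonad C M
    using assms by (intro psmonad.intro psmonad_axioms.intro)
  interpret alg_diagram C M I F
    using F P.Alg.two_category_axioms
    by (intro alg_diagram.intro two_fun.intro two_fun_axioms.intro P.psmonad_axioms) (auto simp: small_two_category_def)
  \<comment> \<open>The appeal to bicocompleteness, made below for the three diagrams
    \<open>U F\<close>, \<open>T U F\<close> and \<open>T T U F\<close> over the same small
    \<open>I\<close>.\<close>
  have colim: "\<exists>L q qc. two_fun.ocolim I C G L q qc" if "two_fun I C G" for G
    using ocolim_exists[OF assms(1-3)] F that by (auto simp: two_fun_def two_fun_axioms_def)
  obtain L0 q0 qc0 L1 q1 qc1 L2 q2 qc2 where
    "D0.D.ocolim L0 q0 qc0" "D0.TD.ocolim L1 q1 qc1" "D1.TD.ocolim L2 q2 qc2"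
    using colim[OF two_fun_U] colim[OF D0.two_fun_TD] colim[OF D1.two_fun_TD] by metis
  from resolution_exists[OF D0.fcolim_free[OF this(1)] D1.fcolim_free[OF this(2)] D2.fcolim_free[OF this(3)]]
  obtain dd0 dd1 jj pp0 pp1 pp2 \<delta>0 \<delta>1 \<epsilon> \<pi>0 \<pi>1 \<pi>2 N0 N1 H01 H02 H12 where
    "resolution C M I F (P.free L0) (P.free L1) (P.free L2) (\<lambda>i. \<eta> M L0 \<cdot>\<^bsub>C\<^esub> q0 i) (\<lambda>d. \<eta> M L0 \<triangleright>\<^bsub>C\<^esub> qc0 d)
      (\<lambda>i. \<eta> M L1 \<cdot>\<^bsub>C\<^esub> q1 i) (\<lambda>d. \<eta> M L1 \<triangleright>\<^bsub>C\<^esub> qc1 d) (\<lambda>i. \<eta> M L2 \<cdot>\<^bsub>C\<^esub> q2 i) (\<lambda>d. \<eta> M L2 \<triangleright>\<^bsub>C\<^esub> qc2 d)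
      dd0 dd1 jj pp0 pp1 pp2 \<delta>0 \<delta>1 \<epsilon> \<pi>0 \<pi>1 \<pi>2 N0 N1 H01 H02 H12"
    by blast
  then interpret R: resolution C M I F "P.free L0" "P.free L1" "P.free L2" "\<lambda>i. \<eta> M L0 \<cdot>\<^bsub>C\<^esub> q0 i" "\<lambda>d. \<eta> M L0 \<triangleright>\<^bsub>C\<^esub> qc0 d"
      "\<lambda>i. \<eta> M L1 \<cdot>\<^bsub>C\<^esub> q1 i" "\<lambda>d. \<eta> M L1 \<triangleright>\<^bsub>C\<^esub> qc1 d" "\<lambda>i. \<eta> M L2 \<cdot>\<^bsub>C\<^esub> q2 i" "\<lambda>d. \<eta> M L2 \<triangleright>\<^bsub>C\<^esub> qc2 d"
      dd0 dd1 jj pp0 pp1 pp2 \<delta>0 \<delta>1 \<epsilon> \<pi>0 \<pi>1 \<pi>2 N0 N1 H01 H02 H12 .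
  obtain L q \<Xi> where "bicoequalizer (T_psAlg C M) R.Res L (q, \<Xi>)"
    using assms(5) R.is_codescent_Res unfolding has_bicoequalizers_def by (metis surj_pair)
  then show "\<exists>L q. oplax_bicolimit I (T_psAlg C M) F L q"
    using R.bicolimit_of_bicoequalizer by blast
qed

end
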